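(* Assume that $0<\alpha<1/2$. Let $f\in L^2(0,T;H^{-\beta}(\Omega))$ and $u_0\in H^{-\beta}(\Omega)$ with $0\leqslant\beta<1$, and let $u\in W$ be the weak solution of the time fractional diffusion problem with data $(u_0,f)$. Then there is a constant $C_{\alpha,\Omega}>0$ depending only on $\alpha$ and $\Omega$ such that \[ \begin{aligned} &|u|_{H^{\alpha(1-\beta/2)}(0,t;L^2(\Omega))}+|u|_{H^{\alpha/2}(0,t;\dot H^{1-\beta}(\Omega))}+|u|_{H^{\alpha(1-\beta)/2}(0,t;\dot H^1(\Omega))}+\|u\|_{L^2(0,t;\dot H^{2-\beta}(\Omega))}\\ &\qquad\leqslant C_{\alpha,\Omega}\left(\|f\|_{L^2(0,t;H^{-\beta}(\Omega))}+t^{1/2-\alpha}\|u_0\|_{H^{-\beta}(\Omega)}\right) \end{aligned} \] for all $0<t<T$.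
   Context: Setting: $T>0$, $0<\alpha<1$, $\Omega\subset\mathbb R^d$ ($d=1,2,3$) is a convex polygonal domain (interval, polygon, polyhedron). The model problem is $\mathrm D_{0+}^\alpha(u-u_0)-\Delta u=f$ in $\Omega\times(0,T)$, $u=0$ on $\partial\Omega\times(0,T)$, $u(0)=u_0$ in $\Omega$. Fractional operators: on an interval $(a,b)$, for $\gamma>0$, $(\mathrm I_{a+}^\gamma v)(t)=\frac1{\Gamma(\gamma)}\int_a^t(t-s)^{\gamma-1}v(s)\,ds$ and $(\mathrm I_{b-}^\gamma v)(t)=\frac1{\Gamma(\gamma)}\int_t^b(s-t)^{\gamma-1}v(s)\,ds$; for $0<\gamma<1$, $\mathrm D_{a+}^\gamma=\mathrm D\,\mathrm I_{a+}^{1-\gamma}$ and $\mathrm D_{b-}^\gamma=-\mathrm D\,\mathrm I_{b-}^{1-\gamma}$, with $\mathrm D$ the distributional first derivative. Spaces: $\{\phi_i\}_{i\in\mathbb N}\subset H_0^1(\Omega)\cap H^2(\Omega)$ is an orthonormal basis of $L^2(\Omega)$ with $-\Delta\phi_i=\lambda_i\phi_i$, $\lambda_i>0$ non-decreasing. For $\gamma\geqslant0$, $\dot H^\gamma(\Omega)=\{v\in L^2(\Omega):\|v\|_{\dot H^\gamma(\Omega)}^2:=\sum_i\lambda_i^\gamma(v,\phi_i)_{L^2(\Omega)}^2<\infty\}$; $\dot H^1(\Omega)=H_0^1(\Omega)$. $H^{-\beta}(\Omega)$ is the standard Sobolev space, dual of $H_0^\beta(\Omega)$ ($=L^2(\Omega)$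 if $\beta=0$). For $0<\gamma<1/2$ and $0<t\leqslant T$, $|w|_{H^\gamma(0,t)}^2:=\int_{\mathbb R}|\xi|^{2\gamma}|\mathcal F(w\chi_{(0,t)})(\xi)|^2\,d\xi$ with $\mathcal F$ the Fourier transform and $\chi_{(0,t)}$ the indicator function; for a separable Hilbert space $X$ with orthonormal basis $\{e_i\}$, $|v|_{H^\gamma(0,t;X)}^2:=\sum_i|(v,e_i)_X|_{H^\gamma(0,t)}^2$. Weak solution: $W:=H^{\alpha/2}(0,T;L^2(\Omega))\cap L^2(0,T;\dot H^1(\Omega))$ with norm $|\cdot|_{H^{\alpha/2}(0,T;L^2(\Omega))}+\|\cdot\|_{L^2(0,T;\dot H^1(\Omega))}$. The weak solution is the unique $u\in W$ with \[\langle\mathrm D_{0+}^\alpha u,v\rangle_{H^{\alpha/2}(0,T;L^2(\Omega))}+\int_0^T\!\!\int_\Omega\nabla u\cdot\nabla v=\langle\mathrm D_{0+}^\alpha u_0+f,v\rangle_W\quad\forall v\in W.\] Here $\langle\cdot,\cdot\rangle_X$ is the duality pairing between $X^*$ and $X$; $\langle\mathrm D_{0+}^\alpha u,v\rangle_{H^{\alpha/2}(0,T;L^2(\Omega))}=\int_0^T(\mathrm D_{0+}^{\alpha/2}u,\mathrm D_{T-}^{\alpha/2}v)_{L^2(\Omega)}dt$; and $\mathrm D_{0+}^\alpha u_0=\frac{t^{-\alpha}}{\Gamma(1-\alpha)}u_0$, so the right-hand side is $\int_0^T\big\langle\frac{t^{-\alpha}}{\Gamma(1-\alpha)}u_0+f(t),v(t)\big\rangle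 dt$. *)

theory Defs
  imports "HOL-Analysis.Analysis"
begin

text \<open>
  The real Hilbert space \<open>L\<^sup>2(\<real>\<^sup>d)\<close> as a type, so that Bochner integrals of
  \<open>L\<^sup>2\<close>-valued functions are available. The space \<open>L\<^sup>2(\<Omega>)\<close> is the subspace of classes
  vanishing outside \<open>\<Omega>\<close>, see \<open>L2_on\<close> below.
\<close>

definition sq_integrable :: "('a::euclidean_space \<Rightarrow> real) \<Rightarrow> bool" where
  "sq_integrable f \<longleftrightarrow> f \<in> borel_measurable lebesgue \<and> integrable lebesgue (\<lambda>x. (f x)\<^sup>2)"

definition L2_rel :: "('a::euclidean_space \<Rightarrow> real) \<Rightarrow> ('a \<Rightarrow> real) \<Rightarrow> bool" where
  "L2_rel f g \<longleftrightarrow> sq_integrable f \<and> sq_integrable g \<and> (AE x in lebesgue. f x = g x)"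

lemma sq_integrable_zero: "sq_integrable (\<lambda>x. 0)"
  by (simp add: sq_integrable_def)

quotient_type (overloaded) 'a L2 = "'a::euclidean_space \<Rightarrow> real" / partial: L2_rel
  morphisms rep_L2 abs_L2
proof (rule part_equivpI)
  show "\<exists>f. L2_rel f f"
    using sq_integrable_zero by (auto simp: L2_rel_def)
  show "symp L2_rel"
    by (rule sympI) (auto simp: L2_rel_def elim: eventually_mono)
  show "transp L2_rel"
  proof (rule transpI)
    fix f g h
    assume "L2_rel f g" "L2_rel g h"
    then show "L2_rel f h"
      unfolding L2_rel_def by (auto elim: eventually_elim2)
  qed
qed

lemma abs_rep_L2 [simp]: "abs_L2 (rep_L2 v) = v"
  by (rule Quotient3_abs_rep[OF Quotient3_L2])

lemma sq_integrable_rep [simp]: "sq_integrable (rep_L2 v)"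
  using Quotient3_rep_reflp[OF Quotient3_L2, of v] by (simp add: L2_rel_def)

lemma rep_abs_L2: "sq_integrable f \<Longrightarrow> AE x in lebesgue. rep_L2 (abs_L2 f) x = f x"
  using Quotient3_rep_abs[OF Quotient3_L2, of f] by (simp add: L2_rel_def)

lemma L2_eqI: "(AE x in lebesgue. rep_L2 v x = rep_L2 w x) \<Longrightarrow> v = w"
  using Quotient3_rel_rep[OF Quotient3_L2, of v w] by (simp add: L2_rel_def)

lemma measurable_rep_L2 [measurable]: "rep_L2 v \<in> borel_measurable lebesgue"
  using sq_integrable_rep[of v] by (simp add: sq_integrable_def)

lemma sq_integrable_mult:
  assumes "sq_integrable f" "sq_integrable g"
  shows "integrable lebesgue (\<lambda>x. f x * g x)"
proof (rule Bochner_Integration.integrable_bound)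
  show "integrable lebesgue (\<lambda>x. (f x)\<^sup>2 + (g x)\<^sup>2)"
    using assms by (auto simp: sq_integrable_def)
  show "(\<lambda>x. f x * g x) \<in> borel_measurable lebesgue"
    using assms by (auto simp: sq_integrable_def)
  have "norm (a * b) \<le> norm (a\<^sup>2 + b\<^sup>2)" for a b :: real
  proof -
    have "0 \<le> (\<bar>a\<bar> - \<bar>b\<bar>)\<^sup>2" by simp
    then have "2 * (\<bar>a\<bar> * \<bar>b\<bar>) \<le> a\<^sup>2 + b\<^sup>2" by (simp add: power2_diff)
    moreover have "0 \<le> \<bar>a\<bar> * \<bar>b\<bar>" by simp
    ultimately have "\<bar>a\<bar> * \<bar>b\<bar> \<le> a\<^sup>2 + b\<^sup>2" by linarith
    then show ?thesis by (simp add: abs_mult)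
  qed
  then show "AE x in lebesgue. norm (f x * g x) \<le> norm ((f x)\<^sup>2 + (g x)\<^sup>2)"
    by simp
qed

lemma sq_integrable_scale:
  assumes "sq_integrable f"
  shows "sq_integrable (\<lambda>x. c * f x)"
  using assms by (auto simp: sq_integrable_def power_mult_distrib)

lemma sq_integrable_add:
  assumes "sq_integrable f" "sq_integrable g"
  shows "sq_integrable (\<lambda>x. f x + g x)"
  using assms sq_integrable_mult[OF assms]
  by (auto simp: sq_integrable_def power2_sum mult.assoc)

lemma sq_integrable_diff:
  assumes "sq_integrable f" "sq_integrable g"
  shows "sq_integrable (\<lambda>x. f x - g x)"
  using sq_integrable_add[OF assms(1) sq_integrable_scale[OF assms(2), of "-1"]] by simp

lemma sq_integrable_indicator:
  assumes "A \<in> lmeasurable"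
  shows "sq_integrable (indicator A)"
proof -
  have "(\<lambda>x. (indicator A x :: real)\<^sup>2) = indicator A"
    by (auto simp: indicator_def)
  then show ?thesis
    using assms by (auto simp: sq_integrable_def fmeasurable_def)
qed

instantiation L2 :: (euclidean_space) real_vector
begin

definition "0 = abs_L2 (\<lambda>x::'a. 0)"
definition "v + w = abs_L2 (\<lambda>x::'a. rep_L2 v x + rep_L2 w x)"
definition "v - w = abs_L2 (\<lambda>x::'a. rep_L2 v x - rep_L2 w x)"
definition "- v = abs_L2 (\<lambda>x::'a. - rep_L2 v x)"
definition "c *\<^sub>R v = abs_L2 (\<lambda>x::'a. c * rep_L2 v x)"

lemma rep_L2_zero: "AE x in lebesgue. rep_L2 (0::'a L2) x = 0"
  unfolding zero_L2_def by (rule rep_abs_L2) (rule sq_integrable_zero)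

lemma rep_L2_add: "AE x in lebesgue. rep_L2 (v + w :: 'a L2) x = rep_L2 v x + rep_L2 w x"
  unfolding plus_L2_def by (rule rep_abs_L2) (simp add: sq_integrable_add)

lemma rep_L2_diff: "AE x in lebesgue. rep_L2 (v - w :: 'a L2) x = rep_L2 v x - rep_L2 w x"
  unfolding minus_L2_def by (rule rep_abs_L2) (simp add: sq_integrable_diff)

lemma rep_L2_uminus: "AE x in lebesgue. rep_L2 (- v :: 'a L2) x = - rep_L2 v x"
  unfolding uminus_L2_def
  using sq_integrable_scale[OF sq_integrable_rep, of "-1" v] by (intro rep_abs_L2) simp

lemma rep_L2_scale: "AE x in lebesgue. rep_L2 (c *\<^sub>R v :: 'a L2) x = c * rep_L2 v x"
  unfolding scaleR_L2_def by (rule rep_abs_L2) (simp add: sq_integrable_scale)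

instance
proof
  fix u v w :: "'a L2" and a b :: real
  show "u + v + w = u + (v + w)"
    by (rule L2_eqI) (use rep_L2_add[of u v] rep_L2_add[of "u + v" w] rep_L2_add[of v w] rep_L2_add[of u "v + w"] in eventually_elim, simp)
  show "u + v = v + u"
    by (rule L2_eqI) (use rep_L2_add[of u v] rep_L2_add[of v u] in eventually_elim, simp)
  show "0 + u = u"
    by (rule L2_eqI) (use rep_L2_add[of 0 u] rep_L2_zero in eventually_elim, simp)
  show "- u + u = 0"
    by (rule L2_eqI) (use rep_L2_add[of "- u" u] rep_L2_uminus[of u] rep_L2_zero in eventually_elim, simp)
  show "u - v = u + - v"
    by (rule L2_eqI) (use rep_L2_add[of u "- v"] rep_L2_uminus[of v] rep_L2_diff[of u v] in eventually_elim, simp)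
  show "a *\<^sub>R (u + v) = a *\<^sub>R u + a *\<^sub>R v"
    by (rule L2_eqI) (use rep_L2_add[of u v] rep_L2_scale[of a "u + v"] rep_L2_scale[of a u] rep_L2_scale[of a v] rep_L2_add[of "a *\<^sub>R u" "a *\<^sub>R v"] in eventually_elim, simp add: algebra_simps)
  show "(a + b) *\<^sub>R u = a *\<^sub>R u + b *\<^sub>R u"
    by (rule L2_eqI) (use rep_L2_scale[of "a + b" u] rep_L2_scale[of a u] rep_L2_scale[of b u] rep_L2_add[of "a *\<^sub>R u" "b *\<^sub>R u"] in eventually_elim, simp add: algebra_simps)
  show "a *\<^sub>R b *\<^sub>R u = (a * b) *\<^sub>R u"
    by (rule L2_eqI) (use rep_L2_scale[of a "b *\<^sub>R u"] rep_L2_scale[of b u] rep_L2_scale[of "a * b" u] in eventually_elim, simp)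
  show "1 *\<^sub>R u = u"
    by (rule L2_eqI) (use rep_L2_scale[of 1 u] in eventually_elim, simp)
qed

end

instantiation L2 :: (euclidean_space) real_inner
begin

definition "v \<bullet> w = (LINT x|lebesgue. rep_L2 v (x::'a) * rep_L2 w x)"
definition "norm v = sqrt (v \<bullet> (v :: 'a L2))"
definition "dist v w = norm (v - w :: 'a L2)"
definition "sgn v = v /\<^sub>R norm (v :: 'a L2)"
definition "uniformity = (INF e\<in>{0<..}. principal {(v, w :: 'a L2). dist v w < e})"
definition "open S = (\<forall>v\<in>S. \<forall>\<^sub>F (v', w) in uniformity. v' = v \<longrightarrow> (w :: 'a L2) \<in> S)"

instance
proof
  fix u v w :: "'a L2" and a :: real
  show "dist u v = norm (u - v)" by (rule dist_L2_def)
  show "sgn u = u /\<^sub>R norm u" by (rule sgn_L2_def)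
  show "(uniformity :: ('a L2 \<times> 'a L2) filter) = (INF e\<in>{0<..}. principal {(v, w). dist v w < e})"
    by (rule uniformity_L2_def)
  show "open S = (\<forall>v\<in>S. \<forall>\<^sub>F (v', w) in uniformity. v' = v \<longrightarrow> w \<in> S)" for S :: "'a L2 set"
    by (rule open_L2_def)
  show "norm u = sqrt (u \<bullet> u)" by (rule norm_L2_def)
  show "u \<bullet> v = v \<bullet> u" by (simp add: inner_L2_def mult.commute)
  have "(u + v) \<bullet> w = (LINT x|lebesgue. rep_L2 u x * rep_L2 w x + rep_L2 v x * rep_L2 w x)"
    unfolding inner_L2_def using rep_L2_add[of u v]
    by (intro integral_cong_AE) (auto elim!: eventually_mono simp: algebra_simps)
  also have "\<dots> = u \<bullet> w + v \<bullet> w"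
    unfolding inner_L2_def by (rule Bochner_Integration.integral_add) (simp_all add: sq_integrable_mult)
  finally show "(u + v) \<bullet> w = u \<bullet> w + v \<bullet> w" .
  have "(a *\<^sub>R u) \<bullet> v = (LINT x|lebesgue. a * (rep_L2 u x * rep_L2 v x))"
    unfolding inner_L2_def using rep_L2_scale[of a u]
    by (intro integral_cong_AE) (auto elim!: eventually_mono)
  then show "(a *\<^sub>R u) \<bullet> v = a * (u \<bullet> v)"
    by (simp add: inner_L2_def)
  show "0 \<le> u \<bullet> u" by (simp add: inner_L2_def)
  show "(u \<bullet> u = 0) = (u = 0)"
  proof
    assume "u \<bullet> u = 0"
    then have "AE x in lebesgue. rep_L2 u x * rep_L2 u x = 0"
      unfolding inner_L2_def
      by (subst (asm) integral_nonneg_eq_0_iff_AE) (simp_all add: sq_integrable_mult)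
    with rep_L2_zero have "AE x in lebesgue. rep_L2 u x = rep_L2 0 x"
      by eventually_elim simp
    then show "u = 0" by (rule L2_eqI)
  next
    assume "u = 0"
    have "u \<bullet> u = (LINT x|(lebesgue :: 'a measure). 0)"
      unfolding inner_L2_def \<open>u = 0\<close> using rep_L2_zero
      by (intro integral_cong_AE) (auto elim!: eventually_mono)
    then show "u \<bullet> u = 0" by simp
  qed
qed

end

lemma nn_integral_rep_L2: "(\<integral>\<^sup>+x. ennreal ((rep_L2 v x)\<^sup>2) \<partial>lebesgue) = ennreal ((norm v)\<^sup>2)"
proof -
  have "(norm v)\<^sup>2 = (LINT x|lebesgue. (rep_L2 v x)\<^sup>2)"
    unfolding power2_norm_eq_inner inner_L2_def by (simp add: power2_eq_square)
  then show ?thesis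
    using sq_integrable_rep[of v] by (simp add: sq_integrable_def nn_integral_eq_integral)
qed

lemma nn_integral_rep_diff:
  "(\<integral>\<^sup>+x. ennreal ((rep_L2 v x - rep_L2 w x)\<^sup>2) \<partial>lebesgue) = ennreal ((norm (v - w))\<^sup>2)"
  unfolding nn_integral_rep_L2[symmetric]
  using rep_L2_diff[of v w] by (intro nn_integral_cong_AE) (auto elim!: eventually_mono)

text \<open>Riesz--Fischer.\<close>

instance L2 :: (euclidean_space) banach
proof
  fix X :: "nat \<Rightarrow> 'a L2"
  assume X: "Cauchy X"
  have "\<exists>N. \<forall>m\<ge>N. \<forall>n\<ge>N. norm (X m - X n) < (1/2)^k" for k
    using X unfolding Cauchy_def dist_norm by (metis zero_less_divide_1_iff zero_less_numeral zero_less_power)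
  then obtain N where N: "\<And>k m n. m \<ge> N k \<Longrightarrow> n \<ge> N k \<Longrightarrow> norm (X m - X n) < (1/2)^k"
    by metis
  define r where "r k = (\<Sum>i\<le>k. N i) + k" for k
  have r: "r k \<ge> N k" "r k \<ge> k" "r (Suc k) \<ge> r k" for k
    using member_le_sum[of k "{..k}" N] by (auto simp: r_def)
  define g where "g k x = rep_L2 (X (r (Suc k))) x - rep_L2 (X (r k)) x" for k x
  have [measurable]: "g k \<in> borel_measurable lebesgue" for k
    unfolding g_def by measurable
  have g: "(\<integral>\<^sup>+x. ennreal ((g k x)\<^sup>2) \<partial>lebesgue) \<le> ennreal ((1/4)^k)" for k
  proof -
    have "norm (X (r (Suc k)) - X (r k)) < (1/2)^k"
      using r[of k] by (intro N) auto
    then have "(norm (X (r (Suc k)) - X (r k)))\<^sup>2 \<le> ((1/2)^k)\<^sup>2"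
      by (intro power_mono) auto
    also have "((1/2)^k)\<^sup>2 = (1/4 :: real)^k"
      by (simp add: power2_eq_square power_mult_distrib[symmetric])
    finally show ?thesis
      by (simp add: g_def nn_integral_rep_diff ennreal_leI)
  qed
  have "(\<integral>\<^sup>+x. (\<Sum>k. ennreal (2^k * (g k x)\<^sup>2)) \<partial>lebesgue)
      = (\<Sum>k. \<integral>\<^sup>+x. ennreal (2^k * (g k x)\<^sup>2) \<partial>lebesgue)"
    by (rule nn_integral_suminf) measurable
  also have "\<dots> = (\<Sum>k. ennreal (2^k) * (\<integral>\<^sup>+x. ennreal ((g k x)\<^sup>2) \<partial>lebesgue))"
    by (simp add: ennreal_mult nn_integral_cmult)
  also have "\<dots> \<le> (\<Sum>k. ennreal (2^k) * ennreal ((1/4)^k))"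
    by (intro suminf_le mult_left_mono g) auto
  also have "\<dots> = (\<Sum>k. ennreal ((1/2)^k))"
    by (simp add: ennreal_mult[symmetric] power_mult_distrib[symmetric])
  also have "\<dots> < \<infinity>"
    using summable_geometric[of "1/2::real"]
    by (subst suminf_ennreal2) auto
  finally have "AE x in lebesgue. (\<Sum>k. ennreal (2^k * (g k x)\<^sup>2)) \<noteq> \<infinity>"
    by (intro nn_integral_noteq_infinite) auto
  then have conv: "AE x in lebesgue. convergent (\<lambda>k. rep_L2 (X (r k)) x)"
  proof (rule eventually_mono)
    fix x
    assume "(\<Sum>k. ennreal (2^k * (g k x)\<^sup>2)) \<noteq> \<infinity>"
    then have "summable (\<lambda>k. 2^k * (g k x)\<^sup>2)"
      by (intro summable_suminf_not_top) auto
    moreover have "summable (\<lambda>k. (1/2 :: real)^k)"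
      by (simp add: summable_geometric)
    ultimately have "summable (\<lambda>k. 2^k * (g k x)\<^sup>2 + (1/2)^k)"
      by (rule summable_add)
    moreover have "norm (g k x) \<le> 2^k * (g k x)\<^sup>2 + (1/2)^k" for k
    proof -
      have "0 \<le> 2^k * (\<bar>g k x\<bar> - (1/2)^k)\<^sup>2" by simp
      also have "\<dots> = 2^k * (g k x)\<^sup>2 + (1/2)^k - 2 * \<bar>g k x\<bar>"
        by (simp add: power2_diff field_simps power_divide power2_eq_square)
      finally show ?thesis using abs_ge_zero[of "g k x"] by simp
    qed
    ultimately have "summable (\<lambda>k. g k x)"
      by (rule summable_comparison_test'[where N = 0])
    then have "convergent (\<lambda>n. \<Sum>k<n. g k x)"
      by (simp add: summable_iff_convergent)
    moreover have "(\<lambda>n. \<Sum>k<n. g k x) = (\<lambda>n. rep_L2 (X (r n)) x - rep_L2 (X (r 0)) x)"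
      unfolding g_def by (intro ext) (rule sum_lessThan_telescope)
    ultimately have "convergent (\<lambda>n. (rep_L2 (X (r n)) x - rep_L2 (X (r 0)) x) + rep_L2 (X (r 0)) x)"
      by (intro convergent_add convergent_const) simp
    then show "convergent (\<lambda>k. rep_L2 (X (r k)) x)" by simp
  qed
  define f where "f x = lim (\<lambda>k. rep_L2 (X (r k)) x)" for x
  have [measurable]: "f \<in> borel_measurable lebesgue"
    unfolding f_def by measurable
  have lim: "AE x in lebesgue. (\<lambda>k. rep_L2 (X (r k)) x) \<longlonglongrightarrow> f x"
    using conv by (auto elim!: eventually_mono simp: f_def convergent_LIMSEQ_iff)
  have bound: "(\<integral>\<^sup>+x. ennreal ((f x - rep_L2 (X m) x)\<^sup>2) \<partial>lebesgue) \<le> ennreal ((1/4)^j)"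
    if "m \<ge> N j" for m j
  proof -
    have "(\<integral>\<^sup>+x. ennreal ((f x - rep_L2 (X m) x)\<^sup>2) \<partial>lebesgue)
        = (\<integral>\<^sup>+x. liminf (\<lambda>k. ennreal ((rep_L2 (X (r k)) x - rep_L2 (X m) x)\<^sup>2)) \<partial>lebesgue)"
      using lim
    proof (intro nn_integral_cong_AE, elim eventually_mono)
      fix x
      assume "(\<lambda>k. rep_L2 (X (r k)) x) \<longlonglongrightarrow> f x"
      then have "(\<lambda>k. ennreal ((rep_L2 (X (r k)) x - rep_L2 (X m) x)\<^sup>2))
          \<longlonglongrightarrow> ennreal ((f x - rep_L2 (X m) x)\<^sup>2)"
        by (intro tendsto_intros)
      then show "ennreal ((f x - rep_L2 (X m) x)\<^sup>2)
          = liminf (\<lambda>k. ennreal ((rep_L2 (X (r k)) x - rep_L2 (X m) x)\<^sup>2))"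
        by (rule lim_imp_Liminf[OF sequentially_bot, symmetric])
    qed
    also have "\<dots> \<le> liminf (\<lambda>k. \<integral>\<^sup>+x. ennreal ((rep_L2 (X (r k)) x - rep_L2 (X m) x)\<^sup>2) \<partial>lebesgue)"
      by (rule nn_integral_liminf) measurable
    also have "\<dots> = liminf (\<lambda>k. ennreal ((norm (X (r k) - X m))\<^sup>2))"
      by (simp add: nn_integral_rep_diff)
    also have "\<dots> \<le> liminf (\<lambda>k. ennreal ((1/4)^j))"
    proof (rule Liminf_mono)
      show "\<forall>\<^sub>F k in sequentially. ennreal ((norm (X (r k) - X m))\<^sup>2) \<le> ennreal ((1/4)^j)"
        using eventually_ge_at_top[of "N j"]
      proof eventually_elim
        case (elim k)
        then have "norm (X (r k) - X m) < (1/2)^j"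
          using r(2)[of k] that by (intro N) auto
        then have "(norm (X (r k) - X m))\<^sup>2 \<le> ((1/2)^j)\<^sup>2"
          by (intro power_mono) auto
        also have "((1/2)^j)\<^sup>2 = (1/4 :: real)^j"
          by (simp add: power2_eq_square power_mult_distrib[symmetric])
        finally show ?case by (simp add: ennreal_leI)
      qed
    qed
    also have "\<dots> = ennreal ((1/4)^j)" by (simp add: Liminf_const)
    finally show ?thesis .
  qed
  have "sq_integrable (\<lambda>x. f x - rep_L2 (X (N 0)) x)"
    unfolding sq_integrable_def
  proof (intro conjI integrableI_bounded)
    show "(\<integral>\<^sup>+x. ennreal (norm ((f x - rep_L2 (X (N 0)) x)\<^sup>2)) \<partial>lebesgue) < \<infinity>"
      using bound[of 0 "N 0"] by (auto simp: le_less_trans)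
  qed measurable
  then have "sq_integrable (\<lambda>x. (f x - rep_L2 (X (N 0)) x) + rep_L2 (X (N 0)) x)"
    by (rule sq_integrable_add) simp
  then have f: "sq_integrable f" by simp
  have "X \<longlonglongrightarrow> abs_L2 f"
  proof (rule LIMSEQ_I)
    fix e :: real
    assume "0 < e"
    then obtain j where j: "(1/2)^j < e"
      using real_arch_pow_inv[of e "1/2"] by auto
    show "\<exists>no. \<forall>n\<ge>no. norm (X n - abs_L2 f) < e"
    proof (intro exI allI impI)
      fix n assume "n \<ge> N j"
      have "ennreal ((norm (abs_L2 f - X n))\<^sup>2) = (\<integral>\<^sup>+x. ennreal ((f x - rep_L2 (X n) x)\<^sup>2) \<partial>lebesgue)"
        unfolding nn_integral_rep_diff[symmetric]
        using rep_abs_L2[OF f] by (intro nn_integral_cong_AE) (auto elim!: eventually_mono)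
      also have "\<dots> \<le> ennreal ((1/4)^j)"
        by (rule bound) fact
      finally have "(norm (abs_L2 f - X n))\<^sup>2 \<le> ((1/2)^j)\<^sup>2"
        by (simp add: power2_eq_square power_mult_distrib[symmetric])
      then have "norm (abs_L2 f - X n) \<le> (1/2)^j"
        by (rule power2_le_imp_le) simp
      with j show "norm (X n - abs_L2 f) < e" by (simp add: norm_minus_commute)
    qed
  qed
  then show "convergent X" by (auto simp: convergent_def)
qed


text \<open>Separability: rational combinations of indicators of a countable family of bounded sets.\<close>

lemma rep_L2_sum:
  "finite I \<Longrightarrow> AE x in lebesgue. rep_L2 (\<Sum>i\<in>I. v i :: 'a::euclidean_space L2) x = (\<Sum>i\<in>I. rep_L2 (v i) x)"
proof (induction I rule: finite_induct)
  case empty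
  then show ?case using rep_L2_zero by simp
next
  case (insert i I)
  from rep_L2_add[of "v i" "\<Sum>i\<in>I. v i"] insert.IH
  show ?case unfolding sum.insert[OF insert.hyps] by eventually_elim simp
qed

lemma abs_L2_eqI:
  assumes "sq_integrable f" "AE x in lebesgue. rep_L2 v x = f x"
  shows "abs_L2 f = v"
  using rep_abs_L2[OF assms(1)] assms(2)
  by (intro L2_eqI) (auto elim: eventually_elim2)

lemma norm_diff_abs_L2:
  assumes "sq_integrable f"
  shows "(norm (v - abs_L2 f))\<^sup>2 = (LINT x|lebesgue. (rep_L2 v x - f x)\<^sup>2)"
proof -
  have [measurable]: "f \<in> borel_measurable lebesgue"
    using assms by (simp add: sq_integrable_def)
  have "(norm (v - abs_L2 f))\<^sup>2 = (LINT x|lebesgue. (rep_L2 (v - abs_L2 f) x)\<^sup>2)"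
    unfolding power2_norm_eq_inner inner_L2_def by (simp add: power2_eq_square)
  also have "\<dots> = (LINT x|lebesgue. (rep_L2 v x - f x)\<^sup>2)"
  proof (rule integral_cong_AE)
    from rep_L2_diff[of v "abs_L2 f"] rep_abs_L2[OF assms]
    show "AE x in lebesgue. (rep_L2 (v - abs_L2 f) x)\<^sup>2 = (rep_L2 v x - f x)\<^sup>2"
      by eventually_elim simp
  qed measurable
  finally show ?thesis .
qed

lemma tendsto_abs_L2:
  fixes v :: "'a::euclidean_space L2"
  assumes "\<And>n. sq_integrable (s n)"
    and "\<And>x. (\<lambda>n. s n x) \<longlonglongrightarrow> rep_L2 v x"
    and "\<And>n x. norm (s n x) \<le> 2 * norm (rep_L2 v x)"
  shows "(\<lambda>n. abs_L2 (s n)) \<longlonglongrightarrow> v"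
proof -
  have [measurable]: "s n \<in> borel_measurable lebesgue" for n
    using assms(1) by (simp add: sq_integrable_def)
  have "(\<lambda>n. LINT x|lebesgue. (rep_L2 v x - s n x)\<^sup>2) \<longlonglongrightarrow> (LINT x|(lebesgue :: 'a measure). (0 :: real))"
  proof (rule integral_dominated_convergence[where w = "\<lambda>x. 9 * (rep_L2 v x)\<^sup>2"])
    show "integrable lebesgue (\<lambda>x. 9 * (rep_L2 v x)\<^sup>2)"
      using sq_integrable_rep[of v] by (auto simp: sq_integrable_def)
    show "AE x in lebesgue. (\<lambda>n. (rep_L2 v x - s n x)\<^sup>2) \<longlonglongrightarrow> 0"
      using assms(2) by (intro AE_I2) (auto intro!: tendsto_eq_intros)
    show "AE x in lebesgue. norm ((rep_L2 v x - s n x)\<^sup>2) \<le> 9 * (rep_L2 v x)\<^sup>2" for n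
    proof (rule AE_I2)
      fix x
      have "\<bar>rep_L2 v x - s n x\<bar> \<le> 3 * \<bar>rep_L2 v x\<bar>"
        using assms(3)[of n x] by simp
      then have "\<bar>rep_L2 v x - s n x\<bar>\<^sup>2 \<le> (3 * \<bar>rep_L2 v x\<bar>)\<^sup>2"
        by (intro power_mono) auto
      then show "norm ((rep_L2 v x - s n x)\<^sup>2) \<le> 9 * (rep_L2 v x)\<^sup>2"
        by (simp add: power_mult_distrib)
    qed
  qed measurable
  then have "(\<lambda>n. (norm (v - abs_L2 (s n)))\<^sup>2) \<longlonglongrightarrow> 0"
    by (simp add: norm_diff_abs_L2[OF assms(1)])
  then have "(\<lambda>n. sqrt ((norm (v - abs_L2 (s n)))\<^sup>2)) \<longlonglongrightarrow> sqrt 0"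
    by (rule tendsto_real_sqrt)
  then have "(\<lambda>n. norm (abs_L2 (s n) - v)) \<longlonglongrightarrow> 0"
    by (simp add: norm_minus_commute)
  then show ?thesis
    by (simp add: LIM_zero_iff tendsto_norm_zero_iff)
qed

definition L2_chi :: "'a::euclidean_space set \<Rightarrow> 'a L2" where
  "L2_chi A = abs_L2 (indicator A)"

lemma rep_L2_chi: "A \<in> lmeasurable \<Longrightarrow> AE x in lebesgue. rep_L2 (L2_chi A) x = indicator A x"
  unfolding L2_chi_def by (intro rep_abs_L2 sq_integrable_indicator)

lemma L2_eq_closure:
  fixes S :: "'a::euclidean_space L2 set"
  assumes closed: "closed S" and sub: "subspace S"
    and base: "\<And>A. A \<in> lmeasurable \<Longrightarrow> L2_chi A \<in> S"
  shows "v \<in> S"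
proof -
  obtain s where s: "\<And>i. simple_function lebesgue (s i)"
    "\<And>x. (\<lambda>i. s i x) \<longlonglongrightarrow> rep_L2 v x"
    "\<And>i x. norm (s i x) \<le> 2 * norm (rep_L2 v x)"
    using borel_measurable_implies_sequence_metric[OF measurable_rep_L2[of v], of 0]
    by (auto simp: dist_real_def)
  have ms [measurable]: "s i \<in> borel_measurable lebesgue" for i
    by (rule borel_measurable_simple_function) (rule s)
  have sq: "sq_integrable (s i)" for i
    unfolding sq_integrable_def
  proof (intro conjI)
    show "integrable lebesgue (\<lambda>x. (s i x)\<^sup>2)"
    proof (rule Bochner_Integration.integrable_bound)
      show "integrable lebesgue (\<lambda>x. 4 * (rep_L2 v x)\<^sup>2)"
        using sq_integrable_rep[of v] by (auto simp: sq_integrable_def)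
      show "AE x in lebesgue. norm ((s i x)\<^sup>2) \<le> norm (4 * (rep_L2 v x)\<^sup>2)"
      proof (rule AE_I2)
        fix x
        have "\<bar>s i x\<bar>\<^sup>2 \<le> (2 * \<bar>rep_L2 v x\<bar>)\<^sup>2"
          using s(3)[of i x] by (intro power_mono) auto
        then show "norm ((s i x)\<^sup>2) \<le> norm (4 * (rep_L2 v x)\<^sup>2)"
          by (simp add: power_mult_distrib)
      qed
    qed measurable
  qed measurable
  have "abs_L2 (s i) \<in> S" for i
  proof -
    define Y where "Y = range (s i) - {0}"
    define A where "A y = s i -` {y}" for y
    have fin: "finite Y"
      using s(1)[of i] by (simp add: Y_def simple_function_def)
    have A: "A y \<in> lmeasurable" if "y \<in> Y" for y
    proof -
      have "y \<noteq> 0" using that by (simp add: Y_def)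
      have m: "A y \<in> sets lebesgue"
        using s(1)[of i] that by (auto simp: A_def Y_def simple_function_def)
      have "integrable lebesgue (indicat_real (A y))"
      proof (rule Bochner_Integration.integrable_bound)
        show "integrable lebesgue (\<lambda>x. (s i x)\<^sup>2 / y\<^sup>2)"
          using sq[of i] by (auto simp: sq_integrable_def)
        show "AE x in lebesgue. norm (indicat_real (A y) x) \<le> norm ((s i x)\<^sup>2 / y\<^sup>2)"
          using \<open>y \<noteq> 0\<close> by (intro AE_I2) (auto simp: A_def indicator_def)
        show "indicat_real (A y) \<in> borel_measurable lebesgue"
          using m by simp
      qed
      then show ?thesis
        using m by (simp add: integrable_indicator_iff fmeasurable_def)
    qed
    have "abs_L2 (s i) = (\<Sum>y\<in>Y. y *\<^sub>R L2_chi (A y))"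
    proof (rule abs_L2_eqI[OF sq])
      have "AE x in lebesgue. \<forall>y\<in>Y. rep_L2 (y *\<^sub>R L2_chi (A y)) x = y * indicator (A y) x"
      proof (subst AE_finite_all[OF fin], intro ballI)
        fix y assume "y \<in> Y"
        from rep_L2_scale[of y "L2_chi (A y)"] rep_L2_chi[OF A[OF this]]
        show "AE x in lebesgue. rep_L2 (y *\<^sub>R L2_chi (A y)) x = y * indicator (A y) x"
          by eventually_elim simp
      qed
      with rep_L2_sum[OF fin, of "\<lambda>y. y *\<^sub>R L2_chi (A y)"]
      show "AE x in lebesgue. rep_L2 (\<Sum>y\<in>Y. y *\<^sub>R L2_chi (A y)) x = s i x"
      proof eventually_elim
        case (elim x)
        have "(\<Sum>y\<in>Y. y * indicator (A y) x) = (\<Sum>y\<in>Y. if y = s i x then s i x else 0)"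
          by (intro sum.cong) (auto simp: A_def indicator_def)
        also have "\<dots> = s i x"
          using fin by (auto simp: Y_def)
        finally show ?case using elim by simp
      qed
    qed
    also have "\<dots> \<in> S"
      using A base by (intro subspace_sum[OF sub] subspace_scale[OF sub]) auto
    finally show ?thesis .
  qed
  then show "v \<in> S"
    by (rule closed_sequentially[OF closed _ tendsto_abs_L2[OF sq s(2,3)]])
qed

lemma L2_chi_AE:
  assumes "A \<in> lmeasurable" "B \<in> lmeasurable" "AE x in lebesgue. x \<in> A \<longleftrightarrow> x \<in> B"
  shows "L2_chi A = L2_chi B"
proof (rule L2_eqI)
  from rep_L2_chi[OF assms(1)] rep_L2_chi[OF assms(2)] assms(3)
  show "AE x in lebesgue. rep_L2 (L2_chi A) x = rep_L2 (L2_chi B) x"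
    by eventually_elim (simp add: indicator_def)
qed

lemma L2_chi_Un:
  assumes "A \<in> lmeasurable" "B \<in> lmeasurable" "A \<inter> B = {}"
  shows "L2_chi (A \<union> B) = L2_chi A + L2_chi B"
proof (rule L2_eqI)
  from rep_L2_chi[OF assms(1)] rep_L2_chi[OF assms(2)] rep_L2_chi[OF fmeasurable.Un[OF assms(1,2)]]
    rep_L2_add[of "L2_chi A" "L2_chi B"]
  show "AE x in lebesgue. rep_L2 (L2_chi (A \<union> B)) x = rep_L2 (L2_chi A + L2_chi B) x"
    by eventually_elim (use assms(3) in \<open>auto simp: indicator_def\<close>)
qed

lemma L2_chi_lim:
  fixes A :: "'a::euclidean_space set"
  assumes "A \<in> lmeasurable" "\<And>n. B n \<in> lmeasurable" "incseq B" "(\<Union>n. B n) = A"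
  shows "(\<lambda>n. L2_chi (B n)) \<longlonglongrightarrow> L2_chi A"
proof -
  have "(\<lambda>n. LINT x|lebesgue. (rep_L2 (L2_chi A) x - indicator (B n) x)\<^sup>2) \<longlonglongrightarrow> (LINT x|(lebesgue :: 'a measure). (0 :: real))"
  proof (rule integral_dominated_convergence[where w = "\<lambda>x. indicator A x"])
    show "integrable lebesgue (indicat_real A)"
      using assms(1) by (auto simp: fmeasurable_def)
    show "AE x in lebesgue. (\<lambda>n. (rep_L2 (L2_chi A) x - indicator (B n) x)\<^sup>2) \<longlonglongrightarrow> 0"
      using rep_L2_chi[OF assms(1)]
    proof eventually_elim
      case (elim x)
      have "(\<lambda>n. indicat_real (B n) x) \<longlonglongrightarrow> indicator A x"
        using LIMSEQ_indicator_incseq[OF assms(3), of x] assms(4) by simp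
      then show ?case
        using elim by (auto intro!: tendsto_eq_intros)
    qed
    show "AE x in lebesgue. norm ((rep_L2 (L2_chi A) x - indicator (B n) x)\<^sup>2) \<le> indicator A x" for n
      using rep_L2_chi[OF assms(1)]
    proof eventually_elim
      case (elim x)
      then show ?case
        using assms(4) by (auto simp: indicator_def)
    qed
    show "(\<lambda>x. (rep_L2 (L2_chi A) x - indicator (B n) x)\<^sup>2) \<in> borel_measurable lebesgue" for n
      using assms(2)[of n] by (auto simp: fmeasurable_def)
  qed simp
  then have "(\<lambda>n. (norm (L2_chi A - L2_chi (B n)))\<^sup>2) \<longlonglongrightarrow> 0"
    unfolding L2_chi_def[of "B _"] by (simp add: norm_diff_abs_L2[OF sq_integrable_indicator[OF assms(2)]])
  then have "(\<lambda>n. sqrt ((norm (L2_chi A - L2_chi (B n)))\<^sup>2)) \<longlonglongrightarrow> sqrt 0"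
    by (rule tendsto_real_sqrt)
  then have "(\<lambda>n. norm (L2_chi (B n) - L2_chi A)) \<longlonglongrightarrow> 0"
    by (simp add: norm_minus_commute)
  then show ?thesis
    by (simp add: LIM_zero_iff tendsto_norm_zero_iff)
qed

lemma lmeasurable_Int_ball: "A \<in> sets lebesgue \<Longrightarrow> A \<inter> ball 0 r \<in> lmeasurable"
  by (metis Int_commute fmeasurable_Int_fmeasurable lmeasurable_ball)

lemma L2_chi_borel:
  fixes S :: "'a::euclidean_space L2 set"
  assumes closed: "closed S" and sub: "subspace S"
    and G: "Int_stable G" "UNIV \<in> G" "sets borel = sigma_sets UNIV G"
    and base: "\<And>A. A \<in> G \<Longrightarrow> L2_chi (A \<inter> ball 0 r) \<in> S"
    and A: "A \<in> sets borel"
  shows "L2_chi (A \<inter> ball 0 r) \<in> S"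
proof -
  have leb: "A \<in> sets lebesgue" if "A \<in> sigma_sets UNIV G" for A
    using that G(3) by auto
  note lm = lmeasurable_Int_ball[OF leb]
  have z: "L2_chi {} = (0 :: 'a L2)"
    using L2_chi_Un[of "{}" "{}"] by simp
  have "A \<in> sigma_sets UNIV G" using A G(3) by simp
  with G(1) Pow_UNIV[THEN equalityD2, THEN subset_trans[OF subset_UNIV]] show ?thesis
  proof (induction rule: sigma_sets_induct_disjoint)
    case (basic A)
    then show ?case by (rule base)
  next
    case empty
    show ?case using subspace_0[OF sub] z by simp
  next
    case (compl A)
    have c: "UNIV - A \<in> sigma_sets UNIV G" using compl(1) by (rule sigma_sets.Compl)
    have "L2_chi (A \<inter> ball 0 r \<union> (UNIV - A) \<inter> ball 0 r) = L2_chi (A \<inter> ball 0 r) + L2_chi ((UNIV - A) \<inter> ball 0 r)"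
      by (intro L2_chi_Un lm compl c) auto
    moreover have "A \<inter> ball 0 r \<union> (UNIV - A) \<inter> ball 0 r = UNIV \<inter> ball 0 r" by auto
    ultimately have "L2_chi ((UNIV - A) \<inter> ball 0 r) = L2_chi (UNIV \<inter> ball 0 r) - L2_chi (A \<inter> ball 0 r)"
      by (simp add: algebra_simps)
    then show ?case
      using subspace_diff[OF sub base[OF G(2)] compl(2)] by simp
  next
    case (union A)
    define B where "B n = (\<Union>i<n. A i) \<inter> ball 0 r" for n
    have s: "(\<Union>i<n. A i) \<in> sigma_sets UNIV G" for n
    proof -
      have "A i \<in> sets borel" for i
        unfolding G(3) using union(2) by (rule subsetD) (rule rangeI)
      then have "(\<Union>i\<in>{..<n}. A i) \<in> sets borel"
        by (intro sets.finite_UN) auto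
      then show ?thesis unfolding G(3) .
    qed
    have u: "(\<Union>i. A i) \<in> sigma_sets UNIV G"
      using union(2) by (intro sigma_sets.Union) (rule subsetD, assumption, rule rangeI)
    have B: "L2_chi (B n) \<in> S" for n
    proof (induction n)
      case 0
      show ?case using subspace_0[OF sub] z by (simp add: B_def)
    next
      case (Suc n)
      have eq: "B (Suc n) = B n \<union> A n \<inter> ball 0 r"
        by (auto simp: B_def less_Suc_eq)
      have "L2_chi (B n \<union> A n \<inter> ball 0 r) = L2_chi (B n) + L2_chi (A n \<inter> ball 0 r)"
      proof (rule L2_chi_Un)
        show "B n \<in> lmeasurable" unfolding B_def by (rule lm[OF s])
        have "A n \<in> sigma_sets UNIV G" using union(2) by (rule subsetD) (rule rangeI)
        then show "A n \<inter> ball 0 r \<in> lmeasurable" by (rule lm)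
        show "B n \<inter> (A n \<inter> ball 0 r) = {}"
        proof -
          have "A i \<inter> A n = {}" if "i < n" for i
            using disjoint_family_onD[OF union(1), of i n] that by simp
          then show ?thesis unfolding B_def by blast
        qed
      qed
      then show ?case
        unfolding eq using subspace_add[OF sub Suc.IH union(3)[of n]] by simp
    qed
    have "(\<lambda>n. L2_chi (B n)) \<longlonglongrightarrow> L2_chi ((\<Union>i. A i) \<inter> ball 0 r)"
    proof (rule L2_chi_lim)
      show "(\<Union>i. A i) \<inter> ball 0 r \<in> lmeasurable" by (rule lm[OF u])
      show "B n \<in> lmeasurable" for n unfolding B_def by (rule lm[OF s])
      show "incseq B" unfolding incseq_def B_def by (auto intro: less_le_trans)
      show "(\<Union>n. B n) = (\<Union>i. A i) \<inter> ball 0 r" by (auto simp: B_def)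
    qed
    with B show ?case
      by (rule closed_sequentially[OF closed])
  qed
qed

lemma L2_eq_closure_ball:
  fixes S :: "'a::euclidean_space L2 set"
  assumes closed: "closed S" and sub: "subspace S"
    and G: "Int_stable G" "UNIV \<in> G" "sets borel = sigma_sets UNIV G"
    and base: "\<And>A n. A \<in> G \<Longrightarrow> L2_chi (A \<inter> ball 0 (real n)) \<in> S"
  shows "v \<in> S"
proof (rule L2_eq_closure[OF closed sub])
  fix A :: "'a set"
  assume A: "A \<in> lmeasurable"
  then have "A \<in> sets lebesgue" by (simp add: fmeasurable_def)
  then obtain B N N' where B: "A = B \<union> N" "N \<subseteq> N'" "N' \<in> null_sets lborel" "B \<in> sets lborel"
    by (rule sets_completionE)
  have leb: "B \<in> sets lebesgue" using B(4) by simp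
  have "B \<in> lmeasurable"
    using fmeasurableI2[OF A _ leb] B(1) by auto
  have "N' \<in> null_sets lebesgue"
    using B(3) by (rule null_sets_completionI)
  then have "AE x in lebesgue. x \<notin> N'" by (rule AE_not_in)
  then have "L2_chi A = L2_chi B"
    using A \<open>B \<in> lmeasurable\<close> B(1,2) by (intro L2_chi_AE) (auto elim!: eventually_mono)
  moreover have "L2_chi (B \<inter> ball 0 (real n)) \<in> S" for n
    using B(4) by (intro L2_chi_borel[OF closed sub G base]) auto
  moreover have "(\<lambda>n. L2_chi (B \<inter> ball 0 (real n))) \<longlonglongrightarrow> L2_chi B"
  proof (rule L2_chi_lim)
    show "B \<inter> ball 0 (real n) \<in> lmeasurable" for n
      by (rule lmeasurable_Int_ball[OF leb])
    show "incseq (\<lambda>n. B \<inter> ball 0 (real n))"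
      by (auto simp: incseq_def)
    show "(\<Union>n. B \<inter> ball 0 (real n)) = B"
      using reals_Archimedean2 by auto
  qed fact
  ultimately show "L2_chi A \<in> S"
    using closed_sequentially[OF closed, of "\<lambda>n. L2_chi (B \<inter> ball 0 (real n))"] by simp
qed

instance L2 :: (euclidean_space) second_countable_topology
proof
  obtain B :: "'a set set" where B: "countable B" "topological_basis B"
    using ex_countable_basis by auto
  define G where "G = Inter ` {F. finite F \<and> F \<subseteq> B}"
  have "countable {F. finite F \<and> F \<subseteq> B}"
    using B(1) by (rule countable_Collect_finite_subset)
  then have cG: "countable G" unfolding G_def by (rule countable_image)
  have UG: "UNIV \<in> G"
    unfolding G_def by (rule image_eqI[of _ _ "{}"]) auto
  have IG: "Int_stable G"
  proof (rule Int_stableI)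
    fix X Y assume "X \<in> G" "Y \<in> G"
    then obtain F F' where "finite F" "F \<subseteq> B" "X = \<Inter>F" "finite F'" "F' \<subseteq> B" "Y = \<Inter>F'"
      by (auto simp: G_def)
    then show "X \<inter> Y \<in> G"
      unfolding G_def by (intro image_eqI[of _ _ "F \<union> F'"]) auto
  qed
  have sG: "sets borel = sigma_sets UNIV G"
  proof
    have "sets borel = sets (sigma UNIV B)"
      by (simp only: borel_eq_countable_basis[OF B])
    also have "\<dots> = sigma_sets UNIV B" by simp
    also have "\<dots> \<subseteq> sigma_sets UNIV G"
    proof (rule sigma_sets_mono')
      show "B \<subseteq> G"
        unfolding G_def by (auto intro!: image_eqI[of _ _ "{_}"])
    qed
    finally show "sets borel \<subseteq> sigma_sets UNIV G" .
    have "open X" if "X \<in> G" for X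
      using that topological_basis_open[OF B(2)] by (auto simp: G_def intro!: open_Inter)
    then have "G \<subseteq> sets borel" by auto
    then show "sigma_sets UNIV G \<subseteq> sets borel"
      using sets.sigma_sets_subset[of G borel] by simp
  qed
  define E where "E = (\<lambda>(A, n). L2_chi (A \<inter> ball 0 (real n)) :: 'a L2) ` (G \<times> (UNIV :: nat set))"
  have cE: "countable E"
    unfolding E_def using cG by auto
  define D where "D = (\<lambda>l. sum_list (map (\<lambda>(q, e). real_of_rat q *\<^sub>R e) l)) ` lists ((UNIV :: rat set) \<times> E)"
  have cD: "countable D"
    unfolding D_def using cE by auto
  have D0: "0 \<in> D"
    unfolding D_def by (rule image_eqI[of _ _ "[]"]) auto
  have Dadd: "x + y \<in> D" if "x \<in> D" "y \<in> D" for x y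
  proof -
    from that obtain l l' where l: "l \<in> lists ((UNIV :: rat set) \<times> E)" "l' \<in> lists ((UNIV :: rat set) \<times> E)"
      "x = sum_list (map (\<lambda>(q, e). real_of_rat q *\<^sub>R e) l)"
      "y = sum_list (map (\<lambda>(q, e). real_of_rat q *\<^sub>R e) l')"
      by (auto simp: D_def)
    then show ?thesis
      unfolding D_def by (intro image_eqI[of _ _ "l @ l'"]) auto
  qed
  have Dscale: "real_of_rat q *\<^sub>R x \<in> D" if "x \<in> D" for x q
  proof -
    from that obtain l where l: "l \<in> lists ((UNIV :: rat set) \<times> E)"
      "x = sum_list (map (\<lambda>(q, e). real_of_rat q *\<^sub>R e) l)"
      by (auto simp: D_def)
    have "real_of_rat q *\<^sub>R sum_list (map (\<lambda>(q, e). real_of_rat q *\<^sub>R e) l)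
        = sum_list (map (\<lambda>(q, e). real_of_rat q *\<^sub>R e) (map (\<lambda>(p, e). (q * p, e)) l))"
      by (induction l) (auto simp: scaleR_add_right of_rat_mult)
    then show ?thesis
      unfolding D_def l(2) using l(1) by (intro image_eqI[of _ _ "map (\<lambda>(p, e). (q * p, e)) l"]) auto
  qed
  have ED: "E \<subseteq> D"
  proof
    fix e assume "e \<in> E"
    then show "e \<in> D"
      unfolding D_def by (intro image_eqI[of _ _ "[(1, e)]"]) auto
  qed
  have sub: "subspace (closure D)"
  proof (rule subspaceI)
    show "0 \<in> closure D" using D0 closure_subset by blast
    fix x y assume "x \<in> closure D" "y \<in> closure D"
    then obtain X Y where "\<And>n. X n \<in> D" "X \<longlonglongrightarrow> x" "\<And>n. Y n \<in> D" "Y \<longlonglongrightarrow> y"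
      by (auto simp: closure_sequential)
    then have "\<forall>n. X n + Y n \<in> D" "(\<lambda>n. X n + Y n) \<longlonglongrightarrow> x + y"
      by (auto intro!: Dadd tendsto_add)
    then show "x + y \<in> closure D"
      unfolding closure_sequential by (intro exI[of _ "\<lambda>n. X n + Y n"]) auto
  next
    fix c :: real and x assume "x \<in> closure D"
    then obtain X where X: "\<And>n. X n \<in> D" "X \<longlonglongrightarrow> x"
      by (auto simp: closure_sequential)
    have "\<exists>q. \<bar>c - real_of_rat q\<bar> < inverse (Suc n)" for n
    proof -
      have "c - inverse (real (Suc n)) < c" by simp
      then obtain q where "c - inverse (real (Suc n)) < real_of_rat q" "real_of_rat q < c"
        using of_rat_dense by blast
      then have "\<bar>c - real_of_rat q\<bar> < inverse (real (Suc n))" by linarith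
      then show ?thesis by blast
    qed
    then obtain q where q: "\<And>n. \<bar>c - real_of_rat (q n)\<bar> < inverse (Suc n)"
      by metis
    have "(\<lambda>n. real_of_rat (q n) - c) \<longlonglongrightarrow> 0"
    proof (rule Lim_null_comparison)
      show "\<forall>\<^sub>F n in sequentially. norm (real_of_rat (q n) - c) \<le> inverse (real (Suc n))"
        using q by (intro always_eventually allI) (metis abs_minus_commute less_imp_le real_norm_def)
      show "(\<lambda>n. inverse (real (Suc n))) \<longlonglongrightarrow> 0" by (rule LIMSEQ_inverse_real_of_nat)
    qed
    then have "(\<lambda>n. real_of_rat (q n)) \<longlonglongrightarrow> c" by (simp add: LIM_zero_iff)
    then have "(\<lambda>n. real_of_rat (q n) *\<^sub>R X n) \<longlonglongrightarrow> c *\<^sub>R x"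
      using X(2) by (rule tendsto_scaleR)
    then show "c *\<^sub>R x \<in> closure D"
      using X(1) Dscale unfolding closure_sequential by (intro exI[of _ "\<lambda>n. real_of_rat (q n) *\<^sub>R X n"]) auto
  qed
  have dense: "v \<in> closure D" for v
  proof (rule L2_eq_closure_ball[OF closed_closure sub IG UG sG])
    fix A n assume "A \<in> G"
    then have "L2_chi (A \<inter> ball 0 (real n)) \<in> E" by (auto simp: E_def)
    then show "L2_chi (A \<inter> ball 0 (real n)) \<in> closure D"
      using ED closure_subset by blast
  qed
  define T where "T = (\<lambda>(d, n). ball d (inverse (real (Suc n)))) ` (D \<times> (UNIV :: nat set))"
  have "countable T"
    unfolding T_def using cD by auto
  moreover have "topological_basis T"
  proof (rule topological_basisI)
    fix U assume "U \<in> T"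
    then show "open U" by (auto simp: T_def)
  next
    fix U :: "'a L2 set" and x assume "open U" "x \<in> U"
    then obtain e where e: "e > 0" "ball x e \<subseteq> U" by (meson open_contains_ball)
    then obtain n where n: "inverse (real (Suc n)) < e / 2"
      using reals_Archimedean[of "e / 2"] by auto
    obtain d where d: "d \<in> D" "dist d x < inverse (real (Suc n))"
      using dense[of x] unfolding closure_approachable
      by (metis inverse_positive_iff_positive of_nat_0_less_iff zero_less_Suc)
    have "ball d (inverse (real (Suc n))) \<subseteq> ball x e"
    proof
      fix y assume "y \<in> ball d (inverse (real (Suc n)))"
      then have "dist x y < e"
        using d(2) n dist_triangle[of x y d] by (simp add: dist_commute)
      then show "y \<in> ball x e" by simp
    qed
    then show "\<exists>B'\<in>T. x \<in> B' \<and> B' \<subseteq> U"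
      using d e(2) by (intro bexI[of _ "ball d (inverse (real (Suc n)))"]) (auto simp: T_def)
  qed
  ultimately show "\<exists>B :: 'a L2 set set. countable B \<and> open = generate_topology B"
    using topological_basis_imp_subbasis by blast
qed

subsection \<open>Domain, test functions, weak derivatives\<close>

definition convex_polygonal_domain :: "'a::euclidean_space set \<Rightarrow> bool" where
  "convex_polygonal_domain \<Omega> \<longleftrightarrow> open \<Omega> \<and> \<Omega> \<noteq> {} \<and> convex \<Omega> \<and> polytope (closure \<Omega>)"

definition L2_on :: "'a::euclidean_space set \<Rightarrow> 'a L2 set" where
  "L2_on \<Omega> = {v. AE x in lebesgue. x \<notin> \<Omega> \<longrightarrow> rep_L2 v x = 0}"

definition partial :: "'a::euclidean_space \<Rightarrow> ('a \<Rightarrow> real) \<Rightarrow> 'a \<Rightarrow> real" where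
  "partial b \<psi> x = frechet_derivative \<psi> (at x) b"

primrec C_k :: "nat \<Rightarrow> ('a::euclidean_space \<Rightarrow> real) \<Rightarrow> bool" where
  "C_k 0 \<psi> \<longleftrightarrow> continuous_on UNIV \<psi>"
| "C_k (Suc k) \<psi> \<longleftrightarrow> \<psi> differentiable_on UNIV \<and> (\<forall>b\<in>Basis. C_k k (partial b \<psi>))"

text \<open>\<open>C\<^sub>c\<^sup>\<infinity>(\<Omega>)\<close>, with functions extended by zero.\<close>

definition test_fun :: "'a::euclidean_space set \<Rightarrow> ('a \<Rightarrow> real) \<Rightarrow> bool" where
  "test_fun \<Omega> \<psi> \<longleftrightarrow> (\<forall>k. C_k k \<psi>) \<and> (\<exists>K. compact K \<and> K \<subseteq> \<Omega> \<and> (\<forall>x. x \<notin> K \<longrightarrow> \<psi> x = 0))"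

definition has_weak_partial ::
  "'a::euclidean_space set \<Rightarrow> 'a \<Rightarrow> 'a L2 \<Rightarrow> 'a L2 \<Rightarrow> bool" where
  "has_weak_partial \<Omega> b v g \<longleftrightarrow> g \<in> L2_on \<Omega> \<and>
    (\<forall>\<psi>. test_fun \<Omega> \<psi> \<longrightarrow>
      (LINT x:\<Omega>|lebesgue. rep_L2 v x * partial b \<psi> x) = - (LINT x:\<Omega>|lebesgue. rep_L2 g x * \<psi> x))"

definition weak_partial :: "'a::euclidean_space set \<Rightarrow> 'a \<Rightarrow> 'a L2 \<Rightarrow> 'a L2" where
  "weak_partial \<Omega> b v = (THE g. has_weak_partial \<Omega> b v g)"

definition H1 :: "'a::euclidean_space set \<Rightarrow> 'a L2 set" where
  "H1 \<Omega> = {v \<in> L2_on \<Omega>. \<forall>b\<in>Basis. \<exists>g. has_weak_partial \<Omega> b v g}"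

definition H1_norm :: "'a::euclidean_space set \<Rightarrow> 'a L2 \<Rightarrow> real" where
  "H1_norm \<Omega> v = sqrt ((norm v)\<^sup>2 + (\<Sum>b\<in>Basis. (norm (weak_partial \<Omega> b v))\<^sup>2))"

definition H2 :: "'a::euclidean_space set \<Rightarrow> 'a L2 set" where
  "H2 \<Omega> = {v \<in> H1 \<Omega>. \<forall>b\<in>Basis. weak_partial \<Omega> b v \<in> H1 \<Omega>}"

definition H1_0 :: "'a::euclidean_space set \<Rightarrow> 'a L2 set" where
  "H1_0 \<Omega> = {v \<in> H1 \<Omega>. \<exists>\<psi>. (\<forall>n. test_fun \<Omega> (\<psi> n)) \<and>
     (\<lambda>n::nat. H1_norm \<Omega> (v - abs_L2 (\<psi> n))) \<longlonglongrightarrow> 0}"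

definition laplacian :: "'a::euclidean_space set \<Rightarrow> 'a L2 \<Rightarrow> 'a L2" where
  "laplacian \<Omega> v = (\<Sum>b\<in>Basis. weak_partial \<Omega> b (weak_partial \<Omega> b v))"

subsection \<open>Eigenfunctions and the spaces \<open>dot H\<^sup>\<gamma>(\<Omega>)\<close>\<close>

definition dirichlet_eigenbasis ::
  "'a::euclidean_space set \<Rightarrow> (nat \<Rightarrow> 'a L2) \<Rightarrow> (nat \<Rightarrow> real) \<Rightarrow> bool" where
  "dirichlet_eigenbasis \<Omega> \<phi> lam \<longleftrightarrow>
    (\<forall>i. \<phi> i \<in> H1_0 \<Omega> \<inter> H2 \<Omega> \<and> - laplacian \<Omega> (\<phi> i) = lam i *\<^sub>R \<phi> i \<and> 0 < lam i) \<and>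
    mono lam \<and>
    (\<forall>i j. \<phi> i \<bullet> \<phi> j = (if i = j then 1 else 0)) \<and>
    closure (span (range \<phi>)) = L2_on \<Omega>"

text \<open>Norms take values in \<open>[0, \<infinity>]\<close>, so that a bound on a norm includes its finiteness.\<close>

definition esqrt :: "ennreal \<Rightarrow> ennreal" where
  "esqrt x = (if x = \<infinity> then \<infinity> else ennreal (sqrt (enn2real x)))"

definition dotH_norm ::
  "(nat \<Rightarrow> 'a::euclidean_space L2) \<Rightarrow> (nat \<Rightarrow> real) \<Rightarrow> real \<Rightarrow> 'a L2 \<Rightarrow> ennreal" where
  "dotH_norm \<phi> lam \<gamma> v = esqrt (\<Sum>i. ennreal (lam i powr \<gamma> * (v \<bullet> \<phi> i)\<^sup>2))"

definition dotH ::
  "'a::euclidean_space set \<Rightarrow> (nat \<Rightarrow> 'a L2) \<Rightarrow> (nat \<Rightarrow> real) \<Rightarrow> real \<Rightarrow> 'a L2 set" where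
  "dotH \<Omega> \<phi> lam \<gamma> = {v \<in> L2_on \<Omega>. dotH_norm \<phi> lam \<gamma> v < \<infinity>}"

definition dotH_inner ::
  "(nat \<Rightarrow> 'a::euclidean_space L2) \<Rightarrow> (nat \<Rightarrow> real) \<Rightarrow> real \<Rightarrow> 'a L2 \<Rightarrow> 'a L2 \<Rightarrow> real" where
  "dotH_inner \<phi> lam \<gamma> v w = (\<Sum>i. lam i powr \<gamma> * (v \<bullet> \<phi> i) * (w \<bullet> \<phi> i))"

text \<open>The orthonormal basis of \<open>dot H\<^sup>\<gamma>(\<Omega>)\<close> obtained by normalizing the eigenfunctions.\<close>

definition dotH_basis ::
  "(nat \<Rightarrow> 'a::euclidean_space L2) \<Rightarrow> (nat \<Rightarrow> real) \<Rightarrow> real \<Rightarrow> nat \<Rightarrow> 'a L2" where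
  "dotH_basis \<phi> lam \<gamma> i = (lam i powr (- \<gamma> / 2)) *\<^sub>R \<phi> i"

subsection \<open>Fourier transform and Sobolev spaces of fractional order on \<open>\<Omega>\<close>\<close>

definition fourier :: "('a::euclidean_space \<Rightarrow> real) \<Rightarrow> 'a \<Rightarrow> complex" where
  "fourier w \<xi> = ((2 * pi) powr (- real DIM('a) / 2)) *\<^sub>R
     (LINT x|lebesgue. w x *\<^sub>R cis (- (x \<bullet> \<xi>)))"

text \<open>
  The Fourier--Plancherel transform on \<open>L\<^sup>2(\<real>\<^sup>d)\<close>, as the \<open>L\<^sup>2\<close>-limit of the transforms of
  truncations; it is determined up to null sets.
\<close>

definition plancherel :: "'a::euclidean_space L2 \<Rightarrow> 'a \<Rightarrow> complex" where
  "plancherel v = (SOME g. g \<in> borel_measurable lebesgue \<and>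
     (\<lambda>n. \<integral>\<^sup>+\<xi>. ennreal ((cmod (g \<xi> - fourier (\<lambda>x. indicator (ball 0 (real n)) x * rep_L2 v x) \<xi>))\<^sup>2)
        \<partial>lebesgue) \<longlonglongrightarrow> 0)"

definition Hs_norm_space :: "real \<Rightarrow> 'a::euclidean_space L2 \<Rightarrow> ennreal" where
  "Hs_norm_space s v =
     esqrt (\<integral>\<^sup>+\<xi>. ennreal ((1 + (norm \<xi>)\<^sup>2) powr s * (cmod (plancherel v \<xi>))\<^sup>2) \<partial>lebesgue)"

text \<open>
  \<open>H\<^sup>s(\<Omega>)\<close> for \<open>s \<ge> 0\<close> is the space of restrictions to \<open>\<Omega>\<close> of elements of \<open>H\<^sup>s(\<real>\<^sup>d)\<close>, with the
  quotient norm; \<open>H\<^sub>0\<^sup>s(\<Omega>)\<close> is the closure of \<open>C\<^sub>c\<^sup>\<infinity>(\<Omega>)\<close> in it.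
\<close>

definition Hs_norm :: "'a::euclidean_space set \<Rightarrow> real \<Rightarrow> 'a L2 \<Rightarrow> ennreal" where
  "Hs_norm \<Omega> s v =
     (INF V\<in>{V. AE x in lebesgue. x \<in> \<Omega> \<longrightarrow> rep_L2 V x = rep_L2 v x}. Hs_norm_space s V)"

definition Hs_0 :: "'a::euclidean_space set \<Rightarrow> real \<Rightarrow> 'a L2 set" where
  "Hs_0 \<Omega> s = {v \<in> L2_on \<Omega>. Hs_norm \<Omega> s v < \<infinity> \<and>
     (\<exists>\<psi>. (\<forall>n. test_fun \<Omega> (\<psi> n)) \<and> (\<lambda>n::nat. Hs_norm \<Omega> s (v - abs_L2 (\<psi> n))) \<longlonglongrightarrow> 0)}"

text \<open>
  \<open>H\<^bsup>-\<beta>\<^esup>(\<Omega>)\<close> is the dual of \<open>H\<^sub>0\<^sup>\<beta>(\<Omega>)\<close>. A functional is represented by a map on the whole type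
  of which only the values on \<open>H\<^sub>0\<^sup>\<beta>(\<Omega>)\<close> matter. For \<open>\<beta> = 0\<close> this is \<open>L\<^sup>2(\<Omega>)\<close>, identified with its
  dual.
\<close>

definition Hneg_norm :: "'a::euclidean_space set \<Rightarrow> real \<Rightarrow> ('a L2 \<Rightarrow> real) \<Rightarrow> ennreal" where
  "Hneg_norm \<Omega> \<beta> F = (SUP v\<in>{v \<in> Hs_0 \<Omega> \<beta>. Hs_norm \<Omega> \<beta> v \<le> 1}. ennreal \<bar>F v\<bar>)"

definition Hneg :: "'a::euclidean_space set \<Rightarrow> real \<Rightarrow> ('a L2 \<Rightarrow> real) set" where
  "Hneg \<Omega> \<beta> = {F. (\<forall>v\<in>Hs_0 \<Omega> \<beta>. \<forall>w\<in>Hs_0 \<Omega> \<beta>. F (v + w) = F v + F w) \<and>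
     (\<forall>c. \<forall>v\<in>Hs_0 \<Omega> \<beta>. F (c *\<^sub>R v) = c * F v) \<and> Hneg_norm \<Omega> \<beta> F < \<infinity>}"

subsection \<open>Functions of time\<close>

text \<open>
  Strong (Bochner) measurability and \<open>L\<^sup>2(I; X)\<close> for a normed space given by a carrier \<open>X\<close> and
  a norm \<open>N\<close>, which need not be the norm of the ambient type.
\<close>

definition strongly_measurable ::
  "'x::minus set \<Rightarrow> ('x \<Rightarrow> ennreal) \<Rightarrow> real set \<Rightarrow> (real \<Rightarrow> 'x) \<Rightarrow> bool" where
  "strongly_measurable X N I v \<longleftrightarrow>
    (\<exists>s. (\<forall>n. simple_function (lebesgue_on I) (s n) \<and> s n ` I \<subseteq> X) \<and>
      (AE \<tau> in lebesgue_on I. v \<tau> \<in> X \<and> (\<lambda>n::nat. N (v \<tau> - s n \<tau>)) \<longlonglongrightarrow> 0))"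

definition L2_time_norm :: "('x \<Rightarrow> ennreal) \<Rightarrow> real set \<Rightarrow> (real \<Rightarrow> 'x) \<Rightarrow> ennreal" where
  "L2_time_norm N I v = esqrt (\<integral>\<^sup>+\<tau>. (N (v \<tau>))\<^sup>2 \<partial>lebesgue_on I)"

definition L2_time ::
  "'x::minus set \<Rightarrow> ('x \<Rightarrow> ennreal) \<Rightarrow> real set \<Rightarrow> (real \<Rightarrow> 'x) set" where
  "L2_time X N I = {v. strongly_measurable X N I v \<and> L2_time_norm N I v < \<infinity>}"

text \<open>The seminorms of \<open>H\<^sup>\<gamma>(0,t)\<close> and, for a Hilbert space with inner product \<open>ip\<close> and orthonormal
  basis \<open>e\<close>, of \<open>H\<^sup>\<gamma>(0,t;X)\<close>.\<close>

definition frac_seminorm :: "real \<Rightarrow> real \<Rightarrow> (real \<Rightarrow> real) \<Rightarrow> ennreal" where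
  "frac_seminorm \<gamma> t w =
     esqrt (\<integral>\<^sup>+\<xi>. ennreal (\<bar>\<xi>\<bar> powr (2 * \<gamma>) *
       (cmod (fourier (\<lambda>\<tau>. indicator {0<..<t} \<tau> * w \<tau>) \<xi>))\<^sup>2) \<partial>lebesgue)"

definition frac_seminorm_vec ::
  "real \<Rightarrow> real \<Rightarrow> ('x \<Rightarrow> 'x \<Rightarrow> real) \<Rightarrow> (nat \<Rightarrow> 'x) \<Rightarrow> (real \<Rightarrow> 'x) \<Rightarrow> ennreal" where
  "frac_seminorm_vec \<gamma> t ip e v = esqrt (\<Sum>i. (frac_seminorm \<gamma> t (\<lambda>\<tau>. ip (v \<tau>) (e i)))\<^sup>2)"

subsection \<open>Fractional derivatives\<close>

definition frac_int_left ::
  "real \<Rightarrow> real \<Rightarrow> (real \<Rightarrow> 'b::{banach, second_countable_topology}) \<Rightarrow> real \<Rightarrow> 'b" where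
  "frac_int_left a \<gamma> v t =
     (1 / Gamma \<gamma>) *\<^sub>R (LINT s:{a<..<t}|lebesgue. ((t - s) powr (\<gamma> - 1)) *\<^sub>R v s)"

definition frac_int_right ::
  "real \<Rightarrow> real \<Rightarrow> (real \<Rightarrow> 'b::{banach, second_countable_topology}) \<Rightarrow> real \<Rightarrow> 'b" where
  "frac_int_right b \<gamma> v t =
     (1 / Gamma \<gamma>) *\<^sub>R (LINT s:{t<..<b}|lebesgue. ((s - t) powr (\<gamma> - 1)) *\<^sub>R v s)"

text \<open>The distributional derivative on \<open>(a,b)\<close>, represented by a locally integrable function, which
  is determined up to null sets.\<close>

definition has_distr_deriv ::
  "real \<Rightarrow> real \<Rightarrow> (real \<Rightarrow> 'b::{banach, second_countable_topology}) \<Rightarrow> (real \<Rightarrow> 'b) \<Rightarrow> bool" where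
  "has_distr_deriv a b w g \<longleftrightarrow>
    (\<forall>c d. a < c \<and> c < d \<and> d < b \<longrightarrow>
      set_integrable lebesgue {c..d} w \<and> set_integrable lebesgue {c..d} g) \<and>
    (\<forall>\<psi>. test_fun {a<..<b} \<psi> \<longrightarrow>
      (LINT t:{a<..<b}|lebesgue. deriv \<psi> t *\<^sub>R w t) = - (LINT t:{a<..<b}|lebesgue. \<psi> t *\<^sub>R g t))"

definition distr_deriv ::
  "real \<Rightarrow> real \<Rightarrow> (real \<Rightarrow> 'b::{banach, second_countable_topology}) \<Rightarrow> real \<Rightarrow> 'b" where
  "distr_deriv a b w = (SOME g. has_distr_deriv a b w g)"

definition frac_deriv_left ::
  "real \<Rightarrow> real \<Rightarrow> real \<Rightarrow> (real \<Rightarrow> 'b::{banach, second_countable_topology}) \<Rightarrow> real \<Rightarrow> 'b" where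
  "frac_deriv_left a b \<gamma> v = distr_deriv a b (frac_int_left a (1 - \<gamma>) v)"

definition frac_deriv_right ::
  "real \<Rightarrow> real \<Rightarrow> real \<Rightarrow> (real \<Rightarrow> 'b::{banach, second_countable_topology}) \<Rightarrow> real \<Rightarrow> 'b" where
  "frac_deriv_right a b \<gamma> v t = - distr_deriv a b (frac_int_right b (1 - \<gamma>) v) t"

subsection \<open>Weak solutions\<close>

definition W_space ::
  "real \<Rightarrow> 'a::euclidean_space set \<Rightarrow> (nat \<Rightarrow> 'a L2) \<Rightarrow> (nat \<Rightarrow> real) \<Rightarrow> real \<Rightarrow> (real \<Rightarrow> 'a L2) set" where
  "W_space \<alpha> \<Omega> \<phi> lam T =
    {v \<in> L2_time (L2_on \<Omega>) (\<lambda>w. ennreal (norm w)) {0<..<T}.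
       frac_seminorm_vec (\<alpha> / 2) T inner \<phi> v < \<infinity>} \<inter>
    L2_time (dotH \<Omega> \<phi> lam 1) (dotH_norm \<phi> lam 1) {0<..<T}"

definition weak_solution ::
  "real \<Rightarrow> 'a::euclidean_space set \<Rightarrow> (nat \<Rightarrow> 'a L2) \<Rightarrow> (nat \<Rightarrow> real) \<Rightarrow> real \<Rightarrow>
   ('a L2 \<Rightarrow> real) \<Rightarrow> (real \<Rightarrow> 'a L2 \<Rightarrow> real) \<Rightarrow> (real \<Rightarrow> 'a L2) \<Rightarrow> bool" where
  "weak_solution \<alpha> \<Omega> \<phi> lam T u0 f u \<longleftrightarrow>
    u \<in> W_space \<alpha> \<Omega> \<phi> lam T \<and>
    (\<forall>v\<in>W_space \<alpha> \<Omega> \<phi> lam T.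
      (LINT t:{0<..<T}|lebesgue.
          frac_deriv_left 0 T (\<alpha> / 2) u t \<bullet> frac_deriv_right 0 T (\<alpha> / 2) v t) +
      (LINT t:{0<..<T}|lebesgue. \<Sum>b\<in>Basis. weak_partial \<Omega> b (u t) \<bullet> weak_partial \<Omega> b (v t)) =
      (LINT t:{0<..<T}|lebesgue. t powr (- \<alpha>) / Gamma (1 - \<alpha>) * u0 (v t) + f t (v t)))"

end

(*
  Expand the solution in the eigenfunctions. Testing with v = (I_{T-}^{alpha/2} h) phi_i turns the weak
  form into the scalar Volterra equations y_i = I^alpha (g_i - lam_i y_i), where g_i collects the
  coefficients of the data. Positivity of the Riemann--Liouville kernel gives
  |g_i - lam_i y_i| <= |g_i| and lam_i |y_i| <= |g_i| in L^2(0,t); together with the bound of I^alpha into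
  H^alpha (alpha < 1/2) and interpolation in the frequency variable this bounds every intermediate norm of
  y_i by lam_i^(theta-1) |g_i|. Summation over i leaves the sum of lam_i^(-beta) |g_i|^2, which is controlled
  by the H^(-beta) norms of the data because the spectral norm of finite eigenfunction combinations
  dominates their H^beta norm (K-functional interpolation between L^2 and H^1_0).
*)
theory Submission
  imports Defs "HOL-Probability.Probability"
begin

text \<open>The time seminorms are those of the extension by zero from (0,t), so the cut at t
  matters. After a leading term, the transform of the cut-off fractional integral is governed by a
  kernel that depends only on |xi| (t - y). The Schur test for this kernel converges because alpha <
  1/2, and by homogeneity its constant is independent of t. The same restriction puts tau^(-alpha)
  into L^2(0,t) with norm a multiple of t^(1/2-alpha), which is the weight of the initial datum. The
  Volterra equations are causal, so cutting them at t gives equations of the same form and every t <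
  T is covered by one argument. \<open>Omega\<close> enters the constants only through the radius of
  a ball that contains it, by way of Poincare's inequality.

  The derivatives in the weak form are chosen by \<open>SOME\<close>. They carry information only
  after existence of the fractional derivatives has been established, which takes a separate
  argument by Riesz representation. From Plancherel's theory two inequalities are used, Bessel's
  inequality and a Parseval bound; both come from Gaussian damping.\<close>

abbreviation nn_leb :: "('a::euclidean_space => ennreal) => ennreal" (binder "INTP " 10)
  where "nn_leb f == nn_integral lebesgue f"

abbreviation blm :: "('a::euclidean_space => 'b::topological_space) set"
  where "blm == borel_measurable lebesgue"


section \<open>Products of Lebesgue measure and the Fourier transform of integrable
  functions\<close>

lemma sigma_finite_lebesgue: "sigma_finite_measure (lebesgue :: 'a::euclidean_space measure)"
proof
 obtain A :: "nat => 'a set" where A: "range A \<subseteq> sets lborel" "(\<Union>i. A i) = space lborel"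
 "!!i. emeasure lborel (A i) ~= \<infinity>"
 using sigma_finite_measure.sigma_finite[OF sigma_finite_lborel] by metis
 show "\<exists>A::'a set set. countable A \<and> A \<subseteq> sets lebesgue \<and> \<Union>A = space lebesgue \<and> (\<forall>a\<in>A. emeasure lebesgue a ~= \<infinity>)"
 by (rule exI[of _ "range A"]) (use A in \<open>auto simp: image_subset_iff\<close>)
qed

interpretation lebesgue: sigma_finite_measure lebesgue
 by (rule sigma_finite_lebesgue)

interpretation lebesgue_pair: pair_sigma_finite lebesgue lebesgue ..

lemma lebesgue_ident_measurable: "(%x. x) \<in> borel_measurable (lebesgue :: 'a::euclidean_space measure)"
 by (rule measurable_completion) simp

text \<open>\<open>measurable_fst\<close> maps into \<open>lebesgue\<close>, whereas Borel kernels
  have to be composed with projections into \<open>borel\<close>. These rules are given to the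
  measurability prover before Fubini is applied to such kernels.\<close>

lemma lebesgue_fst_measurable: "fst \<in> borel_measurable ((lebesgue :: 'a::euclidean_space measure) \<Otimes>\<^sub>M M)"
 by (rule measurable_compose[OF measurable_fst lebesgue_ident_measurable])

lemma lebesgue_snd_measurable: "snd \<in> borel_measurable (M \<Otimes>\<^sub>M (lebesgue :: 'a::euclidean_space measure))"
 by (rule measurable_compose[OF measurable_snd lebesgue_ident_measurable])

lemmas lebesgue_proj_measurable = lebesgue_fst_measurable lebesgue_snd_measurable

lemma cis_measurable [measurable]: "f \<in> borel_measurable M ==> (%x. cis (f x)) \<in> borel_measurable M"
 by (rule borel_measurable_continuous_on[of cis]) (auto intro!: continuous_intros)

lemma integrable_lebesgue_product:
 fixes f :: "'a::euclidean_space => real" and g :: "'b::euclidean_space => 'c::{real_normed_vector, banach, second_countable_topology}"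
 assumes "integrable lebesgue f" "integrable lebesgue g"
 shows "integrable (lebesgue \<Otimes>\<^sub>M lebesgue) (%(x, y). f x *\<^sub>R g y)"
proof (rule lebesgue_pair.Fubini_integrable)
 have [measurable]: "f \<in> blm" "g \<in> blm" using assms by auto
 show "(%(x, y). f x *\<^sub>R g y) \<in> borel_measurable (lebesgue \<Otimes>\<^sub>M lebesgue)" by measurable
 show "integrable lebesgue (%x. LINT y|lebesgue. norm (case (x, y) of (x, y) => f x *\<^sub>R g y))"
 using assms by simp
 show "AE x in lebesgue. integrable lebesgue (%y. case (x, y) of (x, y) => f x *\<^sub>R g y)"
 using assms by simp
qed

lemma fourier_measurable [measurable]:
 assumes [measurable]: "w \<in> blm"
 shows "fourier w \<in> blm"
proof -
 note lebesgue_proj_measurable[measurable]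
 show ?thesis unfolding fourier_def by measurable
qed

lemma integrable_fourier_kernel:
 fixes w :: "'a::euclidean_space => real"
 assumes "integrable lebesgue w"
 shows "integrable lebesgue (%x. w x *\<^sub>R cis (- (x \<bullet> xi)))"
proof (rule Bochner_Integration.integrable_bound[OF assms])
 note lebesgue_ident_measurable[measurable]
 have [measurable]: "w \<in> blm" using assms by auto
 show "(%x. w x *\<^sub>R cis (- (x \<bullet> xi))) \<in> blm" by measurable
qed auto

lemma cmod_fourier_le:
 fixes w :: "'a::euclidean_space => real"
 shows "cmod (fourier w xi) <= (2 * pi) powr (- real DIM('a) / 2) * (LINT x|lebesgue. \<bar>w x\<bar>)"
proof -
 have "cmod (LINT x|lebesgue. w x *\<^sub>R cis (- (x \<bullet> xi))) <= (LINT x|lebesgue. cmod (w x *\<^sub>R cis (- (x \<bullet> xi))))"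
 by (rule integral_norm_bound)
 then show ?thesis unfolding fourier_def by (simp add: mult_left_mono)
qed

lemma fourier_cong_AE:
 assumes "w \<in> blm" "v \<in> blm" "AE x in lebesgue. w x = v x"
 shows "fourier w = fourier v"
proof
 fix xi :: 'a
 have [measurable]: "w \<in> blm" "v \<in> blm" using assms by auto
 have [measurable]: "(%x. cis (- (x \<bullet> xi))) \<in> blm"
 by (rule measurable_completion) measurable
 have "(LINT x|lebesgue. w x *\<^sub>R cis (- (x \<bullet> xi))) = (LINT x|lebesgue. v x *\<^sub>R cis (- (x \<bullet> xi)))"
 by (rule integral_cong_AE) (use assms(3) in \<open>auto elim!: eventually_mono\<close>)
 then show "fourier w xi = fourier v xi"
 unfolding fourier_def by simp
qed

lemma fourier_scale: "fourier (%x. c * w x) xi = c *\<^sub>R fourier w xi"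
 unfolding fourier_def by (simp add: scaleR_scaleR[symmetric] del: scaleR_scaleR) (simp add: mult.commute)

lemma fourier_add:
 assumes "integrable lebesgue w" "integrable lebesgue v"
 shows "fourier (%x. w x + v x) xi = fourier w xi + fourier v xi"
 unfolding fourier_def scaleR_add_left
 by (subst Bochner_Integration.integral_add) (auto intro: integrable_fourier_kernel assms simp: algebra_simps)

text \<open>The multiplication formula: Fubini moves the transform from \<open>w\<close> onto
  \<open>G\<close>. The double integral converges absolutely because the character has modulus
  1.\<close>

lemma fourier_multiplication:
 fixes w :: "'a::euclidean_space => real" and G :: "'a => complex"
 assumes w: "integrable lebesgue w" and G: "integrable lebesgue G"
 shows "(LINT xi|lebesgue. fourier w xi * G xi) =
 (2 * pi) powr (- real DIM('a) / 2) *\<^sub>R (LINT x|lebesgue. w x *\<^sub>R (LINT xi|lebesgue. cis (- (x \<bullet> xi)) * G xi))"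
proof -
 have [measurable]: "w \<in> blm" "G \<in> blm" using w G by auto
 note lebesgue_proj_measurable[measurable]
 have int: "integrable (lebesgue \<Otimes>\<^sub>M lebesgue) (%(x, xi). w x *\<^sub>R (cis (- (x \<bullet> xi)) * G xi))"
 by (rule Bochner_Integration.integrable_bound[OF integrable_lebesgue_product[OF w G]])
 (measurable, auto simp: norm_mult)
 have "(LINT x|lebesgue. w x *\<^sub>R (LINT xi|lebesgue. cis (- (x \<bullet> xi)) * G xi))
 = (LINT x|lebesgue. (LINT xi|lebesgue. w x *\<^sub>R (cis (- (x \<bullet> xi)) * G xi)))"
 by simp
 also have "... = (LINT xi|lebesgue. (LINT x|lebesgue. w x *\<^sub>R (cis (- (x \<bullet> xi)) * G xi)))"
 using lebesgue_pair.Fubini_integral[OF int] by simp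
 also have "... = (LINT xi|lebesgue. (LINT x|lebesgue. w x *\<^sub>R cis (- (x \<bullet> xi))) * G xi)"
 by (simp flip: scaleR_left_commute mult_scaleR_left)
 finally show ?thesis unfolding fourier_def by simp
qed

text \<open>True without integrability, because the Bochner integral of a non-integrable function is
  0.\<close>

lemma norm_integral_le_nn_integral:
 fixes f :: "_ => 'b::{banach, second_countable_topology}"
 shows "ennreal (norm (integral\<^sup>L M f)) <= (\<integral>\<^sup>+x. ennreal (norm (f x)) \<partial>M)"
 by (cases "integrable M f") (simp_all add: integral_norm_bound_ennreal not_integrable_integral_eq)

section \<open>Gaussian damping: Bessel's inequality and a Parseval bound\<close>

text \<open>The centred normal density with standard deviation \<epsilon> in each coordinate; it
  serves as an approximate identity for \<epsilon> tending to 0.\<close>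

definition gauss_kernel :: "real => 'a::euclidean_space => real" where
 "gauss_kernel \<epsilon> x = (\<Prod>b\<in>Basis. normal_density 0 \<epsilon> (x \<bullet> b))"

text \<open>Rescaling by \<epsilon> reduces the integral to the characteristic function of the
  standard normal distribution.\<close>

lemma gauss_fourier_real:
 assumes "\<epsilon> > 0"
 shows "integrable lborel (%s. exp (- (\<epsilon> * s)\<^sup>2 / 2) *\<^sub>R cis (- (x * s)))"
 "(LINT s|lborel. exp (- (\<epsilon> * s)\<^sup>2 / 2) *\<^sub>R cis (- (x * s))) = complex_of_real (2 * pi * normal_density 0 \<epsilon> x)"
proof -
 have d: "exp (- (\<epsilon> * s)\<^sup>2 / 2) = sqrt (2 * pi) / \<epsilon> * normal_density 0 (1 / \<epsilon>) s" for s
 using assms by (simp add: normal_density_def power_divide real_sqrt_divide power_mult_distrib real_sqrt_mult)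
 have i: "integrable lborel (%s. exp (- (\<epsilon> * s)\<^sup>2 / 2))"
 unfolding d using assms by (intro integrable_mult_right) auto
 show "integrable lborel (%s. exp (- (\<epsilon> * s)\<^sup>2 / 2) *\<^sub>R cis (- (x * s)))"
 by (rule Bochner_Integration.integrable_bound[OF i])
 (auto intro!: borel_measurable_continuous_onI continuous_intros)
 have "(LINT s|lborel. exp (- (\<epsilon> * s)\<^sup>2 / 2) *\<^sub>R cis (- (x * s))) =
 \<bar>1 / \<epsilon>\<bar> *\<^sub>R (LINT s|lborel. exp (- (\<epsilon> * (0 + (1 / \<epsilon>) * s))\<^sup>2 / 2) *\<^sub>R cis (- (x * (0 + (1 / \<epsilon>) * s))))"
 by (rule lborel_integral_real_affine) (use assms in auto)
 also have "... = (1 / \<epsilon>) *\<^sub>R (LINT s|lborel. sqrt (2 * pi) *\<^sub>R (std_normal_density s *\<^sub>R iexp ((- x / \<epsilon>) * s)))"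
 using assms by (simp add: std_normal_density_def cis_conv_exp mult_ac)
 also have "... = (sqrt (2 * pi) / \<epsilon>) *\<^sub>R char std_normal_distribution (- x / \<epsilon>)"
 unfolding char_def integral_scaleR_right by (subst integral_density) auto
 also have "... = complex_of_real (2 * pi * normal_density 0 \<epsilon> x)"
 unfolding char_std_normal_distribution using assms
 by (simp add: normal_density_def power_divide real_sqrt_mult field_simps scaleR_conv_of_real flip: of_real_mult of_real_divide)
 finally show "(LINT s|lborel. exp (- (\<epsilon> * s)\<^sup>2 / 2) *\<^sub>R cis (- (x * s))) = complex_of_real (2 * pi * normal_density 0 \<epsilon> x)" .
qed

text \<open>\<open>lborel\<close> on a Euclidean space is the image of a product of copies of
  \<open>lborel\<close> on the line, so a product of functions of single coordinates integrates
  factor by factor.\<close>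

lemma lborel_prod_integral:
 fixes f :: "'a::euclidean_space => real => complex"
 assumes "!!b. b \<in> Basis ==> integrable lborel (f b)"
 shows "integrable lborel (%x. \<Prod>b\<in>Basis. f b (x \<bullet> b))"
 "(LINT x|lborel. (\<Prod>b\<in>Basis. f b (x \<bullet> b))) = (\<Prod>b\<in>Basis. LINT s|lborel. f b s)"
proof -
 have ps: "product_sigma_finite (%_::'a. lborel :: real measure)"
 by (simp add: product_sigma_finite_def sigma_finite_lborel)
 note P = product_sigma_finite.product_integrable_prod[OF ps finite_Basis assms]
 product_sigma_finite.product_integral_prod[OF ps finite_Basis assms]
 have m: "(%h. \<Sum>b\<in>Basis. h b *\<^sub>R b) \<in> measurable (\<Pi>\<^sub>M b\<in>(Basis::'a set). (lborel :: real measure)) borel"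
 by measurable
 have mf: "(%x. \<Prod>b\<in>Basis. f b (x \<bullet> b)) \<in> borel_measurable borel"
 proof (rule borel_measurable_prod)
 fix b :: 'a assume "b \<in> Basis"
 then have [measurable]: "f b \<in> borel_measurable borel" using assms[of b] by auto
 show "(%x. f b (x \<bullet> b)) \<in> borel_measurable borel" by measurable
 qed
 have eq: "(\<Prod>b\<in>Basis. f b ((\<Sum>b'\<in>Basis. h b' *\<^sub>R b') \<bullet> b)) = (\<Prod>b\<in>Basis. f b (h b))" for h
 by (rule prod.cong) auto
 show "integrable lborel (%x. \<Prod>b\<in>Basis. f b (x \<bullet> b))"
 using P(1) by (subst lborel_eq, subst integrable_distr_eq[OF m mf]) (simp add: eq)
 show "(LINT x|lborel. (\<Prod>b\<in>Basis. f b (x \<bullet> b))) = (\<Prod>b\<in>Basis. LINT s|lborel. f b s)"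
 using P(2) by (subst lborel_eq, subst integral_distr[OF m mf]) (simp add: eq)
qed

lemma norm_power2_Basis: "(norm (x::'a::euclidean_space))\<^sup>2 = (\<Sum>b\<in>Basis. (x \<bullet> b)\<^sup>2)"
 unfolding power2_norm_eq_inner by (subst euclidean_inner) (simp add: power2_eq_square)

lemma gauss_fourier:
 fixes x :: "'a::euclidean_space"
 assumes "\<epsilon> > 0"
 shows "integrable lebesgue (%xi::'a. exp (- (\<epsilon> * norm xi)\<^sup>2 / 2))"
 "(LINT xi|lebesgue. exp (- (\<epsilon> * norm xi)\<^sup>2 / 2) *\<^sub>R cis (- (x \<bullet> xi))) = complex_of_real ((2 * pi) ^ DIM('a) * gauss_kernel \<epsilon> x)"
proof -
 define f where "f b s = exp (- (\<epsilon> * s)\<^sup>2 / 2) *\<^sub>R cis (- ((x \<bullet> b) * s))" for b s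
 have fp: "(\<Prod>b\<in>Basis. f b (xi \<bullet> b)) = exp (- (\<epsilon> * norm xi)\<^sup>2 / 2) *\<^sub>R cis (- (x \<bullet> xi))" for xi
 proof -
 have e: "exp (- (\<epsilon> * norm xi)\<^sup>2 / 2) = (\<Prod>b\<in>Basis. exp (- (\<epsilon> * (xi \<bullet> b))\<^sup>2 / 2))"
 by (simp add: power_mult_distrib norm_power2_Basis sum_distrib_left sum_negf sum_divide_distrib flip: exp_sum)
 have c: "cis (- (x \<bullet> xi)) = (\<Prod>b\<in>Basis. cis (- ((x \<bullet> b) * (xi \<bullet> b))))"
 unfolding cis_conv_exp by (subst euclidean_inner) (simp add: sum_distrib_left flip: exp_sum sum_negf)
 show ?thesis unfolding e c f_def scaleR_conv_of_real prod.distrib by simp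
 qed
 have fi: "integrable lborel (f b)" for b
 unfolding f_def by (rule gauss_fourier_real(1)[OF assms])
 have i: "integrable lborel (%xi. exp (- (\<epsilon> * norm xi)\<^sup>2 / 2) *\<^sub>R cis (- (x \<bullet> xi)))"
 using lborel_prod_integral(1)[of f, OF fi] unfolding fp .
 have "integrable lborel (%xi::'a. exp (- (\<epsilon> * norm xi)\<^sup>2 / 2))"
 by (rule Bochner_Integration.integrable_bound[OF i]) auto
 then show "integrable lebesgue (%xi::'a. exp (- (\<epsilon> * norm xi)\<^sup>2 / 2))"
 by (simp add: integrable_completion)
 have "(LINT xi|lebesgue. exp (- (\<epsilon> * norm xi)\<^sup>2 / 2) *\<^sub>R cis (- (x \<bullet> xi))) = (LINT xi|lborel. exp (- (\<epsilon> * norm xi)\<^sup>2 / 2) *\<^sub>R cis (- (x \<bullet> xi)))"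
 by (rule integral_completion) measurable
 also have "... = (\<Prod>b\<in>Basis. complex_of_real (2 * pi * normal_density 0 \<epsilon> (x \<bullet> b)))"
 unfolding fp[symmetric] lborel_prod_integral(2)[of f, OF fi]
 unfolding f_def gauss_fourier_real(2)[OF assms] ..
 also have "... = complex_of_real ((2 * pi) ^ DIM('a) * gauss_kernel \<epsilon> x)"
 by (simp add: gauss_kernel_def prod.distrib)
 finally show "(LINT xi|lebesgue. exp (- (\<epsilon> * norm xi)\<^sup>2 / 2) *\<^sub>R cis (- (x \<bullet> xi))) = complex_of_real ((2 * pi) ^ DIM('a) * gauss_kernel \<epsilon> x)" .
qed

lemma gauss_kernel_nonneg [simp]: "0 <= gauss_kernel \<epsilon> x"
 by (simp add: gauss_kernel_def prod_nonneg)

lemma gauss_kernel_measurable [measurable]: "gauss_kernel \<epsilon> \<in> borel_measurable borel"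
proof -
 have "(%x. normal_density 0 \<epsilon> (x \<bullet> b)) \<in> borel_measurable borel" for b :: 'a
 by measurable
 then have "(%x::'a. \<Prod>b\<in>Basis. normal_density 0 \<epsilon> (x \<bullet> b)) \<in> borel_measurable borel"
 by (intro borel_measurable_prod)
 then show ?thesis unfolding gauss_kernel_def[abs_def] .
qed

lemma gauss_kernel_minus: "gauss_kernel \<epsilon> (x - y) = gauss_kernel \<epsilon> (y - x)"
 unfolding gauss_kernel_def by (rule prod.cong) (auto simp: normal_density_def inner_diff_left power2_commute)

lemma nn_integral_gauss_kernel:
 assumes "\<epsilon> > 0"
 shows "(\<integral>\<^sup>+y. ennreal (gauss_kernel \<epsilon> (x - y)) \<partial>(lebesgue :: 'a::euclidean_space measure)) = 1"
proof -
 have "(INTP y. ennreal (gauss_kernel \<epsilon> (x - y))) = (\<integral>\<^sup>+y. ennreal (gauss_kernel \<epsilon> (y - x)) \<partial>lborel)"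
 by (subst gauss_kernel_minus) (simp add: nn_integral_completion)
 also have "... = (\<integral>\<^sup>+y. ennreal (gauss_kernel \<epsilon> y) \<partial>distr lborel borel (%y. - x + y))"
 by (subst nn_integral_distr) (auto simp: algebra_simps)
 also have "... = (\<integral>\<^sup>+y. ennreal (gauss_kernel \<epsilon> y) \<partial>(lborel :: 'a measure))"
 by (simp only: lborel_distr_plus)
 also have "... = (\<integral>\<^sup>+y. ennreal (\<Prod>b\<in>Basis. normal_density 0 \<epsilon> (y \<bullet> b)) \<partial>(lborel :: 'a measure))"
 by (simp add: gauss_kernel_def)
 also have "... = (\<Prod>b\<in>(Basis :: 'a set). \<integral>\<^sup>+s. ennreal (normal_density 0 \<epsilon> s) \<partial>lborel)"
 by (subst nn_integral_lborel_prod[symmetric]) (auto simp: prod_ennreal)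
 also have "(\<integral>\<^sup>+s. ennreal (normal_density 0 \<epsilon> s) \<partial>lborel) = 1"
 using prob_space.emeasure_space_1[OF prob_space_normal_density[OF assms, of 0]]
 by (simp add: emeasure_density)
 finally show ?thesis by simp
qed

text \<open>Parseval's identity with a Gaussian factor, which makes all integrals absolutely
  convergent for merely integrable functions. The multiplication formula is applied once to each
  function, and the transform of the Gaussian then appears as a convolution with
  \<open>gauss_kernel\<close>.\<close>

lemma fourier_gauss_identity:
 fixes w1 w2 :: "'a::euclidean_space => real"
 assumes "\<epsilon> > 0" and w: "integrable lebesgue w1" "integrable lebesgue w2"
 shows "(LINT xi|lebesgue. exp (- (\<epsilon> * norm xi)\<^sup>2 / 2) *\<^sub>R (fourier w1 xi * cnj (fourier w2 xi)))
 = complex_of_real (LINT x|lebesgue. w1 x * (LINT y|lebesgue. w2 y * gauss_kernel \<epsilon> (x - y)))"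
proof -
 define c where "c = (2 * pi) powr (- real DIM('a) / 2)"
 \<comment> \<open>The normalization of the transform enters twice and cancels the factor that the
   Gaussian integral produces.\<close>
 have c2: "c * c * (2 * pi) ^ DIM('a) = 1"
 by (simp add: c_def powr_minus divide_simps flip: powr_add powr_realpow) (simp add: powr_mult)
 define g where "g xi = exp (- (\<epsilon> * norm xi)\<^sup>2 / 2)" for xi :: 'a
 have g: "integrable lebesgue g"
 unfolding g_def by (rule gauss_fourier(1)[OF assms(1)])
 have [measurable]: "w1 \<in> blm" "w2 \<in> blm"
 "g \<in> blm" using w g by auto
 have cis_m [measurable]: "(%xi. cis (x \<bullet> xi)) \<in> blm" for x :: 'a
 by (rule measurable_completion) measurable
 have [measurable]: "(%xi. cnj (fourier w2 xi)) \<in> blm"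
 by (rule borel_measurable_continuous_on[of cnj]) (auto intro!: continuous_intros)
 have F2: "integrable lebesgue (%xi. g xi *\<^sub>R cnj (fourier w2 xi))"
 proof (rule Bochner_Integration.integrable_bound[OF integrable_mult_left[OF g, of "c * (LINT x|lebesgue. \<bar>w2 x\<bar>)"]])
 show "AE xi in lebesgue. norm (g xi *\<^sub>R cnj (fourier w2 xi)) <= norm (g xi * (c * (LINT x|lebesgue. \<bar>w2 x\<bar>)))"
 using cmod_fourier_le[of w2] by (auto intro!: mult_left_mono simp: abs_mult c_def g_def)
 qed measurable
 have G: "integrable lebesgue (%xi. g xi *\<^sub>R cis (x \<bullet> xi))" for x
 by (rule Bochner_Integration.integrable_bound[OF g]) auto
 have inner: "(LINT xi|lebesgue. cis (- (x \<bullet> xi)) * (g xi *\<^sub>R cnj (fourier w2 xi)))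
 = complex_of_real (c * (2 * pi) ^ DIM('a) * (LINT y|lebesgue. w2 y * gauss_kernel \<epsilon> (x - y)))" for x
 proof -
 have gk: "(LINT xi|lebesgue. cis (- (y \<bullet> xi)) * (g xi *\<^sub>R cis (x \<bullet> xi))) = complex_of_real ((2 * pi) ^ DIM('a) * gauss_kernel \<epsilon> (x - y))" for y
 using gauss_fourier(2)[OF assms(1), of "y - x"]
 by (simp add: g_def cis_mult inner_diff_left gauss_kernel_minus[of _ y])
 have "(LINT xi|lebesgue. fourier w2 xi * (g xi *\<^sub>R cis (x \<bullet> xi))) =
 c *\<^sub>R (LINT y|lebesgue. w2 y *\<^sub>R (LINT xi|lebesgue. cis (- (y \<bullet> xi)) * (g xi *\<^sub>R cis (x \<bullet> xi))))"
 unfolding c_def by (rule fourier_multiplication[OF w(2) G])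
 then have "(LINT xi|lebesgue. fourier w2 xi * (g xi *\<^sub>R cis (x \<bullet> xi))) =
 c *\<^sub>R (LINT y|lebesgue. complex_of_real ((2 * pi) ^ DIM('a) * (w2 y * gauss_kernel \<epsilon> (x - y))))"
 unfolding gk by (simp add: scaleR_conv_of_real mult_ac)
 then have "cnj (LINT xi|lebesgue. fourier w2 xi * (g xi *\<^sub>R cis (x \<bullet> xi))) =
 complex_of_real (c * (2 * pi) ^ DIM('a) * (LINT y|lebesgue. w2 y * gauss_kernel \<epsilon> (x - y)))"
 by (simp only: integral_complex_of_real) (simp add: scaleR_conv_of_real)
 then have "(LINT xi|lebesgue. cnj (fourier w2 xi * (g xi *\<^sub>R cis (x \<bullet> xi)))) =
 complex_of_real (c * (2 * pi) ^ DIM('a) * (LINT y|lebesgue. w2 y * gauss_kernel \<epsilon> (x - y)))"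
 unfolding Bochner_Integration.integral_cnj .
 then show ?thesis
 by (simp add: cis_cnj mult_ac)
 qed
 have "(LINT xi|lebesgue. fourier w1 xi * (g xi *\<^sub>R cnj (fourier w2 xi))) =
 c *\<^sub>R (LINT x|lebesgue. w1 x *\<^sub>R (LINT xi|lebesgue. cis (- (x \<bullet> xi)) * (g xi *\<^sub>R cnj (fourier w2 xi))))"
 unfolding c_def by (rule fourier_multiplication[OF w(1) F2])
 also have "... = c *\<^sub>R (LINT x|lebesgue. complex_of_real ((c * (2 * pi) ^ DIM('a)) * (w1 x * (LINT y|lebesgue. w2 y * gauss_kernel \<epsilon> (x - y)))))"
 unfolding inner by (simp add: scaleR_conv_of_real mult_ac)
 also have "... = complex_of_real ((c * c * (2 * pi) ^ DIM('a)) * (LINT x|lebesgue. w1 x * (LINT y|lebesgue. w2 y * gauss_kernel \<epsilon> (x - y))))"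
 unfolding integral_complex_of_real integral_mult_right_zero by (simp add: scaleR_conv_of_real)
 finally show ?thesis unfolding c2 by (simp add: g_def)
qed

lemma sq_integrable_imp_measurable: "sq_integrable w ==> w \<in> blm"
 by (simp add: sq_integrable_def)

text \<open>With Gaussian damping the left side is a quadratic form of \<open>gauss_kernel\<close>.
  Since |w x| |w y| is at most the mean of the two squares and the kernel has mass 1 in each
  variable, that form is at most the integral of the square of \<open>w\<close>. Fatou's lemma
  removes the damping.\<close>

lemma fourier_bessel:
 fixes w :: "'a::euclidean_space => real"
 assumes w: "integrable lebesgue w" and m[measurable]: "w \<in> blm"
 shows "(INTP xi. ennreal ((cmod (fourier w xi))\<^sup>2)) <= (INTP x. ennreal ((w x)\<^sup>2))"
proof -
 note lebesgue_proj_measurable[measurable]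
 define S where "S = (INTP x. ennreal ((w x)\<^sup>2))"
 have damped: "(INTP xi. ennreal (exp (- (\<epsilon> * norm xi)\<^sup>2 / 2) * (cmod (fourier w xi))\<^sup>2)) <= S" if "\<epsilon> > 0" for \<epsilon>
 proof -
 let ?g = "%xi::'a. exp (- (\<epsilon> * norm xi)\<^sup>2 / 2)"
 let ?G = "gauss_kernel \<epsilon> :: 'a => real"
 let ?K = "%x y. ennreal (\<bar>w x\<bar> * (\<bar>w y\<bar> * ?G (x - y)))"
 have Gm [measurable]: "(%y. ?G (x - y)) \<in> blm" for x
 by (rule measurable_completion) measurable
 note g = gauss_fourier(1)[OF that, where ?'a = 'a]
 have gm [measurable]: "?g \<in> blm" using g by auto
 have i: "integrable lebesgue (%xi. ?g xi * (cmod (fourier w xi))\<^sup>2)"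
 proof (rule Bochner_Integration.integrable_bound[OF integrable_mult_left[OF g, of "((2 * pi) powr (- real DIM('a) / 2) * (LINT x|lebesgue. \<bar>w x\<bar>))\<^sup>2"]])
 show "AE xi in lebesgue. norm (?g xi * (cmod (fourier w xi))\<^sup>2) <= norm (?g xi * ((2 * pi) powr (- real DIM('a) / 2) * (LINT x|lebesgue. \<bar>w x\<bar>))\<^sup>2)"
 unfolding norm_mult using cmod_fourier_le[of w] by (intro AE_I2 mult_left_mono) (simp_all add: power_mono)
 qed measurable
 have "complex_of_real (LINT xi|lebesgue. ?g xi * (cmod (fourier w xi))\<^sup>2) = (LINT xi|lebesgue. ?g xi *\<^sub>R (fourier w xi * cnj (fourier w xi)))"
 unfolding integral_complex_of_real[symmetric] complex_norm_square[symmetric] by (simp add: scaleR_conv_of_real)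
 then have eq: "(LINT xi|lebesgue. ?g xi * (cmod (fourier w xi))\<^sup>2) = (LINT x|lebesgue. w x * (LINT y|lebesgue. w y * ?G (x - y)))"
 unfolding fourier_gauss_identity[OF that w w] of_real_eq_iff .
 have "(INTP xi. ennreal (?g xi * (cmod (fourier w xi))\<^sup>2)) = ennreal (LINT x|lebesgue. w x * (LINT y|lebesgue. w y * ?G (x - y)))"
 unfolding eq[symmetric] by (rule nn_integral_eq_integral[OF i]) auto
 also have "... <= ennreal (norm (LINT x|lebesgue. w x * (LINT y|lebesgue. w y * ?G (x - y))))"
 by (intro ennreal_leI) auto
 also have "... <= (INTP x. ennreal (norm (w x * (LINT y|lebesgue. w y * ?G (x - y)))))"
 by (rule norm_integral_le_nn_integral)
 also have "... <= (\<integral>\<^sup>+x. \<integral>\<^sup>+y. ?K x y \<partial>lebesgue \<partial>lebesgue)"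
 proof (rule nn_integral_mono)
 fix x
 have "ennreal (norm (w x * (LINT y|lebesgue. w y * ?G (x - y)))) = ennreal \<bar>w x\<bar> * ennreal (norm (LINT y|lebesgue. w y * ?G (x - y)))"
 by (simp add: abs_mult ennreal_mult)
 also have "... <= ennreal \<bar>w x\<bar> * (INTP y. ennreal (norm (w y * ?G (x - y))))"
 by (intro mult_left_mono norm_integral_le_nn_integral) auto
 also have "... = (INTP y. ?K x y)"
 proof (subst nn_integral_cmult[symmetric])
 show "(%y. ennreal (norm (w y * ?G (x - y)))) \<in> blm"
 by measurable
 qed (simp add: abs_mult ennreal_mult)
 finally show "ennreal (norm (w x * (LINT y|lebesgue. w y * ?G (x - y)))) <= (INTP y. ?K x y)" .
 qed
 also have "... <= (\<integral>\<^sup>+x. \<integral>\<^sup>+y. (ennreal ((w x)\<^sup>2 / 2) * ennreal (?G (x - y)) + ennreal ((w y)\<^sup>2 / 2) * ennreal (?G (x - y))) \<partial>lebesgue \<partial>lebesgue)"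
 proof (intro nn_integral_mono)
 fix x y
 have "\<bar>w x\<bar> * \<bar>w y\<bar> <= (w x)\<^sup>2 / 2 + (w y)\<^sup>2 / 2"
 using sum_squares_bound[of "\<bar>w x\<bar>" "\<bar>w y\<bar>"] by simp
 then have "\<bar>w x\<bar> * (\<bar>w y\<bar> * ?G (x - y)) <= ((w x)\<^sup>2 / 2 + (w y)\<^sup>2 / 2) * ?G (x - y)"
 by (simp add: mult.assoc[symmetric] mult_right_mono)
 then show "?K x y <= ennreal ((w x)\<^sup>2 / 2) * ennreal (?G (x - y)) + ennreal ((w y)\<^sup>2 / 2) * ennreal (?G (x - y))"
 by (simp add: ennreal_leI algebra_simps flip: ennreal_mult ennreal_plus)
 qed
 also have "... = (\<integral>\<^sup>+x. \<integral>\<^sup>+y. ennreal ((w x)\<^sup>2 / 2) * ennreal (?G (x - y)) \<partial>lebesgue \<partial>lebesgue) + (\<integral>\<^sup>+x. \<integral>\<^sup>+y. ennreal ((w y)\<^sup>2 / 2) * ennreal (?G (x - y)) \<partial>lebesgue \<partial>lebesgue)"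
 by (subst nn_integral_add[symmetric]) (measurable, intro nn_integral_cong nn_integral_add, measurable)
 also have "(\<integral>\<^sup>+x. \<integral>\<^sup>+y. ennreal ((w y)\<^sup>2 / 2) * ennreal (?G (x - y)) \<partial>lebesgue \<partial>lebesgue) = (\<integral>\<^sup>+x. \<integral>\<^sup>+y. ennreal ((w x)\<^sup>2 / 2) * ennreal (?G (x - y)) \<partial>lebesgue \<partial>lebesgue)"
 by (subst lebesgue_pair.Fubini') (simp_all add: gauss_kernel_minus)
 also have "(\<integral>\<^sup>+x. \<integral>\<^sup>+y. ennreal ((w x)\<^sup>2 / 2) * ennreal (?G (x - y)) \<partial>lebesgue \<partial>lebesgue)
 + (\<integral>\<^sup>+x. \<integral>\<^sup>+y. ennreal ((w x)\<^sup>2 / 2) * ennreal (?G (x - y)) \<partial>lebesgue \<partial>lebesgue)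
 = (INTP x. ennreal ((w x)\<^sup>2 / 2)) + (INTP x. ennreal ((w x)\<^sup>2 / 2))"
 by (simp add: nn_integral_cmult nn_integral_gauss_kernel[OF that])
 also have "... = S"
 proof -
 have half: "ennreal (a\<^sup>2 / 2) + ennreal (a\<^sup>2 / 2) = ennreal (a\<^sup>2)" for a :: real
 proof -
 have "ennreal (a\<^sup>2 / 2) + ennreal (a\<^sup>2 / 2) = ennreal (a\<^sup>2 / 2 + a\<^sup>2 / 2)"
 by (rule ennreal_plus[symmetric]) simp_all
 then show ?thesis by (simp only: field_sum_of_halves)
 qed
 show ?thesis
 unfolding S_def by (subst nn_integral_add[symmetric]) (simp_all only: half, measurable)
 qed
 finally show ?thesis .
 qed
 define F where "F n xi = ennreal (exp (- (inverse (Suc n) * norm xi)\<^sup>2 / 2) * (cmod (fourier w xi))\<^sup>2)" for n :: nat and xi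
 have lim: "(%n. F n xi) \<longlonglongrightarrow> ennreal ((cmod (fourier w xi))\<^sup>2)" for xi
 proof -
 have "(%n. exp (- (inverse (Suc n) * norm xi)\<^sup>2 / 2) * (cmod (fourier w xi))\<^sup>2) \<longlonglongrightarrow> exp (- (0 * norm xi)\<^sup>2 / 2) * (cmod (fourier w xi))\<^sup>2"
 by (intro tendsto_intros LIMSEQ_inverse_real_of_nat) simp
 then show ?thesis unfolding F_def by (intro tendsto_ennrealI) simp
 qed
 have exp_m: "(%xi::'a. exp (- (\<epsilon> * norm xi)\<^sup>2 / 2)) \<in> blm" for \<epsilon>
 by (rule measurable_completion) measurable
 have Fm: "F n \<in> blm" for n
 unfolding F_def using exp_m[of "inverse (Suc n)"] by measurable
 have "(INTP xi. ennreal ((cmod (fourier w xi))\<^sup>2)) = (INTP xi. liminf (%n. F n xi))"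
 by (intro nn_integral_cong lim_imp_Liminf[symmetric] lim) simp
 also have "... <= liminf (%n. \<integral>\<^sup>+xi. F n xi \<partial>lebesgue)"
 by (rule nn_integral_liminf) (rule Fm)
 also have "... <= liminf (%n. S)"
 unfolding F_def by (intro Liminf_mono always_eventually allI damped) auto
 finally show ?thesis by (simp add: Liminf_const S_def)
qed

text \<open>The substitution y = x + \<epsilon> z turns the convolution into an average of \<Psi>
  against the standard normal density. Both claims are read off from this form.\<close>

lemma gauss_convolution_tendsto:
 fixes \<Psi> :: "real => real"
 assumes c: "continuous_on UNIV \<Psi>" and b: "!!x. \<bar>\<Psi> x\<bar> <= M"
 shows "(%n. LINT y|lebesgue. \<Psi> y * gauss_kernel (inverse (Suc n)) (x - y)) \<longlonglongrightarrow> \<Psi> x"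
 and "\<epsilon> > 0 ==> \<bar>LINT y|lebesgue. \<Psi> y * gauss_kernel \<epsilon> (x - y)\<bar> <= M"
proof -
 have [measurable]: "\<Psi> \<in> borel_measurable borel" using c by (simp add: borel_measurable_continuous_onI)
 have M: "0 <= M" using b[of 0] by simp
 have dens: "integrable lborel std_normal_density" "(LINT z|lborel. std_normal_density z) = 1"
 by (simp_all add: std_normal_density_def[symmetric])
 have eq: "(LINT y|lebesgue. \<Psi> y * gauss_kernel \<epsilon> (x - y)) = (LINT z|lborel. \<Psi> (x + \<epsilon> * z) * std_normal_density z)"
 if "\<epsilon> > 0" for \<epsilon>
 proof -
 have "(LINT y|lebesgue. \<Psi> y * gauss_kernel \<epsilon> (x - y)) = (LINT y|lborel. \<Psi> y * gauss_kernel \<epsilon> (x - y))"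
 by (rule integral_completion) measurable
 also have "... = \<bar>\<epsilon>\<bar> *\<^sub>R (LINT z|lborel. \<Psi> (x + \<epsilon> * z) * gauss_kernel \<epsilon> (x - (x + \<epsilon> * z)))"
 by (rule lborel_integral_real_affine) (use that in auto)
 also have "... = (LINT z|lborel. \<epsilon> * (\<Psi> (x + \<epsilon> * z) * gauss_kernel \<epsilon> (x - (x + \<epsilon> * z))))"
 using that by simp
 also have "... = (LINT z|lborel. \<Psi> (x + \<epsilon> * z) * std_normal_density z)"
 using that by (intro Bochner_Integration.integral_cong) (auto simp: gauss_kernel_def normal_density_def real_sqrt_mult power_mult_distrib)
 finally show ?thesis .
 qed
 have "(%n. LINT z|lborel. \<Psi> (x + inverse (Suc n) * z) * std_normal_density z) \<longlonglongrightarrow> (LINT z|lborel. \<Psi> x * std_normal_density z)"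
 proof (rule integral_dominated_convergence[where w = "%z. M * std_normal_density z"])
 show "AE z in lborel. (%n. \<Psi> (x + inverse (real (Suc n)) * z) * std_normal_density z) \<longlonglongrightarrow> \<Psi> x * std_normal_density z"
 proof (intro AE_I2 tendsto_mult tendsto_const)
 fix z
 have "(%n. x + inverse (real (Suc n)) * z) \<longlonglongrightarrow> x + 0 * z"
 by (intro tendsto_intros LIMSEQ_inverse_real_of_nat)
 then have "(%n. x + inverse (real (Suc n)) * z) \<longlonglongrightarrow> x" by simp
 moreover have "isCont \<Psi> x" using c by (simp add: continuous_on_eq_continuous_at)
 ultimately show "(%n. \<Psi> (x + inverse (real (Suc n)) * z)) \<longlonglongrightarrow> \<Psi> x"
 by (rule isCont_tendsto_compose[rotated])
 qed
 show "integrable lborel (%z. M * std_normal_density z)" using dens by simp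
 show "AE z in lborel. norm (\<Psi> (x + inverse (real (Suc n)) * z) * std_normal_density z) <= M * std_normal_density z" for n
 using b by (auto simp: abs_mult normal_density_nonneg intro!: mult_right_mono)
 qed measurable
 then show "(%n. LINT y|lebesgue. \<Psi> y * gauss_kernel (inverse (Suc n)) (x - y)) \<longlonglongrightarrow> \<Psi> x"
 using dens by (simp add: eq)
 assume e: "\<epsilon> > 0"
 have "\<bar>LINT z|lborel. \<Psi> (x + \<epsilon> * z) * std_normal_density z\<bar> <= (LINT z|lborel. M * std_normal_density z)"
 unfolding real_norm_def[symmetric]
 proof (rule order_trans[OF integral_norm_bound integral_mono])
 show "integrable lborel (%z. norm (\<Psi> (x + \<epsilon> * z) * std_normal_density z))"
 by (rule integrable_norm, rule Bochner_Integration.integrable_bound[of _ "%z. M * std_normal_density z"])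
 (use dens b M in \<open>auto simp: abs_mult intro!: mult_right_mono\<close>)
 show "integrable lborel (%z. M * std_normal_density z)" using dens by simp
 qed (use b in \<open>auto simp: abs_mult intro!: mult_right_mono\<close>)
 then show "\<bar>LINT y|lebesgue. \<Psi> y * gauss_kernel \<epsilon> (x - y)\<bar> <= M"
 using dens by (simp add: eq[OF e])
qed

text \<open>Limit of the damped Parseval identity: on the left the Gaussian averages of \<Psi>
  converge pointwise and boundedly, on the right the damping factor is at most 1. The right side may
  be infinite.\<close>

lemma fourier_parseval_le:
 fixes w \<Psi> :: "real => real"
 assumes w: "integrable lebesgue w" and \<Psi>: "integrable lebesgue \<Psi>"
 and c: "continuous_on UNIV \<Psi>" and b: "!!x. \<bar>\<Psi> x\<bar> <= M"
 shows "ennreal \<bar>LINT x|lebesgue. w x * \<Psi> x\<bar> <= (INTP xi. ennreal (cmod (fourier w xi) * cmod (fourier \<Psi> xi)))"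
proof -
 note lebesgue_proj_measurable[measurable]
 define a where "a n = (LINT x|lebesgue. w x * (LINT y|lebesgue. \<Psi> y * gauss_kernel (inverse (Suc n)) (x - y)))" for n :: nat
 have [measurable]: "w \<in> blm" "\<Psi> \<in> blm" using w \<Psi> by auto
 have M: "0 <= M" using b[of 0] by simp
 have "a \<longlonglongrightarrow> (LINT x|lebesgue. w x * \<Psi> x)"
 unfolding a_def
 proof (rule integral_dominated_convergence[where w = "%x. \<bar>w x\<bar> * M"])
 show "integrable lebesgue (%x. \<bar>w x\<bar> * M)" using w by simp
 show "AE x in lebesgue. (%n. w x * (LINT y|lebesgue. \<Psi> y * gauss_kernel (inverse (Suc n)) (x - y))) \<longlonglongrightarrow> w x * \<Psi> x"
 by (intro AE_I2 tendsto_mult tendsto_const gauss_convolution_tendsto(1)[OF c b])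
 show "AE x in lebesgue. norm (w x * (LINT y|lebesgue. \<Psi> y * gauss_kernel (inverse (Suc n)) (x - y))) <= \<bar>w x\<bar> * M" for n
 using gauss_convolution_tendsto(2)[OF c b, of "inverse (Suc n)"]
 by (intro AE_I2) (simp add: abs_mult mult_left_mono del: of_nat_Suc)
 qed measurable
 then have "(%n. ennreal \<bar>a n\<bar>) \<longlonglongrightarrow> ennreal \<bar>LINT x|lebesgue. w x * \<Psi> x\<bar>"
 by (intro tendsto_ennrealI tendsto_rabs)
 moreover have "ennreal \<bar>a n\<bar> <= (INTP xi. ennreal (cmod (fourier w xi) * cmod (fourier \<Psi> xi)))" for n
 proof -
 have "ennreal \<bar>a n\<bar> = ennreal (norm (complex_of_real (a n)))" by simp
 also have "... <= (INTP xi. ennreal (norm (exp (- (inverse (Suc n) * norm xi)\<^sup>2 / 2) *\<^sub>R (fourier w xi * cnj (fourier \<Psi> xi)))))"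
 unfolding a_def by (subst fourier_gauss_identity[OF _ w \<Psi>, symmetric]) (simp, rule norm_integral_le_nn_integral)
 also have "... <= (INTP xi. ennreal (cmod (fourier w xi) * cmod (fourier \<Psi> xi)))"
 by (intro nn_integral_mono ennreal_leI) (auto simp: norm_mult intro!: mult_left_le_one_le)
 finally show ?thesis .
 qed
 ultimately show ?thesis
 by (rule tendsto_upperbound[OF _ always_eventually[OF allI]]) simp
qed

section \<open>Smooth functions, bump functions and test functions\<close>

lemma partial_eqI: "(f has_derivative f') (at x) ==> partial b f x = f' b"
 by (simp add: partial_def frechet_derivative_at[symmetric])

lemma C_k_Suc_imp: "C_k (Suc k) f ==> C_k k f"
 by (induction k arbitrary: f) (auto intro: differentiable_imp_continuous_on)

lemma C_k_const: "C_k k (%x. c)"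
proof (induction k arbitrary: c)
 case (Suc k)
 have "partial b (%x::'a. c) = (%x. 0)" for b
 by (rule ext, rule partial_eqI) (auto intro!: derivative_eq_intros)
 then show ?case using Suc[of 0] by simp
qed simp

lemma C_k_add: "C_k k f ==> C_k k g ==> C_k k (%x. f x + g x)"
proof (induction k arbitrary: f g)
 case 0 then show ?case by (auto intro: continuous_intros)
next
 case (Suc k)
 have d: "(f has_derivative frechet_derivative f (at x)) (at x)" "(g has_derivative frechet_derivative g (at x)) (at x)" for x
 using Suc.prems by (auto simp: differentiable_on_def frechet_derivative_works)
 have "partial b (%x. f x + g x) = (%x. partial b f x + partial b g x)" for b
 by (rule ext) (simp add: partial_eqI[OF has_derivative_add[OF d]], simp add: partial_def)
 then show ?case using Suc by (auto intro: differentiable_on_add)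
qed

lemma C_k_mult: "C_k k f ==> C_k k g ==> C_k k (%x. f x * g x)"
proof (induction k arbitrary: f g)
 case 0 then show ?case by (auto intro: continuous_intros)
next
 case (Suc k)
 have d: "(f has_derivative frechet_derivative f (at x)) (at x)" "(g has_derivative frechet_derivative g (at x)) (at x)" for x
 using Suc.prems by (auto simp: differentiable_on_def frechet_derivative_works)
 have "partial b (%x. f x * g x) = (%x. f x * partial b g x + partial b f x * g x)" for b
 by (rule ext) (simp add: partial_eqI[OF has_derivative_mult[OF d]], simp add: partial_def)
 moreover have "C_k k f" "C_k k g" using Suc.prems by (auto intro: C_k_Suc_imp)
 ultimately show ?case using Suc by (auto intro!: differentiable_on_mult C_k_add)
qed

lemma C_k_prod: "finite I ==> (!!i. i \<in> I ==> C_k k (f i)) ==> C_k k (%x. \<Prod>i\<in>I. f i x)"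
 by (induction I rule: finite_induct) (auto intro: C_k_const C_k_mult)

lemma C_k_power: "C_k k f ==> C_k k (%x. f x ^ n)"
 by (induction n) (auto intro: C_k_const C_k_mult)

lemma C_k_diff: "C_k k f ==> C_k k g ==> C_k k (%x. f x - g x)"
 using C_k_add[OF _ C_k_mult[OF C_k_const[of k "-1"]], of f g] by simp

text \<open>The functions \<open>exp (-1/t) / t\<^sup>n\<close>, whose span is closed under differentiation.\<close>

definition flat_exp :: "nat => real => real" where
 "flat_exp n t = (if t > 0 then exp (- 1 / t) / t ^ n else 0)"

lemma flat_exp_tendsto: "((%t. exp (- 1 / t) / t ^ n) \<longlongrightarrow> (0::real)) (at_right 0)"
proof -
 have "((%u::real. u ^ n / exp u) \<longlongrightarrow> 0) at_top"
 by (rule tendsto_power_div_exp_0)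
 then have "((%t::real. (inverse t) ^ n / exp (inverse t)) \<longlongrightarrow> 0) (at_right 0)"
 by (rule filterlim_compose[OF _ filterlim_inverse_at_top_right])
 then show ?thesis
 by (rule Lim_transform_eventually) (auto simp: eventually_at_right_less field_simps exp_minus)
qed

lemma DERIV_flat_exp:
 "(flat_exp n has_real_derivative flat_exp (n + 2) t - n * flat_exp (n + 1) t) (at t)"
proof (cases "t = 0")
 case True
 \<comment> \<open>From the right the difference quotient at 0 is \<open>flat_exp (Suc n)\<close>;
   from the left it vanishes.\<close>
 have "((%h. flat_exp n h / h) \<longlongrightarrow> 0) (at_right 0)"
 by (rule Lim_transform_eventually[OF flat_exp_tendsto[of "Suc n"]])
 (auto simp: flat_exp_def eventually_at_right_less intro!: eventually_mono[OF eventually_at_right_less])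
 moreover have "((%h. flat_exp n h / h) \<longlongrightarrow> 0) (at_left 0)"
 by (rule tendsto_eventually) (auto simp: flat_exp_def eventually_at_left_field intro: exI[of _ "-1"])
 ultimately have "((%h. flat_exp n h / h) \<longlongrightarrow> 0) (at 0)"
 by (simp add: filterlim_split_at)
 then show ?thesis
 unfolding True DERIV_def by (simp add: flat_exp_def)
next
 case False
 then consider "t > 0" | "t < 0" by linarith
 then show ?thesis
 proof cases
 case 1
 have "((%t. exp (- 1 / t) / t ^ n) has_real_derivative flat_exp (n + 2) t - n * flat_exp (n + 1) t) (at t)"
 proof (cases n)
 case 0
 then show ?thesis
 using 1 by (auto intro!: derivative_eq_intros simp: flat_exp_def field_simps power2_eq_square)
 next
 case (Suc m)
 have "((%t. exp (- 1 / t) / t ^ n) has_real_derivative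
 (exp (- 1 / t) * (1 / t\<^sup>2) * t ^ n - exp (- 1 / t) * (n * t ^ m)) / (t ^ n * t ^ n)) (at t)"
 proof (rule DERIV_divide)
 show "((%t. exp (- 1 / t)) has_real_derivative exp (- 1 / t) * (1 / t\<^sup>2)) (at t)"
 using 1 by (auto intro!: derivative_eq_intros simp: power2_eq_square)
 show "((%t. t ^ n) has_real_derivative n * t ^ m) (at t)"
 using DERIV_pow[of n t] Suc by simp
 qed (use 1 in simp)
 moreover have "(exp (- 1 / t) * (1 / t\<^sup>2) * t ^ n - exp (- 1 / t) * (n * t ^ m)) / (t ^ n * t ^ n)
 = flat_exp (n + 2) t - n * flat_exp (n + 1) t"
 using 1 Suc by (simp add: flat_exp_def field_simps power2_eq_square)
 ultimately show ?thesis by simp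
 qed
 moreover have "\<forall>\<^sub>F x in nhds t. flat_exp n x = exp (- 1 / x) / x ^ n"
 using 1 eventually_nhds_in_open[of "{0<..}" t] by (auto simp: flat_exp_def elim!: eventually_mono)
 ultimately show ?thesis by (subst DERIV_cong_ev[OF refl _ refl])
 next
 case 2
 have "((%t. 0) has_real_derivative flat_exp (n + 2) t - n * flat_exp (n + 1) t) (at t)"
 using 2 by (auto simp: flat_exp_def)
 moreover have "\<forall>\<^sub>F x in nhds t. flat_exp n x = 0"
 using 2 eventually_nhds_in_open[of "{..<0}" t] by (auto simp: flat_exp_def elim!: eventually_mono)
 ultimately show ?thesis by (subst DERIV_cong_ev[OF refl _ refl])
 qed
qed

text \<open>A partial derivative of such a function is a combination of the functions with indices n
  + 2 and n + 1. The induction on the order of smoothness is therefore carried out for all n at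
  once.\<close>

lemma C_k_flat_exp: "C_k k (%x. flat_exp n (a \<bullet> x + c))"
proof (induction k arbitrary: n)
 case 0
 have "isCont (flat_exp n) t" for t using DERIV_flat_exp by (rule DERIV_isCont)
 then have "continuous_on UNIV (flat_exp n)" by (simp add: continuous_on_eq_continuous_at)
 then show ?case by (auto intro!: continuous_on_compose2[of UNIV "flat_exp n"] continuous_intros)
next
 case (Suc k)
 have d: "((%x. flat_exp n (a \<bullet> x + c)) has_derivative
 (%h. (a \<bullet> h) * (flat_exp (n + 2) (a \<bullet> x + c) - n * flat_exp (n + 1) (a \<bullet> x + c)))) (at x)" for x
 by (rule DERIV_compose_FDERIV[OF DERIV_flat_exp]) (auto intro!: derivative_eq_intros)
 then have "partial b (%x. flat_exp n (a \<bullet> x + c)) = (%x. (a \<bullet> b) * (flat_exp (n + 2) (a \<bullet> x + c) - n * flat_exp (n + 1) (a \<bullet> x + c)))" for b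
 by (intro ext partial_eqI)
 moreover have "(%x. flat_exp n (a \<bullet> x + c)) differentiable_on UNIV"
 using d by (auto simp: differentiable_on_def differentiable_def)
 ultimately show ?case
 using Suc by (auto intro!: C_k_mult C_k_const C_k_diff)
qed

text \<open>Each coordinate contributes two one-sided cutoffs, one at each face, so the product is
  positive exactly on the open box. All factors lie in [0,1].\<close>

definition box_bump :: "'a::euclidean_space => 'a => 'a => real" where
 "box_bump p q x = (\<Prod>b\<in>Basis. flat_exp 0 (b \<bullet> x + - (p \<bullet> b)) * flat_exp 0 (- b \<bullet> x + q \<bullet> b))"

lemma flat_exp_0_bounds: "0 <= flat_exp 0 t" "flat_exp 0 t <= 1" "0 < flat_exp 0 t \<longleftrightarrow> 0 < t"
 by (auto simp: flat_exp_def)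

lemma C_k_box_bump: "C_k k (box_bump p q)"
 unfolding box_bump_def[abs_def] by (intro C_k_prod C_k_mult C_k_flat_exp) auto

lemma box_bump_nonneg: "0 <= box_bump p q x"
 unfolding box_bump_def by (intro prod_nonneg mult_nonneg_nonneg flat_exp_0_bounds)

lemma box_bump_le_1: "box_bump p q x <= 1"
 unfolding box_bump_def by (intro prod_le_1 conjI mult_nonneg_nonneg mult_le_one flat_exp_0_bounds)

lemma box_bump_pos: "0 < box_bump p q x \<longleftrightarrow> x \<in> box p q"
proof
 assume "x \<in> box p q"
 then show "0 < box_bump p q x"
 unfolding box_bump_def by (intro prod_pos) (auto simp: flat_exp_def mem_box inner_commute)
next
 assume *: "0 < box_bump p q x"
 show "x \<in> box p q"
 proof (rule ccontr)
 assume "x \<notin> box p q"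
 then obtain b where "b \<in> Basis" "\<not> (p \<bullet> b < x \<bullet> b \<and> x \<bullet> b < q \<bullet> b)" by (auto simp: mem_box)
 then have "box_bump p q x = 0"
 unfolding box_bump_def by (intro prod_zero) (auto simp: flat_exp_def inner_commute intro!: bexI[of _ b])
 with * show False by simp
 qed
qed

lemma compact_support_integrable:
 fixes f :: "'a::euclidean_space => real"
 assumes c: "continuous_on UNIV f" and K: "compact K" "!!x. x \<notin> K ==> f x = 0"
 shows "integrable lborel f" "integrable lebesgue f" "\<exists>M. \<forall>x. \<bar>f x\<bar> <= M" "sq_integrable f"
proof -
 have 1: "integrable lborel g" if "continuous_on UNIV g" "!!x. x \<notin> K ==> g x = 0" for g :: "'a => real"
 proof -
 have eq: "(%x. indicator K x *\<^sub>R g x) = g" using that(2) by (auto simp: indicator_def fun_eq_iff)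
 show ?thesis using borel_integrable_compact[OF K(1) continuous_on_subset[OF that(1)]] unfolding eq by simp
 qed
 show i: "integrable lborel f" using c K by (intro 1)
 then show "integrable lebesgue f" by (simp add: integrable_completion)
 have "compact (f ` K)" using K c by (intro compact_continuous_image) (auto intro: continuous_on_subset)
 then obtain M where "\<forall>x\<in>K. \<bar>f x\<bar> <= M" by (auto dest!: compact_imp_bounded simp: bounded_iff)
 then have "\<forall>x. \<bar>f x\<bar> <= max M 0" using K(2) by (metis abs_zero max.cobounded2 max.coboundedI1)
 then show "\<exists>M. \<forall>x. \<bar>f x\<bar> <= M" by blast
 have "integrable lborel (%x. (f x)\<^sup>2)" using K by (intro 1 continuous_intros c) auto
 then show "sq_integrable f"
 using i by (auto simp: sq_integrable_def integrable_completion intro!: measurable_completion)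
qed

lemma test_funD:
 assumes "test_fun Omega psi"
 shows "continuous_on UNIV psi" "(psi has_derivative frechet_derivative psi (at x)) (at x)"
 "!!b. b \<in> Basis ==> test_fun Omega (partial b psi)" "x \<notin> Omega ==> psi x = 0"
 "integrable lborel psi" "integrable lebesgue psi" "\<exists>M. \<forall>x. \<bar>psi x\<bar> <= M" "sq_integrable psi" "psi \<in> borel_measurable borel"
proof -
 from assms have C: "!!k. C_k k psi" by (simp add: test_fun_def)
 from assms obtain K where K: "compact K" "K \<subseteq> Omega" "!!x. x \<notin> K ==> psi x = 0" by (auto simp: test_fun_def)
 show c: "continuous_on UNIV psi" using C[of 0] by simp
 show d: "(psi has_derivative frechet_derivative psi (at x)) (at x)" for x
 using C[of 1] by (simp add: differentiable_on_def frechet_derivative_works)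
 show "x \<notin> Omega ==> psi x = 0" using K by auto
 note ci = compact_support_integrable[OF c K(1,3)]
 show "integrable lborel psi" "integrable lebesgue psi" "\<exists>M. \<forall>x. \<bar>psi x\<bar> <= M" "sq_integrable psi" by (rule ci; simp)+
 then show "psi \<in> borel_measurable borel" by auto
 fix b :: 'a assume b: "b \<in> Basis"
 have "partial b psi x = 0" if "x \<notin> K" for x
 proof -
 have "open (- K)" using K(1) by (simp add: compact_imp_closed open_Compl)
 then have "\<forall>\<^sub>F y in nhds x. psi y = 0"
 using that K(3) eventually_nhds_in_open[of "- K" x] by (auto elim!: eventually_mono)
 have "((%x. 0) has_derivative (%h. 0)) (at x)" by simp
 then have "(psi has_derivative (%h. 0)) (at x)"
 by (rule has_derivative_transform_within_open[OF _ \<open>open (- K)\<close>]) (use that K(3) in auto)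
 then show ?thesis by (rule partial_eqI)
 qed
 moreover have "C_k k (partial b psi)" for k using C[of "Suc k"] b by simp
 ultimately show "test_fun Omega (partial b psi)" using K unfolding test_fun_def by blast
qed

lemma test_fun_add: "test_fun Omega f ==> test_fun Omega g ==> test_fun Omega (%x. f x + g x)"
 unfolding test_fun_def
proof safe
 fix K L assume "compact K" "K \<subseteq> Omega" "\<forall>x. x \<notin> K --> f x = 0" "compact L" "L \<subseteq> Omega" "\<forall>x. x \<notin> L --> g x = 0"
 then show "\<exists>K. compact K \<and> K \<subseteq> Omega \<and> (\<forall>x. x \<notin> K --> f x + g x = 0)"
 by (intro exI[of _ "K \<union> L"]) auto
qed (auto intro: C_k_add)

lemma test_fun_scale: "test_fun Omega f ==> test_fun Omega (%x. c * f x)"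
 unfolding test_fun_def by (auto intro: C_k_mult C_k_const)

lemma test_fun_diff: "test_fun Omega f ==> test_fun Omega g ==> test_fun Omega (%x. f x - g x)"
 using test_fun_add[of Omega f "%x. (-1) * g x"] test_fun_scale[of Omega g "-1"] by simp

lemma test_fun_zero: "test_fun Omega (%x. 0)"
 unfolding test_fun_def by (auto intro: C_k_const exI[of _ "{}"])

text \<open>The integral of every difference quotient vanishes by translation invariance. The mean
  value theorem bounds the quotients by the maximum of the derivative. Steps of length at most 1
  keep their supports in a ball of radius R + 1, so dominated convergence applies.\<close>

lemma integral_directional_derivative_eq_0:
 fixes F :: "'a::euclidean_space => real"
 assumes d: "!!x. (F has_derivative F' x) (at x)" and b: "norm b = 1"
 and K: "compact K" "!!x. x \<notin> K ==> F x = 0" and c: "continuous_on UNIV (%x. F' x b)"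
 shows "(LINT x|lebesgue. F' x b) = 0"
proof -
 have cF: "continuous_on UNIV F"
 using d by (auto intro!: has_derivative_continuous simp: continuous_on_eq_continuous_at)
 have z: "F' x b = 0" if "x \<notin> K" for x
 proof -
 have "open (- K)" using K(1) by (simp add: compact_imp_closed open_Compl)
 have "((%x. 0) has_derivative (%h. 0)) (at x)" by simp
 then have "(F has_derivative (%h. 0)) (at x)"
 by (rule has_derivative_transform_within_open[OF _ \<open>open (- K)\<close>]) (use that K(2) in auto)
 with d[of x] have "F' x = (%h. 0)" by (rule has_derivative_unique)
 then show ?thesis by simp
 qed
 have iF: "integrable lborel F" by (rule compact_support_integrable(1)[OF cF K])
 have iF': "integrable lborel (%x. F' x b)" "\<exists>M. \<forall>x. \<bar>F' x b\<bar> <= M"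
 by (rule compact_support_integrable[OF c K(1) z], assumption)+
 obtain M where M: "!!x. \<bar>F' x b\<bar> <= M" using iF'(2) by auto
 have M0: "0 <= M" using M[of 0] by simp
 obtain R where R: "K \<subseteq> ball 0 R" using compact_imp_bounded[OF K(1)] bounded_subset_ballD by blast
 define D where "D n x = (F (x + inverse (Suc n) *\<^sub>R b) - F x) / inverse (Suc n)" for n :: nat and x
 have mb: "F \<in> borel_measurable borel" using iF by auto
 note [measurable] = mb
 have trans: "integrable lborel (%x. F (x + a))" "(LINT x|lborel. F (x + a)) = (LINT x|lborel. F x)" for a
 proof -
 have "integrable (distr lborel borel (%x. a + x)) F" using iF by (simp only: lborel_distr_plus)
 then show "integrable lborel (%x. F (x + a))" by (subst (asm) integrable_distr_eq) (auto simp: add.commute)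
 have "(LINT x|lborel. F x) = (LINT x|distr lborel borel (%x. a + x). F x)" by (simp only: lborel_distr_plus)
 then show "(LINT x|lborel. F (x + a)) = (LINT x|lborel. F x)" by (subst (asm) integral_distr) (auto simp: add.commute)
 qed
 have D0: "(LINT x|lborel. D n x) = 0" for n
 unfolding D_def using trans iF by simp
 have "(%n. LINT x|lborel. D n x) \<longlonglongrightarrow> (LINT x|lborel. F' x b)"
 proof (rule integral_dominated_convergence[where w = "%x. M * indicator (cball 0 (R + 1)) x"])
 show "(%x. F' x b) \<in> borel_measurable lborel" using iF'(1) by auto
 show "integrable lborel (%x. M * indicator (cball 0 (R + 1)) x)"
 by (intro integrable_mult_right integrable_real_indicator emeasure_bounded_finite) auto
 show "AE x in lborel. (%n. D n x) \<longlonglongrightarrow> F' x b"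
 proof (rule AE_I2)
 fix x
 have "((%s. F (x + s *\<^sub>R b)) has_derivative (%s. F' (x + 0 *\<^sub>R b) (s *\<^sub>R b))) (at 0)"
 by (rule has_derivative_compose[of "%s. x + s *\<^sub>R b" "%s. s *\<^sub>R b" 0 UNIV F, simplified]) (auto intro!: derivative_eq_intros d)
 then have "((%s. F (x + s *\<^sub>R b)) has_real_derivative F' x b) (at 0)"
 using linear_scale[OF has_derivative_linear[OF d[of x]]]
 by (simp add: has_field_derivative_def mult.commute[of _ "F' x b"])
 then have "((%h. (F (x + h *\<^sub>R b) - F x) / h) \<longlongrightarrow> F' x b) (at 0)"
 by (simp add: DERIV_def)
 moreover have "filterlim (%n. inverse (real (Suc n))) (at 0) sequentially"
 by (intro filterlim_atI LIMSEQ_inverse_real_of_nat) auto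
 ultimately show "(%n. D n x) \<longlonglongrightarrow> F' x b"
 unfolding D_def by (rule filterlim_compose)
 qed
 show "AE x in lborel. norm (D n x) <= M * indicator (cball 0 (R + 1)) x" for n
 proof (rule AE_I2)
 fix x
 define h where "h = inverse (real (Suc n))"
 have h: "0 < h" "h <= 1" by (auto simp: h_def field_simps)
 show "norm (D n x) <= M * indicator (cball 0 (R + 1)) x"
 proof (cases "x \<in> cball 0 (R + 1)")
 case True
 have der: "((%s. F (x + s *\<^sub>R b)) has_real_derivative F' (x + s *\<^sub>R b) b) (at s)" for s
 proof -
 have "((%s. F (x + s *\<^sub>R b)) has_derivative (%t. F' (x + s *\<^sub>R b) (t *\<^sub>R b))) (at s)"
 by (rule has_derivative_compose[of "%s. x + s *\<^sub>R b" "%s. s *\<^sub>R b" s UNIV F, simplified]) (auto intro!: derivative_eq_intros d)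
 then show ?thesis
 using linear_scale[OF has_derivative_linear[OF d[of "x + s *\<^sub>R b"]]]
 by (simp add: has_field_derivative_def mult.commute[of _ "F' (x + s *\<^sub>R b) b"])
 qed
 from MVT2[OF h(1) der] obtain s where "F (x + h *\<^sub>R b) - F (x + 0 *\<^sub>R b) = (h - 0) * F' (x + s *\<^sub>R b) b" by blast
 then have "D n x = F' (x + s *\<^sub>R b) b" using h unfolding D_def h_def[symmetric] by simp
 then show ?thesis using M True by simp
 next
 case False
 then have "norm x > R + 1" by simp
 moreover have "norm (x + h *\<^sub>R b) \<ge> norm x - norm (h *\<^sub>R b)" by (rule norm_diff_ineq)
 ultimately have "x \<notin> K" "x + h *\<^sub>R b \<notin> K" using R h b by auto
 then show ?thesis using False K(2) unfolding D_def h_def[symmetric] by simp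
 qed
 qed
 qed (simp_all add: D_def[abs_def])
 then have "(LINT x|lborel. F' x b) = 0" unfolding D0 by (simp add: LIMSEQ_const_iff)
 then show ?thesis using iF'(1) by (subst integral_completion) auto
qed

section \<open>The fundamental lemma of the calculus of variations\<close>

text \<open>A smooth approximation of the indicator of a union of boxes. At a point of some box one
  factor tends to 0 as n grows, and the exponent n is what forces the limit 1 there; at a point in
  no box the value is exactly 0.\<close>

lemma test_fun_box_bump_union:
 fixes p q :: "'a::euclidean_space"
 assumes "cbox p q \<subseteq> Omega" "!!k. box (a k) (b k) \<subseteq> cbox p q"
 shows "test_fun Omega (%x. 1 - (\<Prod>k<n. (1 - box_bump (a k) (b k) x) ^ n))"
 unfolding test_fun_def
proof (intro conjI allI exI[of _ "cbox p q"] impI)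
 show "C_k m (%x. 1 - (\<Prod>k<n. (1 - box_bump (a k) (b k) x) ^ n))" for m
 by (intro C_k_diff C_k_const C_k_prod C_k_power C_k_box_bump) auto
 fix x assume "x \<notin> cbox p q"
 then have "box_bump (a k) (b k) x = 0" for k
 using assms(2)[of k] box_bump_pos[of "a k" "b k" x] box_bump_nonneg[of "a k" "b k" x] by (auto simp: less_le)
 then show "1 - (\<Prod>k<n. (1 - box_bump (a k) (b k) x) ^ n) = 0" by simp
qed (use assms in auto)

text \<open>Up to a null set every measurable set is a decreasing intersection of open sets.
  Dominated convergence carries the vanishing of the integrals over to it, and a density is
  determined by its integrals over measurable sets.\<close>

lemma integral_open_eq_0_imp_AE:
 fixes g :: "'a::euclidean_space => real"
 assumes g: "integrable lebesgue g" and O: "!!U. open U ==> (LINT x|lebesgue. indicator U x * g x) = 0"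
 shows "AE x in lebesgue. g x = 0"
proof (rule lebesgue.density_unique_banach[OF g, of "%_. 0"])
 fix A :: "'a set" assume A: "A \<in> sets lebesgue"
 have gm [measurable]: "g \<in> blm" using g by auto
 obtain C T where CT: "gdelta C" "T \<in> null_sets lebesgue" "A \<union> T = C" "disjnt A T"
 using lebesgue_set_almost_gdelta[OF A] by metis
 obtain G :: "nat => 'a set" where G: "!!n. open (G n)" "C = \<Inter>(range G)"
 using CT(1) by (auto elim!: gdelta.cases)
 define H where "H n = (\<Inter>i\<le>n. G i)" for n
 have H: "open (H n)" for n unfolding H_def using G by (intro open_INT) auto
 have Hm [measurable]: "H n \<in> sets lebesgue" for n using H[of n] by (simp add: borel_open sets_completionI_sets)
 have dec: "decseq H" unfolding H_def decseq_def by (auto intro: order_trans)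
 have HC: "(\<Inter>n. H n) = C" unfolding H_def G(2) by auto
 have Am [measurable]: "C \<in> sets lebesgue" using HC[symmetric] Hm by auto
 have "(%n. LINT x|lebesgue. indicator (H n) x * g x) \<longlonglongrightarrow> (LINT x|lebesgue. indicator C x * g x)"
 proof (rule integral_dominated_convergence[where w = "%x. \<bar>g x\<bar>"])
 show "AE x in lebesgue. (%n. indicator (H n) x * g x) \<longlonglongrightarrow> indicator C x * g x"
 by (rule AE_I2, rule tendsto_mult[OF LIMSEQ_indicator_decseq[OF dec, unfolded HC] tendsto_const])
 show "AE x in lebesgue. norm (indicator (H n) x * g x) <= \<bar>g x\<bar>" for n
 by (auto simp: indicator_def)
 show "integrable lebesgue (%x. \<bar>g x\<bar>)" using g by simp
 qed measurable
 then have "(LINT x|lebesgue. indicator C x * g x) = 0" using O[OF H] by (simp add: LIMSEQ_const_iff)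
 moreover have "(LINT x|lebesgue. indicator C x * g x) = (LINT x|lebesgue. indicator A x * g x)"
 proof (rule integral_cong_AE)
 have "AE x in lebesgue. x \<notin> T" by (rule AE_not_in[OF CT(2)])
 then show "AE x in lebesgue. indicator C x * g x = indicator A x * g x"
 using CT(3) by (auto elim!: eventually_mono simp: indicator_def)
 qed (use A in \<open>measurable\<close>)
 ultimately show "set_lebesgue_integral lebesgue A g = set_lebesgue_integral lebesgue A (%_. 0)"
 by (simp add: set_lebesgue_integral_def)
qed simp

text \<open>On a compact box inside \<open>Omega\<close> the function is integrable. The
  approximations by bumps converge boundedly to the indicator of any open subset of the box, which
  reduces the claim to vanishing integrals over open sets. Countably many boxes cover
  \<open>Omega\<close>.\<close>

lemma fundamental_lemma:
 fixes f :: "'a::euclidean_space => real"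
 assumes "open Omega" and int: "!!p q. cbox p q \<subseteq> Omega ==> set_integrable lebesgue (cbox p q) f"
 and zero: "!!psi. test_fun Omega psi ==> (LINT x:Omega|lebesgue. f x * psi x) = 0"
 shows "AE x in lebesgue. x \<in> Omega --> f x = 0"
proof -
 have box: "AE x in lebesgue. x \<in> cbox p q --> f x = 0" if pq: "cbox p q \<subseteq> Omega" for p q
 proof -
 have ci: "integrable lebesgue (%x. indicator (cbox p q) x * f x)"
 using int[OF pq] by (simp add: set_integrable_def)
 then have [measurable]: "(%x. indicator (cbox p q) x * f x) \<in> blm" by auto
 have bm [measurable]: "box p q \<in> sets lebesgue" by simp
 have bi: "integrable lebesgue (%x. indicator (box p q) x * f x)"
 proof -
 have "integrable lebesgue (%x. indicator (box p q) x * (indicator (cbox p q) x * f x))"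
 using integrable_mult_indicator[OF bm ci] by simp
 moreover have "(%x. indicator (box p q) x * (indicator (cbox p q) x * f x)) = (%x. indicator (box p q) x * f x)"
 using box_subset_cbox[of p q] by (auto simp: indicator_def fun_eq_iff)
 ultimately show ?thesis by simp
 qed
 have "AE x in lebesgue. indicator (box p q) x * f x = 0"
 proof (rule integral_open_eq_0_imp_AE[OF bi])
 fix V :: "'a set" assume "open V"
 define U where "U = V \<inter> box p q"
 have U: "open U" "U \<subseteq> cbox p q" using \<open>open V\<close> box_subset_cbox[of p q] by (auto simp: U_def)
 have eqU: "indicator V x * (indicator (box p q) x * f x) = indicator U x * f x" for x
 by (auto simp: U_def indicator_def)
 obtain D where D: "countable D" "D \<subseteq> Pow U" "!!X. X \<in> D ==> \<exists>a b. X = box a b" "\<Union>D = U"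
 using open_countable_Union_open_box[OF U(1)] by metis
 show "(LINT x|lebesgue. indicator V x * (indicator (box p q) x * f x)) = 0"
 unfolding eqU
 proof (cases "D = {}")
 case True
 then show "(LINT x|lebesgue. indicator U x * f x) = 0" using D(4) by simp
 next
 case False
 define B where "B = from_nat_into D"
 have BD: "B k \<in> D" for k unfolding B_def using False by (rule from_nat_into)
 have BU: "(\<Union>k. B k) = U" unfolding B_def using D(1,4) False by (simp add: range_from_nat_into)
 obtain a b where ab: "!!k. B k = box (a k) (b k)" using D(3)[OF BD] by metis
 define \<eta> where "\<eta> n x = 1 - (\<Prod>k<n. (1 - box_bump (a k) (b k) x) ^ n)" for n :: nat and x
 have sub: "box (a k) (b k) \<subseteq> cbox p q" for k
 unfolding ab[symmetric] using BU U(2) by auto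
 have tf: "test_fun Omega (\<eta> n)" for n
 unfolding \<eta>_def[abs_def] by (rule test_fun_box_bump_union[OF pq sub])
 have r01: "0 <= 1 - box_bump (a k) (b k) x" "1 - box_bump (a k) (b k) x <= 1" for k x
 using box_bump_nonneg[of "a k" "b k" x] box_bump_le_1[of "a k" "b k" x] by auto
 have eta01: "0 <= \<eta> n x" "\<eta> n x <= 1" for n x
 using prod_nonneg[of "{..<n}" "%k. (1 - box_bump (a k) (b k) x) ^ n"]
 prod_le_1[of "{..<n}" "%k. (1 - box_bump (a k) (b k) x) ^ n"] r01
 by (simp_all add: \<eta>_def power_le_one)
 have eta_lim: "(%n. \<eta> n x) \<longlonglongrightarrow> indicator U x" for x
 proof (cases "x \<in> U")
 case True
 then obtain k where "x \<in> box (a k) (b k)" unfolding BU[symmetric] ab by auto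
 then have r: "1 - box_bump (a k) (b k) x < 1" using box_bump_pos[of "a k" "b k" x] by simp
 have l0: "(%n. (1 - box_bump (a k) (b k) x) ^ n) \<longlonglongrightarrow> 0"
 by (rule LIMSEQ_realpow_zero[OF r01(1) r])
 have ev: "\<forall>\<^sub>F n in sequentially. (\<Prod>k<n. (1 - box_bump (a k) (b k) x) ^ n) <= (1 - box_bump (a k) (b k) x) ^ n"
 using eventually_gt_at_top[of k]
 proof eventually_elim
 case (elim n)
 have "(\<Prod>k<n. (1 - box_bump (a k) (b k) x) ^ n) = (1 - box_bump (a k) (b k) x) ^ n * (\<Prod>k\<in>{..<n} - {k}. (1 - box_bump (a k) (b k) x) ^ n)"
 using elim by (intro prod.remove) auto
 also have "... <= (1 - box_bump (a k) (b k) x) ^ n * 1"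
 using r01 by (intro mult_left_mono prod_le_1 conjI zero_le_power power_le_one)
 finally show ?case by simp
 qed
 have "\<forall>\<^sub>F n in sequentially. 0 <= (\<Prod>k<n. (1 - box_bump (a k) (b k) x) ^ n)"
 by (intro always_eventually allI prod_nonneg zero_le_power r01)
 then have "(%n. \<Prod>k<n. (1 - box_bump (a k) (b k) x) ^ n) \<longlonglongrightarrow> 0"
 by (rule tendsto_sandwich[OF _ ev tendsto_const l0])
 then have "(%n. \<eta> n x) \<longlonglongrightarrow> 1 - 0" unfolding \<eta>_def by (intro tendsto_intros)
 then show ?thesis using True by simp
 next
 case False
 then have "x \<notin> box (a k) (b k)" for k unfolding BU[symmetric] ab by auto
 then have "box_bump (a k) (b k) x = 0" for k
 using box_bump_pos[of "a k" "b k" x] box_bump_nonneg[of "a k" "b k" x] by (auto simp: less_le)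
 then have "\<eta> n x = 0" for n by (simp add: \<eta>_def)
 then show ?thesis using False by simp
 qed
 have eta0: "\<eta> n x = 0" if "x \<notin> cbox p q" for n x
 proof -
 have "x \<notin> box (a k) (b k)" for k using that sub[of k] by auto
 then have "box_bump (a k) (b k) x = 0" for k
 using box_bump_pos[of "a k" "b k" x] box_bump_nonneg[of "a k" "b k" x] by (auto simp: less_le)
 then show ?thesis by (simp add: \<eta>_def)
 qed
 have etam [measurable]: "\<eta> n \<in> blm" for n
 using test_funD(6)[OF tf[of n]] by auto
 have Um [measurable]: "U \<in> sets lebesgue" using U(1) by (simp add: borel_open sets_completionI_sets)
 have "(LINT x|lebesgue. \<eta> n x * (indicator (cbox p q) x * f x)) = (LINT x:Omega|lebesgue. f x * \<eta> n x)" for n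
 unfolding set_lebesgue_integral_def using eta0 pq
 by (intro Bochner_Integration.integral_cong) (auto simp: indicator_def)
 then have z: "(LINT x|lebesgue. \<eta> n x * (indicator (cbox p q) x * f x)) = 0" for n
 using zero[OF tf] by simp
 have "(%n. LINT x|lebesgue. \<eta> n x * (indicator (cbox p q) x * f x)) \<longlonglongrightarrow> (LINT x|lebesgue. indicator U x * (indicator (cbox p q) x * f x))"
 proof (rule integral_dominated_convergence[where w = "%x. \<bar>indicator (cbox p q) x * f x\<bar>"])
 show "AE x in lebesgue. (%n. \<eta> n x * (indicator (cbox p q) x * f x)) \<longlonglongrightarrow> indicator U x * (indicator (cbox p q) x * f x)"
 by (intro AE_I2 tendsto_mult eta_lim tendsto_const)
 show "AE x in lebesgue. norm (\<eta> n x * (indicator (cbox p q) x * f x)) <= \<bar>indicator (cbox p q) x * f x\<bar>" for n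
 using eta01 by (intro AE_I2) (auto simp: abs_mult intro!: mult_left_le_one_le)
 qed (use ci in auto)
 then have "(LINT x|lebesgue. indicator U x * (indicator (cbox p q) x * f x)) = 0" unfolding z by (simp add: LIMSEQ_const_iff)
 moreover have "indicator U x * (indicator (cbox p q) x * f x) = indicator U x * f x" for x
 using U(2) by (auto simp: indicator_def)
 ultimately show "(LINT x|lebesgue. indicator U x * f x) = 0" by simp
 qed
 qed
 moreover have "cbox p q - box p q \<in> null_sets lebesgue"
 using negligible_frontier_interval[of p q] by (simp add: negligible_iff_null_sets)
 then have "AE x in lebesgue. x \<notin> cbox p q - box p q" by (rule AE_not_in)
 ultimately show ?thesis by eventually_elim (auto simp: indicator_def)
 qed
 obtain D where D: "countable D" "D \<subseteq> Pow Omega" "!!X. X \<in> D ==> \<exists>a b. X = cbox a b" "\<Union>D = Omega"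
 using open_countable_Union_open_cbox[OF assms(1)] by metis
 have "AE x in lebesgue. \<forall>X\<in>D. x \<in> X --> f x = 0"
 proof (subst AE_ball_countable[OF D(1)], rule ballI)
 fix X assume X: "X \<in> D"
 with D(3) obtain p q where pq: "X = cbox p q" by blast
 have "X \<subseteq> Omega" using X D(2) by auto
 then show "AE x in lebesgue. x \<in> X --> f x = 0" unfolding pq by (rule box)
 qed
 then show ?thesis using D(4) by (auto elim!: eventually_mono)
qed

section \<open>Integration by parts and test functions on an interval\<close>

text \<open>Test functions are defined through \<open>partial\<close>, distributional derivatives in
  time through \<open>deriv\<close>. On the line the two agree, with basis vector 1.\<close>

lemma test_fun_deriv:
 fixes psi :: "real => real"
 assumes "test_fun S psi"
 shows "(psi has_real_derivative deriv psi t) (at t)" "partial 1 psi = deriv psi" "test_fun S (deriv psi)"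
proof -
 have *: "(psi has_real_derivative partial 1 psi t) (at t)" for t
 proof -
 note d = test_funD(2)[OF assms, of t]
 have "frechet_derivative psi (at t) = (*) (partial 1 psi t)"
 proof
 fix h
 show "frechet_derivative psi (at t) h = partial 1 psi t * h"
 using linear_scale[OF has_derivative_linear[OF d], of h 1] by (simp add: partial_def)
 qed
 with d show ?thesis unfolding has_field_derivative_def by (simp only:)
 qed
 show eq: "partial 1 psi = deriv psi" by (rule ext, rule DERIV_imp_deriv[OF *, symmetric])
 show "(psi has_real_derivative deriv psi t) (at t)" using *[of t] unfolding eq .
 show "test_fun S (deriv psi)" using test_funD(3)[OF assms, of 1] unfolding eq by simp
qed

lemma test_fun_ibp_smooth:
 fixes psi g :: "'a::euclidean_space => real"
 assumes psi: "test_fun Omega psi" and b: "b \<in> Basis" and g: "!!x. (g has_derivative g' x) (at x)"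
 and cg: "continuous_on UNIV (%x. g' x b)"
 shows "(LINT x|lebesgue. partial b psi x * g x) = - (LINT x|lebesgue. psi x * g' x b)"
 "integrable lebesgue (%x. partial b psi x * g x)" "integrable lebesgue (%x. psi x * g' x b)"
proof -
 from psi obtain K where K: "compact K" "!!x. x \<notin> K ==> psi x = 0" by (auto simp: test_fun_def)
 from test_funD(3)[OF psi b] obtain L where L: "compact L" "!!x. x \<notin> L ==> partial b psi x = 0" by (auto simp: test_fun_def)
 have cont: "continuous_on UNIV g"
 using g by (auto intro!: has_derivative_continuous simp: continuous_on_eq_continuous_at)
 note ct = test_funD(1)[OF psi] test_funD(1)[OF test_funD(3)[OF psi b]]
 show i1: "integrable lebesgue (%x. partial b psi x * g x)"
 by (rule compact_support_integrable(2)[OF _ L(1)]) (use cont ct L in \<open>auto intro!: continuous_intros\<close>)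
 show i2: "integrable lebesgue (%x. psi x * g' x b)"
 by (rule compact_support_integrable(2)[OF _ K(1)]) (use cg ct K in \<open>auto intro!: continuous_intros\<close>)
 have "(LINT x|lebesgue. psi x * g' x b + frechet_derivative psi (at x) b * g x) = 0"
 proof (rule integral_directional_derivative_eq_0[where F = "%x. psi x * g x"])
 show "((%x. psi x * g x) has_derivative (%h. psi x * g' x h + frechet_derivative psi (at x) h * g x)) (at x)" for x
 by (rule has_derivative_mult[OF test_funD(2)[OF psi] g])
 show "continuous_on UNIV (%x. psi x * g' x b + frechet_derivative psi (at x) b * g x)"
 unfolding partial_def[symmetric] by (intro continuous_intros ct cg cont)
 qed (use K b in auto)
 then show "(LINT x|lebesgue. partial b psi x * g x) = - (LINT x|lebesgue. psi x * g' x b)"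
 unfolding partial_def[symmetric] by (subst (asm) Bochner_Integration.integral_add[OF i2 i1]) simp
qed

text \<open>Integration by parts is available for real functions, so it is applied to the cosine and
  the sine part of the character separately.\<close>

lemma fourier_partial:
 assumes psi: "test_fun Omega psi" and b: "b \<in> Basis"
 shows "fourier (partial b psi) xi = (\<i> * (xi \<bullet> b)) * fourier psi xi"
proof -
 let ?c = "%x. cos (x \<bullet> xi)" and ?s = "%x. sin (x \<bullet> xi)"
 have dc: "(?c has_derivative (%h. - ?s x * (h \<bullet> xi))) (at x)" for x
 by (auto intro!: derivative_eq_intros simp: mult.commute)
 have ds: "(?s has_derivative (%h. ?c x * (h \<bullet> xi))) (at x)" for x
 by (auto intro!: derivative_eq_intros simp: mult.commute)
 have cc: "continuous_on UNIV (%x. - ?s x * (b \<bullet> xi))" "continuous_on UNIV (%x. ?c x * (b \<bullet> xi))"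
 by (auto intro!: continuous_intros)
 note C = test_fun_ibp_smooth[OF psi b dc cc(1)] and S = test_fun_ibp_smooth[OF psi b ds cc(2)]
 have i: "integrable lebesgue (%x. psi x * ?c x)" "integrable lebesgue (%x. psi x * ?s x)"
 proof -
 from psi obtain K where K: "compact K" "!!x. x \<notin> K ==> psi x = 0" by (auto simp: test_fun_def)
 show "integrable lebesgue (%x. psi x * ?c x)" "integrable lebesgue (%x. psi x * ?s x)"
 by (rule compact_support_integrable(2)[OF _ K(1)]; use K test_funD(1)[OF psi] in \<open>auto intro!: continuous_intros\<close>)+
 qed
 have split: "(LINT x|lebesgue. f x *\<^sub>R cis (- (x \<bullet> xi))) = complex_of_real (LINT x|lebesgue. f x * ?c x) - \<i> * complex_of_real (LINT x|lebesgue. f x * ?s x)"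
 if "integrable lebesgue (%x. f x * ?c x)" "integrable lebesgue (%x. f x * ?s x)" for f
 proof -
 have "f x *\<^sub>R cis (- (x \<bullet> xi)) = complex_of_real (f x * ?c x) - \<i> * complex_of_real (f x * ?s x)" for x
 by (auto simp: complex_eq_iff)
 then show ?thesis
 using that by (simp add: Bochner_Integration.integral_diff integrable_of_real del: of_real_mult)
 qed
 have "(LINT x|lebesgue. partial b psi x *\<^sub>R cis (- (x \<bullet> xi))) = complex_of_real ((b \<bullet> xi) * (LINT x|lebesgue. psi x * ?s x)) - \<i> * complex_of_real (- (b \<bullet> xi) * (LINT x|lebesgue. psi x * ?c x))"
 unfolding split[OF C(2) S(2)] C(1) S(1) by (simp add: mult.assoc[symmetric])
 also have "... = (\<i> * (xi \<bullet> b)) * (LINT x|lebesgue. psi x *\<^sub>R cis (- (x \<bullet> xi)))"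
 unfolding split[OF i] by (simp add: complex_eq_iff inner_commute)
 finally show ?thesis unfolding fourier_def by simp
qed

lemma test_fun_real_support:
 fixes psi :: "real => real"
 assumes "test_fun {a<..<b} psi" "a < b"
 obtains c d where "a < c" "c < d" "d < b" "!!x. x \<notin> {c..d} ==> psi x = 0"
proof -
 from assms obtain K where K: "compact K" "K \<subseteq> {a<..<b}" "!!x. x \<notin> K ==> psi x = 0" by (auto simp: test_fun_def)
 show ?thesis
 proof (cases "K = {}")
 case True
 then show ?thesis using K(3) assms(2) by (intro that[of "(2 * a + b) / 3" "(a + 2 * b) / 3"]) auto
 next
 case False
 obtain s where s: "s \<in> K" "!!x. x \<in> K ==> s <= x" using compact_attains_inf[OF K(1) False] by blast
 obtain t where t: "t \<in> K" "!!x. x \<in> K ==> x <= t" using compact_attains_sup[OF K(1) False] by blast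
 have "a < s" "t < b" "s <= t" using s t K(2) by auto
 moreover have "psi x = 0" if "x \<notin> {(a + s) / 2..(t + b) / 2}" for x
 proof (rule K(3), rule notI)
 assume "x \<in> K"
 then have "s <= x" "x <= t" using s t by auto
 with that \<open>a < s\<close> \<open>t < b\<close> show False by auto
 qed
 ultimately show ?thesis by (intro that[of "(a + s) / 2" "(t + b) / 2"]) auto
 qed
qed

lemma test_fun_scaleR_integrable:
 fixes f :: "real => 'b::{banach, second_countable_topology}"
 assumes psi: "test_fun {a<..<b} psi" and "a < b"
 and int: "!!c d. a < c ==> c < d ==> d < b ==> set_integrable lebesgue {c..d} f"
 shows "integrable lebesgue (%t. indicator {a<..<b} t *\<^sub>R (psi t *\<^sub>R f t))"
proof -
 obtain c d where cd: "a < c" "c < d" "d < b" "!!x. x \<notin> {c..d} ==> psi x = 0"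
 using test_fun_real_support[OF assms(1,2)] by metis
 obtain M where M: "!!x. \<bar>psi x\<bar> <= M" using test_funD(7)[OF psi] by auto
 have M0: "0 <= M" using M[of 0] by simp
 have i: "integrable lebesgue (%t. indicator {c..d} t *\<^sub>R f t)" using int[OF cd(1-3)] by (simp add: set_integrable_def)
 have [measurable]: "(%t. indicator {c..d} t *\<^sub>R f t) \<in> blm" "psi \<in> blm"
 using i test_funD(6)[OF psi] by auto
 have eq: "indicator {a<..<b} t *\<^sub>R (psi t *\<^sub>R f t) = psi t *\<^sub>R (indicator {c..d} t *\<^sub>R f t)" for t
 using cd by (auto simp: indicator_def)
 show ?thesis unfolding eq
 proof (rule Bochner_Integration.integrable_bound[OF integrable_scaleR_right[OF i, of M]])
 show "AE x in lebesgue. norm (psi x *\<^sub>R indicat_real {c..d} x *\<^sub>R f x) <= norm (M *\<^sub>R indicat_real {c..d} x *\<^sub>R f x)"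
 using M M0 by (intro AE_I2) (auto simp: abs_mult intro!: mult_right_mono)
 qed measurable
qed

text \<open>The scalar lemma is applied to the inner products with a countable dense set of vectors,
  so that the exceptional null sets can be united. A nonzero vector has positive inner product with
  some vector of a dense set.\<close>

lemma fundamental_lemma_vector:
 fixes f :: "real => 'b::{real_inner, banach, second_countable_topology}"
 assumes "a < b" and int: "!!c d. a < c ==> c < d ==> d < b ==> set_integrable lebesgue {c..d} f"
 and zero: "!!psi. test_fun {a<..<b} psi ==> (LINT x:{a<..<b}|lebesgue. psi x *\<^sub>R f x) = 0"
 shows "AE x in lebesgue. x \<in> {a<..<b} --> f x = 0"
proof -
 obtain D :: "'b set" where D: "countable D" "!!X. open X ==> X ~= {} ==> \<exists>d\<in>D. d \<in> X"
 using countable_dense_setE by metis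
 have "AE x in lebesgue. \<forall>z\<in>D. x \<in> {a<..<b} --> f x \<bullet> z = 0"
 proof (subst AE_ball_countable[OF D(1)], rule ballI)
 fix z
 show "AE x in lebesgue. x \<in> {a<..<b} --> f x \<bullet> z = 0"
 proof (rule fundamental_lemma)
 fix p q :: real assume pq: "cbox p q \<subseteq> {a<..<b}"
 show "set_integrable lebesgue (cbox p q) (%x. f x \<bullet> z)"
 proof (cases "p <= q")
 case True
 then have "a < p" "q < b" using pq by (auto simp: subset_eq)
 then have "set_integrable lebesgue {p..(q + b)/2} f" using True by (intro int) auto
 then have "set_integrable lebesgue (cbox p q) f"
 by (rule set_integrable_subset) (use \<open>q < b\<close> in auto)
 then have "integrable lebesgue (%x. (indicator (cbox p q) x *\<^sub>R f x) \<bullet> z)"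
 unfolding set_integrable_def by (intro integrable_inner_left)
 then show ?thesis unfolding set_integrable_def by simp
 qed (simp add: set_integrable_def)
 next
 fix psi :: "real => real" assume psi: "test_fun {a<..<b} psi"
 have "(LINT x|lebesgue. (indicator {a<..<b} x *\<^sub>R (psi x *\<^sub>R f x)) \<bullet> z) = (LINT x|lebesgue. indicator {a<..<b} x *\<^sub>R (psi x *\<^sub>R f x)) \<bullet> z"
 by (intro integral_inner_left test_fun_scaleR_integrable[OF psi assms(1) int])
 then show "(LINT x:{a<..<b}|lebesgue. f x \<bullet> z * psi x) = 0"
 using zero[OF psi] by (simp add: set_lebesgue_integral_def mult_ac)
 qed simp
 qed
 then show ?thesis
 proof (rule eventually_mono, intro impI)
 fix x assume *: "\<forall>z\<in>D. x \<in> {a<..<b} --> f x \<bullet> z = 0" "x \<in> {a<..<b}"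
 show "f x = 0"
 proof (rule ccontr)
 assume n: "f x ~= 0"
 have "open {z. f x \<bullet> z > 0}" by (intro open_Collect_less continuous_intros)
 moreover have "f x \<in> {z. f x \<bullet> z > 0}" using n by simp
 ultimately obtain z where "z \<in> D" "f x \<bullet> z > 0" using D(2) by blast
 with * show False by auto
 qed
 qed
qed

text \<open>The primitive taken from the left endpoint is constant to the right of the support, and
  this constant is the total integral, which is 0.\<close>

lemma test_fun_antiderivative:
 fixes \<zeta> :: "real => real"
 assumes \<zeta>: "test_fun {a<..<b} \<zeta>" "a < b" and zero: "(LINT x|lebesgue. \<zeta> x) = 0"
 obtains h where "test_fun {a<..<b} h" "deriv h = \<zeta>"
proof -
 obtain c d where cd: "a < c" "c < d" "d < b" "!!x. x \<notin> {c..d} ==> \<zeta> x = 0"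
 using test_fun_real_support[OF assms(1,2)] by metis
 define h where "h x = integral {a..x} \<zeta>" for x
 have cont: "continuous_on S \<zeta>" for S using test_funD(1)[OF \<zeta>(1)] continuous_on_subset by blast
 have h0: "h x = 0" if "x < c" for x
 unfolding h_def using cd that by (intro integral_eq_0_iff[THEN iffD2] has_integral_is_0[THEN integral_unique]) auto
 have hd: "(h has_real_derivative \<zeta> x) (at x)" for x
 proof (cases "x < c")
 case True
 have "((%x. 0) has_real_derivative \<zeta> x) (at x)" using True cd by simp
 moreover have "\<forall>\<^sub>F y in nhds x. h y = 0"
 using eventually_nhds_in_open[of "{..<c}" x] True by (auto intro: h0 elim!: eventually_mono)
 ultimately show ?thesis by (subst DERIV_cong_ev[OF refl _ refl])
 next
 case False
 have "(h has_real_derivative \<zeta> x) (at x within {a..x + 1})"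
 unfolding h_def using False cd by (intro integral_has_real_derivative cont) auto
 moreover have "at x within {a..x + 1} = at x"
 using False cd by (intro at_within_interior) auto
 ultimately show ?thesis by simp
 qed
 have h1: "h x = 0" if "x > d" for x
 proof -
 have "(\<zeta> has_integral (LINT x|lebesgue. \<zeta> x)) UNIV"
 by (rule has_integral_integral_lebesgue) (rule test_funD(6)[OF \<zeta>(1)])
 then have "(\<zeta> has_integral 0) {a..x}"
 unfolding zero by (subst has_integral_restrict_UNIV[symmetric], elim has_integral_eq[rotated]) (use that cd in auto)
 then show ?thesis unfolding h_def by (rule integral_unique)
 qed
 have pz: "partial 1 h = \<zeta>"
 by (intro ext) (simp add: partial_eqI[OF hd[unfolded has_field_derivative_def]])
 have "C_k k h" for k
 proof (cases k)
 case 0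
 then show ?thesis using hd by (auto intro!: DERIV_isCont simp: continuous_on_eq_continuous_at)
 next
 case (Suc m)
 have "h differentiable_on UNIV"
 using hd by (auto simp: differentiable_on_def real_differentiable_def)
 then show ?thesis using \<zeta>(1) pz Suc by (simp add: test_fun_def)
 qed
 moreover have "h x = 0" if "x \<notin> {c..d}" for x using that h0 h1 by auto
 ultimately have "test_fun {a<..<b} h"
 unfolding test_fun_def using cd by (intro conjI allI exI[of _ "{c..d}"]) auto
 moreover have "deriv h = \<zeta>" using hd by (intro ext DERIV_imp_deriv)
 ultimately show ?thesis by (rule that)
qed

lemma test_fun_unit_integral:
 assumes "a < (b::real)"
 obtains \<eta> where "test_fun {a<..<b} \<eta>" "(LINT x|lebesgue. \<eta> x) = 1"
proof -
 define p q where "p = (2 * a + b) / 3" and "q = (a + 2 * b) / 3"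
 have pq: "a < p" "p < q" "q < b" using assms by (auto simp: p_def q_def)
 have t: "test_fun {a<..<b} (box_bump p q)"
 unfolding test_fun_def
 proof (intro conjI allI exI[of _ "cbox p q"] impI C_k_box_bump)
 fix x assume "x \<notin> cbox p q"
 then have "x \<notin> box p q" by auto
 then show "box_bump p q x = 0"
 using box_bump_pos[of p q x] box_bump_nonneg[of p q x] by (auto simp: less_le)
 qed (use pq in auto)
 define I where "I = (LINT x|lebesgue. box_bump p q x)"
 have "I ~= 0"
 proof
 assume "I = 0"
 then have "AE x in lebesgue. box_bump p q x = 0"
 unfolding I_def using integral_nonneg_eq_0_iff_AE[OF test_funD(6)[OF t]] box_bump_nonneg by auto
 then have "AE x in lebesgue. x \<notin> box p q"
 by (rule eventually_mono) (metis box_bump_pos less_irrefl)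
 then have "emeasure lebesgue (box p q) = 0"
 by (subst (asm) AE_iff_measurable[of "box p q"]) auto
 then show False using pq by (simp add: box_real)
 qed
 then show ?thesis
 using test_fun_scale[OF t, of "1 / I"] by (intro that[of "%x. 1 / I * box_bump p q x"]) (simp_all add: I_def)
qed

text \<open>Subtracting from a test function its integral times a fixed test function \<eta> of
  integral 1 leaves the derivative of a test function. Hence \<open>f\<close> minus its
  \<eta>-weighted mean is annihilated by all test functions.\<close>

lemma du_bois_reymond:
 fixes f :: "real => real"
 assumes "a < b" and int: "!!c d. a < c ==> c < d ==> d < b ==> set_integrable lebesgue {c..d} f"
 and zero: "!!psi. test_fun {a<..<b} psi ==> (LINT x:{a<..<b}|lebesgue. deriv psi x * f x) = 0"
 obtains k where "AE x in lebesgue. x \<in> {a<..<b} --> f x = k"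
proof -
 obtain \<eta> where \<eta>: "test_fun {a<..<b} \<eta>" "(LINT x|lebesgue. \<eta> x) = 1"
 using test_fun_unit_integral[OF assms(1)] by metis
 define k where "k = (LINT x:{a<..<b}|lebesgue. \<eta> x * f x)"
 have "AE x in lebesgue. x \<in> {a<..<b} --> f x - k = 0"
 proof (rule fundamental_lemma_vector[OF assms(1)])
 show "set_integrable lebesgue {c..d} (%x. f x - k)" if "a < c" "c < d" "d < b" for c d
 proof (rule set_integral_diff(1)[OF int[OF that]])
 show "set_integrable lebesgue {c..d} (%x. k)"
 unfolding set_integrable_def using that by (intro integrable_scaleR_left) (auto simp: integrable_indicator_iff)
 qed
 fix theta assume theta: "test_fun {a<..<b} theta"
 define m where "m = (LINT x|lebesgue. theta x)"
 define \<zeta> where "\<zeta> x = theta x - m * \<eta> x" for x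
 have \<zeta>: "test_fun {a<..<b} \<zeta>"
 unfolding \<zeta>_def[abs_def] by (intro test_fun_diff theta test_fun_scale \<eta>(1))
 have "(LINT x|lebesgue. \<zeta> x) = 0"
 unfolding \<zeta>_def using test_funD(6)[OF theta] test_funD(6)[OF \<eta>(1)] \<eta>(2) by (simp add: m_def)
 then obtain h where h: "test_fun {a<..<b} h" "deriv h = \<zeta>"
 using test_fun_antiderivative[OF \<zeta> assms(1)] by metis
 note itheta = test_fun_scaleR_integrable[OF theta assms(1) int]
 note i\<eta> = test_fun_scaleR_integrable[OF \<eta>(1) assms(1) int]
 have it: "integrable lebesgue theta" by (rule test_funD(6)[OF theta])
 have t0: "indicator {a<..<b} x *\<^sub>R theta x = theta x" for x using test_funD(4)[OF theta, of x] by (auto simp: indicator_def)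
 have "0 = (LINT x|lebesgue. indicator {a<..<b} x *\<^sub>R (theta x *\<^sub>R f x) - m *\<^sub>R (indicator {a<..<b} x *\<^sub>R (\<eta> x *\<^sub>R f x)))"
 using zero[OF h(1)] unfolding h(2) set_lebesgue_integral_def \<zeta>_def by (simp add: algebra_simps)
 also have "... = (LINT x|lebesgue. indicator {a<..<b} x *\<^sub>R (theta x *\<^sub>R f x)) - m * k"
 using itheta i\<eta> by (subst Bochner_Integration.integral_diff) (auto simp: k_def set_lebesgue_integral_def)
 also have "m * k = (LINT x|lebesgue. theta x * k)"
 using it by (simp add: m_def)
 also have "(LINT x|lebesgue. indicator {a<..<b} x *\<^sub>R (theta x *\<^sub>R f x)) - ... = (LINT x|lebesgue. indicator {a<..<b} x *\<^sub>R (theta x *\<^sub>R f x) - theta x * k)"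
 using itheta it by (subst Bochner_Integration.integral_diff) auto
 also have "... = (LINT x:{a<..<b}|lebesgue. theta x *\<^sub>R (f x - k))"
 unfolding set_lebesgue_integral_def using t0 by (intro Bochner_Integration.integral_cong) (auto simp: algebra_simps)
 finally show "(LINT x:{a<..<b}|lebesgue. theta x *\<^sub>R (f x - k)) = 0" by simp
 qed
 then show ?thesis by (intro that[of k]) (auto elim!: eventually_mono)
qed

section \<open>The Riemann-Liouville kernel and its truncated Fourier integrals\<close>

text \<open>The kernel of the fractional integral without its Gamma factor. The extension by zero
  makes the fractional integral a convolution over the whole line.\<close>

definition rl_kernel :: "real => real => real" where
 "rl_kernel a s = (if s > 0 then s powr (a - 1) else 0)"

lemma rl_kernel_nonneg [simp]: "0 <= rl_kernel a s"
 by (simp add: rl_kernel_def)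

lemma rl_kernel_measurable [measurable]: "rl_kernel a \<in> borel_measurable borel"
 unfolding rl_kernel_def[abs_def] by measurable

lemma nn_integral_lebesgue_has_integral:
 fixes f :: "real => real"
 assumes "!!x. x \<in> S ==> 0 <= f x" "(f has_integral I) S"
 shows "(INTP x. ennreal (indicator S x * f x)) = ennreal I"
proof -
 have hi: "((%x. indicator S x * f x) has_integral I) UNIV"
 proof -
 have "((%x. if x \<in> S then f x else 0) has_integral I) UNIV"
 using assms(2) by (simp only: has_integral_restrict_UNIV)
 moreover have "(%x. if x \<in> S then f x else 0) = (%x. indicator S x * f x)" by (auto simp: indicator_def)
 ultimately show ?thesis by simp
 qed
 have nn: "0 <= indicator S x * f x" for x using assms(1) by (auto simp: indicator_def)
 show ?thesis using iffD1[OF has_integral_iff_nn_integral_lebesgue[OF nn] hi] by simp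
qed

lemma nn_integral_rl_kernel:
 assumes "0 < a" "0 <= c"
 shows "(INTP s. ennreal (indicator {..<c} s * rl_kernel a s)) = ennreal (c powr a / a)"
proof -
 have "(INTP s. ennreal (indicator {0..c} s * s powr (a - 1))) = ennreal (c powr (a - 1 + 1) / (a - 1 + 1))"
 by (rule nn_integral_lebesgue_has_integral[OF _ has_integral_powr_from_0]) (use assms in auto)
 then have I: "(INTP s. ennreal (indicator {0..c} s * s powr (a - 1))) = ennreal (c powr a / a)" by simp
 have ae: "AE s in lebesgue. ennreal (indicator {..<c} s * rl_kernel a s) = ennreal (indicator {0..c} s * s powr (a - 1))"
 proof -
 have "{c} \<in> null_sets (lebesgue :: real measure)" by simp
 then have "AE s in lebesgue. s \<notin> {c}" by (rule AE_not_in)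
 then show ?thesis
 by (rule eventually_mono) (auto simp: rl_kernel_def indicator_def)
 qed
 show ?thesis by (rule trans[OF nn_integral_cong_AE[OF ae] I])
qed

lemma nn_integral_rl_kernel_shift:
 assumes "0 < a" "y <= t"
 shows "(INTP x. ennreal (indicator {..<t} x * rl_kernel a (x - y))) = ennreal ((t - y) powr a / a)"
proof -
 have m: "(%x. ennreal (indicator {..<t} x * rl_kernel a (x - y))) \<in> blm"
 by (rule measurable_completion) measurable
 have "indicator {..<t} (y + x) = (indicator {..<t - y} x :: real)" for x by (auto simp: indicator_def)
 then show ?thesis
 using nn_integral_rl_kernel[OF assms(1), of "t - y"] assms(2)
 by (subst nn_integral_real_affine_lebesgue[OF m, of 1 y]) auto
qed

lemma rl_kernel_integrable:
 assumes "0 < a"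
 shows "integrable lebesgue (%s. indicator {..<c} s * rl_kernel a s)"
proof (rule integrableI_bounded)
 show "(%s. indicator {..<c} s * rl_kernel a s) \<in> blm"
 by (rule measurable_completion) measurable
 have "(INTP s. ennreal (norm (indicator {..<c} s * rl_kernel a s))) <= (INTP s. ennreal (indicator {..<max c 0} s * rl_kernel a s))"
 by (intro nn_integral_mono ennreal_leI) (auto simp: indicator_def rl_kernel_def)
 also have "... < \<infinity>" using assms by (subst nn_integral_rl_kernel) auto
 finally show "(INTP s. ennreal (norm (indicator {..<c} s * rl_kernel a s))) < \<infinity>" .
qed

text \<open>Tonelli with a uniform bound on the mass of the kernel in x. The bound is asked for only
  where \<open>f\<close> is nonzero: cut off at t, the Riemann-Liouville kernel has mass at most t^a
  / a for y in (0,t), but not for every y.\<close>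

lemma pair_kernel_integrable:
 fixes K :: "real => real => real" and f :: "real => 'c::{banach, second_countable_topology}"
 assumes K [measurable]: "(%(x, y). K x y) \<in> borel_measurable (lebesgue \<Otimes>\<^sub>M lebesgue)"
 and f: "integrable lebesgue f"
 and C: "!!y. f y ~= 0 ==> (INTP x. ennreal \<bar>K x y\<bar>) <= ennreal C"
 shows "integrable (lebesgue \<Otimes>\<^sub>M lebesgue) (%(x, y). K x y *\<^sub>R f y)"
proof (rule integrableI_bounded)
 have [measurable]: "f \<in> blm" using f by auto
 show m: "(%(x, y). K x y *\<^sub>R f y) \<in> borel_measurable (lebesgue \<Otimes>\<^sub>M lebesgue)" by measurable
 have m': "(%p. ennreal (norm (case p of (x, y) => K x y *\<^sub>R f y))) \<in> borel_measurable (lebesgue \<Otimes>\<^sub>M lebesgue)"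
 by (rule measurable_compose[OF measurable_compose[OF m borel_measurable_norm] measurable_ennreal])
 have "(\<integral>\<^sup>+p. ennreal (norm (case p of (x, y) => K x y *\<^sub>R f y)) \<partial>(lebesgue \<Otimes>\<^sub>M lebesgue)) = (\<integral>\<^sup>+y. \<integral>\<^sup>+x. ennreal (norm (K x y *\<^sub>R f y)) \<partial>lebesgue \<partial>lebesgue)"
 by (subst lebesgue_pair.nn_integral_snd[OF m', symmetric]) simp
 also have "... <= (INTP y. ennreal C * ennreal (norm (f y)))"
 proof (rule nn_integral_mono)
 fix y :: real
 have Ky: "(%x. K x y) \<in> blm" by measurable
 have "(INTP x. ennreal (norm (K x y *\<^sub>R f y))) = (INTP x. ennreal \<bar>K x y\<bar>) * ennreal (norm (f y))"
 using Ky by (subst nn_integral_multc[symmetric]) (auto simp: ennreal_mult)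
 also have "... <= ennreal C * ennreal (norm (f y))"
 using C[of y] by (cases "f y = 0") (auto intro: mult_right_mono)
 finally show "(INTP x. ennreal (norm (K x y *\<^sub>R f y))) <= ennreal C * ennreal (norm (f y))" .
 qed
 also have "... = ennreal C * (INTP y. ennreal (norm (f y)))"
 by (rule nn_integral_cmult) measurable
 also have "... < \<infinity>" using f by (simp add: integrable_iff_bounded ennreal_mult_less_top)
 finally show "(\<integral>\<^sup>+p. ennreal (norm (case p of (x, y) => K x y *\<^sub>R f y)) \<partial>(lebesgue \<Otimes>\<^sub>M lebesgue)) < \<infinity>" .
qed

lemma rl_pair_integrable:
 fixes f :: "real => 'c::{banach, second_countable_topology}"
 assumes "0 < a" "integrable lebesgue f" "!!y. y \<notin> {0<..<t} ==> f y = 0"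
 shows "integrable (lebesgue \<Otimes>\<^sub>M lebesgue) (%(x, y). (indicator {..<t} x * rl_kernel a (x - y)) *\<^sub>R f y)"
proof (rule pair_kernel_integrable[where C = "t powr a / a"])
 note lebesgue_proj_measurable[measurable]
 show "(%(x, y). indicator {..<t} x * rl_kernel a (x - y)) \<in> borel_measurable (lebesgue \<Otimes>\<^sub>M lebesgue)"
 by measurable
 fix y assume "f y ~= 0"
 then have y: "y \<in> {0<..<t}" using assms(3) by blast
 have "(INTP x. ennreal \<bar>indicator {..<t} x * rl_kernel a (x - y)\<bar>) = ennreal ((t - y) powr a / a)"
 using nn_integral_rl_kernel_shift[OF assms(1), of y t] y by simp
 also have "... <= ennreal (t powr a / a)"
 using assms(1) y by (intro ennreal_leI divide_right_mono powr_mono2) auto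
 finally show "(INTP x. ennreal \<bar>indicator {..<t} x * rl_kernel a (x - y)\<bar>) <= ennreal (t powr a / a)" .
qed (use assms in auto)

lemma sq_integrable_imp_integrable:
 fixes f :: "'a::euclidean_space => real"
 assumes "sq_integrable f" "bounded S" "!!x. x \<notin> S ==> f x = 0"
 shows "integrable lebesgue f"
proof -
 obtain R where R: "S \<subseteq> ball 0 R" using assms(2) bounded_subset_ballD by blast
 have i: "integrable lebesgue (%x. indicator (ball 0 R) x + (f x)\<^sup>2)"
 using assms(1) lmeasurable_ball[of "0::'a" R]
 by (intro Bochner_Integration.integrable_add) (auto simp: sq_integrable_def integrable_indicator_iff fmeasurable_def)
 show ?thesis
 proof (rule Bochner_Integration.integrable_bound[OF i])
 show "f \<in> blm" using assms(1) by (simp add: sq_integrable_def)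
 have "\<bar>f x\<bar> <= 1 + (f x)\<^sup>2" for x
 using sum_squares_bound[of "\<bar>f x\<bar>" 1] zero_le_power2[of "f x"] by (simp)
 then show "AE x in lebesgue. norm (f x) <= norm (indicator (ball 0 R) x + (f x)\<^sup>2)"
 proof (intro AE_I2)
 fix x
 show "norm (f x) <= norm (indicator (ball 0 R) x + (f x)\<^sup>2)"
 proof (cases "x \<in> S")
 case True
 then have "x \<in> ball 0 R" using R by blast
 then show ?thesis using \<open>\<bar>f x\<bar> <= 1 + (f x)\<^sup>2\<close> by simp
 qed (simp add: assms(3))
 qed
 qed
qed

text \<open>The Fourier integral of s^(a-1) over (0,\<sigma>), without the factor that normalizes
  \<open>fourier\<close>.\<close>

definition osc_integral :: "real => real => real => complex" where
 "osc_integral a xi \<sigma> = (LINT s|lebesgue. (indicator {..<\<sigma>} s * rl_kernel a s) *\<^sub>R cis (- (s * xi)))"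

lemma cis_lebesgue_measurable [measurable]: "(%s::real. cis (- (s * xi))) \<in> blm"
 by (rule measurable_completion) measurable

lemma osc_integrable:
 assumes "0 < a"
 shows "integrable lebesgue (%s. (indicator {..<\<sigma>} s * rl_kernel a s) *\<^sub>R cis (- (s * xi)))"
proof (rule Bochner_Integration.integrable_bound[OF rl_kernel_integrable[OF assms, of \<sigma>]])
 have [measurable]: "(%s. indicator {..<\<sigma>} s * rl_kernel a s) \<in> blm"
 using rl_kernel_integrable[OF assms] by auto
 show "(%s. (indicator {..<\<sigma>} s * rl_kernel a s) *\<^sub>R cis (- (s * xi))) \<in> blm" by measurable
qed simp

lemma osc_integral_measurable [measurable]: "(%y. osc_integral a xi (t - y)) \<in> blm"
proof -
 note lebesgue_proj_measurable[measurable]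
 have eq: "osc_integral a xi \<sigma> = (LINT s|lebesgue. (if s < \<sigma> then rl_kernel a s else 0) *\<^sub>R cis (- (s * xi)))" for \<sigma>
 unfolding osc_integral_def by (intro Bochner_Integration.integral_cong) auto
 have "(%(y, s). (if s < t - y then rl_kernel a s else 0) *\<^sub>R cis (- (s * xi))) \<in> borel_measurable (lebesgue \<Otimes>\<^sub>M lebesgue)"
 by measurable
 then show ?thesis unfolding eq by (rule lebesgue.borel_measurable_lebesgue_integral)
qed

text \<open>By the second mean value theorem for the monotone factor s^(a-1), only differences of
  the bounded primitive F enter. There are two of them, each at most 2 B.\<close>

lemma oscillatory_bound:
 fixes f F :: "real => real"
 assumes u: "0 < u" "u <= v" and a: "a < 1" and F: "!!s. (F has_real_derivative f s) (at s)"
 and b: "!!s. \<bar>F s\<bar> <= B"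
 shows "\<bar>integral {u..v} (%s. s powr (a - 1) * f s)\<bar> <= 4 * B * u powr (a - 1)"
proof -
 have ftc: "(f has_integral (F y - F x)) {x..y}" if "x <= y" for x y
 using that F by (intro fundamental_theorem_of_calculus)
 (auto intro: has_field_derivative_at_within simp: has_real_derivative_iff_has_vector_derivative[symmetric])
 have g: "- (x powr (a - 1)) <= - (y powr (a - 1))" if "u <= x" "x <= y" "y <= v" for x y
 using powr_mono2'[of "a - 1" x y] that a u by simp
 obtain c where c: "c \<in> {u..v}" "integral {u..v} (%x. - (x powr (a - 1)) * f x) = - (u powr (a - 1)) * integral {u..c} f + - (v powr (a - 1)) * integral {c..v} f"
 using second_mean_value_theorem[of f u v "%x. - (x powr (a - 1))"] ftc[OF u(2)] u(2) g
 by (auto simp: integrable_on_def)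
 have i: "integral {u..c} f = F c - F u" "integral {c..v} f = F v - F c"
 using ftc[of u c] ftc[of c v] c(1) by (auto intro: integral_unique)
 have e: "integral {u..v} (%s. s powr (a - 1) * f s) = u powr (a - 1) * (F c - F u) + v powr (a - 1) * (F v - F c)"
 using c(2) unfolding i by (simp add: algebra_simps)
 have "\<bar>F c - F u\<bar> <= 2 * B" "\<bar>F v - F c\<bar> <= 2 * B" using b[of c] b[of u] b[of v] by linarith+
 moreover have "v powr (a - 1) <= u powr (a - 1)" using powr_mono2'[of "a - 1" u v] a u by simp
 moreover have "0 <= B" using b[of 0] by linarith
 ultimately have "\<bar>u powr (a - 1) * (F c - F u)\<bar> <= u powr (a - 1) * (2 * B)" "\<bar>v powr (a - 1) * (F v - F c)\<bar> <= u powr (a - 1) * (2 * B)"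
 by (auto simp: abs_mult intro!: mult_mono)
 then show ?thesis unfolding e by (simp add: algebra_simps)
qed

text \<open>The real and the imaginary part are oscillatory integrals whose primitives are bounded
  by 1 / |xi|; each contributes a factor 4.\<close>

lemma osc_integral_diff_bound:
 assumes u: "0 < u" "u <= v" and a: "0 < a" "a < 1" and "xi ~= 0"
 shows "cmod (osc_integral a xi v - osc_integral a xi u) <= 8 * u powr (a - 1) / \<bar>xi\<bar>"
proof -
 let ?c = "%s. indicator {u..v} s *\<^sub>R (s powr (a - 1) * cos (s * xi))" and ?s = "%s. indicator {u..v} s *\<^sub>R (s powr (a - 1) * sin (s * xi))"
 have c: "set_integrable lborel {u..v} (%s. s powr (a - 1) * cos (s * xi))"
 and s: "set_integrable lborel {u..v} (%s. s powr (a - 1) * sin (s * xi))"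
 using u by (auto intro!: borel_integrable_atLeastAtMost' continuous_intros)
 have cl: "integrable lebesgue ?c" "integrable lebesgue ?s" using c s by (simp_all add: set_integrable_def integrable_completion)
 have ci: "(LINT s|lebesgue. ?c s) = integral {u..v} (%s. s powr (a - 1) * cos (s * xi))"
 using set_borel_integral_eq_integral(2)[OF c] c by (subst integral_completion) (auto simp: set_lebesgue_integral_def set_integrable_def)
 have si: "(LINT s|lebesgue. ?s s) = integral {u..v} (%s. s powr (a - 1) * sin (s * xi))"
 using set_borel_integral_eq_integral(2)[OF s] s by (subst integral_completion) (auto simp: set_lebesgue_integral_def set_integrable_def)
 have cb: "\<bar>LINT s|lebesgue. ?c s\<bar> <= 4 * (1 / \<bar>xi\<bar>) * u powr (a - 1)" unfolding ci
 by (rule oscillatory_bound[OF u a(2), where F = "%s. sin (s * xi) / xi"])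
 (use assms(5) in \<open>auto intro!: derivative_eq_intros divide_right_mono simp: abs_divide\<close>)
 have sb: "\<bar>LINT s|lebesgue. ?s s\<bar> <= 4 * (1 / \<bar>xi\<bar>) * u powr (a - 1)" unfolding si
 by (rule oscillatory_bound[OF u a(2), where F = "%s. - cos (s * xi) / xi"])
 (use assms(5) in \<open>auto intro!: derivative_eq_intros divide_right_mono simp: abs_divide\<close>)
 have "{v} \<in> null_sets (lebesgue :: real measure)" by simp
 then have nv: "AE s in lebesgue. s \<notin> {v}" by (rule AE_not_in)
 have "osc_integral a xi v - osc_integral a xi u = (LINT s|lebesgue. (indicator {..<v} s * rl_kernel a s) *\<^sub>R cis (- (s * xi)) - (indicator {..<u} s * rl_kernel a s) *\<^sub>R cis (- (s * xi)))"
 unfolding osc_integral_def by (rule Bochner_Integration.integral_diff[symmetric, OF osc_integrable osc_integrable]) (rule a)+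
 also have "... = (LINT s|lebesgue. complex_of_real (?c s) - \<i> * complex_of_real (?s s))"
 proof (rule integral_cong_AE)
 show "AE s in lebesgue. (indicator {..<v} s * rl_kernel a s) *\<^sub>R cis (- (s * xi)) - (indicator {..<u} s * rl_kernel a s) *\<^sub>R cis (- (s * xi)) = complex_of_real (?c s) - \<i> * complex_of_real (?s s)"
 using nv by eventually_elim (use u in \<open>auto simp: indicator_def rl_kernel_def complex_eq_iff\<close>)
 show "(%s. complex_of_real (?c s) - \<i> * complex_of_real (?s s)) \<in> blm"
 by (intro borel_measurable_diff borel_measurable_times borel_measurable_const
 measurable_compose[OF borel_measurable_integrable[OF cl(1)] borel_measurable_of_real] measurable_compose[OF borel_measurable_integrable[OF cl(2)] borel_measurable_of_real])
 show "(%s. (indicator {..<v} s * rl_kernel a s) *\<^sub>R cis (- (s * xi)) - (indicator {..<u} s * rl_kernel a s) *\<^sub>R cis (- (s * xi))) \<in> blm"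
 using osc_integrable[OF a(1)] by (intro borel_measurable_diff) auto
 qed
 also have "... = complex_of_real (LINT s|lebesgue. ?c s) - \<i> * complex_of_real (LINT s|lebesgue. ?s s)"
 proof (subst Bochner_Integration.integral_diff)
 show "integrable lebesgue (%s. complex_of_real (?c s))" "integrable lebesgue (%s. \<i> * complex_of_real (?s s))"
 by (intro integrable_of_real integrable_mult_right cl)+
 qed (simp only: integral_complex_of_real integral_mult_right_zero)
 finally have "cmod (osc_integral a xi v - osc_integral a xi u) <= \<bar>LINT s|lebesgue. ?c s\<bar> + \<bar>LINT s|lebesgue. ?s s\<bar>"
 using norm_triangle_ineq4[of "complex_of_real (LINT s|lebesgue. ?c s)" "\<i> * complex_of_real (LINT s|lebesgue. ?s s)"]
 by (simp add: norm_mult)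
 then show ?thesis using cb sb by simp
qed

text \<open>The range of integration is split at 1 / |xi|. Below, the kernel is integrated in
  absolute value and gives 1/a; above, oscillation gives 8.\<close>

lemma osc_integral_bound:
 assumes a: "0 < a" "a < 1" and "xi ~= 0" "0 < \<sigma>"
 shows "cmod (osc_integral a xi \<sigma>) <= (1 / a + 8) * \<bar>xi\<bar> powr (- a)"
proof -
 have small: "cmod (osc_integral a xi \<sigma>) <= \<sigma> powr a / a" if "0 < \<sigma>" for \<sigma>
 proof -
 have "ennreal (cmod (osc_integral a xi \<sigma>)) <= (INTP s. ennreal (norm ((indicator {..<\<sigma>} s * rl_kernel a s) *\<^sub>R cis (- (s * xi)))))"
 unfolding osc_integral_def by (rule norm_integral_le_nn_integral)
 also have "... = ennreal (\<sigma> powr a / a)"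
 using nn_integral_rl_kernel[OF a(1), of \<sigma>] that by simp
 finally show ?thesis using a that by (simp add: ennreal_le_iff)
 qed
 define \<sigma>0 where "\<sigma>0 = 1 / \<bar>xi\<bar>"
 have s0: "0 < \<sigma>0" using assms by (simp add: \<sigma>0_def)
 have p0: "\<sigma>0 powr a = \<bar>xi\<bar> powr (- a)" unfolding \<sigma>0_def using assms by (simp add: powr_divide powr_minus_divide)
 show ?thesis
 proof (cases "\<sigma> <= \<sigma>0")
 case True
 have "cmod (osc_integral a xi \<sigma>) <= \<sigma> powr a / a" by (rule small) fact
 also have "... <= \<sigma>0 powr a / a" using a True assms(4) by (intro divide_right_mono powr_mono2) auto
 also have "... <= (1 / a + 8) * \<bar>xi\<bar> powr (- a)" unfolding p0 by (simp add: field_simps)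
 finally show ?thesis .
 next
 case False
 have "cmod (osc_integral a xi \<sigma>) <= cmod (osc_integral a xi \<sigma>0) + cmod (osc_integral a xi \<sigma> - osc_integral a xi \<sigma>0)"
 by (rule norm_triangle_sub)
 also have "... <= \<sigma>0 powr a / a + 8 * (\<sigma>0 powr (a - 1) / \<bar>xi\<bar>)"
 using osc_integral_diff_bound[OF s0 _ a assms(3), of \<sigma>] False s0 by (intro add_mono small) auto
 also have "\<sigma>0 powr (a - 1) / \<bar>xi\<bar> = \<bar>xi\<bar> powr (- a)"
 using assms by (simp add: \<sigma>0_def powr_divide powr_diff powr_minus field_simps)
 finally show ?thesis unfolding p0 by (simp add: field_simps)
 qed
qed

section \<open>The Schur test and the bound of the fractional integral in frequency space\<close>

text \<open>For a < 1 this is 1 up to u = 1 and u^(a-1) beyond. With u = |xi| \<sigma> it is the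
  size of the tail of the oscillatory integral from \<sigma> on, relative to |xi|^(-a).\<close>

definition schur_kernel :: "real => real => real" where
 "schur_kernel a u = (if u > 0 then min 1 (u powr (a - 1)) else 0)"

lemma schur_kernel_nonneg [simp]: "0 <= schur_kernel a u"
 by (simp add: schur_kernel_def)

lemma schur_kernel_measurable [measurable]: "schur_kernel a \<in> borel_measurable borel"
 unfolding schur_kernel_def[abs_def] by measurable

text \<open>The integral against \<sigma>^(-1/2) is split at 1 / \<eta>: the near part gives the 2,
  the far part gives 1 / (1/2 - a). Convergence at infinity is where a < 1/2 enters.\<close>

lemma schur_kernel_weight:
 assumes a: "a < 1 / 2" and "0 < \<eta>"
 shows "(\<integral>\<^sup>+\<sigma>. ennreal (schur_kernel a (\<eta> * \<sigma>) * rl_kernel (1 / 2) \<sigma>) \<partial>lebesgue) <= ennreal ((2 + 1 / (1 / 2 - a)) * \<eta> powr (- 1 / 2))"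
proof -
 let ?f = "%\<sigma>. indicator {..<1 / \<eta>} \<sigma> * rl_kernel (1 / 2) \<sigma>"
 let ?g = "%\<sigma>. indicator {1 / \<eta>..} \<sigma> * \<sigma> powr (a - 3 / 2)"
 have [measurable]: "?f \<in> blm" "?g \<in> blm"
 by (rule measurable_completion, measurable)+
 have g0: "0 <= ?g \<sigma>" for \<sigma> by simp
 have pw: "schur_kernel a (\<eta> * \<sigma>) * rl_kernel (1 / 2) \<sigma> <= ?f \<sigma> + \<eta> powr (a - 1) * ?g \<sigma>" for \<sigma>
 proof (cases "0 < \<sigma>")
 case True
 show ?thesis
 proof (cases "\<sigma> < 1 / \<eta>")
 case c: True
 have "schur_kernel a (\<eta> * \<sigma>) * rl_kernel (1 / 2) \<sigma> <= 1 * rl_kernel (1 / 2) \<sigma>"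
 by (intro mult_right_mono) (auto simp: schur_kernel_def)
 then show ?thesis using c by simp
 next
 case False
 have "schur_kernel a (\<eta> * \<sigma>) * rl_kernel (1 / 2) \<sigma> <= (\<eta> * \<sigma>) powr (a - 1) * \<sigma> powr (- 1 / 2)"
 using True assms(2) by (auto simp: schur_kernel_def rl_kernel_def intro!: mult_right_mono)
 also have "... = \<eta> powr (a - 1) * \<sigma> powr (a - 3 / 2)"
 using True assms(2) by (simp add: powr_mult powr_add[symmetric])
 finally show ?thesis using False by simp
 qed
 qed (auto simp: schur_kernel_def rl_kernel_def)
 have tail: "(\<integral>\<^sup>+\<sigma>. ennreal (?g \<sigma>) \<partial>lebesgue) = ennreal (- ((1 / \<eta>) powr (a - 3 / 2 + 1)) / (a - 3 / 2 + 1))"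
 by (rule nn_integral_lebesgue_has_integral[OF _ has_integral_powr_to_inf]) (use assms in auto)
 have "(\<integral>\<^sup>+\<sigma>. ennreal (schur_kernel a (\<eta> * \<sigma>) * rl_kernel (1 / 2) \<sigma>) \<partial>lebesgue)
 <= (\<integral>\<^sup>+\<sigma>. ennreal (?f \<sigma>) + ennreal (\<eta> powr (a - 1)) * ennreal (?g \<sigma>) \<partial>lebesgue)"
 using pw g0 by (intro nn_integral_mono) (simp add: ennreal_leI flip: ennreal_plus ennreal_mult)
 also have "... = ennreal ((1 / \<eta>) powr (1 / 2) / (1 / 2)) + ennreal (\<eta> powr (a - 1)) * ennreal (- ((1 / \<eta>) powr (a - 3 / 2 + 1)) / (a - 3 / 2 + 1))"
 using assms by (simp add: nn_integral_add nn_integral_cmult nn_integral_rl_kernel tail del: ennreal_plus)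
 also have "... = ennreal ((1 / \<eta>) powr (1 / 2) / (1 / 2) + \<eta> powr (a - 1) * (- ((1 / \<eta>) powr (a - 3 / 2 + 1)) / (a - 3 / 2 + 1)))"
 proof -
 have "0 <= - ((1 / \<eta>) powr (a - 3 / 2 + 1)) / (a - 3 / 2 + 1)"
 by (rule divide_nonpos_neg) (use a in auto)
 then have "0 <= \<eta> powr (a - 1) * (- ((1 / \<eta>) powr (a - 3 / 2 + 1)) / (a - 3 / 2 + 1))"
 and "ennreal (\<eta> powr (a - 1)) * ennreal (- ((1 / \<eta>) powr (a - 3 / 2 + 1)) / (a - 3 / 2 + 1)) = ennreal (\<eta> powr (a - 1) * (- ((1 / \<eta>) powr (a - 3 / 2 + 1)) / (a - 3 / 2 + 1)))"
 by (auto intro: mult_nonneg_nonneg simp only: ennreal_mult powr_ge_zero)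
 then show ?thesis by (simp only: ennreal_plus powr_ge_zero divide_nonneg_pos zero_less_one half_gt_zero)
 qed
 also have "(1 / \<eta>) powr (1 / 2) / (1 / 2) + \<eta> powr (a - 1) * (- ((1 / \<eta>) powr (a - 3 / 2 + 1)) / (a - 3 / 2 + 1)) = (2 + 1 / (1 / 2 - a)) * \<eta> powr (- 1 / 2)"
 proof -
 have 1: "(1 / \<eta>) powr (1 / 2) = \<eta> powr (- 1 / 2)"
 using assms(2) by (simp add: powr_divide powr_minus_divide)
 have 2: "\<eta> powr (a - 1) * (1 / \<eta>) powr (a - 3 / 2 + 1) = \<eta> powr (- 1 / 2)"
 proof -
 have "(1 / \<eta>) powr p = \<eta> powr (- p)" for p
 using assms(2) by (simp add: powr_divide powr_minus_divide)
 then have "(1 / \<eta>) powr (a - 3 / 2 + 1) = \<eta> powr (- (a - 3 / 2 + 1))" .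
 then show ?thesis by (simp add: powr_add[symmetric])
 qed
 have "\<eta> powr (a - 1) * (- ((1 / \<eta>) powr (a - 3 / 2 + 1)) / (a - 3 / 2 + 1)) = (\<eta> powr (a - 1) * (1 / \<eta>) powr (a - 3 / 2 + 1)) / (1 / 2 - a)"
 using a by (simp add: field_simps)
 then show ?thesis unfolding 1 2 by (simp add: algebra_simps)
 qed
 finally show ?thesis .
qed

text \<open>The first entry of the minimum comes from bounding both oscillatory integrals by
  \<open>osc_integral_bound\<close>, the second from \<open>osc_integral_diff_bound\<close>.\<close>

lemma osc_integral_tail_bound:
 assumes a: "0 < a" "a < 1" and "xi ~= 0" "0 < \<sigma>" "\<sigma> <= t"
 shows "\<bar>xi\<bar> powr a * cmod (osc_integral a xi t - osc_integral a xi \<sigma>) <= 2 * (1 / a + 8) * schur_kernel a (\<bar>xi\<bar> * \<sigma>)"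
proof -
 let ?D = "cmod (osc_integral a xi t - osc_integral a xi \<sigma>)"
 have "?D <= cmod (osc_integral a xi t) + cmod (osc_integral a xi \<sigma>)" by (rule norm_triangle_ineq4)
 also have "... <= (1 / a + 8) * \<bar>xi\<bar> powr (- a) + (1 / a + 8) * \<bar>xi\<bar> powr (- a)"
 using assms by (intro add_mono osc_integral_bound) auto
 also have "... = 2 * (1 / a + 8) * \<bar>xi\<bar> powr (- a)" by (simp only: mult_2 distrib_right)
 finally have "\<bar>xi\<bar> powr a * ?D <= \<bar>xi\<bar> powr a * (2 * (1 / a + 8) * \<bar>xi\<bar> powr (- a))"
 by (rule mult_left_mono) simp
 also have "... = 2 * (1 / a + 8) * 1"
 using assms(3) by (simp add: powr_minus)
 finally have 1: "\<bar>xi\<bar> powr a * ?D <= 2 * (1 / a + 8) * 1" .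
 have "\<bar>xi\<bar> powr a * ?D <= \<bar>xi\<bar> powr a * (8 * \<sigma> powr (a - 1) / \<bar>xi\<bar>)"
 using osc_integral_diff_bound[OF assms(4,5) a assms(3)] by (intro mult_left_mono) auto
 also have "... = 8 * (\<bar>xi\<bar> * \<sigma>) powr (a - 1)"
 using assms by (simp add: powr_mult powr_diff mult_ac)
 also have "... <= 2 * (1 / a + 8) * (\<bar>xi\<bar> * \<sigma>) powr (a - 1)"
 using a by (intro mult_right_mono) auto
 finally have "\<bar>xi\<bar> powr a * ?D <= 2 * (1 / a + 8) * (\<bar>xi\<bar> * \<sigma>) powr (a - 1)" .
 with 1 show ?thesis using assms by (simp add: schur_kernel_def min_def)
qed

text \<open>Fubini and the shift x = y + s. Cutting x at t becomes cutting s at t - y, which is why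
  the truncated oscillatory integral appears.\<close>

lemma riemann_liouville_fourier:
 fixes rho :: "real => real"
 assumes a: "0 < a" and rho: "integrable lebesgue rho" "!!y. y \<notin> {0<..<t} ==> rho y = 0"
 shows "fourier (%x. indicator {..<t} x * (LINT y|lebesgue. rl_kernel a (x - y) * rho y)) xi
 = ((2 * pi) powr (- 1 / 2)) *\<^sub>R (LINT y|lebesgue. rho y *\<^sub>R (cis (- (y * xi)) * osc_integral a xi (t - y)))"
proof -
 note lebesgue_proj_measurable[measurable]
 have [measurable]: "rho \<in> blm" using rho by auto
 let ?H = "%x y. ((indicator {..<t} x * rl_kernel a (x - y)) * rho y) *\<^sub>R cis (- (x * xi))"
 have int: "integrable (lebesgue \<Otimes>\<^sub>M lebesgue) (%(x, y). ?H x y)"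
 by (rule Bochner_Integration.integrable_bound[OF rl_pair_integrable[OF a rho]]) (measurable, auto)
 have "(LINT x|lebesgue. (indicator {..<t} x * (LINT y|lebesgue. rl_kernel a (x - y) * rho y)) *\<^sub>R cis (- (x * xi)))
 = (LINT x|lebesgue. LINT y|lebesgue. ?H x y)"
 proof (rule Bochner_Integration.integral_cong[OF refl])
 fix x :: real
 have "(LINT y|lebesgue. ?H x y) = (LINT y|lebesgue. (indicator {..<t} x * (rl_kernel a (x - y) * rho y)) *\<^sub>R cis (- (x * xi)))"
 by (simp add: mult.assoc)
 also have "... = (LINT y|lebesgue. indicator {..<t} x * (rl_kernel a (x - y) * rho y)) *\<^sub>R cis (- (x * xi))"
 by (simp only: scaleR_conv_of_real integral_mult_left_zero integral_complex_of_real)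
 finally show "(indicator {..<t} x * (LINT y|lebesgue. rl_kernel a (x - y) * rho y)) *\<^sub>R cis (- (x * xi)) = (LINT y|lebesgue. ?H x y)"
 by simp
 qed
 also have "... = (LINT y|lebesgue. LINT x|lebesgue. ?H x y)"
 using lebesgue_pair.Fubini_integral[OF int] by simp
 also have "... = (LINT y|lebesgue. rho y *\<^sub>R (cis (- (y * xi)) * osc_integral a xi (t - y)))"
 proof (rule Bochner_Integration.integral_cong[OF refl])
 fix y :: real
 have "(LINT x|lebesgue. ?H x y) = (LINT x|lebesgue. rho y *\<^sub>R ((indicator {..<t} x * rl_kernel a (x - y)) *\<^sub>R cis (- (x * xi))))"
 by (simp add: mult_ac)
 also have "... = rho y *\<^sub>R (LINT x|lebesgue. (indicator {..<t} x * rl_kernel a (x - y)) *\<^sub>R cis (- (x * xi)))"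
 by (simp only: integral_scaleR_right)
 also have "(LINT x|lebesgue. (indicator {..<t} x * rl_kernel a (x - y)) *\<^sub>R cis (- (x * xi)))
 = (LINT s|lebesgue. (indicator {..<t} (y + s) * rl_kernel a s) *\<^sub>R cis (- ((y + s) * xi)))"
 by (subst lebesgue_integral_real_affine[of 1 _ y]) auto
 also have "... = (LINT s|lebesgue. cis (- (y * xi)) * ((indicator {..<t - y} s * rl_kernel a s) *\<^sub>R cis (- (s * xi))))"
 proof (rule Bochner_Integration.integral_cong[OF refl])
 fix s
 have "indicator {..<t} (y + s) = (indicator {..<t - y} s :: real)" by (auto simp: indicator_def)
 moreover have "cis (- ((y + s) * xi)) = cis (- (y * xi)) * cis (- (s * xi))"
 by (simp add: cis_mult algebra_simps)
 ultimately show "(indicator {..<t} (y + s) * rl_kernel a s) *\<^sub>R cis (- ((y + s) * xi)) = cis (- (y * xi)) * ((indicator {..<t - y} s * rl_kernel a s) *\<^sub>R cis (- (s * xi)))"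
 by simp
 qed
 also have "... = cis (- (y * xi)) * osc_integral a xi (t - y)"
 unfolding osc_integral_def by (rule integral_mult_right_zero)
 finally show "(LINT x|lebesgue. ?H x y) = rho y *\<^sub>R (cis (- (y * xi)) * osc_integral a xi (t - y))" .
 qed
 finally show ?thesis unfolding fourier_def by simp
qed

lemma nn_integral_abs_le:
 fixes f :: "real => ennreal"
 assumes [measurable]: "f \<in> borel_measurable borel"
 shows "(INTP xi. f \<bar>xi\<bar>) <= 2 * (INTP xi. f xi * indicator {0<..} xi)"
proof -
 have m [measurable]: "(%xi. f xi * indicator {0<..} xi) \<in> blm"
 by (rule measurable_completion) measurable
 have m' [measurable]: "(%xi. f (- xi) * indicator {0<..} (- xi)) \<in> blm"
 by (rule measurable_completion) measurable
 have "{0} \<in> null_sets (lebesgue :: real measure)" by simp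
 then have "AE s in lebesgue. s \<notin> {0::real}" by (rule AE_not_in)
 then have "(INTP xi. f \<bar>xi\<bar>) = (INTP xi. f xi * indicator {0<..} xi + f (- xi) * indicator {0<..} (- xi))"
 by (intro nn_integral_cong_AE) (auto elim!: eventually_mono simp: indicator_def abs_if)
 also have "... = (INTP xi. f xi * indicator {0<..} xi) + (INTP xi. f (- xi) * indicator {0<..} (- xi))"
 by (rule nn_integral_add) measurable
 also have "(INTP xi. f (- xi) * indicator {0<..} (- xi)) = (INTP xi. f xi * indicator {0<..} xi)"
 using nn_integral_real_affine_lebesgue[OF m, of "-1" 0] by simp
 finally show ?thesis by (simp add: mult_2)
qed

text \<open>Schur's test with the weights (t - y)^(-1/2) and |xi|^(-1/2). The kernel depends only on
  the product of |xi| and t - y, so \<open>schur_kernel_weight\<close> serves for both variables.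
  The factor 2 counts the two half-lines of frequencies.\<close>

lemma schur_test:
 fixes rho :: "real => real"
 assumes a: "a < 1 / 2" and [measurable]: "rho \<in> blm" and rho: "!!y. y \<notin> {0<..<t} ==> rho y = 0"
 shows "(\<integral>\<^sup>+xi. (INTP y. ennreal (schur_kernel a (\<bar>xi\<bar> * (t - y)) * \<bar>rho y\<bar>))\<^sup>2 \<partial>lebesgue)
 <= ennreal (2 * (2 + 1 / (1 / 2 - a))\<^sup>2) * (INTP y. ennreal ((rho y)\<^sup>2))"
proof -
 note lebesgue_proj_measurable[measurable]
 define A where "A = 2 + 1 / (1 / 2 - a)"
 have A: "0 < A" using a by (simp add: A_def add_pos_pos)
 let ?S = "%xi y. schur_kernel a (\<bar>xi\<bar> * (t - y))"
 let ?w = "%y. rl_kernel (1 / 2) (t - y)"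
 have Sm [measurable]: "(%y. ?S xi y) \<in> blm" "?w \<in> blm" for xi
 by (rule measurable_completion, measurable)+
 have w1: "(INTP y. ennreal (?S xi y * ?w y)) <= ennreal (A * \<bar>xi\<bar> powr (- 1 / 2))" if "xi ~= 0" for xi
 proof -
 have m: "(%\<sigma>. ennreal (schur_kernel a (\<bar>xi\<bar> * \<sigma>) * rl_kernel (1 / 2) \<sigma>)) \<in> blm"
 by (rule measurable_completion) measurable
 have "(INTP y. ennreal (?S xi y * ?w y)) = (\<integral>\<^sup>+\<sigma>. ennreal (schur_kernel a (\<bar>xi\<bar> * \<sigma>) * rl_kernel (1 / 2) \<sigma>) \<partial>lebesgue)"
 using nn_integral_real_affine_lebesgue[OF m, of "-1" t] by simp
 also have "... <= ennreal (A * \<bar>xi\<bar> powr (- 1 / 2))"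
 unfolding A_def using that by (intro schur_kernel_weight[OF a]) auto
 finally show ?thesis .
 qed
 have w2: "(INTP xi. ennreal (?S xi y * \<bar>xi\<bar> powr (- 1 / 2))) <= ennreal (2 * A * (t - y) powr (- 1 / 2))" if "y < t" for y
 proof -
 have "(INTP xi. ennreal (?S xi y * \<bar>xi\<bar> powr (- 1 / 2))) <= 2 * (INTP xi. ennreal (schur_kernel a (xi * (t - y)) * xi powr (- 1 / 2)) * indicator {0<..} xi)"
 by (rule nn_integral_abs_le) measurable
 also have "(INTP xi. ennreal (schur_kernel a (xi * (t - y)) * xi powr (- 1 / 2)) * indicator {0<..} xi) = (INTP xi. ennreal (schur_kernel a ((t - y) * xi) * rl_kernel (1 / 2) xi))"
 by (intro nn_integral_cong) (auto simp: rl_kernel_def indicator_def mult.commute)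
 also have "2 * (INTP xi. ennreal (schur_kernel a ((t - y) * xi) * rl_kernel (1 / 2) xi)) <= 2 * ennreal (A * (t - y) powr (- 1 / 2))"
 unfolding A_def using that by (intro mult_left_mono schur_kernel_weight[OF a]) auto
 also have "... = ennreal (2 * A * (t - y) powr (- 1 / 2))"
 using A by (simp add: ennreal_mult mult.assoc)
 finally show ?thesis .
 qed
 have cs: "(INTP y. ennreal (?S xi y * \<bar>rho y\<bar>))\<^sup>2 <= ennreal A * (INTP y. ennreal (\<bar>xi\<bar> powr (- 1 / 2) * ?S xi y * ((rho y)\<^sup>2 * (t - y) powr (1 / 2))))" if "xi ~= 0" for xi
 proof -
 let ?f = "%y. ennreal (sqrt (?S xi y * ?w y))"
 let ?g = "%y. ennreal (\<bar>rho y\<bar> * sqrt (?S xi y * (t - y) powr (1 / 2)))"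
 have gm [measurable]: "(%y. (t - y) powr (1 / 2)) \<in> blm"
 by (rule measurable_completion) measurable
 \<comment> \<open>The weight and its inverse cancel only for y < t. Outside (0,t) both sides vanish
   with \<open>rho\<close>.\<close>
 have eq: "ennreal (?S xi y * \<bar>rho y\<bar>) = ?f y * ?g y" for y
 proof (cases "y \<in> {0<..<t}")
 case True
 then have "sqrt (?S xi y * ?w y) * sqrt (?S xi y * (t - y) powr (1 / 2)) = ?S xi y"
 by (simp add: rl_kernel_def real_sqrt_mult[symmetric] powr_add[symmetric] mult_ac)
 then show ?thesis by (simp add: ennreal_mult[symmetric] mult_ac)
 qed (use rho in simp)
 have "(INTP y. ennreal (?S xi y * \<bar>rho y\<bar>))\<^sup>2 = (INTP y. ?f y * ?g y)\<^sup>2"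
 by (simp only: eq)
 also have "... <= (INTP y. (?f y)\<^sup>2) * (INTP y. (?g y)\<^sup>2)"
 by (rule Cauchy_Schwarz_nn_integral) measurable
 also have "(INTP y. (?f y)\<^sup>2) = (INTP y. ennreal (?S xi y * ?w y))"
 by (simp add: ennreal_power)
 also have "(INTP y. (?g y)\<^sup>2) = (INTP y. ennreal (?S xi y * ((rho y)\<^sup>2 * (t - y) powr (1 / 2))))"
 by (intro nn_integral_cong) (simp add: ennreal_power power_mult_distrib mult_ac)
 also have "(INTP y. ennreal (?S xi y * ?w y)) * ... <= ennreal (A * \<bar>xi\<bar> powr (- 1 / 2)) * ..."
 by (intro mult_right_mono w1 that) simp
 also have "... = ennreal A * (ennreal (\<bar>xi\<bar> powr (- 1 / 2)) * (INTP y. ennreal (?S xi y * ((rho y)\<^sup>2 * (t - y) powr (1 / 2)))))"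
 using A by (simp add: ennreal_mult mult.assoc)
 also have "ennreal (\<bar>xi\<bar> powr (- 1 / 2)) * (INTP y. ennreal (?S xi y * ((rho y)\<^sup>2 * (t - y) powr (1 / 2)))) = (INTP y. ennreal (\<bar>xi\<bar> powr (- 1 / 2) * ?S xi y * ((rho y)\<^sup>2 * (t - y) powr (1 / 2))))"
 by (subst nn_integral_cmult[symmetric]) (measurable, simp add: ennreal_mult[symmetric] mult_ac)
 finally show ?thesis .
 qed
 have "{0} \<in> null_sets (lebesgue :: real measure)" by simp
 then have "AE s in lebesgue. s \<notin> {0::real}" by (rule AE_not_in)
 then have "(\<integral>\<^sup>+xi. (INTP y. ennreal (?S xi y * \<bar>rho y\<bar>))\<^sup>2 \<partial>lebesgue) <= (\<integral>\<^sup>+xi. ennreal A * (INTP y. ennreal (\<bar>xi\<bar> powr (- 1 / 2) * ?S xi y * ((rho y)\<^sup>2 * (t - y) powr (1 / 2)))) \<partial>lebesgue)"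
 by (intro nn_integral_mono_AE, elim eventually_mono, intro cs) simp
 also have "... = ennreal A * (\<integral>\<^sup>+xi. \<integral>\<^sup>+y. ennreal (\<bar>xi\<bar> powr (- 1 / 2) * ?S xi y * ((rho y)\<^sup>2 * (t - y) powr (1 / 2))) \<partial>lebesgue \<partial>lebesgue)"
 by (rule nn_integral_cmult) measurable
 also have "(\<integral>\<^sup>+xi. \<integral>\<^sup>+y. ennreal (\<bar>xi\<bar> powr (- 1 / 2) * ?S xi y * ((rho y)\<^sup>2 * (t - y) powr (1 / 2))) \<partial>lebesgue \<partial>lebesgue)
 = (\<integral>\<^sup>+y. \<integral>\<^sup>+xi. ennreal (\<bar>xi\<bar> powr (- 1 / 2) * ?S xi y * ((rho y)\<^sup>2 * (t - y) powr (1 / 2))) \<partial>lebesgue \<partial>lebesgue)"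
 by (rule lebesgue_pair.Fubini'[symmetric]) measurable
 also have "... <= (INTP y. ennreal (2 * A) * ennreal ((rho y)\<^sup>2))"
 proof (rule nn_integral_mono)
 fix y :: real
 have Sm' [measurable]: "(%xi. ?S xi y * \<bar>xi\<bar> powr (- 1 / 2)) \<in> blm"
 by (rule measurable_completion) measurable
 show "(INTP xi. ennreal (\<bar>xi\<bar> powr (- 1 / 2) * ?S xi y * ((rho y)\<^sup>2 * (t - y) powr (1 / 2)))) <= ennreal (2 * A) * ennreal ((rho y)\<^sup>2)"
 proof (cases "y \<in> {0<..<t}")
 case True
 have "(INTP xi. ennreal (\<bar>xi\<bar> powr (- 1 / 2) * ?S xi y * ((rho y)\<^sup>2 * (t - y) powr (1 / 2))))
 = (INTP xi. ennreal (?S xi y * \<bar>xi\<bar> powr (- 1 / 2)) * ennreal ((rho y)\<^sup>2 * (t - y) powr (1 / 2)))"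
 by (intro nn_integral_cong) (simp add: ennreal_mult[symmetric] mult_ac)
 also have "... = (INTP xi. ennreal (?S xi y * \<bar>xi\<bar> powr (- 1 / 2))) * ennreal ((rho y)\<^sup>2 * (t - y) powr (1 / 2))"
 by (rule nn_integral_multc) measurable
 also have "... <= ennreal (2 * A * (t - y) powr (- 1 / 2)) * ennreal ((rho y)\<^sup>2 * (t - y) powr (1 / 2))"
 using True by (intro mult_right_mono w2) auto
 also have "... = ennreal (2 * A * (rho y)\<^sup>2 * ((t - y) powr (- 1 / 2) * (t - y) powr (1 / 2)))"
 using A by (simp add: ennreal_mult[symmetric] mult_ac)
 also have "(t - y) powr (- 1 / 2) * (t - y) powr (1 / 2) = 1"
 using True by (simp add: powr_add[symmetric])
 finally show ?thesis using A by (simp add: ennreal_mult)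
 qed (use rho in simp)
 qed
 also have "... = ennreal (2 * A) * (INTP y. ennreal ((rho y)\<^sup>2))"
 by (rule nn_integral_cmult) measurable
 finally have "(\<integral>\<^sup>+xi. (INTP y. ennreal (?S xi y * \<bar>rho y\<bar>))\<^sup>2 \<partial>lebesgue) <= ennreal A * (ennreal (2 * A) * (INTP y. ennreal ((rho y)\<^sup>2)))"
 by (simp add: mult_left_mono)
 also have "... = ennreal (2 * A\<^sup>2) * (INTP y. ennreal ((rho y)\<^sup>2))"
 proof -
 have "ennreal A * ennreal (2 * A) = ennreal (2 * A\<^sup>2)"
 using A by (subst ennreal_mult[symmetric]) (auto simp: power2_eq_square)
 then show ?thesis by (simp only: mult.assoc[symmetric])
 qed
 finally show ?thesis unfolding A_def .
qed

text \<open>With \<open>J(xi, \<sigma>)\<close> the truncated oscillatory integral, the Fourier transform of the cut-off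
 fractional integral is \<open>J(xi, t)\<close> times that of \<open>rho\<close>, up to an error with the homogeneous kernel
 \<open>min 1 ((|xi| (t - y)) powr (a - 1))\<close>, to which the Schur test applies because \<open>a < 1/2\<close>.\<close>

lemma riemann_liouville_seminorm:
 assumes a: "0 < a" "a < 1 / 2"
 obtains C where "0 < C" "!!t rho. sq_integrable rho ==> (!!y. y \<notin> {0<..<t} ==> rho y = 0) ==>
 (INTP xi. ennreal (\<bar>xi\<bar> powr (2 * a) * (cmod (fourier (%x. indicator {..<t} x * (LINT y|lebesgue. rl_kernel a (x - y) * rho y)) xi))\<^sup>2))
 <= ennreal C * (INTP y. ennreal ((rho y)\<^sup>2))"
proof -
 define B where "B = 1 / a + 8"
 define A where "A = 2 * (2 + 1 / (1 / 2 - a))\<^sup>2"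
 have B: "0 < B" using a by (simp add: B_def add_pos_pos)
 have A: "0 <= A" by (simp add: A_def)
 have "(INTP xi. ennreal (\<bar>xi\<bar> powr (2 * a) * (cmod (fourier (%x. indicator {..<t} x * (LINT y|lebesgue. rl_kernel a (x - y) * rho y)) xi))\<^sup>2))
 <= ennreal (2 * B\<^sup>2 + 8 * B\<^sup>2 * A) * (INTP y. ennreal ((rho y)\<^sup>2))"
 if rho: "sq_integrable rho" "!!y. y \<notin> {0<..<t} ==> rho y = 0" for t rho
 proof -
 note lebesgue_proj_measurable[measurable]
 let ?Y = "%x. indicator {..<t} x * (LINT y|lebesgue. rl_kernel a (x - y) * rho y)"
 let ?S = "%xi y. schur_kernel a (\<bar>xi\<bar> * (t - y))"
 let ?N = "%xi. \<integral>\<^sup>+y. ennreal (?S xi y * \<bar>rho y\<bar>) \<partial>lebesgue"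
 have i: "integrable lebesgue rho" by (rule sq_integrable_imp_integrable[OF rho(1), where S = "{0<..<t}"]) (use rho(2) in auto)
 have [measurable]: "rho \<in> blm" using i by auto
 have Sm [measurable]: "(%y. ?S xi y) \<in> blm" for xi
 by (rule measurable_completion) measurable
 define c where "c = (2 * pi) powr (- 1 / 2)"
 have c1: "0 <= c" "c <= 1"
 using powr_mono[of "- 1 / 2" 0 "2 * pi"] pi_gt3 by (auto simp: c_def)
 have pw: "ennreal (\<bar>xi\<bar> powr (2 * a) * (cmod (fourier ?Y xi))\<^sup>2) <= ennreal (2 * B\<^sup>2) * ennreal ((cmod (fourier rho xi))\<^sup>2) + ennreal (8 * B\<^sup>2) * (?N xi)\<^sup>2" if xi: "xi ~= 0" for xi
 proof -
 let ?E = "%y. rho y *\<^sub>R (cis (- (y * xi)) * (osc_integral a xi t - osc_integral a xi (t - y)))"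
 let ?J = "%y. rho y *\<^sub>R (cis (- (y * xi)) * osc_integral a xi (t - y))"
 have iJ: "integrable lebesgue (%y. osc_integral a xi t * (rho y *\<^sub>R cis (- (y * xi))))"
 using integrable_fourier_kernel[OF i, of xi] by (intro integrable_mult_right) simp
 have e: "?E y = osc_integral a xi t * (rho y *\<^sub>R cis (- (y * xi))) - ?J y" for y
 by (simp add: algebra_simps scaleR_conv_of_real)
 have Jm: "?J \<in> blm"
 using osc_integral_measurable[of a xi t] by measurable
 have Jb: "cmod (?J y) <= \<bar>B * \<bar>xi\<bar> powr (- a) * rho y\<bar>" for y
 proof (cases "y \<in> {0<..<t}")
 case True
 then show ?thesis using osc_integral_bound[OF a(1) _ xi, of "t - y"] a B
 by (simp add: norm_mult abs_mult B_def mult_left_mono mult.commute[of "\<bar>rho y\<bar>"] mult_right_mono)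
 qed (simp add: rho(2))
 have iJ2: "integrable lebesgue ?J"
 by (rule Bochner_Integration.integrable_bound[OF integrable_mult_right[OF i, of "B * \<bar>xi\<bar> powr (- a)"] Jm])
 (use Jb in \<open>simp del: norm_scaleR\<close>)
 have "(LINT y|lebesgue. ?E y) = osc_integral a xi t * (LINT y|lebesgue. rho y *\<^sub>R cis (- (y * xi))) - (LINT y|lebesgue. ?J y)"
 unfolding e by (simp only: Bochner_Integration.integral_diff[OF iJ iJ2] integral_mult_right_zero)
 moreover have "fourier ?Y xi = c *\<^sub>R (LINT y|lebesgue. ?J y)"
 unfolding c_def by (rule riemann_liouville_fourier[OF a(1) i rho(2)])
 moreover have "fourier rho xi = c *\<^sub>R (LINT y|lebesgue. rho y *\<^sub>R cis (- (y * xi)))"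
 by (simp add: fourier_def c_def)
 ultimately have Yeq: "fourier ?Y xi = osc_integral a xi t * fourier rho xi - c *\<^sub>R (LINT y|lebesgue. ?E y)"
 by (simp only: scaleR_diff_right mult_scaleR_right) simp
 have Eb: "ennreal (\<bar>xi\<bar> powr a * cmod (LINT y|lebesgue. ?E y)) <= ennreal (2 * B) * ?N xi"
 proof -
 have "ennreal (\<bar>xi\<bar> powr a * cmod (LINT y|lebesgue. ?E y)) = ennreal (cmod (LINT y|lebesgue. \<bar>xi\<bar> powr a *\<^sub>R ?E y))"
 by (simp only: integral_scaleR_right norm_scaleR abs_of_nonneg powr_ge_zero)
 also have "... <= (INTP y. ennreal (cmod (\<bar>xi\<bar> powr a *\<^sub>R ?E y)))"
 by (rule norm_integral_le_nn_integral)
 also have "... <= (INTP y. ennreal (2 * B) * ennreal (?S xi y * \<bar>rho y\<bar>))"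
 proof (rule nn_integral_mono)
 fix y
 show "ennreal (cmod (\<bar>xi\<bar> powr a *\<^sub>R ?E y)) <= ennreal (2 * B) * ennreal (?S xi y * \<bar>rho y\<bar>)"
 proof (cases "y \<in> {0<..<t}")
 case True
 have "cmod (\<bar>xi\<bar> powr a *\<^sub>R ?E y) = \<bar>rho y\<bar> * (\<bar>xi\<bar> powr a * cmod (osc_integral a xi t - osc_integral a xi (t - y)))"
 by (simp add: norm_mult abs_mult)
 also have "... <= \<bar>rho y\<bar> * (2 * B * ?S xi y)"
 unfolding B_def using True a xi by (intro mult_left_mono osc_integral_tail_bound) auto
 finally show ?thesis using B by (simp add: ennreal_mult[symmetric] ennreal_leI mult_ac)
 qed (simp add: rho(2))
 qed
 also have "... = ennreal (2 * B) * ?N xi" by (rule nn_integral_cmult) measurable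
 finally show ?thesis .
 qed
 have "\<bar>xi\<bar> powr a * cmod (fourier ?Y xi) <= \<bar>xi\<bar> powr a * (cmod (osc_integral a xi t) * cmod (fourier rho xi) + 1 * cmod (LINT y|lebesgue. ?E y))"
 proof (rule mult_left_mono)
 have "cmod (fourier ?Y xi) <= cmod (osc_integral a xi t * fourier rho xi) + cmod (c *\<^sub>R (LINT y|lebesgue. ?E y))"
 unfolding Yeq by (rule norm_triangle_ineq4)
 also have "... <= cmod (osc_integral a xi t) * cmod (fourier rho xi) + 1 * cmod (LINT y|lebesgue. ?E y)"
 unfolding norm_scaleR norm_mult using c1 by (intro add_mono order_refl mult_right_mono) auto
 finally show "cmod (fourier ?Y xi) <= cmod (osc_integral a xi t) * cmod (fourier rho xi) + 1 * cmod (LINT y|lebesgue. ?E y)" .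
 qed simp
 also have "... <= B * cmod (fourier rho xi) + \<bar>xi\<bar> powr a * cmod (LINT y|lebesgue. ?E y)"
 proof (cases "0 < t")
 case True
 have "\<bar>xi\<bar> powr a * cmod (osc_integral a xi t) <= \<bar>xi\<bar> powr a * (B * \<bar>xi\<bar> powr (- a))"
 unfolding B_def using a xi True by (intro mult_left_mono osc_integral_bound) auto
 also have "... = B" using xi by (simp add: powr_minus)
 finally have "\<bar>xi\<bar> powr a * cmod (osc_integral a xi t) * cmod (fourier rho xi) <= B * cmod (fourier rho xi)"
 by (rule mult_right_mono) simp
 then show ?thesis by (simp add: algebra_simps)
 next
 case False
 then have "rho = (%y. 0)" using rho(2) by (intro ext) auto
 then show ?thesis by (simp add: fourier_def)
 qed
 finally have "(\<bar>xi\<bar> powr a * cmod (fourier ?Y xi))\<^sup>2 <= (B * cmod (fourier rho xi) + \<bar>xi\<bar> powr a * cmod (LINT y|lebesgue. ?E y))\<^sup>2"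
 by (rule power_mono) simp
 also have "... <= 2 * (B * cmod (fourier rho xi))\<^sup>2 + 2 * (\<bar>xi\<bar> powr a * cmod (LINT y|lebesgue. ?E y))\<^sup>2"
 using sum_squares_bound[of "B * cmod (fourier rho xi)" "\<bar>xi\<bar> powr a * cmod (LINT y|lebesgue. ?E y)"] by (simp add: power2_sum)
 finally have "ennreal ((\<bar>xi\<bar> powr a * cmod (fourier ?Y xi))\<^sup>2) <= ennreal (2 * (B * cmod (fourier rho xi))\<^sup>2) + 2 * (ennreal (\<bar>xi\<bar> powr a * cmod (LINT y|lebesgue. ?E y)))\<^sup>2"
 by (simp add: ennreal_leI ennreal_power ennreal_mult[symmetric] flip: ennreal_plus ennreal_numeral)
 also have "... <= ennreal (2 * (B * cmod (fourier rho xi))\<^sup>2) + 2 * (ennreal (2 * B) * ?N xi)\<^sup>2"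
 by (intro add_mono mult_left_mono power_mono Eb order_refl) auto
 also have "ennreal (2 * (B * cmod (fourier rho xi))\<^sup>2) = ennreal (2 * B\<^sup>2) * ennreal ((cmod (fourier rho xi))\<^sup>2)"
 by (simp add: ennreal_mult[symmetric] power_mult_distrib mult_ac)
 also have "2 * (ennreal (2 * B) * ?N xi)\<^sup>2 = ennreal (8 * B\<^sup>2) * (?N xi)\<^sup>2"
 proof -
 have "2 * (ennreal (2 * B))\<^sup>2 = ennreal (8 * B\<^sup>2)"
 using B by (simp add: ennreal_power ennreal_mult[symmetric] power_mult_distrib flip: ennreal_numeral)
 then show ?thesis by (simp add: power_mult_distrib mult.assoc[symmetric])
 qed
 also have "(\<bar>xi\<bar> powr a * cmod (fourier ?Y xi))\<^sup>2 = \<bar>xi\<bar> powr (2 * a) * (cmod (fourier ?Y xi))\<^sup>2"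
 by (simp add: power_mult_distrib power2_eq_square powr_add[symmetric])
 finally show ?thesis .
 qed
 have "{0} \<in> null_sets (lebesgue :: real measure)" by simp
 then have "AE s in lebesgue. s \<notin> {0::real}" by (rule AE_not_in)
 then have "(INTP xi. ennreal (\<bar>xi\<bar> powr (2 * a) * (cmod (fourier ?Y xi))\<^sup>2)) <= (INTP xi. ennreal (2 * B\<^sup>2) * ennreal ((cmod (fourier rho xi))\<^sup>2) + ennreal (8 * B\<^sup>2) * (?N xi)\<^sup>2)"
 by (intro nn_integral_mono_AE) (auto elim!: eventually_mono intro: pw)
 also have "... = (INTP xi. ennreal (2 * B\<^sup>2) * ennreal ((cmod (fourier rho xi))\<^sup>2)) + (INTP xi. ennreal (8 * B\<^sup>2) * (?N xi)\<^sup>2)"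
 by (rule nn_integral_add) measurable
 also have "... = ennreal (2 * B\<^sup>2) * (INTP xi. ennreal ((cmod (fourier rho xi))\<^sup>2)) + ennreal (8 * B\<^sup>2) * (INTP xi. (?N xi)\<^sup>2)"
 by (intro arg_cong2[where f = plus] nn_integral_cmult) measurable
 also have "... <= ennreal (2 * B\<^sup>2) * (INTP y. ennreal ((rho y)\<^sup>2)) + ennreal (8 * B\<^sup>2) * (ennreal A * (INTP y. ennreal ((rho y)\<^sup>2)))"
 unfolding A_def using a rho(2) by (intro add_mono mult_left_mono fourier_bessel i schur_test) auto
 also have "... = ennreal (2 * B\<^sup>2 + 8 * B\<^sup>2 * A) * (INTP y. ennreal ((rho y)\<^sup>2))"
 proof -
 have "ennreal (8 * B\<^sup>2) * ennreal A = ennreal (8 * B\<^sup>2 * A)"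
 using A by (intro ennreal_mult[symmetric]) auto
 moreover have "ennreal (2 * B\<^sup>2) + ennreal (8 * B\<^sup>2 * A) = ennreal (2 * B\<^sup>2 + 8 * B\<^sup>2 * A)"
 using A by (intro ennreal_plus[symmetric]) auto
 ultimately show ?thesis by (simp only: mult.assoc[symmetric] distrib_right[symmetric])
 qed
 finally show ?thesis .
 qed
 moreover have "0 < 2 * B\<^sup>2 + 8 * B\<^sup>2 * A" using A B by (simp add: add_pos_nonneg)
 ultimately show ?thesis by (rule that[rotated])
qed

section \<open>Positivity of the Riemann-Liouville kernel\<close>

lemma lebesgue_singleton_AE: "AE s in lebesgue. s ~= (c::real)"
 using AE_not_in[of "{c}" lebesgue] by simp

lemma rl_kernel_scale: "0 < d ==> rl_kernel b (d * s) = d powr (b - 1) * rl_kernel b s"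
 by (auto simp: rl_kernel_def powr_mult zero_less_mult_iff)

text \<open>Scaling by the distance of x and y reduces the integral to the constant given by (1 +
  s)^(b-1) s^(b-1) over s > 0. It is finite at 0 because b > 0 and at infinity because b <
  1/2.\<close>

lemma nn_integral_rl_kernel_product:
 assumes b: "0 < b" "b < 1 / 2"
 obtains c where "0 < c" "!!x y. x ~= y ==>
 (INTP z. ennreal (rl_kernel b (x - z) * rl_kernel b (y - z))) = ennreal (c * (rl_kernel (2 * b) (x - y) + rl_kernel (2 * b) (y - x)))"
proof -
 let ?k = "%s. rl_kernel b (1 + s) * rl_kernel b s"
 define I where "I = (INTP s. ennreal (?k s))"
 have km: "(%s. ennreal (?k s)) \<in> blm"
 by (rule measurable_completion) measurable
 let ?f = "%s. indicator {..<1} s * rl_kernel b s" and ?g = "%s. indicator {1..} s * s powr (2 * b - 2)"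
 have fgm [measurable]: "?f \<in> blm" "?g \<in> blm"
 by (rule measurable_completion, measurable)+
 have pw: "?k s <= ?f s + ?g s" for s
 proof (cases "0 < s")
 case True
 have le: "rl_kernel b (1 + s) <= 1" "rl_kernel b (1 + s) <= s powr (b - 1)"
 using True b powr_mono2'[of "b - 1" 1 "1 + s"] powr_mono2'[of "b - 1" s "1 + s"] by (auto simp: rl_kernel_def)
 show ?thesis
 proof (cases "s < 1")
 case s: True
 have "?k s <= 1 * rl_kernel b s" by (rule mult_right_mono[OF le(1)]) simp
 then show ?thesis using s by simp
 next
 case False
 have "?k s <= s powr (b - 1) * rl_kernel b s" by (rule mult_right_mono[OF le(2)]) simp
 also have "... = s powr (2 * b - 2)" using True by (simp add: rl_kernel_def powr_add[symmetric])
 finally show ?thesis using False by simp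
 qed
 qed (simp add: rl_kernel_def)
 have fin: "I < \<infinity>"
 proof -
 have "I <= (INTP s. ennreal (?f s) + ennreal (?g s))"
 unfolding I_def using pw by (intro nn_integral_mono) (simp add: ennreal_leI flip: ennreal_plus)
 also have "... = (INTP s. ennreal (?f s)) + (INTP s. ennreal (?g s))"
 by (rule nn_integral_add) measurable
 also have "... < \<infinity>"
 using nn_integral_rl_kernel[OF b(1), of 1] nn_integral_lebesgue_has_integral[OF _ has_integral_powr_to_inf[of "2 * b - 2" 1]] b
 by simp
 finally show ?thesis .
 qed
 have pos: "I ~= 0"
 proof
 assume "I = 0"
 then have "AE s in lebesgue. ennreal (?k s) = 0" unfolding I_def using nn_integral_0_iff_AE[OF km] by simp
 then have "AE s in lebesgue. s \<notin> {0<..<1::real}"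
 by (rule eventually_mono) (auto simp: rl_kernel_def)
 then have "emeasure lebesgue {0<..<1::real} = 0"
 by (subst (asm) AE_iff_measurable[of "{0<..<1}"]) auto
 then show False by simp
 qed
 define c where "c = enn2real I"
 have c: "I = ennreal c" "0 < c" using fin pos by (auto simp: c_def enn2real_positive_iff less_top zero_less_iff_neq_zero)
 have main: "(INTP z. ennreal (rl_kernel b (x - z) * rl_kernel b (y - z))) = ennreal (c * rl_kernel (2 * b) (x - y))" if "y < x" for x y
 proof -
 define d where "d = x - y"
 have d: "0 < d" using that by (simp add: d_def)
 have m: "(%z. ennreal (rl_kernel b (x - z) * rl_kernel b (y - z))) \<in> blm"
 by (rule measurable_completion) measurable
 have "(INTP z. ennreal (rl_kernel b (x - z) * rl_kernel b (y - z)))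
 = ennreal d * (INTP s. ennreal (rl_kernel b (x - (y + - d * s)) * rl_kernel b (y - (y + - d * s))))"
 using nn_integral_real_affine_lebesgue[OF m, of "- d" y] d by simp
 also have "(%s. rl_kernel b (x - (y + - d * s)) * rl_kernel b (y - (y + - d * s))) = (%s. d powr (2 * b - 2) * ?k s)"
 proof
 fix s
 have "x - (y + - d * s) = d * (1 + s)" "y - (y + - d * s) = d * s" by (auto simp: d_def algebra_simps)
 moreover have "d powr (b - 1) * d powr (b - 1) = d powr (2 * b - 2)" by (simp add: powr_add[symmetric])
 ultimately show "rl_kernel b (x - (y + - d * s)) * rl_kernel b (y - (y + - d * s)) = d powr (2 * b - 2) * ?k s"
 unfolding \<open>x - (y + - d * s) = d * (1 + s)\<close> \<open>y - (y + - d * s) = d * s\<close> rl_kernel_scale[OF d] by (simp add: mult_ac)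
 qed
 also have "(INTP s. ennreal (d powr (2 * b - 2) * ?k s)) = ennreal (d powr (2 * b - 2)) * I"
 unfolding I_def using km by (subst nn_integral_cmult[symmetric]) (auto simp: ennreal_mult)
 also have "ennreal d * (ennreal (d powr (2 * b - 2)) * I) = ennreal (d * (d powr (2 * b - 2) * c))"
 unfolding c(1) using d c(2) by (simp add: ennreal_mult)
 also have "d * (d powr (2 * b - 2) * c) = c * rl_kernel (2 * b) (x - y)"
 proof -
 have "d * d powr (2 * b - 2) = d powr (2 * b - 1)" using powr_mult_base[of d "2 * b - 2"] d by simp
 then show ?thesis using d by (simp add: rl_kernel_def d_def)
 qed
 finally show ?thesis .
 qed
 show ?thesis
 proof (rule that[OF c(2)])
 fix x y :: real assume "x ~= y"
 then consider "y < x" | "x < y" by linarith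
 then show "(INTP z. ennreal (rl_kernel b (x - z) * rl_kernel b (y - z))) = ennreal (c * (rl_kernel (2 * b) (x - y) + rl_kernel (2 * b) (y - x)))"
 proof cases
 case 1
 then have "rl_kernel (2 * b) (y - x) = 0" by (simp add: rl_kernel_def)
 then show ?thesis using main[OF 1] by simp
 next
 case 2
 then have "rl_kernel (2 * b) (x - y) = 0" by (simp add: rl_kernel_def)
 then show ?thesis using main[OF 2] by (simp add: mult.commute[of "rl_kernel b (x - _)"])
 qed
 qed
qed

text \<open>The product \<open>rho x * rho y\<close> is dominated by the sum of the squares. For the
  square in y the kernel is integrated over x < t, for the square in x over y > 0; both masses are
  at most t^a / a.\<close>

lemma rl_square_pair_integrable:
 fixes rho :: "real => real"
 assumes a: "0 < a" and rho: "sq_integrable rho" "!!y. y \<notin> {0<..<t} ==> rho y = 0"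
 shows "integrable (lebesgue \<Otimes>\<^sub>M lebesgue) (%(x, y). rl_kernel a (x - y) * (rho x * rho y))"
proof -
 note lebesgue_proj_measurable[measurable]
 have [measurable]: "rho \<in> blm" using rho by (simp add: sq_integrable_def)
 have i2: "integrable lebesgue (%x. (rho x)\<^sup>2)" using rho by (simp add: sq_integrable_def)
 have 1: "integrable (lebesgue \<Otimes>\<^sub>M lebesgue) (%(x, y). (indicator {..<t} x * rl_kernel a (x - y)) *\<^sub>R (rho y)\<^sup>2)"
 by (rule rl_pair_integrable[OF a i2]) (use rho(2) in auto)
 have 2: "integrable (lebesgue \<Otimes>\<^sub>M lebesgue) (%(y, x). (indicator {0<..} y * rl_kernel a (x - y)) *\<^sub>R (rho x)\<^sup>2)"
 proof (rule pair_kernel_integrable[where C = "t powr a / a", OF _ i2])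
 show "(%(y, x). indicator {0<..} y * rl_kernel a (x - y)) \<in> borel_measurable (lebesgue \<Otimes>\<^sub>M lebesgue)" by measurable
 fix x assume "(rho x)\<^sup>2 ~= 0"
 then have x: "x \<in> {0<..<t}" using rho(2)[of x] by fastforce
 have m: "(%s. ennreal (indicator {..<x} s * rl_kernel a s)) \<in> blm"
 by (rule measurable_completion) measurable
 have "indicator {..<x} (x - y) = (indicator {0<..} y :: real)" for y by (auto simp: indicator_def)
 then have "(INTP y. ennreal \<bar>indicator {0<..} y * rl_kernel a (x - y)\<bar>) = ennreal (x powr a / a)"
 using nn_integral_real_affine_lebesgue[OF m, of "-1" x] nn_integral_rl_kernel[OF a, of x] x by simp
 also have "... <= ennreal (t powr a / a)"
 using x a by (intro ennreal_leI divide_right_mono powr_mono2) auto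
 finally show "(INTP y. ennreal \<bar>indicator {0<..} y * rl_kernel a (x - y)\<bar>) <= ennreal (t powr a / a)" .
 qed
 have 3: "integrable (lebesgue \<Otimes>\<^sub>M lebesgue) (%(x, y). (indicator {0<..} y * rl_kernel a (x - y)) *\<^sub>R (rho x)\<^sup>2)"
 using lebesgue_pair.integrable_product_swap[OF 2] by (simp add: case_prod_beta')
 show ?thesis
 proof (rule Bochner_Integration.integrable_bound[OF Bochner_Integration.integrable_add[OF 1 3]])
 show "(%(x, y). rl_kernel a (x - y) * (rho x * rho y)) \<in> borel_measurable (lebesgue \<Otimes>\<^sub>M lebesgue)" by measurable
 have "\<bar>rl_kernel a (x - y) * (rho x * rho y)\<bar> <= \<bar>indicator {..<t} x * rl_kernel a (x - y) * (rho y)\<^sup>2 + indicator {0<..} y * rl_kernel a (x - y) * (rho x)\<^sup>2\<bar>" for x y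
 proof (cases "x \<in> {0<..<t} \<and> y \<in> {0<..<t}")
 case True
 have "\<bar>rho x * rho y\<bar> <= (rho y)\<^sup>2 + (rho x)\<^sup>2"
 proof -
 have "2 * (\<bar>rho x\<bar> * \<bar>rho y\<bar>) <= (rho x)\<^sup>2 + (rho y)\<^sup>2"
 using sum_squares_bound[of "\<bar>rho x\<bar>" "\<bar>rho y\<bar>"] by simp
 moreover have "0 <= \<bar>rho x\<bar> * \<bar>rho y\<bar>" by simp
 ultimately show ?thesis unfolding abs_mult by linarith
 qed
 then have "rl_kernel a (x - y) * \<bar>rho x * rho y\<bar> <= rl_kernel a (x - y) * ((rho y)\<^sup>2 + (rho x)\<^sup>2)" by (rule mult_left_mono) simp
 then show ?thesis using True by (simp add: abs_mult algebra_simps)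
 qed (use rho(2) in auto)
 then show "AE p in lebesgue \<Otimes>\<^sub>M lebesgue. norm (case p of (x, y) => rl_kernel a (x - y) * (rho x * rho y)) <= norm ((case p of (x, y) => (indicator {..<t} x * rl_kernel a (x - y)) *\<^sub>R (rho y)\<^sup>2) + (case p of (x, y) => (indicator {0<..} y * rl_kernel a (x - y)) *\<^sub>R (rho x)\<^sup>2))"
 by (auto simp: case_prod_beta')
 qed
qed

text \<open>The symmetrized kernel \<open>|x - y| powr (a - 1)\<close> is a multiple of the Gram kernel
 \<open>\<integral> kappa (x - z) * kappa (y - z) dz\<close> of \<open>kappa s = s powr (a/2 - 1)\<close>, hence positive definite.\<close>

lemma rl_kernel_positive:
 fixes rho :: "real => real"
 assumes a: "0 < a" "a < 1" and rho: "sq_integrable rho" "!!y. y \<notin> {0<..<t} ==> rho y = 0"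
 shows "0 <= (LINT x|lebesgue. rho x * (LINT y|lebesgue. rl_kernel a (x - y) * rho y))"
proof -
 note lebesgue_proj_measurable[measurable]
 let ?P = "lebesgue \<Otimes>\<^sub>M lebesgue :: (real \<times> real) measure"
 interpret PL: pair_sigma_finite ?P lebesgue ..
 have [measurable]: "rho \<in> blm" using rho by (simp add: sq_integrable_def)
 obtain c where c: "0 < c" "!!x y. x ~= y ==>
 (INTP z. ennreal (rl_kernel (a / 2) (x - z) * rl_kernel (a / 2) (y - z))) = ennreal (c * (rl_kernel a (x - y) + rl_kernel a (y - x)))"
 using nn_integral_rl_kernel_product[of "a / 2"] a by (auto simp: mult.commute)
 let ?k = "%x z. rl_kernel (a / 2) (x - z)"
 let ?F = "%(x, y). rl_kernel a (x - y) * (rho x * rho y)"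
 let ?G = "%(x, y). rl_kernel a (y - x) * (rho x * rho y)"
 let ?H = "%(p, z). (rho (fst p) * rho (snd p)) * (?k (fst p) z * ?k (snd p) z)"
 have iF: "integrable ?P ?F" by (rule rl_square_pair_integrable[OF a(1) rho])
 have iG: "integrable ?P ?G" and GF: "integral\<^sup>L ?P ?G = integral\<^sup>L ?P ?F"
 proof -
 have "?G = (%(x, y). ?F (y, x))" by (auto simp: mult.commute)
 then show "integrable ?P ?G" "integral\<^sup>L ?P ?G = integral\<^sup>L ?P ?F"
 using lebesgue_pair.integrable_product_swap[OF iF] lebesgue_pair.integral_product_swap[of ?F] iF by auto
 qed
 \<comment> \<open>The formula for the Gram kernel is available only off the diagonal, which is a
   null set.\<close>
 have diag: "AE p in ?P. fst p ~= snd p"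
 proof (rule lebesgue_pair.AE_pair_measure)
 show "{p \<in> space ?P. fst p ~= snd p} \<in> sets ?P" by measurable
 show "AE x in lebesgue. AE y in lebesgue. fst (x, y) ~= snd (x, y::real)"
 proof (rule AE_I2)
 fix x :: real
 show "AE y in lebesgue. fst (x, y) ~= snd (x, y)"
 using lebesgue_singleton_AE[of x] by (rule eventually_mono) auto
 qed
 qed
 have Hm [measurable]: "?H \<in> borel_measurable (?P \<Otimes>\<^sub>M lebesgue)" by measurable
 have nnH: "(INTP z. ennreal (?k x z * ?k y z)) = ennreal (c * (rl_kernel a (x - y) + rl_kernel a (y - x)))" if "x ~= y" for x y
 using c(2)[OF that] .
 have km [measurable]: "(%z. ?k x z * ?k y z) \<in> blm" for x y
 by (rule measurable_completion) measurable
 have iH: "integrable (?P \<Otimes>\<^sub>M lebesgue) ?H"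
 proof (rule integrableI_bounded[OF Hm])
 have "(\<integral>\<^sup>+q. ennreal (norm (?H q)) \<partial>(?P \<Otimes>\<^sub>M lebesgue)) = (\<integral>\<^sup>+p. \<integral>\<^sup>+z. ennreal (norm (?H (p, z))) \<partial>lebesgue \<partial>?P)"
 using Hm by (intro lebesgue.nn_integral_fst[symmetric] measurable_compose[OF measurable_compose[OF Hm borel_measurable_norm] measurable_ennreal])
 also have "... = (\<integral>\<^sup>+p. ennreal c * (ennreal (norm (?F p)) + ennreal (norm (?G p))) \<partial>?P)"
 proof (rule nn_integral_cong_AE, use diag in \<open>rule eventually_mono\<close>)
 fix p :: "real \<times> real" assume ne: "fst p ~= snd p"
 obtain x y where p: "p = (x, y)" by (cases p)
 have "(INTP z. ennreal (norm (?H (p, z)))) = (INTP z. ennreal \<bar>rho x * rho y\<bar> * ennreal (?k x z * ?k y z))"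
 by (intro nn_integral_cong) (simp add: p abs_mult ennreal_mult[symmetric])
 also have "... = ennreal \<bar>rho x * rho y\<bar> * ennreal (c * (rl_kernel a (x - y) + rl_kernel a (y - x)))"
 using ne by (subst nn_integral_cmult) (simp_all add: p nnH)
 also have "... = ennreal c * (ennreal (norm (?F p)) + ennreal (norm (?G p)))"
 using c(1) by (simp add: p abs_mult ennreal_mult[symmetric] ennreal_plus[symmetric] algebra_simps del: ennreal_plus)
 finally show "(INTP z. ennreal (norm (?H (p, z)))) = ennreal c * (ennreal (norm (?F p)) + ennreal (norm (?G p)))" .
 qed
 also have "... = ennreal c * ((\<integral>\<^sup>+p. ennreal (norm (?F p)) \<partial>?P) + (\<integral>\<^sup>+p. ennreal (norm (?G p)) \<partial>?P))"
 proof -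
 have m: "(%p. ennreal (norm (?F p))) \<in> borel_measurable ?P" "(%p. ennreal (norm (?G p))) \<in> borel_measurable ?P"
 using iF iG by (auto intro!: measurable_compose[OF measurable_compose[OF borel_measurable_integrable borel_measurable_norm] measurable_ennreal])
 show ?thesis by (subst nn_integral_cmult) (use m in \<open>auto simp: nn_integral_add\<close>)
 qed
 also have "... < \<infinity>" using iF iG by (auto simp: integrable_iff_bounded ennreal_mult_less_top)
 finally show "(\<integral>\<^sup>+q. ennreal (norm (?H q)) \<partial>(?P \<Otimes>\<^sub>M lebesgue)) < \<infinity>" .
 qed
 have "(LINT p|?P. LINT z|lebesgue. ?H (p, z)) = (LINT p|?P. c * (?F p + ?G p))"
 proof (rule integral_cong_AE)
 show "AE p in ?P. (LINT z|lebesgue. ?H (p, z)) = c * (?F p + ?G p)"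
 proof (use diag in \<open>rule eventually_mono\<close>)
 fix p :: "real \<times> real" assume ne: "fst p ~= snd p"
 obtain x y where p: "p = (x, y)" by (cases p)
 have "(LINT z|lebesgue. ?k x z * ?k y z) = c * (rl_kernel a (x - y) + rl_kernel a (y - x))"
 using ne nnH[of x y] c(1) by (subst integral_eq_nn_integral) (auto simp: p)
 then show "(LINT z|lebesgue. ?H (p, z)) = c * (?F p + ?G p)"
 by (simp add: p algebra_simps)
 qed
 show "(%p. c * (?F p + ?G p)) \<in> borel_measurable ?P" using iF iG by auto
 show "(%p. LINT z|lebesgue. ?H (p, z)) \<in> borel_measurable ?P"
 using PL.integrable_fst'[OF iH] by auto
 qed
 also have "... = 2 * c * integral\<^sup>L ?P ?F"
 using iF iG GF by (simp add: Bochner_Integration.integral_add)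
 also have "integral\<^sup>L ?P ?F = (LINT x|lebesgue. rho x * (LINT y|lebesgue. rl_kernel a (x - y) * rho y))"
 using lebesgue_pair.integral_fst'[OF iF] by (simp add: mult.left_commute)
 finally have 1: "(LINT p|?P. LINT z|lebesgue. ?H (p, z)) = 2 * c * (LINT x|lebesgue. rho x * (LINT y|lebesgue. rl_kernel a (x - y) * rho y))" .
 have "(LINT p|?P. LINT z|lebesgue. ?H (p, z)) = (LINT z|lebesgue. LINT p|?P. ?H (p, z))"
 using PL.Fubini_integral[of "%p z. ?H (p, z)"] iH by (simp add: case_prod_beta')
 also have "... \<ge> 0"
 proof (rule Bochner_Integration.integral_nonneg)
 fix z :: real
 show "0 <= (LINT p|?P. ?H (p, z))"
 \<comment> \<open>For fixed z the double integral is a square when it converges absolutely;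
   otherwise it is 0 by convention.\<close>
 proof (cases "integrable ?P (%p. ?H (p, z))")
 case True
 then have "(LINT p|?P. ?H (p, z)) = (LINT x|lebesgue. LINT y|lebesgue. ?H ((x, y), z))"
 by (rule lebesgue_pair.integral_fst'[symmetric])
 also have "... = (LINT x|lebesgue. LINT y|lebesgue. (rho x * ?k x z) * (rho y * ?k y z))"
 by (simp add: mult_ac)
 also have "... = (LINT x|lebesgue. rho x * ?k x z) * (LINT x|lebesgue. rho x * ?k x z)"
 by (simp only: integral_mult_right_zero integral_mult_left_zero)
 finally show ?thesis by simp
 qed (simp add: not_integrable_integral_eq)
 qed
 finally show ?thesis using c(1) unfolding 1 by (simp add: zero_le_mult_iff)
qed

section \<open>Fractional integrals: energy estimate, semigroup law and duality\<close>

lemma frac_int_left_kernel: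
 "frac_int_left 0 a v x = (1 / Gamma a) *\<^sub>R (LINT y|lebesgue. rl_kernel a (x - y) *\<^sub>R (indicator {0<..} y *\<^sub>R v y))"
 unfolding frac_int_left_def set_lebesgue_integral_def
 by (intro arg_cong[where f = "scaleR _"] Bochner_Integration.integral_cong) (auto simp: rl_kernel_def indicator_def)

lemma frac_int_right_kernel:
 "frac_int_right T a v x = (1 / Gamma a) *\<^sub>R (LINT y|lebesgue. rl_kernel a (y - x) *\<^sub>R (indicator {..<T} y *\<^sub>R v y))"
 unfolding frac_int_right_def set_lebesgue_integral_def
 by (intro arg_cong[where f = "scaleR _"] Bochner_Integration.integral_cong) (auto simp: rl_kernel_def indicator_def)

lemma frac_int_left_real:
 fixes rho :: "real => real"
 assumes "!!y. y <= 0 ==> rho y = 0"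
 shows "frac_int_left 0 a rho x = (1 / Gamma a) * (LINT y|lebesgue. rl_kernel a (x - y) * rho y)"
proof -
 have e: "indicator {0<..} y * rho y = rho y" for y using assms[of y] by (auto simp: indicator_def)
 show ?thesis unfolding frac_int_left_kernel real_scaleR_def e ..
qed

lemma frac_int_left_nonpos: "x <= 0 ==> frac_int_left 0 a v x = 0"
 by (simp add: frac_int_left_def set_lebesgue_integral_def)

lemma frac_int_left_cong:
 fixes v w :: "real => 'b::{banach, second_countable_topology}"
 assumes "AE y in lebesgue. y \<in> {0<..<x} --> v y = w y" "set_borel_measurable lebesgue {0<..<x} v" "set_borel_measurable lebesgue {0<..<x} w"
 shows "frac_int_left 0 a v x = frac_int_left 0 a w x"
proof -
 have e: "indicator {0<..<x} y *\<^sub>R ((x - y) powr (a - 1) *\<^sub>R v y) = (x - y) powr (a - 1) *\<^sub>R (indicator {0<..<x} y *\<^sub>R v y)" for y and v :: "real => 'b"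
 by (rule scaleR_left_commute)
 have [measurable]: "(%y. (x - y) powr (a - 1)) \<in> blm" by (rule measurable_completion) measurable
 note [measurable] = assms(2,3)[unfolded set_borel_measurable_def]
 have "(LINT y|lebesgue. (x - y) powr (a - 1) *\<^sub>R (indicator {0<..<x} y *\<^sub>R v y)) = (LINT y|lebesgue. (x - y) powr (a - 1) *\<^sub>R (indicator {0<..<x} y *\<^sub>R w y))"
 by (rule integral_cong_AE) (measurable, use assms(1) in \<open>auto elim!: eventually_mono simp: indicator_def\<close>)
 then show ?thesis unfolding frac_int_left_def set_lebesgue_integral_def e by simp
qed

lemma rl_convolution_measurable [measurable]:
 fixes rho :: "real => 'b::{banach, second_countable_topology}"
 assumes [measurable]: "rho \<in> blm"
 shows "(%x. LINT y|lebesgue. rl_kernel a (x - y) *\<^sub>R rho y) \<in> blm"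
proof -
 note lebesgue_proj_measurable[measurable]
 show ?thesis by (rule lebesgue.borel_measurable_lebesgue_integral) measurable
qed

lemma frac_int_left_measurable:
 fixes v :: "real => 'b::{banach, second_countable_topology}"
 assumes "(%y. indicator {0<..} y *\<^sub>R v y) \<in> blm"
 shows "frac_int_left 0 a v \<in> blm"
 unfolding frac_int_left_kernel[abs_def]
 by (intro borel_measurable_scaleR borel_measurable_const rl_convolution_measurable assms)

text \<open>Expanding the square of r + lam y leaves a cross term that is a nonnegative multiple of
  the pairing of r with its fractional integral. Both estimates follow by dropping nonnegative
  terms.\<close>

lemma volterra_energy:
 fixes y r g :: "real => real"
 assumes a: "0 < a" "a < 1" and lam: "0 <= lam"
 and r: "sq_integrable r" "!!s. s \<notin> {0<..<t} ==> r s = 0"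
 and y: "sq_integrable y" "!!s. s \<notin> {0<..<t} ==> y s = 0"
 and g: "!!s. g s = r s + lam * y s"
 and eq: "AE s in lebesgue. s \<in> {0<..<t} --> y s = frac_int_left 0 a r s"
 shows "(LINT s|lebesgue. (r s)\<^sup>2) <= (LINT s|lebesgue. (g s)\<^sup>2)"
 "lam\<^sup>2 * (LINT s|lebesgue. (y s)\<^sup>2) <= (LINT s|lebesgue. (g s)\<^sup>2)"
proof -
 have ir: "integrable lebesgue (%s. (r s)\<^sup>2)" and iy: "integrable lebesgue (%s. (y s)\<^sup>2)" using r y by (auto simp: sq_integrable_def)
 have iry: "integrable lebesgue (%s. r s * y s)" using sq_integrable_mult[OF r(1) y(1)] .
 have [measurable]: "r \<in> blm" "y \<in> blm" using r y by (auto simp: sq_integrable_def)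
 have r0: "r s = 0" if "s <= 0" for s using r(2) that by auto
 have "(LINT s|lebesgue. r s * y s) = (LINT s|lebesgue. (1 / Gamma a) * (r s * (LINT x|lebesgue. rl_kernel a (s - x) * r x)))"
 proof (rule integral_cong_AE)
 show "AE s in lebesgue. r s * y s = (1 / Gamma a) * (r s * (LINT x|lebesgue. rl_kernel a (s - x) * r x))"
 proof (rule eventually_mono[OF eq])
 fix s assume *: "s \<in> {0<..<t} --> y s = frac_int_left 0 a r s"
 have F: "frac_int_left 0 a r s = (1 / Gamma a) * (LINT x|lebesgue. rl_kernel a (s - x) * r x)"
 by (rule frac_int_left_real) (rule r0)
 show "r s * y s = (1 / Gamma a) * (r s * (LINT x|lebesgue. rl_kernel a (s - x) * r x))"
 proof (cases "s \<in> {0<..<t}")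
 case True
 then have "y s = frac_int_left 0 a r s" using * by blast
 then show ?thesis unfolding F by simp
 qed (use r(2)[of s] in simp)
 qed
 show "(%s. (1 / Gamma a) * (r s * (LINT x|lebesgue. rl_kernel a (s - x) * r x))) \<in> blm"
 using rl_convolution_measurable[of r a] by simp
 qed measurable
 also have "... = (1 / Gamma a) * (LINT s|lebesgue. r s * (LINT x|lebesgue. rl_kernel a (s - x) * r x))"
 by (rule integral_mult_right_zero)
 also have "... \<ge> 0"
 using rl_kernel_positive[OF a r] Gamma_real_pos[OF a(1)] by simp
 finally have pos: "0 <= (LINT s|lebesgue. r s * y s)" .
 have "(LINT s|lebesgue. (g s)\<^sup>2) = (LINT s|lebesgue. (r s)\<^sup>2 + (2 * lam * (r s * y s) + lam\<^sup>2 * (y s)\<^sup>2))"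
 by (simp add: g power2_sum power_mult_distrib algebra_simps)
 also have "... = (LINT s|lebesgue. (r s)\<^sup>2) + (2 * lam * (LINT s|lebesgue. r s * y s) + lam\<^sup>2 * (LINT s|lebesgue. (y s)\<^sup>2))"
 using ir iy iry by (simp add: Bochner_Integration.integral_add)
 finally have G: "(LINT s|lebesgue. (g s)\<^sup>2) = (LINT s|lebesgue. (r s)\<^sup>2) + (2 * lam * (LINT s|lebesgue. r s * y s) + lam\<^sup>2 * (LINT s|lebesgue. (y s)\<^sup>2))" .
 have "0 <= 2 * lam * (LINT s|lebesgue. r s * y s)" "0 <= lam\<^sup>2 * (LINT s|lebesgue. (y s)\<^sup>2)" "0 <= (LINT s|lebesgue. (r s)\<^sup>2)"
 using pos lam by simp_all
 then show "(LINT s|lebesgue. (r s)\<^sup>2) <= (LINT s|lebesgue. (g s)\<^sup>2)" "lam\<^sup>2 * (LINT s|lebesgue. (y s)\<^sup>2) <= (LINT s|lebesgue. (g s)\<^sup>2)"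
 unfolding G by linarith+
qed

text \<open>Scaling to the unit interval turns the convolution into the Beta integral.\<close>

lemma rl_kernel_convolution:
 assumes ab: "0 < a" "0 < b"
 shows "(INTP s. ennreal (rl_kernel a (x - s) * rl_kernel b (s - y))) = ennreal (Beta a b * rl_kernel (a + b) (x - y))"
proof (cases "y < x")
 case False
 then have z: "rl_kernel a (x - s) * rl_kernel b (s - y) = 0" "rl_kernel (a + b) (x - y) = 0" for s by (auto simp: rl_kernel_def)
 show ?thesis unfolding z by simp
next
 case True
 define d where "d = x - y"
 have d: "0 < d" using True by (simp add: d_def)
 let ?k = "%u. rl_kernel a (1 - u) * rl_kernel b u"
 have m: "(%s. ennreal (rl_kernel a (x - s) * rl_kernel b (s - y))) \<in> blm"
 and km: "(%u. ennreal (?k u)) \<in> blm"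
 by (rule measurable_completion, measurable)+
 have ae: "AE u in lebesgue. ennreal (?k u) = ennreal (indicator {0..1} u * (u powr (b - 1) * (1 - u) powr (a - 1)))"
 using lebesgue_singleton_AE[of 0] lebesgue_singleton_AE[of 1]
 by eventually_elim (auto simp: rl_kernel_def indicator_def mult.commute)
 have "(INTP u. ennreal (indicator {0..1} u * (u powr (b - 1) * (1 - u) powr (a - 1)))) = ennreal (Beta b a)"
 by (rule nn_integral_lebesgue_has_integral[OF _ has_integral_Beta_real]) (use ab in auto)
 then have kB: "(INTP u. ennreal (?k u)) = ennreal (Beta a b)"
 unfolding nn_integral_cong_AE[OF ae] by (simp add: Beta_commute)
 have B0: "0 <= Beta a b" using ab by (simp add: Beta_def Gamma_real_pos less_imp_le)
 have "(INTP s. ennreal (rl_kernel a (x - s) * rl_kernel b (s - y)))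
 = ennreal d * (INTP u. ennreal (rl_kernel a (x - (y + d * u)) * rl_kernel b (y + d * u - y)))"
 using nn_integral_real_affine_lebesgue[OF m, of d y] d by simp
 also have "(%u. rl_kernel a (x - (y + d * u)) * rl_kernel b (y + d * u - y)) = (%u. d powr (a + b - 2) * ?k u)"
 proof
 fix u
 have e: "x - (y + d * u) = d * (1 - u)" "y + d * u - y = d * u" by (auto simp: d_def algebra_simps)
 have p: "d powr (a - 1) * d powr (b - 1) = d powr (a + b - 2)" by (simp add: powr_add[symmetric])
 show "rl_kernel a (x - (y + d * u)) * rl_kernel b (y + d * u - y) = d powr (a + b - 2) * ?k u"
 unfolding e rl_kernel_scale[OF d] p[symmetric] by (simp add: mult_ac)
 qed
 also have "(INTP u. ennreal (d powr (a + b - 2) * ?k u)) = ennreal (d powr (a + b - 2)) * ennreal (Beta a b)"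
 unfolding kB[symmetric] using km by (subst nn_integral_cmult[symmetric]) (auto simp: ennreal_mult)
 also have "ennreal d * (ennreal (d powr (a + b - 2)) * ennreal (Beta a b)) = ennreal (d * (d powr (a + b - 2) * Beta a b))"
 using d B0 by (simp add: ennreal_mult)
 also have "d * (d powr (a + b - 2) * Beta a b) = Beta a b * rl_kernel (a + b) (x - y)"
 proof -
 have "d * d powr (a + b - 2) = d powr (a + b - 1)" using powr_mult_base[of d "a + b - 2"] d by simp
 then show ?thesis using d by (simp add: rl_kernel_def d_def)
 qed
 finally show ?thesis .
qed

lemma rl_kernel_integrable_ge_1:
 fixes rho :: "real => real"
 assumes c: "1 <= c" and rho: "integrable lebesgue rho" "!!y. y <= 0 ==> rho y = 0"
 shows "integrable lebesgue (%y. rl_kernel c (x - y) * rho y)"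
 "\<bar>LINT y|lebesgue. rl_kernel c (x - y) * rho y\<bar> <= x powr (c - 1) * (LINT y|lebesgue. \<bar>rho y\<bar>)"
proof -
 have [measurable]: "rho \<in> blm" "(%y. rl_kernel c (x - y)) \<in> blm"
 using rho by (auto intro: measurable_completion)
 have b: "\<bar>rl_kernel c (x - y) * rho y\<bar> <= x powr (c - 1) * \<bar>rho y\<bar>" for y
 proof (cases "y <= 0 \<or> x <= y")
 case True
 then show ?thesis using rho(2) by (auto simp: rl_kernel_def)
 next
 case False
 then have "(x - y) powr (c - 1) <= x powr (c - 1)" using c by (intro powr_mono2) auto
 then show ?thesis using False by (simp add: rl_kernel_def abs_mult mult_right_mono)
 qed
 show i: "integrable lebesgue (%y. rl_kernel c (x - y) * rho y)"
 by (rule Bochner_Integration.integrable_bound[of _ "%y. x powr (c - 1) * \<bar>rho y\<bar>"]) (use rho b in \<open>auto simp: abs_mult\<close>)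
 have "\<bar>LINT y|lebesgue. rl_kernel c (x - y) * rho y\<bar> <= (LINT y|lebesgue. \<bar>rl_kernel c (x - y) * rho y\<bar>)"
 by (rule integral_abs_bound)
 also have "... <= (LINT y|lebesgue. x powr (c - 1) * \<bar>rho y\<bar>)"
 by (rule integral_mono) (use i rho b in auto)
 finally show "\<bar>LINT y|lebesgue. rl_kernel c (x - y) * rho y\<bar> <= x powr (c - 1) * (LINT y|lebesgue. \<bar>rho y\<bar>)" by simp
qed

text \<open>The condition a + b >= 1 makes the combined kernel locally bounded. Fubini then applies
  at every x, and the identity holds pointwise instead of almost everywhere.\<close>

lemma frac_int_left_semigroup:
 fixes rho :: "real => real"
 assumes ab: "0 < a" "0 < b" "1 <= a + b" and rho: "integrable lebesgue rho" "!!y. y <= 0 ==> rho y = 0"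
 shows "frac_int_left 0 a (frac_int_left 0 b rho) x = frac_int_left 0 (a + b) rho x"
proof -
 note lebesgue_proj_measurable[measurable]
 have [measurable]: "rho \<in> blm" using rho by auto
 have B0: "0 <= Beta a b" using ab by (simp add: Beta_def Gamma_real_pos less_imp_le)
 let ?Q = "%s y. rl_kernel a (x - s) * rl_kernel b (s - y) * rho y"
 have i: "integrable lebesgue (%y. rl_kernel (a + b) (x - y) * rho y)"
 by (rule rl_kernel_integrable_ge_1(1)[OF ab(3) rho])
 have Qm: "(%(s, y). ?Q s y) \<in> borel_measurable (lebesgue \<Otimes>\<^sub>M lebesgue)" by measurable
 have int: "integrable (lebesgue \<Otimes>\<^sub>M lebesgue) (%(s, y). ?Q s y)"
 proof (rule integrableI_bounded[OF Qm])
 have "(\<integral>\<^sup>+p. ennreal (norm (case p of (s, y) => ?Q s y)) \<partial>(lebesgue \<Otimes>\<^sub>M lebesgue)) = (\<integral>\<^sup>+y. \<integral>\<^sup>+s. ennreal (norm (?Q s y)) \<partial>lebesgue \<partial>lebesgue)"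
 by (subst lebesgue_pair.nn_integral_snd[OF measurable_compose[OF measurable_compose[OF Qm borel_measurable_norm] measurable_ennreal], symmetric]) simp
 also have "... = (INTP y. ennreal (Beta a b) * ennreal (norm (rl_kernel (a + b) (x - y) * rho y)))"
 proof (rule nn_integral_cong)
 fix y :: real
 have m: "(%s. ennreal (rl_kernel a (x - s) * rl_kernel b (s - y))) \<in> blm"
 by (rule measurable_completion) measurable
 have "(INTP s. ennreal (norm (?Q s y))) = (INTP s. ennreal (rl_kernel a (x - s) * rl_kernel b (s - y)) * ennreal \<bar>rho y\<bar>)"
 by (intro nn_integral_cong) (simp add: abs_mult ennreal_mult[symmetric])
 also have "... = ennreal (Beta a b * rl_kernel (a + b) (x - y)) * ennreal \<bar>rho y\<bar>"
 by (simp only: nn_integral_multc[OF m] rl_kernel_convolution[OF ab(1,2)])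
 also have "... = ennreal (Beta a b) * ennreal (norm (rl_kernel (a + b) (x - y) * rho y))"
 using B0 by (simp add: ennreal_mult[symmetric] abs_mult mult.assoc)
 finally show "(INTP s. ennreal (norm (?Q s y))) = ennreal (Beta a b) * ennreal (norm (rl_kernel (a + b) (x - y) * rho y))" .
 qed
 also have "... = ennreal (Beta a b) * (INTP y. ennreal (norm (rl_kernel (a + b) (x - y) * rho y)))"
 using i by (intro nn_integral_cmult) (auto intro!: measurable_compose[OF measurable_compose[OF borel_measurable_integrable borel_measurable_norm] measurable_ennreal])
 also have "... < \<infinity>" using i by (auto simp: integrable_iff_bounded ennreal_mult_less_top)
 finally show "(\<integral>\<^sup>+p. ennreal (norm (case p of (s, y) => ?Q s y)) \<partial>(lebesgue \<Otimes>\<^sub>M lebesgue)) < \<infinity>" .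
 qed
 have "(LINT s|lebesgue. rl_kernel a (x - s) * (LINT y|lebesgue. rl_kernel b (s - y) * rho y)) = (LINT s|lebesgue. LINT y|lebesgue. ?Q s y)"
 by (simp add: mult.assoc)
 also have "... = (LINT y|lebesgue. LINT s|lebesgue. ?Q s y)"
 using lebesgue_pair.Fubini_integral[OF int] by simp
 also have "... = (LINT y|lebesgue. Beta a b * (rl_kernel (a + b) (x - y) * rho y))"
 proof (rule Bochner_Integration.integral_cong[OF refl])
 fix y :: real
 have m: "(%s. rl_kernel a (x - s) * rl_kernel b (s - y)) \<in> blm"
 by (rule measurable_completion) measurable
 have "(LINT s|lebesgue. rl_kernel a (x - s) * rl_kernel b (s - y)) = Beta a b * rl_kernel (a + b) (x - y)"
 using m B0 by (subst integral_eq_nn_integral) (auto simp: rl_kernel_convolution[OF ab(1,2)])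
 then show "(LINT s|lebesgue. ?Q s y) = Beta a b * (rl_kernel (a + b) (x - y) * rho y)" by simp
 qed
 also have "... = Beta a b * (LINT y|lebesgue. rl_kernel (a + b) (x - y) * rho y)" by (rule integral_mult_right_zero)
 finally have *: "(LINT s|lebesgue. rl_kernel a (x - s) * (LINT y|lebesgue. rl_kernel b (s - y) * rho y)) = Beta a b * (LINT y|lebesgue. rl_kernel (a + b) (x - y) * rho y)" .
 have F: "frac_int_left 0 b rho s = (1 / Gamma b) * (LINT y|lebesgue. rl_kernel b (s - y) * rho y)" for s
 by (rule frac_int_left_real) (rule rho(2))
 have "frac_int_left 0 a (frac_int_left 0 b rho) x = (1 / Gamma a) * (LINT s|lebesgue. rl_kernel a (x - s) * frac_int_left 0 b rho s)"
 by (rule frac_int_left_real) (rule frac_int_left_nonpos)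
 also have "... = (1 / Gamma a) * (LINT s|lebesgue. rl_kernel a (x - s) * ((1 / Gamma b) * (LINT y|lebesgue. rl_kernel b (s - y) * rho y)))"
 unfolding F ..
 also have "... = (1 / Gamma a) * (1 / Gamma b) * (LINT s|lebesgue. rl_kernel a (x - s) * (LINT y|lebesgue. rl_kernel b (s - y) * rho y))"
 unfolding mult.left_commute[of _ "1 / Gamma b"] integral_mult_right_zero by simp
 also have "... = frac_int_left 0 (a + b) rho x"
 proof -
 have "Gamma a ~= 0" "Gamma b ~= 0"
 using Gamma_real_pos[OF ab(1)] Gamma_real_pos[OF ab(2)] by simp_all
 moreover have "frac_int_left 0 (a + b) rho x = (1 / Gamma (a + b)) * (LINT y|lebesgue. rl_kernel (a + b) (x - y) * rho y)"
 by (rule frac_int_left_real) (rule rho(2))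
 ultimately show ?thesis unfolding * by (simp add: Beta_def)
 qed
 finally show ?thesis .
qed

text \<open>The square of the kernel of order a is the kernel of order 2a - 1, which is locally
  integrable because a > 1/2.\<close>

lemma rl_kernel_cauchy_schwarz:
 fixes n :: "real => real"
 assumes a: "1 / 2 < a" and x: "0 < x" and [measurable]: "n \<in> blm" and n: "!!y. y <= 0 ==> n y = 0" "!!y. 0 <= n y"
 shows "(INTP y. ennreal (rl_kernel a (x - y) * n y))\<^sup>2 <= ennreal (x powr (2 * a - 1) / (2 * a - 1)) * (INTP y. ennreal ((n y)\<^sup>2))"
proof -
 let ?f = "%y. indicator {0<..} y * rl_kernel a (x - y)"
 have [measurable]: "?f \<in> blm" by (rule measurable_completion) measurable
 have m: "(%s. ennreal (indicator {..<x} s * rl_kernel (2 * a - 1) s)) \<in> blm"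
 by (rule measurable_completion) measurable
 have ind: "indicator {..<x} (x - y) = (indicator {0<..} y :: real)" for y by (auto simp: indicator_def)
 have "(INTP y. ennreal (rl_kernel a (x - y) * n y)) = (INTP y. ennreal (?f y) * ennreal (n y))"
 using n by (intro nn_integral_cong) (auto simp: indicator_def ennreal_mult[symmetric] not_less)
 then have "(INTP y. ennreal (rl_kernel a (x - y) * n y))\<^sup>2 <= (INTP y. (ennreal (?f y))\<^sup>2) * (INTP y. (ennreal (n y))\<^sup>2)"
 by (simp only:) (rule Cauchy_Schwarz_nn_integral; measurable)
 also have "(INTP y. (ennreal (n y))\<^sup>2) = (INTP y. ennreal ((n y)\<^sup>2))"
 using n by (simp add: ennreal_power)
 also have "(INTP y. (ennreal (?f y))\<^sup>2) = (INTP y. ennreal (indicator {..<x} (x - y) * rl_kernel (2 * a - 1) (x - y)))"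
 by (intro nn_integral_cong) (auto simp: ind rl_kernel_def indicator_def power2_eq_square powr_add[symmetric] ennreal_mult[symmetric])
 also have "... = ennreal (x powr (2 * a - 1) / (2 * a - 1))"
 using nn_integral_real_affine_lebesgue[OF m, of "-1" x] nn_integral_rl_kernel[of "2 * a - 1" x] a x by simp
 finally show ?thesis .
qed

lemma frac_duality:
 fixes rho h :: "real => real"
 assumes a: "0 < a" and rho: "integrable lebesgue rho" "!!y. y \<notin> {0<..<T} ==> rho y = 0"
 and h [measurable]: "h \<in> blm" and h0: "!!x. T <= x ==> h x = 0" and M: "!!x. \<bar>h x\<bar> <= M"
 shows "(LINT x|lebesgue. h x * frac_int_left 0 a rho x) = (LINT y|lebesgue. rho y * frac_int_right T a h y)"
proof -
 note lebesgue_proj_measurable[measurable]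
 have [measurable]: "rho \<in> blm" using rho by auto
 let ?Q = "%x y. h x * rl_kernel a (x - y) * rho y"
 have M0: "0 <= M" using M[of 0] by simp
 have int: "integrable (lebesgue \<Otimes>\<^sub>M lebesgue) (%(x, y). ?Q x y)"
 proof (rule Bochner_Integration.integrable_bound[OF integrable_mult_right[OF rl_pair_integrable[OF a rho], of M]])
 have "\<bar>?Q x y\<bar> <= M * \<bar>indicator {..<T} x * rl_kernel a (x - y) * rho y\<bar>" for x y
 proof (cases "x < T")
 case True
 have "\<bar>h x\<bar> * (rl_kernel a (x - y) * \<bar>rho y\<bar>) <= M * (rl_kernel a (x - y) * \<bar>rho y\<bar>)"
 by (rule mult_right_mono[OF M]) simp
 then show ?thesis using True by (simp add: abs_mult mult.assoc)
 qed (simp add: h0)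
 then show "AE p in lebesgue \<Otimes>\<^sub>M lebesgue. norm (case p of (x, y) => ?Q x y) <= norm (M * (case p of (x, y) => (indicator {..<T} x * rl_kernel a (x - y)) *\<^sub>R rho y))"
 using M0 by (auto simp: abs_mult)
 qed measurable
 have r0: "rho y = 0" if "y <= 0" for y using rho(2) that by auto
 have "(LINT x|lebesgue. h x * frac_int_left 0 a rho x) = (LINT x|lebesgue. (1 / Gamma a) * (LINT y|lebesgue. ?Q x y))"
 by (simp add: frac_int_left_real[OF r0] mult.assoc)
 also have "... = (1 / Gamma a) * (LINT x|lebesgue. LINT y|lebesgue. ?Q x y)" by (rule integral_mult_right_zero)
 also have "(LINT x|lebesgue. LINT y|lebesgue. ?Q x y) = (LINT y|lebesgue. LINT x|lebesgue. ?Q x y)"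
 using lebesgue_pair.Fubini_integral[OF int] by simp
 also have "(LINT y|lebesgue. LINT x|lebesgue. ?Q x y) = (LINT y|lebesgue. rho y * (LINT x|lebesgue. rl_kernel a (x - y) * (indicator {..<T} x * h x)))"
 proof (rule Bochner_Integration.integral_cong[OF refl])
 fix y
 have e: "indicator {..<T} x * h x = h x" for x using h0[of x] by (auto simp: indicator_def)
 show "(LINT x|lebesgue. ?Q x y) = rho y * (LINT x|lebesgue. rl_kernel a (x - y) * (indicator {..<T} x * h x))"
 unfolding e integral_mult_right_zero[symmetric] by (simp add: mult_ac)
 qed
 also have "(1 / Gamma a) * ... = (LINT y|lebesgue. rho y * frac_int_right T a h y)"
 unfolding integral_mult_right_zero[symmetric] frac_int_right_kernel by (simp add: mult.left_commute)
 finally show ?thesis .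
qed

text \<open>Reversal of time, by which facts about right fractional integrals are obtained from
  those about left ones.\<close>

lemma frac_int_right_reflect:
 fixes h :: "real => real"
 shows "frac_int_right T a h (T - x) = frac_int_left 0 a (%s. h (T - s)) x"
proof -
 have ind: "indicator {..<T} (T - s) = (indicator {0<..} s :: real)" for s by (auto simp: indicator_def)
 show ?thesis
 unfolding frac_int_right_kernel frac_int_left_kernel
 by (subst lebesgue_integral_real_affine[of "-1" _ T]) (simp_all add: ind algebra_simps)
qed

lemma frac_int_right_one_deriv:
 fixes psi :: "real => real"
 assumes psi: "test_fun {0<..<T} psi" and x: "x < T"
 shows "frac_int_right T 1 (deriv psi) x = - psi x"
proof -
 have c: "continuous_on S (deriv psi)" for S
 using test_funD(1)[OF test_fun_deriv(3)[OF psi]] continuous_on_subset by blast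
 have i: "set_integrable lborel {x..T} (deriv psi)" by (rule borel_integrable_atLeastAtMost'[OF c])
 have "(deriv psi has_integral (psi T - psi x)) {x..T}"
 using x test_fun_deriv(1)[OF psi] by (intro fundamental_theorem_of_calculus)
 (auto simp: has_real_derivative_iff_has_vector_derivative[symmetric] intro: has_field_derivative_at_within)
 then have "(LINT s:{x..T}|lborel. deriv psi s) = psi T - psi x"
 using set_borel_integral_eq_integral(2)[OF i] by (simp add: integral_unique)
 moreover have "psi T = 0" using test_funD(4)[OF psi, of T] by simp
 moreover have "(LINT s|lebesgue. rl_kernel 1 (s - x) *\<^sub>R (indicator {..<T} s *\<^sub>R deriv psi s)) = (LINT s|lebesgue. indicator {x..T} s *\<^sub>R deriv psi s)"
 proof (rule integral_cong_AE)
 have [measurable]: "deriv psi \<in> blm" using test_funD(6)[OF test_fun_deriv(3)[OF psi]] by auto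
 have [measurable]: "(%s. rl_kernel 1 (s - x)) \<in> blm" by (rule measurable_completion) measurable
 note lebesgue_ident_measurable[measurable]
 show "(%s. rl_kernel 1 (s - x) *\<^sub>R (indicator {..<T} s *\<^sub>R deriv psi s)) \<in> blm" by measurable
 show "(%s. indicator {x..T} s *\<^sub>R deriv psi s) \<in> blm" by measurable
 show "AE s in lebesgue. rl_kernel 1 (s - x) *\<^sub>R (indicator {..<T} s *\<^sub>R deriv psi s) = indicator {x..T} s *\<^sub>R deriv psi s"
 using lebesgue_singleton_AE[of x] lebesgue_singleton_AE[of T] by eventually_elim (auto simp: rl_kernel_def indicator_def)
 qed
 moreover have "(LINT s|lebesgue. indicator {x..T} s *\<^sub>R deriv psi s) = (LINT s:{x..T}|lborel. deriv psi s)"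
 using i unfolding set_lebesgue_integral_def set_integrable_def by (intro integral_completion) auto
 ultimately show ?thesis unfolding frac_int_right_kernel by simp
qed

text \<open>The integral of order 1 is an antiderivative in the sense of distributions. Duality
  moves it onto psi', where it returns -psi.\<close>

lemma integral_deriv_frac_int_one:
 fixes rho psi :: "real => real"
 assumes psi: "test_fun {0<..<T} psi" and rho: "integrable lebesgue rho" "!!y. y \<notin> {0<..<T} ==> rho y = 0"
 shows "(LINT x|lebesgue. deriv psi x * frac_int_left 0 1 rho x) = - (LINT x|lebesgue. rho x * psi x)"
proof -
 obtain M where M: "!!x. \<bar>deriv psi x\<bar> <= M" using test_funD(7)[OF test_fun_deriv(3)[OF psi]] by auto
 have "(LINT x|lebesgue. deriv psi x * frac_int_left 0 1 rho x) = (LINT y|lebesgue. rho y * frac_int_right T 1 (deriv psi) y)"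
 by (rule frac_duality[OF _ rho _ _ M]) (use test_funD(4,6)[OF test_fun_deriv(3)[OF psi]] in auto)
 also have "... = (LINT y|lebesgue. - (rho y * psi y))"
 proof (rule Bochner_Integration.integral_cong[OF refl])
 fix y show "rho y * frac_int_right T 1 (deriv psi) y = - (rho y * psi y)"
 using frac_int_right_one_deriv[OF psi, of y] rho(2)[of y] by (cases "y \<in> {0<..<T}") auto
 qed
 finally show ?thesis by simp
qed

lemma frac_int_left_measurable_real:
 fixes rho :: "real => real"
 assumes [measurable]: "rho \<in> blm"
 shows "frac_int_left 0 a rho \<in> blm"
proof (rule frac_int_left_measurable)
 note lebesgue_ident_measurable[measurable]
 show "(%y. indicator {0<..} y *\<^sub>R rho y) \<in> blm" by measurable
qed

lemma frac_int_left_cutoff: "x <= T ==> frac_int_left 0 a (%s. indicator {0<..<T} s *\<^sub>R v s) x = frac_int_left 0 a v x"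
 unfolding frac_int_left_def set_lebesgue_integral_def
 by (rule arg_cong[where f = "scaleR _"], rule Bochner_Integration.integral_cong) (auto simp: indicator_def)

text \<open>A pointwise bound that tends to 0 with x; it later determines an integration
  constant.\<close>

lemma frac_int_left_half_bound:
 fixes rho :: "real => real"
 assumes a: "1 / 2 < a" and x: "0 < x" and rho: "sq_integrable rho" "!!y. y <= 0 ==> rho y = 0"
 shows "\<bar>frac_int_left 0 a rho x\<bar> <= (1 / Gamma a) * sqrt (x powr (2 * a - 1) / (2 * a - 1) * (LINT y|lebesgue. (rho y)\<^sup>2))"
proof -
 have [measurable]: "rho \<in> blm" using rho by (simp add: sq_integrable_def)
 have a0: "0 < a" using a by simp
 have G: "0 < Gamma a" by (rule Gamma_real_pos[OF a0])
 let ?I = "LINT y|lebesgue. rl_kernel a (x - y) * rho y"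
 have "ennreal \<bar>?I\<bar> <= (INTP y. ennreal (rl_kernel a (x - y) * \<bar>rho y\<bar>))"
 using norm_integral_le_nn_integral[of lebesgue "%y. rl_kernel a (x - y) * rho y"] by (simp add: abs_mult)
 then have "(ennreal \<bar>?I\<bar>)\<^sup>2 <= (INTP y. ennreal (rl_kernel a (x - y) * \<bar>rho y\<bar>))\<^sup>2" by (rule power_mono) simp
 also have "... <= ennreal (x powr (2 * a - 1) / (2 * a - 1)) * (INTP y. ennreal (\<bar>rho y\<bar>\<^sup>2))"
 by (rule rl_kernel_cauchy_schwarz[OF a x]) (use rho(2) in auto)
 also have "(INTP y. ennreal (\<bar>rho y\<bar>\<^sup>2)) = ennreal (LINT y|lebesgue. (rho y)\<^sup>2)"
 using rho(1) by (simp add: sq_integrable_def nn_integral_eq_integral)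
 also have "ennreal (x powr (2 * a - 1) / (2 * a - 1)) * ennreal (LINT y|lebesgue. (rho y)\<^sup>2) = ennreal (x powr (2 * a - 1) / (2 * a - 1) * (LINT y|lebesgue. (rho y)\<^sup>2))"
 using a by (intro ennreal_mult[symmetric]) auto
 finally have "?I\<^sup>2 <= x powr (2 * a - 1) / (2 * a - 1) * (LINT y|lebesgue. (rho y)\<^sup>2)"
 using a by (simp add: ennreal_power ennreal_le_iff)
 then have "\<bar>?I\<bar> <= sqrt (x powr (2 * a - 1) / (2 * a - 1) * (LINT y|lebesgue. (rho y)\<^sup>2))"
 using real_sqrt_le_mono by fastforce
 moreover have "frac_int_left 0 a rho x = (1 / Gamma a) * ?I" by (rule frac_int_left_real) (rule rho(2))
 ultimately show ?thesis using G by (simp add: abs_mult divide_right_mono)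
qed

lemma set_integrable_bounded:
 fixes f :: "real => 'b::{banach, second_countable_topology}"
 assumes [measurable]: "f \<in> blm" and "!!x. x \<in> {c..d} ==> norm (f x) <= B"
 shows "set_integrable lebesgue {c..d} f"
 unfolding set_integrable_def
proof (rule Bochner_Integration.integrable_bound[of _ "%x. B * indicator {c..d} x"])
 show "integrable lebesgue (%x. B * indicator {c..d} x)"
 by (intro integrable_mult_right) (simp add: integrable_indicator_iff emeasure_lborel_Icc_eq)
 show "(%x. indicator {c..d} x *\<^sub>R f x) \<in> blm"
 by (intro borel_measurable_scaleR borel_measurable_indicator assms(1)) auto
 show "AE x in lebesgue. norm (indicator {c..d} x *\<^sub>R f x) <= norm (B * indicator {c..d} x)"
 using assms(2) by (intro AE_I2) (auto simp: indicator_def intro: order_trans[OF _ abs_ge_self])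
qed

lemma frac_int_left_bound_ge_1:
 fixes rho :: "real => real"
 assumes c: "1 <= c" and rho: "integrable lebesgue rho" "!!y. y <= 0 ==> rho y = 0"
 shows "\<bar>frac_int_left 0 c rho x\<bar> <= (1 / Gamma c) * (x powr (c - 1) * (LINT y|lebesgue. \<bar>rho y\<bar>))"
proof -
 have c0: "0 < c" using c by simp
 have "frac_int_left 0 c rho x = (1 / Gamma c) * (LINT y|lebesgue. rl_kernel c (x - y) * rho y)"
 by (rule frac_int_left_real) (rule rho(2))
 then show ?thesis
 using rl_kernel_integrable_ge_1(2)[OF c rho, of x] Gamma_real_pos[OF c0] by (simp add: abs_mult divide_right_mono)
qed

lemma frac_int_left_diff:
 fixes v w :: "real => real"
 assumes "integrable lebesgue (%y. rl_kernel a (x - y) * v y)" "integrable lebesgue (%y. rl_kernel a (x - y) * w y)"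
 and "!!y. y <= 0 ==> v y = 0" "!!y. y <= 0 ==> w y = 0"
 shows "frac_int_left 0 a (%y. v y - w y) x = frac_int_left 0 a v x - frac_int_left 0 a w x"
proof -
 have e: "frac_int_left 0 a (%y. v y - w y) x = (1 / Gamma a) * (LINT y|lebesgue. rl_kernel a (x - y) * (v y - w y))"
 "frac_int_left 0 a v x = (1 / Gamma a) * (LINT y|lebesgue. rl_kernel a (x - y) * v y)"
 "frac_int_left 0 a w x = (1 / Gamma a) * (LINT y|lebesgue. rl_kernel a (x - y) * w y)"
 by (rule frac_int_left_real; use assms(3,4) in simp)+
 show ?thesis unfolding e right_diff_distrib Bochner_Integration.integral_diff[OF assms(1,2)] ..
qed

section \<open>From the weak form to the scalar Volterra equation\<close>

lemma AE_interval_exists: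
 assumes "AE x in lebesgue. x \<in> {0<..<T} --> P x" "0 < \<delta>" "\<delta> <= (T::real)"
 obtains x where "x \<in> {0<..<\<delta>}" "P x"
proof (rule ccontr)
 assume "\<not> thesis"
 with that have "\<not> P x" if "x \<in> {0<..<\<delta>}" for x using \<open>x \<in> {0<..<\<delta>}\<close> by blast
 then have "AE x in lebesgue. x \<notin> {0<..<\<delta>}"
 using assms(1,3) by (auto elim!: eventually_mono)
 then have "emeasure lebesgue {0<..<\<delta>} = 0"
 by (subst (asm) AE_iff_measurable[of "{0<..<\<delta>}"]) auto
 then show False using assms(2) by simp
qed

text \<open>The distributional identity determines \<open>I\<^bsup>1-gamma\<^esup> y\<close> up to a constant, which vanishes because
 \<open>y \<in> L\<^sup>2\<close> and \<open>gamma < 1/2\<close> force \<open>I\<^bsup>1-gamma\<^esup> y\<close> to tend to \<open>0\<close> at \<open>0\<close>.\<close>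

lemma volterra_from_weak:
 fixes y r :: "real => real"
 assumes gamma: "0 < gamma" "gamma < 1 / 2" and T: "0 < T"
 and y: "sq_integrable y" "!!s. s \<notin> {0<..<T} ==> y s = 0"
 and r: "sq_integrable r" "!!s. s \<notin> {0<..<T} ==> r s = 0"
 and weak: "!!h. test_fun {0<..<T} h ==> (LINT x|lebesgue. deriv h x * frac_int_left 0 (1 - gamma) y x) = - (LINT x|lebesgue. r x * frac_int_right T gamma h x)"
 shows "AE x in lebesgue. x \<in> {0<..<T} --> y x = frac_int_left 0 (2 * gamma) r x"
proof -
 have [measurable]: "y \<in> blm" "r \<in> blm" using y r by (auto simp: sq_integrable_def)
 have iy: "integrable lebesgue y" and ir: "integrable lebesgue r"
 using sq_integrable_imp_integrable[OF y(1), of "{0<..<T}"] sq_integrable_imp_integrable[OF r(1), of "{0<..<T}"] y(2) r(2) by auto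
 have y0: "y s = 0" and r0: "r s = 0" if "s <= 0" for s using y(2) r(2) that by auto
 define q where "q s = indicator {0<..<T} s * frac_int_left 0 gamma r s" for s
 have fm [measurable]: "frac_int_left 0 a y \<in> blm" "frac_int_left 0 a r \<in> blm" for a
 by (intro frac_int_left_measurable_real; measurable)+
 have cut_int: "integrable lebesgue (%s. indicator {0<..<T} s * frac_int_left 0 a rho s)"
 if a: "0 < a" and rho: "integrable lebesgue rho" "!!s. s \<notin> {0<..<T} ==> rho s = 0" for a and rho :: "real => real"
 proof -
 have "integrable lebesgue (%x. LINT y|lebesgue. (indicator {..<T} x * rl_kernel a (x - y)) *\<^sub>R rho y)"
 using lebesgue_pair.integrable_fst'[OF rl_pair_integrable[OF a rho]] by simp
 then have "integrable lebesgue (%x. (1 / Gamma a) * (LINT y|lebesgue. (indicator {..<T} x * rl_kernel a (x - y)) *\<^sub>R rho y))"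
 by (rule integrable_mult_right)
 moreover have "(1 / Gamma a) * (LINT y|lebesgue. (indicator {..<T} x * rl_kernel a (x - y)) *\<^sub>R rho y) = indicator {0<..<T} x * frac_int_left 0 a rho x" for x
 proof -
 have "frac_int_left 0 a rho x = (1 / Gamma a) * (LINT y|lebesgue. rl_kernel a (x - y) * rho y)"
 by (rule frac_int_left_real) (use rho(2) in auto)
 moreover have "frac_int_left 0 a rho x = 0" if "x <= 0" by (rule frac_int_left_nonpos[OF that])
 ultimately show ?thesis by (cases "0 < x") (auto simp: mult.assoc indicator_def)
 qed
 ultimately show ?thesis by simp
 qed
 have iq: "integrable lebesgue q" unfolding q_def by (rule cut_int[OF gamma(1) ir r(2)])
 have q0: "q s = 0" if "s \<notin> {0<..<T}" for s using that by (simp add: q_def)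
 have q0': "q s = 0" if "s <= 0" for s using that by (simp add: q_def)
 have qc: "frac_int_left 0 a q x = frac_int_left 0 a (frac_int_left 0 gamma r) x" if "x <= T" for a x
 using frac_int_left_cutoff[OF that, of a "frac_int_left 0 gamma r"] by (simp add: q_def[abs_def])
 \<comment> \<open>With q the cut-off integral of order gamma of r, the weak identity says that P
   has zero distributional derivative on (0,T).\<close>
 define P where "P x = frac_int_left 0 (1 - gamma) y x - frac_int_left 0 1 q x" for x
 have qm [measurable]: "frac_int_left 0 a q \<in> blm" for a
 using iq by (intro frac_int_left_measurable_real) auto
 have g1: "1 / 2 < 1 - gamma" using gamma by simp
 have sI: "set_integrable lebesgue {c..d} (frac_int_left 0 (1 - gamma) y)" if "0 < c" for c d
 proof (rule set_integrable_bounded[OF fm(1)])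
 fix x assume x: "x \<in> {c..d}"
 then have "0 < x" using that by auto
 have "norm (frac_int_left 0 (1 - gamma) y x) <= (1 / Gamma (1 - gamma)) * sqrt (x powr (2 * (1 - gamma) - 1) / (2 * (1 - gamma) - 1) * (LINT y'|lebesgue. (y y')\<^sup>2))"
 using frac_int_left_half_bound[OF g1 \<open>0 < x\<close> y(1) y0] by simp
 also have "... <= (1 / Gamma (1 - gamma)) * sqrt (d powr (2 * (1 - gamma) - 1) / (2 * (1 - gamma) - 1) * (LINT y'|lebesgue. (y y')\<^sup>2))"
 using x gamma \<open>0 < x\<close> Gamma_real_pos[of "1 - gamma"] by (intro mult_left_mono real_sqrt_le_mono mult_right_mono divide_right_mono powr_mono2) auto
 finally show "norm (frac_int_left 0 (1 - gamma) y x) <= (1 / Gamma (1 - gamma)) * sqrt (d powr (2 * (1 - gamma) - 1) / (2 * (1 - gamma) - 1) * (LINT y'|lebesgue. (y y')\<^sup>2))" .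
 qed
 have sQ: "set_integrable lebesgue {c..d} (frac_int_left 0 1 q)" for c d
 by (rule set_integrable_bounded[OF qm, where B = "LINT y|lebesgue. \<bar>q y\<bar>"])
 (use frac_int_left_bound_ge_1[OF order_refl iq q0'] in \<open>auto simp: frac_int_left_nonpos split: if_splits intro!: order_trans[OF frac_int_left_bound_ge_1[OF order_refl iq q0']]\<close>)
 have sP: "set_integrable lebesgue {c..d} P" if "0 < c" "c < d" "d < T" for c d
 unfolding P_def[abs_def] by (intro set_integral_diff(1) sI sQ that)
 have zero: "(LINT x:{0<..<T}|lebesgue. deriv psi x * P x) = 0" if psi: "test_fun {0<..<T} psi" for psi
 proof -
 note dpsi = test_fun_deriv(3)[OF psi]
 obtain M where M: "!!x. \<bar>psi x\<bar> <= M" using test_funD(7)[OF psi] by auto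
 have i1: "integrable lebesgue (%x. indicator {0<..<T} x *\<^sub>R (deriv psi x *\<^sub>R frac_int_left 0 (1 - gamma) y x))"
 by (rule test_fun_scaleR_integrable[OF dpsi T sI])
 have i2: "integrable lebesgue (%x. indicator {0<..<T} x *\<^sub>R (deriv psi x *\<^sub>R frac_int_left 0 1 q x))"
 by (rule test_fun_scaleR_integrable[OF dpsi T sQ])
 have z: "indicator {0<..<T} x *\<^sub>R (deriv psi x *\<^sub>R v) = deriv psi x * v" for x v
 using test_funD(4)[OF dpsi, of x] by (auto simp: indicator_def)
 have "(LINT x:{0<..<T}|lebesgue. deriv psi x * P x) = (LINT x|lebesgue. deriv psi x * frac_int_left 0 (1 - gamma) y x - deriv psi x * frac_int_left 0 1 q x)"
 unfolding set_lebesgue_integral_def P_def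
 proof (rule Bochner_Integration.integral_cong[OF refl])
 fix x show "indicator {0<..<T} x *\<^sub>R (deriv psi x * (frac_int_left 0 (1 - gamma) y x - frac_int_left 0 1 q x)) = deriv psi x * frac_int_left 0 (1 - gamma) y x - deriv psi x * frac_int_left 0 1 q x"
 using test_funD(4)[OF dpsi, of x] by (cases "x \<in> {0<..<T}") (auto simp: right_diff_distrib)
 qed
 also have "... = (LINT x|lebesgue. deriv psi x * frac_int_left 0 (1 - gamma) y x) - (LINT x|lebesgue. deriv psi x * frac_int_left 0 1 q x)"
 using i1 i2 unfolding z by (rule Bochner_Integration.integral_diff)
 also have "(LINT x|lebesgue. deriv psi x * frac_int_left 0 (1 - gamma) y x) = - (LINT x|lebesgue. psi x * frac_int_left 0 gamma r x)"
 unfolding weak[OF psi] by (subst frac_duality[OF gamma(1) ir r(2) _ _ M]) (use test_funD(4,6)[OF psi] in auto)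
 also have "(LINT x|lebesgue. deriv psi x * frac_int_left 0 1 q x) = - (LINT x|lebesgue. q x * psi x)"
 by (rule integral_deriv_frac_int_one[OF psi iq q0])
 also have "(LINT x|lebesgue. q x * psi x) = (LINT x|lebesgue. psi x * frac_int_left 0 gamma r x)"
 using test_funD(4)[OF psi] by (intro Bochner_Integration.integral_cong) (auto simp: q_def indicator_def)
 finally show ?thesis by simp
 qed
 obtain k where k: "AE x in lebesgue. x \<in> {0<..<T} --> P x = k"
 by (rule du_bois_reymond[OF T sP zero])
 have Q_eq: "frac_int_left 0 1 q x = frac_int_left 0 (1 + gamma) r x" if "x <= T" for x
 unfolding qc[OF that] by (rule frac_int_left_semigroup) (use gamma ir r0 in auto)
 have "k = 0"
 proof (rule ccontr)
 assume k0: "k ~= 0"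
 define b where "b x = (1 / Gamma (1 - gamma)) * sqrt (x powr (2 * (1 - gamma) - 1) / (2 * (1 - gamma) - 1) * (LINT y'|lebesgue. (y y')\<^sup>2))
 + (1 / Gamma (1 + gamma)) * (x powr (1 + gamma - 1) * (LINT y|lebesgue. \<bar>r y\<bar>))" for x :: real
 have Pb: "\<bar>P x\<bar> <= b x" if "x \<in> {0<..<T}" for x
 proof -
 have "\<bar>P x\<bar> <= \<bar>frac_int_left 0 (1 - gamma) y x\<bar> + \<bar>frac_int_left 0 (1 + gamma) r x\<bar>"
 using that by (simp add: P_def Q_eq)
 also have "... <= b x" unfolding b_def
 using that gamma y0 r0 by (intro add_mono frac_int_left_half_bound frac_int_left_bound_ge_1 y ir) auto
 finally show ?thesis .
 qed
 have "(b \<longlongrightarrow> (1 / Gamma (1 - gamma)) * sqrt (0 / (2 * (1 - gamma) - 1) * (LINT y'|lebesgue. (y y')\<^sup>2)) + (1 / Gamma (1 + gamma)) * (0 * (LINT y|lebesgue. \<bar>r y\<bar>))) (at_right 0)"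
 unfolding b_def[abs_def] using gamma
 by (intro tendsto_add tendsto_mult tendsto_const tendsto_real_sqrt tendsto_divide tendsto_powr'[where b = "2 * (1 - gamma) - 1" and a = 0 and f = "%x. x", THEN tendsto_eq_rhs] tendsto_powr'[where b = "1 + gamma - 1" and a = 0 and f = "%x. x", THEN tendsto_eq_rhs])
 (auto simp: eventually_at_right_less intro: eventually_mono[OF eventually_at_right_less])
 then have "(b \<longlongrightarrow> 0) (at_right 0)" by simp
 then have "\<forall>\<^sub>F x in at_right 0. \<bar>b x\<bar> < \<bar>k\<bar>"
 using k0 tendstoD[of b 0 "at_right 0" "\<bar>k\<bar>"] by (simp add: dist_real_def)
 then obtain \<delta> where \<delta>: "0 < \<delta>" "!!x. 0 < x ==> x < \<delta> ==> \<bar>b x\<bar> < \<bar>k\<bar>"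
 unfolding eventually_at_right_field by auto
 obtain x where x: "x \<in> {0<..<min \<delta> T}" "P x = k"
 using AE_interval_exists[OF k, of "min \<delta> T"] \<delta>(1) T by auto
 have "\<bar>b x\<bar> < \<bar>k\<bar>" "\<bar>P x\<bar> <= b x" using \<delta>(2)[of x] Pb[of x] x by auto
 with x show False by auto
 qed
 have AE1: "AE x in lebesgue. x \<in> {0<..<T} --> frac_int_left 0 (1 - gamma) y x = frac_int_left 0 (1 + gamma) r x"
 using k unfolding \<open>k = 0\<close> by eventually_elim (auto simp: P_def Q_eq)
 \<comment> \<open>Now the integral of order 1 - gamma of y equals that of order 1 + gamma of r.
   Integrating once more with order gamma shows that y and u have the same integral of order 1, and
   a distributional derivative then gives y = u. The detour keeps all composed orders at least 1, as
   the semigroup law requires.\<close>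
 define u where "u s = indicator {0<..<T} s * frac_int_left 0 (2 * gamma) r s" for s
 have iu: "integrable lebesgue u" unfolding u_def by (rule cut_int[OF _ ir r(2)]) (use gamma in auto)
 have u0: "u s = 0" if "s \<notin> {0<..<T}" for s using that by (simp add: u_def)
 have I1: "frac_int_left 0 1 (%s. y s - u s) x = 0" if x: "x \<in> {0<..<T}" for x
 proof -
 have "frac_int_left 0 1 y x = frac_int_left 0 gamma (frac_int_left 0 (1 - gamma) y) x"
 using frac_int_left_semigroup[of gamma "1 - gamma" y x] gamma iy y0 by simp
 also have "... = frac_int_left 0 gamma (frac_int_left 0 (1 + gamma) r) x"
 proof (rule frac_int_left_cong)
 show "AE s in lebesgue. s \<in> {0<..<x} --> frac_int_left 0 (1 - gamma) y s = frac_int_left 0 (1 + gamma) r s"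
 using AE1 x by (auto elim!: eventually_mono)
 qed (auto simp: set_borel_measurable_def intro!: borel_measurable_times borel_measurable_indicator)
 also have "... = frac_int_left 0 (gamma + (1 + gamma)) r x"
 by (rule frac_int_left_semigroup) (use gamma ir r0 in auto)
 also have "gamma + (1 + gamma) = 1 + 2 * gamma" by simp
 also have "frac_int_left 0 (1 + 2 * gamma) r x = frac_int_left 0 1 (frac_int_left 0 (2 * gamma) r) x"
 by (rule frac_int_left_semigroup[symmetric]) (use gamma ir r0 in auto)
 also have "... = frac_int_left 0 1 u x"
 using frac_int_left_cutoff[of x T 1 "frac_int_left 0 (2 * gamma) r"] x by (simp add: u_def[abs_def])
 finally have "frac_int_left 0 1 y x = frac_int_left 0 1 u x" .
 then show ?thesis
 using u0 y0 by (subst frac_int_left_diff) (auto intro: rl_kernel_integrable_ge_1(1) iy iu)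
 qed
 have "AE x in lebesgue. x \<in> {0<..<T} --> y x - u x = 0"
 proof (rule fundamental_lemma_vector[OF T])
 show "set_integrable lebesgue {c..d} (%x. y x - u x)" for c d
 unfolding set_integrable_def using iy iu by (intro integrable_mult_indicator Bochner_Integration.integrable_diff) auto
 fix psi assume psi: "test_fun {0<..<T} psi"
 have "(LINT x|lebesgue. deriv psi x * frac_int_left 0 1 (%s. y s - u s) x) = - (LINT x|lebesgue. (y x - u x) * psi x)"
 by (rule integral_deriv_frac_int_one[OF psi]) (use iy iu y(2) u0 in auto)
 moreover have "(LINT x|lebesgue. deriv psi x * frac_int_left 0 1 (%s. y s - u s) x) = (LINT x|(lebesgue::real measure). 0)"
 using I1 test_funD(4)[OF test_fun_deriv(3)[OF psi]] by (intro Bochner_Integration.integral_cong) auto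
 moreover have "(LINT x:{0<..<T}|lebesgue. psi x *\<^sub>R (y x - u x)) = (LINT x|lebesgue. (y x - u x) * psi x)"
 unfolding set_lebesgue_integral_def using test_funD(4)[OF psi]
 by (intro Bochner_Integration.integral_cong) (auto simp: indicator_def)
 ultimately show "(LINT x:{0<..<T}|lebesgue. psi x *\<^sub>R (y x - u x)) = 0" by simp
 qed
 then show ?thesis by (auto elim!: eventually_mono simp: u_def)
qed

section \<open>Uniform estimates for the scalar Volterra equation\<close>

text \<open>The two summands dominate on the two sides of x = lam. Applied with x = |xi|^a this
  interpolates between the L^2 bound and the H^a bound, with the powers of lam that match.\<close>

lemma powr_interpolation:
 fixes x lam :: real
 assumes lam: "0 < lam" and x: "0 <= x" and th: "0 <= theta" "theta <= 1"
 shows "x powr (2 * theta) <= lam powr (2 * theta) + lam powr (2 * theta - 2) * x\<^sup>2"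
proof (cases "x <= lam")
 case True
 then have "x powr (2 * theta) <= lam powr (2 * theta)" using x th by (intro powr_mono2) auto
 then show ?thesis by (simp add: add_increasing2)
next
 case False
 have "x powr (2 * theta) = x powr (2 * theta - 2) * x powr 2" by (subst powr_add[symmetric]) simp
 also have "x powr 2 = x\<^sup>2" using False lam by (simp add: powr_numeral)
 also have "x powr (2 * theta - 2) <= lam powr (2 * theta - 2)" using False lam th by (intro powr_mono2') auto
 finally have "x powr (2 * theta) <= lam powr (2 * theta - 2) * x\<^sup>2" by (simp add: mult_right_mono)
 then show ?thesis by (simp add: add_increasing)
qed

text \<open>Stated for any measurable representative \<open>w\<close>, because the coefficients of
  the solution agree with a fractional integral only almost everywhere.\<close>

lemma frac_int_left_seminorm:
 assumes a: "0 < a" "a < 1 / 2"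
 obtains C where "0 < C" "!!t rho w. sq_integrable rho ==> (!!y. y \<notin> {0<..<t} ==> rho y = 0) ==>
 w \<in> blm ==> (AE s in lebesgue. w s = indicator {0<..<t} s * frac_int_left 0 a rho s) ==>
 (INTP xi. ennreal (\<bar>xi\<bar> powr (2 * a) * (cmod (fourier w xi))\<^sup>2)) <= ennreal C * (INTP y. ennreal ((rho y)\<^sup>2))"
proof -
 obtain C where C: "0 < C" "!!t rho. sq_integrable rho ==> (!!y. y \<notin> {0<..<t} ==> rho y = 0) ==>
 (INTP xi. ennreal (\<bar>xi\<bar> powr (2 * a) * (cmod (fourier (%x. indicator {..<t} x * (LINT y|lebesgue. rl_kernel a (x - y) * rho y)) xi))\<^sup>2))
 <= ennreal C * (INTP y. ennreal ((rho y)\<^sup>2))"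
 by (rule riemann_liouville_seminorm[OF a], rule that, assumption) blast
 have G: "0 < Gamma a" by (rule Gamma_real_pos[OF a(1)])
 define D where "D = (1 / Gamma a)\<^sup>2 * C"
 have D: "0 < D" using G C(1) by (simp add: D_def)
 show ?thesis
 proof (rule that[OF D])
 fix t :: real and rho w :: "real => real"
 assume rho: "sq_integrable rho" "!!y. y \<notin> {0<..<t} ==> rho y = 0" and wm [measurable]: "w \<in> blm"
 and w: "AE s in lebesgue. w s = indicator {0<..<t} s * frac_int_left 0 a rho s"
 have [measurable]: "rho \<in> blm" using rho by (simp add: sq_integrable_def)
 let ?Y = "%x. indicator {..<t} x * (LINT y|lebesgue. rl_kernel a (x - y) * rho y)"
 have Ym: "(%x. LINT y|lebesgue. rl_kernel a (x - y) * rho y) \<in> blm"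
 using rl_convolution_measurable[of rho a] by simp
 have Ym' [measurable]: "?Y \<in> blm" by (intro borel_measurable_times borel_measurable_indicator Ym) auto
 have eq: "indicator {0<..<t} s * frac_int_left 0 a rho s = (1 / Gamma a) * ?Y s" for s
 proof -
 have "frac_int_left 0 a rho s = (1 / Gamma a) * (LINT y|lebesgue. rl_kernel a (s - y) * rho y)"
 by (rule frac_int_left_real) (use rho(2) in auto)
 moreover have "frac_int_left 0 a rho s = 0" if "s <= 0" by (rule frac_int_left_nonpos[OF that])
 ultimately show ?thesis by (cases "0 < s") (auto simp: indicator_def)
 qed
 have "fourier w = fourier (%s. (1 / Gamma a) * ?Y s)"
 by (rule fourier_cong_AE) (use w eq in auto)
 then have "cmod (fourier w xi) = (1 / Gamma a) * cmod (fourier ?Y xi)" for xi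
 using G by (simp only: fourier_scale norm_scaleR) simp
 then have "(INTP xi. ennreal (\<bar>xi\<bar> powr (2 * a) * (cmod (fourier w xi))\<^sup>2))
 = (INTP xi. ennreal ((1 / Gamma a)\<^sup>2) * ennreal (\<bar>xi\<bar> powr (2 * a) * (cmod (fourier ?Y xi))\<^sup>2))"
 by (intro nn_integral_cong) (simp add: ennreal_mult[symmetric] power_mult_distrib mult_ac power_divide)
 also have "... = ennreal ((1 / Gamma a)\<^sup>2) * (INTP xi. ennreal (\<bar>xi\<bar> powr (2 * a) * (cmod (fourier ?Y xi))\<^sup>2))"
 proof (rule nn_integral_cmult)
 note lebesgue_ident_measurable[measurable]
 show "(%xi. ennreal (\<bar>xi\<bar> powr (2 * a) * (cmod (fourier ?Y xi))\<^sup>2)) \<in> blm" by measurable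
 qed
 also have "... <= ennreal ((1 / Gamma a)\<^sup>2) * (ennreal C * (INTP y. ennreal ((rho y)\<^sup>2)))"
 by (intro mult_left_mono C(2) rho) auto
 also have "... = ennreal D * (INTP y. ennreal ((rho y)\<^sup>2))"
 using C(1) by (simp only: D_def ennreal_mult[OF zero_le_power2 less_imp_le] mult.assoc)
 finally show "(INTP xi. ennreal (\<bar>xi\<bar> powr (2 * a) * (cmod (fourier w xi))\<^sup>2)) <= ennreal D * (INTP y. ennreal ((rho y)\<^sup>2))" .
 qed
qed

lemma nn_integral_sq: "sq_integrable f ==> (INTP x. ennreal ((f x)\<^sup>2)) = ennreal (LINT x|lebesgue. (f x)\<^sup>2)"
 by (simp add: sq_integrable_def nn_integral_eq_integral)

text \<open>One constant serves for all lam, t and theta. Independence of lam permits summation over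
  the spectrum, independence of t gives every subinterval, and varying theta gives the different
  seminorms.\<close>

lemma volterra_estimate:
 assumes a: "0 < a" "a < 1 / 2"
 obtains C where "0 < C" "!!lam t y r g theta. 0 < lam ==> sq_integrable r ==> (!!s. s \<notin> {0<..<t} ==> r s = 0) ==>
 sq_integrable y ==> (!!s. s \<notin> {0<..<t} ==> y s = 0) ==> (!!s. g s = r s + lam * y s) ==>
 (AE s in lebesgue. s \<in> {0<..<t} --> y s = frac_int_left 0 a r s) ==> 0 <= theta ==> theta <= 1 ==>
 (INTP xi. ennreal (\<bar>xi\<bar> powr (2 * (theta * a)) * (cmod (fourier y xi))\<^sup>2))
 <= ennreal (C * lam powr (2 * theta - 2)) * (INTP s. ennreal ((g s)\<^sup>2))"
proof -
 obtain C where C: "0 < C" "!!t rho w. sq_integrable rho ==> (!!y. y \<notin> {0<..<t} ==> rho y = 0) ==>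
 w \<in> blm ==> (AE s in lebesgue. w s = indicator {0<..<t} s * frac_int_left 0 a rho s) ==>
 (INTP xi. ennreal (\<bar>xi\<bar> powr (2 * a) * (cmod (fourier w xi))\<^sup>2)) <= ennreal C * (INTP y. ennreal ((rho y)\<^sup>2))"
 by (rule frac_int_left_seminorm[OF a], rule that, assumption) blast
 have pos: "0 < 1 + C" using C(1) by simp
 show ?thesis
 proof (rule that[OF pos])
 fix lam t theta :: real and y r g :: "real => real"
 assume lam: "0 < lam" and r: "sq_integrable r" "!!s. s \<notin> {0<..<t} ==> r s = 0"
 and y: "sq_integrable y" "!!s. s \<notin> {0<..<t} ==> y s = 0" and g: "!!s. g s = r s + lam * y s"
 and eq: "AE s in lebesgue. s \<in> {0<..<t} --> y s = frac_int_left 0 a r s" and th: "0 <= theta" "theta <= 1"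
 note lebesgue_ident_measurable[measurable]
 have [measurable]: "y \<in> blm" using y by (simp add: sq_integrable_def)
 have iy: "integrable lebesgue y" by (rule sq_integrable_imp_integrable[OF y(1), of "{0<..<t}"]) (use y(2) in auto)
 have gs: "sq_integrable g" unfolding g[abs_def] by (intro sq_integrable_add sq_integrable_scale r y)
 define N where "N = (LINT s|lebesgue. (g s)\<^sup>2)"
 have N0: "0 <= N" unfolding N_def by simp
 have a1: "a < 1" using a by simp
 note E = volterra_energy[OF a(1) a1 less_imp_le[OF lam] r y g eq, folded N_def]
 have Y2: "(INTP xi. ennreal ((cmod (fourier y xi))\<^sup>2)) <= ennreal (N / lam\<^sup>2)"
 proof -
 have "(INTP xi. ennreal ((cmod (fourier y xi))\<^sup>2)) <= ennreal (LINT s|lebesgue. (y s)\<^sup>2)"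
 using fourier_bessel[OF iy] nn_integral_sq[OF y(1)] by simp
 also have "... <= ennreal (N / lam\<^sup>2)"
 using E(2) lam by (intro ennreal_leI) (simp add: pos_le_divide_eq mult.commute)
 finally show ?thesis .
 qed
 have Ya: "(INTP xi. ennreal (\<bar>xi\<bar> powr (2 * a) * (cmod (fourier y xi))\<^sup>2)) <= ennreal (C * N)"
 proof -
 have "(INTP xi. ennreal (\<bar>xi\<bar> powr (2 * a) * (cmod (fourier y xi))\<^sup>2)) <= ennreal C * (INTP s. ennreal ((r s)\<^sup>2))"
 by (rule C(2)[OF r]) (use eq y(2) in \<open>auto elim!: eventually_mono simp: indicator_def\<close>)
 also have "... <= ennreal C * ennreal N"
 unfolding nn_integral_sq[OF r(1)] using E(1) by (intro mult_left_mono ennreal_leI) auto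
 finally show ?thesis using C(1) N0 by (simp add: ennreal_mult)
 qed
 have pw: "\<bar>xi\<bar> powr (2 * (theta * a)) * (cmod (fourier y xi))\<^sup>2 <= lam powr (2 * theta) * (cmod (fourier y xi))\<^sup>2 + lam powr (2 * theta - 2) * (\<bar>xi\<bar> powr (2 * a) * (cmod (fourier y xi))\<^sup>2)" for xi
 proof -
 have "\<bar>xi\<bar> powr (2 * (theta * a)) = (\<bar>xi\<bar> powr a) powr (2 * theta)" by (simp add: powr_powr mult_ac)
 also have "... <= lam powr (2 * theta) + lam powr (2 * theta - 2) * (\<bar>xi\<bar> powr a)\<^sup>2"
 by (rule powr_interpolation[OF lam _ th]) simp
 also have "(\<bar>xi\<bar> powr a)\<^sup>2 = \<bar>xi\<bar> powr (2 * a)" by (simp add: power2_eq_square powr_add[symmetric])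
 finally have "\<bar>xi\<bar> powr (2 * (theta * a)) <= lam powr (2 * theta) + lam powr (2 * theta - 2) * \<bar>xi\<bar> powr (2 * a)" .
 from mult_right_mono[OF this, of "(cmod (fourier y xi))\<^sup>2"] show ?thesis
 by (simp add: distrib_right mult.assoc)
 qed
 have "(INTP xi. ennreal (\<bar>xi\<bar> powr (2 * (theta * a)) * (cmod (fourier y xi))\<^sup>2))
 <= (INTP xi. ennreal (lam powr (2 * theta)) * ennreal ((cmod (fourier y xi))\<^sup>2) + ennreal (lam powr (2 * theta - 2)) * ennreal (\<bar>xi\<bar> powr (2 * a) * (cmod (fourier y xi))\<^sup>2))"
 using pw by (intro nn_integral_mono) (simp add: ennreal_leI flip: ennreal_plus ennreal_mult)
 also have "... = ennreal (lam powr (2 * theta)) * (INTP xi. ennreal ((cmod (fourier y xi))\<^sup>2)) + ennreal (lam powr (2 * theta - 2)) * (INTP xi. ennreal (\<bar>xi\<bar> powr (2 * a) * (cmod (fourier y xi))\<^sup>2))"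
 by (subst nn_integral_add, measurable, intro arg_cong2[where f = plus] nn_integral_cmult; measurable)
 also have "... <= ennreal (lam powr (2 * theta)) * ennreal (N / lam\<^sup>2) + ennreal (lam powr (2 * theta - 2)) * ennreal (C * N)"
 by (intro add_mono mult_left_mono Y2 Ya) auto
 also have "... = ennreal (lam powr (2 * theta) * (N / lam\<^sup>2) + lam powr (2 * theta - 2) * (C * N))"
 using N0 C(1) lam by (simp add: ennreal_mult[symmetric] ennreal_plus[symmetric] del: ennreal_plus)
 also have "lam powr (2 * theta) * (N / lam\<^sup>2) + lam powr (2 * theta - 2) * (C * N) = (1 + C) * lam powr (2 * theta - 2) * N"
 using lam by (simp add: powr_diff powr_numeral field_simps)
 also have "ennreal ((1 + C) * lam powr (2 * theta - 2) * N) = ennreal ((1 + C) * lam powr (2 * theta - 2)) * (INTP s. ennreal ((g s)\<^sup>2))"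
 unfolding nn_integral_sq[OF gs] N_def[symmetric] using C(1) N0 by (intro ennreal_mult) auto
 finally show "(INTP xi. ennreal (\<bar>xi\<bar> powr (2 * (theta * a)) * (cmod (fourier y xi))\<^sup>2))
 <= ennreal ((1 + C) * lam powr (2 * theta - 2)) * (INTP s. ennreal ((g s)\<^sup>2))" .
 qed
qed

section \<open>Existence of the fractional derivative\<close>

text \<open>Riesz representation for a functional given by its graph over a subspace that need not
  be closed; the bound makes the graph single-valued. A minimizing sequence of |v|^2 / 2 - l over
  the graph is Cauchy by the parallelogram identity, and its limit represents the functional. The
  graph form suits functionals defined on test functions, which embed into L^2 as classes.\<close>

lemma riesz_graph:
 fixes S :: "('h::{real_inner, banach} \<times> real) set"
 assumes sub: "subspace S" and b: "!!v l. (v, l) \<in> S ==> \<bar>l\<bar> <= M * norm v" and M: "0 <= M"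
 obtains g where "!!v l. (v, l) \<in> S ==> l = g \<bullet> v" "norm g <= M"
proof -
 define J where "J p = (fst p \<bullet> fst p) / 2 - snd p" for p :: "'h \<times> real"
 have Jb: "- (M\<^sup>2 / 2) <= J p" if "p \<in> S" for p
 proof -
 have "snd p <= M * norm (fst p)" using b[of "fst p" "snd p"] that by simp
 moreover have "0 <= (norm (fst p) - M)\<^sup>2" by simp
 ultimately show ?thesis by (simp add: J_def power2_diff dot_square_norm mult.commute)
 qed
 define m where "m = Inf (J ` S)"
 have ne: "J ` S ~= {}" using subspace_0[OF sub] by auto
 have bdd: "bdd_below (J ` S)" using Jb by (auto intro!: bdd_belowI)
 have mle: "m <= J p" if "p \<in> S" for p unfolding m_def using that bdd by (intro cInf_lower) auto
 have "\<exists>p\<in>S. J p < m + inverse (Suc n)" for n :: nat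
 proof -
 have "Inf (J ` S) < m + inverse (Suc n)" by (simp add: m_def)
 then show ?thesis using cInf_lessD[OF ne] by auto
 qed
 then obtain p where p: "!!n. p n \<in> S" "!!n::nat. J (p n) < m + inverse (Suc n)" by metis
 define v where "v n = fst (p n)" for n
 define l where "l n = snd (p n)" for n
 have Jlim: "(%n. J (p n)) \<longlonglongrightarrow> m"
 proof (rule tendsto_sandwich[OF _ _ tendsto_const])
 show "\<forall>\<^sub>F n in sequentially. m <= J (p n)" using mle p(1) by simp
 show "\<forall>\<^sub>F n in sequentially. J (p n) <= m + inverse (Suc n)" using p(2) by (simp add: less_imp_le)
 show "(%n. m + inverse (real (Suc n))) \<longlonglongrightarrow> m"
 using tendsto_add[OF tendsto_const LIMSEQ_inverse_real_of_nat, of m] by simp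
 qed
 have par: "(norm (v n - v k))\<^sup>2 <= 4 * (inverse (Suc n) + inverse (Suc k))" for n k
 proof -
 have "(1 / 2) *\<^sub>R (p n + p k) \<in> S" using sub p(1) by (intro subspace_scale subspace_add)
 then have "m <= J ((1 / 2) *\<^sub>R (p n + p k))" by (rule mle)
 moreover have "J (p n) + J (p k) - 2 * J ((1 / 2) *\<^sub>R (p n + p k)) = (norm (v n - v k))\<^sup>2 / 4"
 by (simp add: J_def v_def power2_norm_eq_inner inner_add inner_diff inner_commute field_simps)
 ultimately show ?thesis using p(2)[of n] p(2)[of k] by simp
 qed
 have "Cauchy v"
 proof (rule CauchyI)
 fix e :: real assume e: "0 < e"
 obtain N where N: "inverse (real (Suc N)) < e\<^sup>2 / 8" using reals_Archimedean[of "e\<^sup>2 / 8"] e by auto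
 have "norm (v n - v k) < e" if "n \<ge> N" "k \<ge> N" for n k
 proof -
 have "inverse (real (Suc n)) <= inverse (real (Suc N))" "inverse (real (Suc k)) <= inverse (real (Suc N))"
 using that by (auto intro!: le_imp_inverse_le)
 then have "4 * (inverse (real (Suc n)) + inverse (real (Suc k))) <= 4 * (inverse (real (Suc N)) + inverse (real (Suc N)))"
 by (intro mult_left_mono add_mono) auto
 also have "... < e\<^sup>2" using N by simp
 finally have "(norm (v n - v k))\<^sup>2 < e\<^sup>2" using par[of n k] by simp
 then show ?thesis using e by (simp add: power2_less_imp_less)
 qed
 then show "\<exists>N. \<forall>n\<ge>N. \<forall>k\<ge>N. norm (v n - v k) < e" by blast
 qed
 then obtain g where g: "v \<longlonglongrightarrow> g" using convergent_eq_Cauchy[of v] by blast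
 have rep: "c = g \<bullet> w" if wc: "(w, c) \<in> S" for w c
 proof -
 \<comment> \<open>First variation: the minimizing sequence is perturbed in the direction (w, c),
   and the limit is taken along the sequence.\<close>
 have q: "0 <= s * (g \<bullet> w - c) + s\<^sup>2 * (w \<bullet> w) / 2" for s :: real
 proof -
 have A: "(%n. J (p n) + (s * (v n \<bullet> w - c) + s\<^sup>2 * (w \<bullet> w) / 2)) \<longlonglongrightarrow> m + (s * (g \<bullet> w - c) + s\<^sup>2 * (w \<bullet> w) / 2)"
 by (intro tendsto_intros Jlim g)
 have B: "m <= J (p n) + (s * (v n \<bullet> w - c) + s\<^sup>2 * (w \<bullet> w) / 2)" for n
 proof -
 have "p n + s *\<^sub>R (w, c) \<in> S" using sub p(1) wc by (intro subspace_scale subspace_add)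
 then have "m <= J (p n + s *\<^sub>R (w, c))" by (rule mle)
 also have "... = J (p n) + (s * (v n \<bullet> w - c) + s\<^sup>2 * (w \<bullet> w) / 2)"
 by (simp add: J_def v_def inner_add inner_commute power2_eq_square field_simps)
 finally show ?thesis .
 qed
 have "m <= m + (s * (g \<bullet> w - c) + s\<^sup>2 * (w \<bullet> w) / 2)"
 by (rule tendsto_lowerbound[OF A always_eventually[OF allI[OF B]]]) simp
 then show ?thesis by simp
 qed
 define d where "d = g \<bullet> w - c"
 \<comment> \<open>The added 1 keeps the denominator of the step -(d / W) positive when w =
   0.\<close>
 define W where "W = w \<bullet> w + 1"
 have W: "0 < W" unfolding W_def using inner_ge_zero[of w] by linarith
 have "0 <= (- (d / W)) * d + (- (d / W))\<^sup>2 * (w \<bullet> w) / 2" unfolding d_def by (rule q)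
 also have "... <= (- (d / W)) * d + (- (d / W))\<^sup>2 * W / 2"
 by (intro add_left_mono divide_right_mono mult_left_mono) (auto simp: W_def)
 also have "... = - (d\<^sup>2 / (2 * W))" using W by (simp add: power2_eq_square field_simps)
 finally have "d\<^sup>2 / (2 * W) <= 0" by simp
 then have "d = 0" using W by (simp add: divide_le_0_iff)
 then show ?thesis by (simp add: d_def)
 qed
 have "norm g <= M"
 proof -
 have "(%n. g \<bullet> v n) \<longlonglongrightarrow> g \<bullet> g" by (intro tendsto_intros g)
 moreover have "(%n. M * norm (v n)) \<longlonglongrightarrow> M * norm g" by (intro tendsto_intros g)
 moreover have "g \<bullet> v n <= M * norm (v n)" for n
 using b[of "v n" "l n"] rep[of "v n" "l n"] p(1)[of n] by (simp add: v_def l_def)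
 ultimately have "g \<bullet> g <= M * norm g" by (intro LIMSEQ_le) auto
 then have "norm g * norm g <= M * norm g" by (simp add: power2_norm_eq_inner[symmetric] power2_eq_square)
 then show ?thesis using M by (cases "norm g = 0") auto
 qed
 with rep show ?thesis by (rule that)
qed

text \<open>On \<open>(0,T)\<close> the kernel of \<open>I\<^bsup>1-gamma\<^esup>\<close> may be truncated at \<open>T\<close>; its Fourier transform is an
 oscillatory integral of size \<open>|xi| powr (gamma - 1)\<close>, so Parseval bounds the pairing of
 \<open>I\<^bsup>1-gamma\<^esup> y\<close> with \<open>psi'\<close> by the \<open>H\<^sup>gamma\<close> seminorm of \<open>y\<close> and the \<open>L\<^sup>2\<close> norm of \<open>psi\<close>.\<close>

lemma frac_deriv_functional_bound:
 assumes gamma: "0 < gamma" "gamma < 1"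
 obtains C where "0 < C" "!!T y psi. 0 < T ==> sq_integrable y ==> (!!s. s \<notin> {0<..<T} ==> y s = 0) ==> test_fun {0<..<T} psi ==>
 (ennreal \<bar>LINT x|lebesgue. deriv psi x * frac_int_left 0 (1 - gamma) y x\<bar>)\<^sup>2
 <= ennreal C * (INTP xi. ennreal (\<bar>xi\<bar> powr (2 * gamma) * (cmod (fourier y xi))\<^sup>2)) * (INTP x. ennreal ((psi x)\<^sup>2))"
proof -
 define a where "a = 1 - gamma"
 have a: "0 < a" "a < 1" using gamma by (auto simp: a_def)
 define B where "B = 1 / a + 8"
 have B: "0 < B" using a by (simp add: B_def add_pos_pos)
 have G: "0 < Gamma a" by (rule Gamma_real_pos[OF a(1)])
 define C where "C = (B / Gamma a)\<^sup>2"
 have C: "0 < C" using B G by (simp add: C_def)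
 show ?thesis
 proof (rule that[OF C])
 fix T :: real and y psi :: "real => real"
 assume T: "0 < T" and y: "sq_integrable y" "!!s. s \<notin> {0<..<T} ==> y s = 0" and psi: "test_fun {0<..<T} psi"
 note lebesgue_proj_measurable[measurable] lebesgue_ident_measurable[measurable]
 have ym [measurable]: "y \<in> blm" using y by (simp add: sq_integrable_def)
 have iy: "integrable lebesgue y" by (rule sq_integrable_imp_integrable[OF y(1), of "{0<..<T}"]) (use y(2) in auto)
 note dpsi = test_fun_deriv(3)[OF psi]
 define D where "D = deriv psi"
 have iD: "integrable lebesgue D" and cD: "continuous_on UNIV D" and D0: "!!x. x \<notin> {0<..<T} ==> D x = 0" and mD [measurable]: "D \<in> borel_measurable borel"
 using test_funD[OF dpsi] by (auto simp: D_def)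
 obtain M where M: "!!x. \<bar>D x\<bar> <= M" using test_funD(7)[OF dpsi] by (auto simp: D_def)
 have M0: "0 <= M" using M[of 0] by simp
 \<comment> \<open>Cut off at T the kernel is integrable, so correlation with it preserves
   integrability, continuity and boundedness of D.\<close>
 define k where "k s = indicator {..<T} s * rl_kernel a s" for s
 have ik: "integrable lebesgue k" unfolding k_def by (rule rl_kernel_integrable[OF a(1)])
 have k0: "0 <= k s" for s by (simp add: k_def)
 have mk [measurable]: "k \<in> borel_measurable borel" unfolding k_def[abs_def] by measurable
 have mkl [measurable]: "k \<in> blm" and mDl: "D \<in> blm"
 using ik iD by auto
 define \<Psi> where "\<Psi> x = (LINT s|lebesgue. k s * D (x + s))" for x
 have mDs [measurable]: "(%s. D (x + s)) \<in> blm" for x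
 proof -
 have "(%s. D (x + s)) \<in> borel_measurable borel"
 by (intro borel_measurable_continuous_onI continuous_on_compose2[OF cD]) (auto intro!: continuous_intros)
 then show ?thesis by (intro measurable_completion) simp
 qed
 have ikD: "integrable lebesgue (%s. k s * D (x + s))" for x
 by (rule Bochner_Integration.integrable_bound[OF integrable_mult_right[OF ik, of M]])
 (measurable, use M M0 k0 in \<open>auto simp: abs_mult mult.commute[of "k _"] intro!: mult_right_mono\<close>)
 have pairI: "integrable (lebesgue \<Otimes>\<^sub>M lebesgue) (%(x, s). D (x + s) *\<^sub>R k s)"
 proof (rule pair_kernel_integrable[OF _ ik])
 show "(%(x, s). D (x + s)) \<in> borel_measurable (lebesgue \<Otimes>\<^sub>M lebesgue)" by measurable
 fix s :: real
 have m: "(%x. ennreal \<bar>D x\<bar>) \<in> blm" using mDl by measurable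
 have "(INTP x. ennreal \<bar>D (x + s)\<bar>) = (INTP x. ennreal \<bar>D x\<bar>)"
 using nn_integral_real_affine_lebesgue[OF m, of 1 s] by (simp add: add.commute)
 then show "(INTP x. ennreal \<bar>D (x + s)\<bar>) <= ennreal (LINT x|lebesgue. \<bar>D x\<bar>)"
 using iD by (simp add: nn_integral_eq_integral)
 qed
 have i\<Psi>: "integrable lebesgue \<Psi>"
 using lebesgue_pair.integrable_fst'[OF pairI] unfolding \<Psi>_def by (simp add: mult.commute)
 have c\<Psi>: "continuous_on UNIV \<Psi>"
 unfolding continuous_on_sequentially
 proof (intro allI ballI impI, elim conjE)
 fix X :: "nat => real" and x assume X: "X \<longlonglongrightarrow> x"
 have "(%n. LINT s|lebesgue. k s * D (X n + s)) \<longlonglongrightarrow> (LINT s|lebesgue. k s * D (x + s))"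
 proof (rule integral_dominated_convergence[where w = "%s. M * k s"])
 show "AE s in lebesgue. (%n. k s * D (X n + s)) \<longlonglongrightarrow> k s * D (x + s)"
 proof (intro AE_I2 tendsto_mult tendsto_const)
 fix s
 have "isCont D (x + s)" using cD by (simp add: continuous_on_eq_continuous_at)
 moreover have "(%n. X n + s) \<longlonglongrightarrow> x + s" by (intro tendsto_intros X)
 ultimately show "(%n. D (X n + s)) \<longlonglongrightarrow> D (x + s)" by (rule isCont_tendsto_compose)
 qed
 show "AE s in lebesgue. norm (k s * D (X n + s)) <= M * k s" for n
 using M k0 by (auto simp: abs_mult mult.commute[of "k _"] intro!: mult_right_mono)
 show "integrable lebesgue (%s. M * k s)" using ik by simp
 qed measurable
 then show "(\<Psi> \<circ> X) \<longlonglongrightarrow> \<Psi> x" by (simp add: \<Psi>_def o_def)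
 qed
 have b\<Psi>: "\<bar>\<Psi> x\<bar> <= M * (LINT s|lebesgue. k s)" for x
 proof -
 have "\<bar>\<Psi> x\<bar> <= (LINT s|lebesgue. \<bar>k s * D (x + s)\<bar>)" unfolding \<Psi>_def by (rule integral_abs_bound)
 also have "... <= (LINT s|lebesgue. M * k s)"
 proof (rule integral_mono)
 show "integrable lebesgue (%s. \<bar>k s * D (x + s)\<bar>)" using ikD by (rule integrable_abs)
 qed (use ik M k0 in \<open>auto simp: abs_mult mult.commute[of "k _"] intro!: mult_right_mono\<close>)
 finally show ?thesis by simp
 qed
 have F\<Psi>: "fourier \<Psi> xi = osc_integral a (- xi) T * fourier D xi" for xi
 proof -
 let ?H = "%x s. (D (x + s) * k s) *\<^sub>R cis (- (x * xi))"
 have int: "integrable (lebesgue \<Otimes>\<^sub>M lebesgue) (%(x, s). ?H x s)"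
 by (rule Bochner_Integration.integrable_bound[OF pairI]) (measurable, auto)
 have "(LINT x|lebesgue. \<Psi> x *\<^sub>R cis (- (x * xi))) = (LINT x|lebesgue. LINT s|lebesgue. ?H x s)"
 unfolding \<Psi>_def by (simp only: scaleR_conv_of_real integral_mult_left_zero integral_complex_of_real mult.commute[of "k _"])
 also have "... = (LINT s|lebesgue. LINT x|lebesgue. ?H x s)"
 using lebesgue_pair.Fubini_integral[OF int] by simp
 also have "... = (LINT s|lebesgue. (k s *\<^sub>R cis (- (s * - xi))) * (LINT x|lebesgue. D x *\<^sub>R cis (- (x * xi))))"
 proof (rule Bochner_Integration.integral_cong[OF refl])
 fix s :: real
 have "(LINT x|lebesgue. D x *\<^sub>R cis (- (x * xi))) = (LINT x|lebesgue. D (s + x) *\<^sub>R cis (- ((s + x) * xi)))"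
 by (subst lebesgue_integral_real_affine[of 1 _ s]) auto
 then have "(k s *\<^sub>R cis (- (s * - xi))) * (LINT x|lebesgue. D x *\<^sub>R cis (- (x * xi)))
 = (LINT x|lebesgue. (k s *\<^sub>R cis (- (s * - xi))) * (D (s + x) *\<^sub>R cis (- ((s + x) * xi))))"
 by (simp only: integral_mult_right_zero)
 also have "... = (LINT x|lebesgue. ?H x s)"
 proof (rule Bochner_Integration.integral_cong[OF refl])
 fix x
 have "cis (- (s * - xi)) * cis (- ((s + x) * xi)) = cis (- (x * xi))" by (simp add: cis_mult algebra_simps)
 then show "(k s *\<^sub>R cis (- (s * - xi))) * (D (s + x) *\<^sub>R cis (- ((s + x) * xi))) = ?H x s"
 by (simp add: add.commute mult.commute)
 qed
 finally show "(LINT x|lebesgue. ?H x s) = (k s *\<^sub>R cis (- (s * - xi))) * (LINT x|lebesgue. D x *\<^sub>R cis (- (x * xi)))" ..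
 qed
 also have "... = osc_integral a (- xi) T * (LINT x|lebesgue. D x *\<^sub>R cis (- (x * xi)))"
 unfolding osc_integral_def k_def by (rule integral_mult_left_zero)
 finally show ?thesis unfolding fourier_def by simp
 qed
 have FD: "fourier D xi = (\<i> * xi) * fourier psi xi" for xi
 using fourier_partial[OF psi, of 1 xi] unfolding test_fun_deriv(2)[OF psi] D_def by simp
 \<comment> \<open>For x in (0,T) the cut of the kernel at T changes nothing, because D vanishes
   from T on.\<close>
 have eqR: "y x * frac_int_right T a D x = (1 / Gamma a) * (y x * \<Psi> x)" for x
 proof (cases "x \<in> {0<..<T}")
 case True
 have "(LINT s|lebesgue. rl_kernel a (s - x) *\<^sub>R (indicator {..<T} s *\<^sub>R D s)) = (LINT s|lebesgue. rl_kernel a s *\<^sub>R (indicator {..<T} (x + s) *\<^sub>R D (x + s)))"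
 by (subst lebesgue_integral_real_affine[of 1 _ x]) auto
 also have "... = \<Psi> x"
 unfolding \<Psi>_def
 proof (rule Bochner_Integration.integral_cong[OF refl])
 fix s show "rl_kernel a s *\<^sub>R (indicator {..<T} (x + s) *\<^sub>R D (x + s)) = k s * D (x + s)"
 using True D0[of "x + s"] by (cases "0 < s \<and> s < T") (auto simp: k_def indicator_def rl_kernel_def)
 qed
 finally show ?thesis unfolding frac_int_right_kernel by simp
 qed (simp add: y(2))
 have "(LINT x|lebesgue. D x * frac_int_left 0 a y x) = (LINT x|lebesgue. y x * frac_int_right T a D x)"
 by (rule frac_duality[OF a(1) iy y(2) mDl _ M]) (use D0 in auto)
 also have "... = (1 / Gamma a) * (LINT x|lebesgue. y x * \<Psi> x)" unfolding eqR by (rule integral_mult_right_zero)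
 finally have dual: "(LINT x|lebesgue. D x * frac_int_left 0 a y x) = (1 / Gamma a) * (LINT x|lebesgue. y x * \<Psi> x)" .
 let ?f = "%xi. ennreal (\<bar>xi\<bar> powr gamma * cmod (fourier y xi))" and ?g = "%xi. ennreal (B * cmod (fourier psi xi))"
 have mpsi [measurable]: "psi \<in> blm" using test_funD(6)[OF psi] by auto
 have "ennreal \<bar>LINT x|lebesgue. y x * \<Psi> x\<bar> <= (INTP xi. ennreal (cmod (fourier y xi) * cmod (fourier \<Psi> xi)))"
 by (rule fourier_parseval_le[OF iy i\<Psi> c\<Psi> b\<Psi>])
 also have "... <= (INTP xi. ?f xi * ?g xi)"
 proof (rule nn_integral_mono_AE, use lebesgue_singleton_AE[of 0] in eventually_elim)
 case (elim xi)
 have "cmod (fourier \<Psi> xi) = cmod (osc_integral a (- xi) T) * (\<bar>xi\<bar> * cmod (fourier psi xi))"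
 unfolding F\<Psi> FD by (simp add: norm_mult)
 also have "... <= (B * \<bar>- xi\<bar> powr (- a)) * (\<bar>xi\<bar> * cmod (fourier psi xi))"
 unfolding B_def using elim T a by (intro mult_right_mono osc_integral_bound) auto
 also have "... = \<bar>xi\<bar> powr gamma * (B * cmod (fourier psi xi))"
 using elim powr_mult_base[of "\<bar>xi\<bar>" "- a"] by (simp add: a_def mult_ac)
 finally have "cmod (fourier y xi) * cmod (fourier \<Psi> xi) <= cmod (fourier y xi) * (\<bar>xi\<bar> powr gamma * (B * cmod (fourier psi xi)))"
 by (rule mult_left_mono) simp
 then show ?case using B by (simp add: ennreal_mult[symmetric] ennreal_leI mult_ac)
 qed
 finally have "(ennreal \<bar>LINT x|lebesgue. y x * \<Psi> x\<bar>)\<^sup>2 <= (INTP xi. ?f xi * ?g xi)\<^sup>2"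
 by (rule power_mono) simp
 also have "... <= (INTP xi. (?f xi)\<^sup>2) * (INTP xi. (?g xi)\<^sup>2)"
 by (rule Cauchy_Schwarz_nn_integral) measurable
 also have "(INTP xi. (?f xi)\<^sup>2) = (INTP xi. ennreal (\<bar>xi\<bar> powr (2 * gamma) * (cmod (fourier y xi))\<^sup>2))"
 by (intro nn_integral_cong) (simp add: ennreal_power power_mult_distrib power2_eq_square[of "_ powr _"] powr_add[symmetric])
 also have "(INTP xi. (?g xi)\<^sup>2) = ennreal (B\<^sup>2) * (INTP xi. ennreal ((cmod (fourier psi xi))\<^sup>2))"
 using B by (subst nn_integral_cmult[symmetric]) (measurable, simp add: ennreal_power power_mult_distrib ennreal_mult[symmetric])
 also have "(INTP xi. ennreal (\<bar>xi\<bar> powr (2 * gamma) * (cmod (fourier y xi))\<^sup>2)) * (ennreal (B\<^sup>2) * (INTP xi. ennreal ((cmod (fourier psi xi))\<^sup>2)))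
 <= (INTP xi. ennreal (\<bar>xi\<bar> powr (2 * gamma) * (cmod (fourier y xi))\<^sup>2)) * (ennreal (B\<^sup>2) * (INTP x. ennreal ((psi x)\<^sup>2)))"
 by (intro mult_left_mono fourier_bessel test_funD(6)[OF psi]) auto
 finally have fin: "(ennreal \<bar>LINT x|lebesgue. y x * \<Psi> x\<bar>)\<^sup>2 <= (INTP xi. ennreal (\<bar>xi\<bar> powr (2 * gamma) * (cmod (fourier y xi))\<^sup>2)) * (ennreal (B\<^sup>2) * (INTP x. ennreal ((psi x)\<^sup>2)))" .
 have "(ennreal \<bar>LINT x|lebesgue. D x * frac_int_left 0 a y x\<bar>)\<^sup>2 = ennreal ((1 / Gamma a)\<^sup>2) * (ennreal \<bar>LINT x|lebesgue. y x * \<Psi> x\<bar>)\<^sup>2"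
 unfolding dual using G by (simp add: ennreal_power abs_mult power_mult_distrib ennreal_mult[symmetric] power_divide)
 also have "... <= ennreal ((1 / Gamma a)\<^sup>2) * ((INTP xi. ennreal (\<bar>xi\<bar> powr (2 * gamma) * (cmod (fourier y xi))\<^sup>2)) * (ennreal (B\<^sup>2) * (INTP x. ennreal ((psi x)\<^sup>2))))"
 by (rule mult_left_mono[OF fin]) simp
 also have "... = (ennreal ((1 / Gamma a)\<^sup>2) * ennreal (B\<^sup>2)) * (INTP xi. ennreal (\<bar>xi\<bar> powr (2 * gamma) * (cmod (fourier y xi))\<^sup>2)) * (INTP x. ennreal ((psi x)\<^sup>2))"
 by (simp only: ac_simps)
 also have "ennreal ((1 / Gamma a)\<^sup>2) * ennreal (B\<^sup>2) = ennreal C"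
 unfolding C_def by (subst ennreal_mult[symmetric]) (auto simp: power_divide)
 finally show "(ennreal \<bar>LINT x|lebesgue. deriv psi x * frac_int_left 0 (1 - gamma) y x\<bar>)\<^sup>2
 <= ennreal C * (INTP xi. ennreal (\<bar>xi\<bar> powr (2 * gamma) * (cmod (fourier y xi))\<^sup>2)) * (INTP x. ennreal ((psi x)\<^sup>2))"
 unfolding D_def a_def .
 qed
qed

lemma inner_abs_L2:
 assumes "sq_integrable f" "sq_integrable h"
 shows "abs_L2 f \<bullet> abs_L2 h = (LINT x|lebesgue. f x * h x)"
 unfolding inner_L2_def
proof (rule integral_cong_AE)
 show "AE x in lebesgue. rep_L2 (abs_L2 f) x * rep_L2 (abs_L2 h) x = f x * h x"
 using rep_abs_L2[OF assms(1)] rep_abs_L2[OF assms(2)] by eventually_elim simp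
qed (use assms in \<open>auto simp: sq_integrable_def\<close>)

lemma inner_abs_L2_right:
 assumes "sq_integrable f"
 shows "v \<bullet> abs_L2 f = (LINT x|lebesgue. rep_L2 v x * f x)"
 using inner_abs_L2[OF sq_integrable_rep assms, of v] by simp

lemma norm_abs_L2: "sq_integrable f ==> (norm (abs_L2 f))\<^sup>2 = (LINT x|lebesgue. (f x)\<^sup>2)"
 unfolding power2_norm_eq_inner by (simp add: inner_abs_L2 power2_eq_square)

lemma abs_L2_add: "sq_integrable f ==> sq_integrable h ==> abs_L2 f + abs_L2 h = abs_L2 (%x. f x + h x)"
proof (rule L2_eqI)
 assume f: "sq_integrable f" "sq_integrable h"
 show "AE x in lebesgue. rep_L2 (abs_L2 f + abs_L2 h) x = rep_L2 (abs_L2 (%x. f x + h x)) x"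
 using rep_L2_add[of "abs_L2 f" "abs_L2 h"] rep_abs_L2[OF f(1)] rep_abs_L2[OF f(2)] rep_abs_L2[OF sq_integrable_add[OF f]]
 by eventually_elim simp
qed

lemma abs_L2_scale: "sq_integrable f ==> c *\<^sub>R abs_L2 f = abs_L2 (%x. c * f x)"
proof (rule L2_eqI)
 assume f: "sq_integrable f"
 show "AE x in lebesgue. rep_L2 (c *\<^sub>R abs_L2 f) x = rep_L2 (abs_L2 (%x. c * f x)) x"
 using rep_L2_scale[of c "abs_L2 f"] rep_abs_L2[OF f] rep_abs_L2[OF sq_integrable_scale[OF f, of c]]
 by eventually_elim simp
qed

lemma set_integrable_frac_int_left:
 fixes u :: "real => 'b::{banach, second_countable_topology}"
 assumes a: "1 / 2 < a" and um: "u \<in> blm" "!!s. s <= 0 ==> u s = 0"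
 and fin: "(INTP s. ennreal ((norm (u s))\<^sup>2)) < \<infinity>"
 shows "integrable lebesgue (%s. rl_kernel a (x - s) *\<^sub>R u s)" "0 < c ==> set_integrable lebesgue {c..d} (frac_int_left 0 a u)"
proof -
 have [measurable]: "u \<in> blm" by (rule um)
 have km [measurable]: "(%s. rl_kernel a (x - s)) \<in> blm" for x
 by (rule measurable_completion) measurable
 have a0: "0 < a" using a by simp
 have G: "0 < Gamma a" by (rule Gamma_real_pos[OF a0])
 define N where "N = enn2real (INTP s. ennreal ((norm (u s))\<^sup>2))"
 have N: "(INTP s. ennreal ((norm (u s))\<^sup>2)) = ennreal N" "0 <= N"
 using fin by (auto simp: N_def)
 have cs: "(INTP s. ennreal (norm (rl_kernel a (x - s) *\<^sub>R u s)))\<^sup>2 <= ennreal (x powr (2 * a - 1) / (2 * a - 1) * N)" if "0 < x" for x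
 using rl_kernel_cauchy_schwarz[OF a that, of "%s. norm (u s)"] um(2) N a by (simp add: ennreal_mult[symmetric])
 have int: "integrable lebesgue (%s. rl_kernel a (x - s) *\<^sub>R u s)" if "0 < x" for x
 proof (rule integrableI_bounded)
 have "(INTP s. ennreal (norm (rl_kernel a (x - s) *\<^sub>R u s)))\<^sup>2 < \<infinity>"
 using cs[OF that] by (rule le_less_trans) simp
 then show "(INTP s. ennreal (norm (rl_kernel a (x - s) *\<^sub>R u s))) < \<infinity>"
 by (auto simp: power2_eq_square ennreal_mult_less_top less_top)
 qed measurable
 show "integrable lebesgue (%s. rl_kernel a (x - s) *\<^sub>R u s)"
 proof (cases "0 < x")
 case False
 then have "(%s. rl_kernel a (x - s) *\<^sub>R u s) = (%s. 0)"
 using um(2) by (auto simp: rl_kernel_def fun_eq_iff)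
 then show ?thesis by simp
 qed (rule int)
 assume c: "0 < c"
 have e: "indicator {0<..} s *\<^sub>R u s = u s" for s using um(2)[of s] by (auto simp: indicator_def)
 show "set_integrable lebesgue {c..d} (frac_int_left 0 a u)"
 proof (rule set_integrable_bounded)
 show "frac_int_left 0 a u \<in> blm" by (rule frac_int_left_measurable) (simp only: e um)
 fix x assume x: "x \<in> {c..d}"
 then have x0: "0 < x" using c by auto
 have "(ennreal (norm (LINT s|lebesgue. rl_kernel a (x - s) *\<^sub>R u s)))\<^sup>2 <= (INTP s. ennreal (norm (rl_kernel a (x - s) *\<^sub>R u s)))\<^sup>2"
 by (intro power_mono norm_integral_le_nn_integral) simp
 also have "... <= ennreal (x powr (2 * a - 1) / (2 * a - 1) * N)" by (rule cs[OF x0])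
 also have "... <= ennreal (d powr (2 * a - 1) / (2 * a - 1) * N)"
 using x x0 a N by (intro ennreal_leI mult_right_mono divide_right_mono powr_mono2) auto
 finally have "(norm (LINT s|lebesgue. rl_kernel a (x - s) *\<^sub>R u s))\<^sup>2 <= d powr (2 * a - 1) / (2 * a - 1) * N"
 using a N by (simp add: ennreal_power ennreal_le_iff)
 then have "norm (LINT s|lebesgue. rl_kernel a (x - s) *\<^sub>R u s) <= sqrt (d powr (2 * a - 1) / (2 * a - 1) * N)"
 by (rule real_le_rsqrt)
 then show "norm (frac_int_left 0 a u x) <= (1 / Gamma a) * sqrt (d powr (2 * a - 1) / (2 * a - 1) * N)"
 unfolding frac_int_left_kernel e using G by (simp add: divide_right_mono)
 qed
qed

text \<open>The distributional derivative of the integral of order 1 - gamma is a functional on test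
  functions that is bounded in their L^2 norm. Riesz representation turns it into a square
  integrable function, with its norm controlled by the seminorm of y.\<close>

lemma frac_deriv_exists_real:
 assumes gamma: "0 < gamma" "gamma < 1 / 2"
 obtains C where "0 < C" "!!T y. 0 < T ==> sq_integrable y ==> (!!s. s \<notin> {0<..<T} ==> y s = 0) ==>
 (INTP xi. ennreal (\<bar>xi\<bar> powr (2 * gamma) * (cmod (fourier y xi))\<^sup>2)) < \<infinity> ==>
 \<exists>g. sq_integrable g \<and> (\<forall>s. s \<notin> {0<..<T} --> g s = 0) \<and>
 (\<forall>psi. test_fun {0<..<T} psi --> (LINT x|lebesgue. deriv psi x * frac_int_left 0 (1 - gamma) y x) = - (LINT x|lebesgue. psi x * g x)) \<and>
 (INTP x. ennreal ((g x)\<^sup>2)) <= ennreal C * (INTP xi. ennreal (\<bar>xi\<bar> powr (2 * gamma) * (cmod (fourier y xi))\<^sup>2))"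
proof -
 have g1: "gamma < 1" using gamma by simp
 obtain C where C: "0 < C" "!!T y psi. 0 < T ==> sq_integrable y ==> (!!s. s \<notin> {0<..<T} ==> y s = 0) ==> test_fun {0<..<T} psi ==>
 (ennreal \<bar>LINT x|lebesgue. deriv psi x * frac_int_left 0 (1 - gamma) y x\<bar>)\<^sup>2
 <= ennreal C * (INTP xi. ennreal (\<bar>xi\<bar> powr (2 * gamma) * (cmod (fourier y xi))\<^sup>2)) * (INTP x. ennreal ((psi x)\<^sup>2))"
 by (rule frac_deriv_functional_bound[OF gamma(1) g1], rule that, assumption) blast
 show ?thesis
 proof (rule that[OF C(1)])
 fix T :: real and y :: "real => real"
 assume T: "0 < T" and y: "sq_integrable y" "!!s. s \<notin> {0<..<T} ==> y s = 0"
 and fin: "(INTP xi. ennreal (\<bar>xi\<bar> powr (2 * gamma) * (cmod (fourier y xi))\<^sup>2)) < \<infinity>"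
 define N where "N = enn2real (INTP xi. ennreal (\<bar>xi\<bar> powr (2 * gamma) * (cmod (fourier y xi))\<^sup>2))"
 have N: "(INTP xi. ennreal (\<bar>xi\<bar> powr (2 * gamma) * (cmod (fourier y xi))\<^sup>2)) = ennreal N" "0 <= N"
 using fin by (auto simp: N_def)
 have a: "1 / 2 < 1 - gamma" using gamma by simp
 have y0: "y s = 0" if "s <= 0" for s using y(2) that by auto
 have ym: "y \<in> blm" using y by (simp add: sq_integrable_def)
 have yfin: "(INTP s. ennreal ((norm (y s))\<^sup>2)) < \<infinity>" using nn_integral_sq[OF y(1)] by simp
 define L where "L psi = (LINT x|lebesgue. deriv psi x * frac_int_left 0 (1 - gamma) y x)" for psi :: "real => real"
 have Li: "integrable lebesgue (%x. deriv psi x * frac_int_left 0 (1 - gamma) y x)" if psi: "test_fun {0<..<T} psi" for psi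
 proof -
 have "integrable lebesgue (%t. indicator {0<..<T} t *\<^sub>R (deriv psi t *\<^sub>R frac_int_left 0 (1 - gamma) y t))"
 by (rule test_fun_scaleR_integrable[OF test_fun_deriv(3)[OF psi] T set_integrable_frac_int_left(2)[OF a ym y0 yfin]])
 moreover have e: "indicator {0<..<T} t *\<^sub>R (deriv psi t *\<^sub>R v) = deriv psi t * v" for t v
 using test_funD(4)[OF test_fun_deriv(3)[OF psi], of t] by (auto simp: indicator_def)
 ultimately show ?thesis by (simp only: e)
 qed
 have Ladd: "L (%x. psi x + \<eta> x) = L psi + L \<eta>" if "test_fun {0<..<T} psi" "test_fun {0<..<T} \<eta>" for psi \<eta>
 proof -
 have "deriv (%x. psi x + \<eta> x) x = deriv psi x + deriv \<eta> x" for x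
 by (intro DERIV_imp_deriv DERIV_add test_fun_deriv(1)[OF that(1)] test_fun_deriv(1)[OF that(2)])
 then show ?thesis unfolding L_def using Li[OF that(1)] Li[OF that(2)] by (simp add: distrib_right Bochner_Integration.integral_add)
 qed
 have Lscale: "L (%x. c * psi x) = c * L psi" if "test_fun {0<..<T} psi" for c psi
 proof -
 have "deriv (%x. c * psi x) x = c * deriv psi x" for x
 by (intro DERIV_imp_deriv DERIV_cmult test_fun_deriv(1)[OF that])
 then show ?thesis unfolding L_def by (simp add: mult.assoc)
 qed
 define S where "S = {(abs_L2 psi, - L psi) |psi. test_fun {0<..<T} psi}"
 have sub: "subspace S"
 proof (rule subspaceI)
 have "L (%x. 0) = 0" using Lscale[OF test_fun_zero, of 0] by simp
 then show "0 \<in> S" unfolding S_def zero_prod_def zero_L2_def using test_fun_zero[of "{0<..<T}"] by force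
 next
 fix p q assume "p \<in> S" "q \<in> S"
 then obtain psi \<eta> where t: "test_fun {0<..<T} psi" "test_fun {0<..<T} \<eta>" "p = (abs_L2 psi, - L psi)" "q = (abs_L2 \<eta>, - L \<eta>)" by (auto simp: S_def)
 have "p + q = (abs_L2 (%x. psi x + \<eta> x), - L (%x. psi x + \<eta> x))"
 using t by (simp add: Ladd abs_L2_add test_funD(8))
 then show "p + q \<in> S" unfolding S_def using test_fun_add[OF t(1,2)] by blast
 next
 fix c p assume "p \<in> S"
 then obtain psi where t: "test_fun {0<..<T} psi" "p = (abs_L2 psi, - L psi)" by (auto simp: S_def)
 have "c *\<^sub>R p = (abs_L2 (%x. c * psi x), - L (%x. c * psi x))"
 using t by (simp add: Lscale abs_L2_scale test_funD(8))
 then show "c *\<^sub>R p \<in> S" unfolding S_def using test_fun_scale[OF t(1)] by blast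
 qed
 have bound: "\<bar>l\<bar> <= sqrt (C * N) * norm v" if "(v, l) \<in> S" for v l
 proof -
 from that obtain psi where t: "test_fun {0<..<T} psi" "v = abs_L2 psi" "l = - L psi" by (auto simp: S_def)
 have "(ennreal \<bar>L psi\<bar>)\<^sup>2 <= ennreal C * ennreal N * ennreal ((norm v)\<^sup>2)"
 using C(2)[OF T y t(1)] unfolding L_def N(1) nn_integral_sq[OF test_funD(8)[OF t(1)]] t(2) norm_abs_L2[OF test_funD(8)[OF t(1)]] .
 also have "... = ennreal (C * N * (norm v)\<^sup>2)" using C(1) N(2) by (simp add: ennreal_mult)
 finally have "(L psi)\<^sup>2 <= C * N * (norm v)\<^sup>2" using C(1) N(2) by (simp add: ennreal_power ennreal_le_iff)
 then have "\<bar>L psi\<bar> <= sqrt (C * N * (norm v)\<^sup>2)" by (intro real_le_rsqrt) simp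
 then show ?thesis using t(3) by (simp add: real_sqrt_mult)
 qed
 have M0: "0 <= sqrt (C * N)" using C(1) N(2) by simp
 obtain g0 where g0: "!!v l. (v, l) \<in> S ==> l = g0 \<bullet> v" "norm g0 <= sqrt (C * N)"
 using riesz_graph[OF sub bound M0] by blast
 define g where "g s = indicator {0<..<T} s * rep_L2 g0 s" for s
 have gm [measurable]: "g \<in> blm"
 unfolding g_def by (intro borel_measurable_times borel_measurable_indicator) auto
 have gle: "(g s)\<^sup>2 <= (rep_L2 g0 s)\<^sup>2" for s by (auto simp: g_def indicator_def)
 have ig: "integrable lebesgue (%s. (rep_L2 g0 s)\<^sup>2)" using sq_integrable_rep[of g0] by (simp add: sq_integrable_def)
 have gs: "sq_integrable g"
 unfolding sq_integrable_def
 by (intro conjI gm Bochner_Integration.integrable_bound[OF ig]) (use gle in auto)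
 have "(LINT x|lebesgue. deriv psi x * frac_int_left 0 (1 - gamma) y x) = - (LINT x|lebesgue. psi x * g x)" if psi: "test_fun {0<..<T} psi" for psi
 proof -
 have "- L psi = g0 \<bullet> abs_L2 psi" by (rule g0(1)) (use psi in \<open>auto simp: S_def\<close>)
 also have "... = (LINT x|lebesgue. rep_L2 g0 x * psi x)" by (rule inner_abs_L2_right[OF test_funD(8)[OF psi]])
 also have "... = (LINT x|lebesgue. psi x * g x)"
 using test_funD(4)[OF psi] by (intro Bochner_Integration.integral_cong) (auto simp: g_def indicator_def)
 finally show ?thesis by (simp add: L_def)
 qed
 moreover have "(INTP x. ennreal ((g x)\<^sup>2)) <= ennreal C * ennreal N"
 proof -
 have "(INTP x. ennreal ((g x)\<^sup>2)) <= (INTP x. ennreal ((rep_L2 g0 x)\<^sup>2))"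
 by (intro nn_integral_mono ennreal_leI gle)
 also have "... = ennreal ((norm g0)\<^sup>2)" by (rule nn_integral_rep_L2)
 also have "... <= ennreal ((sqrt (C * N))\<^sup>2)" using g0(2) by (intro ennreal_leI power_mono) auto
 also have "... = ennreal C * ennreal N" using C(1) N(2) by (simp add: ennreal_mult)
 finally show ?thesis .
 qed
 moreover have "g s = 0" if "s \<notin> {0<..<T}" for s using that by (simp add: g_def)
 ultimately show "\<exists>g. sq_integrable g \<and> (\<forall>s. s \<notin> {0<..<T} --> g s = 0) \<and>
 (\<forall>psi. test_fun {0<..<T} psi --> (LINT x|lebesgue. deriv psi x * frac_int_left 0 (1 - gamma) y x) = - (LINT x|lebesgue. psi x * g x)) \<and>
 (INTP x. ennreal ((g x)\<^sup>2)) <= ennreal C * (INTP xi. ennreal (\<bar>xi\<bar> powr (2 * gamma) * (cmod (fourier y xi))\<^sup>2))"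
 using gs unfolding N(1) by blast
 qed
qed

lemma closure_span_orthogonal:
 fixes w z :: "'h::real_inner"
 assumes "w \<in> closure (span A)" "!!v. v \<in> A ==> z \<bullet> v = 0"
 shows "z \<bullet> w = 0"
proof -
 have "closed {w. z \<bullet> w = 0}" by (intro closed_Collect_eq continuous_intros)
 moreover have "span A \<subseteq> {w. z \<bullet> w = 0}"
 by (rule span_minimal) (use assms(2) in \<open>auto intro!: subspaceI simp: inner_add_right\<close>)
 ultimately have "closure (span A) \<subseteq> {w. z \<bullet> w = 0}" by (rule closure_minimal[rotated])
 then show ?thesis using assms(1) by auto
qed

lemma orthonormal_inner_sum:
 fixes phi :: "nat => 'h::real_inner"
 assumes "!!i j. phi i \<bullet> phi j = (if i = j then 1 else 0)" "finite I"
 shows "(\<Sum>i\<in>I. c i *\<^sub>R phi i) \<bullet> phi j = (if j \<in> I then c j else 0)"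
 "(norm (\<Sum>i\<in>I. c i *\<^sub>R phi i))\<^sup>2 = (\<Sum>i\<in>I. (c i)\<^sup>2)"
proof -
 show *: "(\<Sum>i\<in>I. c i *\<^sub>R phi i) \<bullet> phi j = (if j \<in> I then c j else 0)" for j
 by (simp add: inner_sum_left assms(1) if_distrib sum.delta[OF assms(2)] cong: if_cong)
 show "(norm (\<Sum>i\<in>I. c i *\<^sub>R phi i))\<^sup>2 = (\<Sum>i\<in>I. (c i)\<^sup>2)"
 unfolding power2_norm_eq_inner by (simp add: inner_sum_right[of "\<Sum>i\<in>I. c i *\<^sub>R phi i"] * power2_eq_square del: inner_sum_left)
qed

lemma orthonormal_summable:
 fixes phi :: "nat => 'h::{real_inner, banach}"
 assumes o: "!!i j. phi i \<bullet> phi j = (if i = j then 1 else 0)" and s: "summable (%i. (c i)\<^sup>2)"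
 shows "summable (%i. c i *\<^sub>R phi i)"
 unfolding summable_Cauchy
proof (intro allI impI)
 fix e :: real assume e: "0 < e"
 then obtain N where N: "!!m n. N <= m ==> norm (\<Sum>i=m..<n. (c i)\<^sup>2) < e\<^sup>2"
 using s[unfolded summable_Cauchy, rule_format, of "e\<^sup>2"] by (meson zero_less_power)
 have "norm (\<Sum>i=m..<n. c i *\<^sub>R phi i) < e" if "N <= m" for m n
 proof -
 have "(norm (\<Sum>i=m..<n. c i *\<^sub>R phi i))\<^sup>2 < e\<^sup>2"
 unfolding orthonormal_inner_sum(2)[OF o finite_atLeastLessThan] using N[OF that, of n] by simp
 then show ?thesis using e by (simp add: power2_less_imp_less)
 qed
 then show "\<exists>N. \<forall>m\<ge>N. \<forall>n. norm (\<Sum>i=m..<n. c i *\<^sub>R phi i) < e" by blast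
qed

lemma orthonormal_suminf:
 fixes phi :: "nat => 'h::{real_inner, banach}"
 assumes o: "!!i j. phi i \<bullet> phi j = (if i = j then 1 else 0)" and s: "summable (%i. (c i)\<^sup>2)"
 shows "(\<Sum>i. c i *\<^sub>R phi i) \<bullet> phi j = c j" "(norm (\<Sum>i. c i *\<^sub>R phi i))\<^sup>2 = (\<Sum>i. (c i)\<^sup>2)"
 "(\<Sum>i. c i *\<^sub>R phi i) \<in> closure (span (range phi))"
proof -
 have S: "(%n. \<Sum>i<n. c i *\<^sub>R phi i) \<longlonglongrightarrow> (\<Sum>i. c i *\<^sub>R phi i)"
 using orthonormal_summable[OF assms] by (rule summable_LIMSEQ)
 have A: "(%n. (\<Sum>i<n. c i *\<^sub>R phi i) \<bullet> phi j) \<longlonglongrightarrow> (\<Sum>i. c i *\<^sub>R phi i) \<bullet> phi j" by (intro tendsto_intros S)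
 have B: "\<forall>\<^sub>F n in sequentially. (\<Sum>i<n. c i *\<^sub>R phi i) \<bullet> phi j = c j"
 using eventually_gt_at_top[of j] by eventually_elim (simp add: orthonormal_inner_sum(1)[OF o])
 show "(\<Sum>i. c i *\<^sub>R phi i) \<bullet> phi j = c j"
 by (rule LIMSEQ_unique[OF A tendsto_eventually[OF B]])
 have "(%n. (norm (\<Sum>i<n. c i *\<^sub>R phi i))\<^sup>2) \<longlonglongrightarrow> (norm (\<Sum>i. c i *\<^sub>R phi i))\<^sup>2" by (intro tendsto_intros S)
 then have L: "(%n. \<Sum>i<n. (c i)\<^sup>2) \<longlonglongrightarrow> (norm (\<Sum>i. c i *\<^sub>R phi i))\<^sup>2"
 unfolding orthonormal_inner_sum(2)[OF o finite_lessThan] .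
 show "(norm (\<Sum>i. c i *\<^sub>R phi i))\<^sup>2 = (\<Sum>i. (c i)\<^sup>2)"
 by (rule LIMSEQ_unique[OF L summable_LIMSEQ[OF s]])
 have "(\<Sum>i<n. c i *\<^sub>R phi i) \<in> span (range phi)" for n
 by (intro span_sum span_scale span_base) simp
 then show "(\<Sum>i. c i *\<^sub>R phi i) \<in> closure (span (range phi))"
 unfolding closure_sequential using S by (intro exI[of _ "%n. \<Sum>i<n. c i *\<^sub>R phi i"]) simp
qed

lemma orthonormal_bessel:
 fixes phi :: "nat => 'h::real_inner"
 assumes o: "!!i j. phi i \<bullet> phi j = (if i = j then 1 else 0)"
 shows "summable (%i. (v \<bullet> phi i)\<^sup>2)" "(\<Sum>i. (v \<bullet> phi i)\<^sup>2) <= (norm v)\<^sup>2"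
proof -
 have b: "(\<Sum>i<n. (v \<bullet> phi i)\<^sup>2) <= (norm v)\<^sup>2" for n
 proof -
 let ?s = "\<Sum>i<n. (v \<bullet> phi i) *\<^sub>R phi i"
 have "v \<bullet> ?s = (\<Sum>i<n. (v \<bullet> phi i)\<^sup>2)" by (simp add: inner_sum_right power2_eq_square)
 moreover have "?s \<bullet> ?s = (\<Sum>i<n. (v \<bullet> phi i)\<^sup>2)"
 using orthonormal_inner_sum(2)[OF o finite_lessThan, of "%i. v \<bullet> phi i" n] unfolding power2_norm_eq_inner .
 moreover have "0 <= (v - ?s) \<bullet> (v - ?s)" by simp
 ultimately show ?thesis
 by (simp add: inner_diff_left inner_diff_right inner_commute[of ?s v] power2_norm_eq_inner)
 qed
 show s: "summable (%i. (v \<bullet> phi i)\<^sup>2)" by (rule summableI_nonneg_bounded[OF _ b]) simp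
 show "(\<Sum>i. (v \<bullet> phi i)\<^sup>2) <= (norm v)\<^sup>2" by (rule suminf_le_const[OF s b])
qed

lemma orthonormal_expansion:
 fixes phi :: "nat => 'h::{real_inner, banach}"
 assumes o: "!!i j. phi i \<bullet> phi j = (if i = j then 1 else 0)" and v: "v \<in> closure (span (range phi))"
 shows "(%i. (v \<bullet> phi i) *\<^sub>R phi i) sums v"
proof -
 note s = orthonormal_bessel(1)[OF o, of v]
 let ?s = "\<Sum>i. (v \<bullet> phi i) *\<^sub>R phi i"
 have z: "(v - ?s) \<bullet> phi i = 0" for i by (simp add: inner_diff_left orthonormal_suminf(1)[OF o s])
 have "(v - ?s) \<bullet> v = 0" "(v - ?s) \<bullet> ?s = 0"
 by (rule closure_span_orthogonal[OF v] closure_span_orthogonal[OF orthonormal_suminf(3)[OF o s]]; use z in auto)+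
 then have "(v - ?s) \<bullet> (v - ?s) = 0" by (simp add: inner_diff_right)
 then have "v = ?s" by simp
 then show ?thesis using summable_sums[OF orthonormal_summable[OF o s]] by simp
qed

lemma frac_int_left_inner:
 fixes u :: "real => 'b::{real_inner, banach, second_countable_topology}"
 assumes "integrable lebesgue (%s. rl_kernel a (x - s) *\<^sub>R u s)" "!!s. s <= 0 ==> u s = 0"
 shows "frac_int_left 0 a u x \<bullet> z = frac_int_left 0 a (%s. u s \<bullet> z) x"
proof -
 have e: "indicator {0<..} s *\<^sub>R u s = u s" for s using assms(2)[of s] by (auto simp: indicator_def)
 have "frac_int_left 0 a (%s. u s \<bullet> z) x = (1 / Gamma a) * (LINT s|lebesgue. rl_kernel a (x - s) * (u s \<bullet> z))"
 by (rule frac_int_left_real) (simp add: assms(2))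
 also have "(LINT s|lebesgue. rl_kernel a (x - s) * (u s \<bullet> z)) = (LINT s|lebesgue. (rl_kernel a (x - s) *\<^sub>R u s) \<bullet> z)" by simp
 also have "... = (LINT s|lebesgue. rl_kernel a (x - s) *\<^sub>R u s) \<bullet> z"
 by (rule integral_inner_left) (rule assms(1))
 finally have F: "frac_int_left 0 a (%s. u s \<bullet> z) x = (1 / Gamma a) * ((LINT s|lebesgue. rl_kernel a (x - s) *\<^sub>R u s) \<bullet> z)" .
 have "frac_int_left 0 a u x = (1 / Gamma a) *\<^sub>R (LINT s|lebesgue. rl_kernel a (x - s) *\<^sub>R u s)"
 by (simp only: frac_int_left_kernel e)
 then show ?thesis unfolding F by simp
qed

text \<open>The derivative is assembled from those of the coefficients; finiteness of the vector
  seminorm makes their squares summable almost everywhere. Without such an existence result the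
  derivative chosen by \<open>SOME\<close> in the weak form would be an unknown function.\<close>

lemma frac_deriv_left_exists:
 fixes U :: "real => 'h::{real_inner, banach, second_countable_topology}" and phi :: "nat => 'h"
 assumes gamma: "0 < gamma" "gamma < 1 / 2" and T: "0 < T"
 and o: "!!i j. phi i \<bullet> phi j = (if i = j then 1 else 0)"
 and Um: "U \<in> blm" and U0: "!!s. s \<notin> {0<..<T} ==> U s = 0"
 and Ufin: "(INTP s. ennreal ((norm (U s))\<^sup>2)) < \<infinity>"
 and Ucl: "AE s in lebesgue. U s \<in> closure (span (range phi))"
 and fin: "(\<Sum>i. \<integral>\<^sup>+xi. ennreal (\<bar>xi\<bar> powr (2 * gamma) * (cmod (fourier (%s. U s \<bullet> phi i) xi))\<^sup>2) \<partial>lebesgue) < \<infinity>"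
 shows "\<exists>g. has_distr_deriv 0 T (frac_int_left 0 (1 - gamma) U) g"
proof -
 note [measurable] = Um
 let ?N = "%i. \<integral>\<^sup>+xi. ennreal (\<bar>xi\<bar> powr (2 * gamma) * (cmod (fourier (%s. U s \<bullet> phi i) xi))\<^sup>2) \<partial>lebesgue"
 have a: "1 / 2 < 1 - gamma" using gamma by simp
 have n1: "norm (phi i) = 1" for i using o[of i i] by (simp add: norm_eq_sqrt_inner)
 have U0': "U s = 0" if "s <= 0" for s using U0 that by auto
 have sqU: "sq_integrable (%s. U s \<bullet> z)" for z
 unfolding sq_integrable_def
 proof (intro conjI integrableI_bounded)
 have "(INTP s. ennreal (norm ((U s \<bullet> z)\<^sup>2))) <= (INTP s. ennreal ((norm z)\<^sup>2) * ennreal ((norm (U s))\<^sup>2))"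
 proof (rule nn_integral_mono)
 fix s
 have "\<bar>U s \<bullet> z\<bar>\<^sup>2 <= (norm (U s) * norm z)\<^sup>2" by (intro power_mono Cauchy_Schwarz_ineq2) simp
 then show "ennreal (norm ((U s \<bullet> z)\<^sup>2)) <= ennreal ((norm z)\<^sup>2) * ennreal ((norm (U s))\<^sup>2)"
 by (simp add: ennreal_mult[symmetric] ennreal_leI power_mult_distrib mult.commute)
 qed
 also have "... = ennreal ((norm z)\<^sup>2) * (INTP s. ennreal ((norm (U s))\<^sup>2))" by (rule nn_integral_cmult) measurable
 also have "... < \<infinity>" using Ufin by (simp add: ennreal_mult_less_top)
 finally show "(INTP s. ennreal (norm ((U s \<bullet> z)\<^sup>2))) < \<infinity>" .
 qed measurable
 obtain C where C: "0 < C" "!!T y. 0 < T ==> sq_integrable y ==> (!!s. s \<notin> {0<..<T} ==> y s = 0) ==>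
 (INTP xi. ennreal (\<bar>xi\<bar> powr (2 * gamma) * (cmod (fourier y xi))\<^sup>2)) < \<infinity> ==>
 \<exists>g. sq_integrable g \<and> (\<forall>s. s \<notin> {0<..<T} --> g s = 0) \<and>
 (\<forall>psi. test_fun {0<..<T} psi --> (LINT x|lebesgue. deriv psi x * frac_int_left 0 (1 - gamma) y x) = - (LINT x|lebesgue. psi x * g x)) \<and>
 (INTP x. ennreal ((g x)\<^sup>2)) <= ennreal C * (INTP xi. ennreal (\<bar>xi\<bar> powr (2 * gamma) * (cmod (fourier y xi))\<^sup>2))"
 by (rule frac_deriv_exists_real[OF gamma], rule that, assumption) blast
 have Nfin: "?N i < \<infinity>" for i
 using fin sum_le_suminf[of ?N "{i}"] by (simp add: le_less_trans)
 have "\<forall>i. \<exists>g. sq_integrable g \<and> (\<forall>s. s \<notin> {0<..<T} --> g s = 0) \<and>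
 (\<forall>psi. test_fun {0<..<T} psi --> (LINT x|lebesgue. deriv psi x * frac_int_left 0 (1 - gamma) (%s. U s \<bullet> phi i) x) = - (LINT x|lebesgue. psi x * g x)) \<and>
 (INTP x. ennreal ((g x)\<^sup>2)) <= ennreal C * ?N i"
 by (intro allI C(2) T sqU Nfin) (simp add: U0)
 then obtain G where "\<forall>i. sq_integrable (G i) \<and> (\<forall>s. s \<notin> {0<..<T} --> G i s = 0) \<and>
 (\<forall>psi. test_fun {0<..<T} psi --> (LINT x|lebesgue. deriv psi x * frac_int_left 0 (1 - gamma) (%s. U s \<bullet> phi i) x) = - (LINT x|lebesgue. psi x * G i x)) \<and>
 (INTP x. ennreal ((G i x)\<^sup>2)) <= ennreal C * ?N i"
 by (rule choice[THEN exE])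
 then have G: "sq_integrable (G i)" "s \<notin> {0<..<T} ==> G i s = 0"
 "test_fun {0<..<T} psi ==> (LINT x|lebesgue. deriv psi x * frac_int_left 0 (1 - gamma) (%s. U s \<bullet> phi i) x) = - (LINT x|lebesgue. psi x * G i x)"
 "(INTP x. ennreal ((G i x)\<^sup>2)) <= ennreal C * ?N i" for i s psi by auto
 have Gm [measurable]: "G i \<in> blm" for i using G(1)[of i] by (simp add: sq_integrable_def)
 define g where "g s = (\<Sum>i. G i s *\<^sub>R phi i)" for s
 have gm [measurable]: "g \<in> blm"
 unfolding g_def by (intro borel_measurable_suminf borel_measurable_scaleR borel_measurable_const Gm)
 have sumG: "(INTP s. (\<Sum>i. ennreal ((G i s)\<^sup>2))) < \<infinity>"
 proof -
 have "(INTP s. (\<Sum>i. ennreal ((G i s)\<^sup>2))) = (\<Sum>i. \<integral>\<^sup>+s. ennreal ((G i s)\<^sup>2) \<partial>lebesgue)"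
 by (rule nn_integral_suminf) measurable
 also have "... <= (\<Sum>i. ennreal C * ?N i)" by (intro suminf_le G(4)) auto
 also have "... = ennreal C * (\<Sum>i. ?N i)" by (rule ennreal_suminf_cmult)
 also have "... < \<infinity>" using fin by (simp add: ennreal_mult_less_top)
 finally show ?thesis .
 qed
 have sm: "AE s in lebesgue. summable (%i. (G i s)\<^sup>2)"
 proof -
 have "AE s in lebesgue. (\<Sum>i. ennreal ((G i s)\<^sup>2)) ~= \<infinity>"
 using sumG by (intro nn_integral_noteq_infinite) auto
 then show ?thesis by (rule eventually_mono) (auto intro: summable_suminf_not_top)
 qed
 have gint: "integrable lebesgue g"
 proof (rule integrableI_bounded[OF gm])
 have g0: "g s = 0" if "s \<notin> {0<..<T}" for s using G(2)[OF that] by (simp add: g_def)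
 have "(INTP s. ennreal (norm (g s))) <= (INTP s. indicator {0<..<T} s + (\<Sum>i. ennreal ((G i s)\<^sup>2)))"
 proof (rule nn_integral_mono_AE, use sm in eventually_elim)
 case (elim s)
 have "(\<Sum>i. ennreal ((G i s)\<^sup>2)) = ennreal ((norm (g s))\<^sup>2)"
 unfolding g_def orthonormal_suminf(2)[OF o elim] using elim by (intro suminf_ennreal2) auto
 moreover have "ennreal (norm (g s)) <= indicator {0<..<T} s + ennreal ((norm (g s))\<^sup>2)"
 proof (cases "s \<in> {0<..<T}")
 case True
 have "norm (g s) <= 1 + (norm (g s))\<^sup>2"
 using sum_squares_bound[of "norm (g s)" 1] norm_ge_zero[of "g s"] unfolding power_one mult_1_right by linarith
 then have "ennreal (norm (g s)) <= ennreal (1 + (norm (g s))\<^sup>2)" by (rule ennreal_leI)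
 then show ?thesis using True by simp
 qed (simp add: g0)
 ultimately show ?case by simp
 qed
 also have "... = (INTP s. indicator {0<..<T} s) + (INTP s. (\<Sum>i. ennreal ((G i s)\<^sup>2)))"
 by (rule nn_integral_add) (auto intro!: borel_measurable_suminf_order borel_measurable_indicator)
 also have "... < \<infinity>" using sumG T by simp
 finally show "(INTP s. ennreal (norm (g s))) < \<infinity>" .
 qed
 have gphi: "AE s in lebesgue. \<forall>i. g s \<bullet> phi i = G i s"
 using sm by eventually_elim (simp add: g_def orthonormal_suminf(1)[OF o])
 have gcl: "AE s in lebesgue. g s \<in> closure (span (range phi))"
 using sm by eventually_elim (simp add: g_def orthonormal_suminf(3)[OF o])
 let ?I = "frac_int_left 0 (1 - gamma) U"
 have Ii: "set_integrable lebesgue {c..d} ?I" if "0 < c" for c d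
 by (rule set_integrable_frac_int_left(2)[OF a Um U0' Ufin that])
 have gi: "set_integrable lebesgue {c..d} g" for c d
 unfolding set_integrable_def using gint by (intro integrable_mult_indicator) auto
 have eq: "(LINT t:{0<..<T}|lebesgue. deriv psi t *\<^sub>R ?I t) = - (LINT t:{0<..<T}|lebesgue. psi t *\<^sub>R g t)" if psi: "test_fun {0<..<T} psi" for psi
 proof -
 note dpsi = test_fun_deriv(3)[OF psi]
 have psim [measurable]: "psi \<in> blm" using test_funD(6)[OF psi] by auto
 define X1 where "X1 = (LINT t:{0<..<T}|lebesgue. deriv psi t *\<^sub>R ?I t)"
 define X2 where "X2 = (LINT t:{0<..<T}|lebesgue. psi t *\<^sub>R g t)"
 have z1: "indicator {0<..<T} t * deriv psi t = deriv psi t" "indicator {0<..<T} t * psi t = psi t" for t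
 using test_funD(4)[OF dpsi, of t] test_funD(4)[OF psi, of t] by (auto simp: indicator_def)
 have X1z: "X1 \<bullet> z = (LINT t|lebesgue. deriv psi t * frac_int_left 0 (1 - gamma) (%s. U s \<bullet> z) t)" for z
 proof -
 have "X1 \<bullet> z = (LINT t|lebesgue. (indicator {0<..<T} t *\<^sub>R (deriv psi t *\<^sub>R ?I t)) \<bullet> z)"
 unfolding X1_def set_lebesgue_integral_def
 by (intro integral_inner_left[symmetric] test_fun_scaleR_integrable[OF dpsi T Ii])
 then show ?thesis
 by (simp add: z1 frac_int_left_inner[OF set_integrable_frac_int_left(1)[OF a Um U0' Ufin] U0'])
 qed
 have X2z: "X2 \<bullet> z = (LINT t|lebesgue. psi t * (g t \<bullet> z))" for z
 proof -
 have "X2 \<bullet> z = (LINT t|lebesgue. (indicator {0<..<T} t *\<^sub>R (psi t *\<^sub>R g t)) \<bullet> z)"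
 unfolding X2_def set_lebesgue_integral_def
 by (intro integral_inner_left[symmetric] test_fun_scaleR_integrable[OF psi T gi])
 then show ?thesis by (simp add: z1)
 qed
 have zphi: "(X1 + X2) \<bullet> phi i = 0" for i
 proof -
 have "X2 \<bullet> phi i = (LINT t|lebesgue. psi t * G i t)"
 unfolding X2z by (rule integral_cong_AE) (measurable, use gphi in \<open>auto elim!: eventually_mono\<close>)
 then show ?thesis unfolding inner_add_left X1z using G(3)[OF psi, of i] by simp
 qed
 \<comment> \<open>Almost all values of U and of g lie in the closed span of the basis, so a vector
   orthogonal to the basis sees neither integral.\<close>
 have orth: "X1 \<bullet> z = 0 \<and> X2 \<bullet> z = 0" if z: "!!i. z \<bullet> phi i = 0" for z
 proof
 have Uz: "AE s in lebesgue. U s \<bullet> z = 0"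
 using Ucl
 proof eventually_elim
 case (elim s)
 have "z \<bullet> U s = 0" by (rule closure_span_orthogonal[OF elim]) (use z in auto)
 then show ?case by (simp add: inner_commute)
 qed
 have A: "frac_int_left 0 (1 - gamma) (%s. U s \<bullet> z) t = frac_int_left 0 (1 - gamma) (%s. 0) t" for t
 by (rule frac_int_left_cong) (use Uz in \<open>auto elim!: eventually_mono simp: set_borel_measurable_def intro!: borel_measurable_times borel_measurable_indicator\<close>)
 have B: "frac_int_left 0 (1 - gamma) (%s. 0 :: real) t = 0" for t by (simp add: frac_int_left_def)
 have C: "frac_int_left 0 (1 - gamma) (%s. U s \<bullet> z) = (%t. 0)" by (rule ext) (rule trans[OF A B])
 have "X1 \<bullet> z = (LINT t|lebesgue. deriv psi t * frac_int_left 0 (1 - gamma) (%s. U s \<bullet> z) t)" by (rule X1z)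
 also have "... = 0" unfolding C by simp
 finally show "X1 \<bullet> z = 0" .
 have "X2 \<bullet> z = (LINT t|(lebesgue :: real measure). 0)" unfolding X2z
 proof (rule integral_cong_AE)
 show "AE t in lebesgue. psi t * (g t \<bullet> z) = 0"
 using gcl
 proof eventually_elim
 case (elim t)
 have "z \<bullet> g t = 0" by (rule closure_span_orthogonal[OF elim]) (use z in auto)
 then show ?case by (simp add: inner_commute[of _ z])
 qed
 show "(%t. psi t * (g t \<bullet> z)) \<in> blm" by measurable
 qed simp
 then show "X2 \<bullet> z = 0" by simp
 qed
 \<comment> \<open>The sum is orthogonal to the whole basis, so it may be inserted for z
   itself.\<close>
 have "X1 \<bullet> (X1 + X2) = 0 \<and> X2 \<bullet> (X1 + X2) = 0" by (rule orth) (rule zphi)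
 then have "(X1 + X2) \<bullet> (X1 + X2) = 0" unfolding inner_add_left[of X1 X2 "X1 + X2"] by simp
 then have "X1 + X2 = 0" by simp
 then show ?thesis unfolding X1_def X2_def by (simp add: eq_neg_iff_add_eq_0)
 qed
 show ?thesis
 unfolding has_distr_deriv_def using Ii gi eq by (intro exI[of _ g]) auto
qed

section \<open>Weak partial derivatives and limits of test functions\<close>

lemma test_fun_partial_linear:
 assumes "test_fun Omega f" "test_fun Omega g"
 shows "partial b (%x. f x + g x) = (%x. partial b f x + partial b g x)"
 "partial b (%x. c * f x) = (%x. c * partial b f x)"
 unfolding partial_def
 by (rule ext, subst frechet_derivative_at[OF has_derivative_add[OF test_funD(2)[OF assms(1)] test_funD(2)[OF assms(2)]], symmetric], rule refl)
 (rule ext, subst frechet_derivative_at[OF has_derivative_mult_right[OF test_funD(2)[OF assms(1)]], symmetric], rule refl)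

lemma L2_on_add: "v \<in> L2_on Omega ==> w \<in> L2_on Omega ==> v + w \<in> L2_on Omega"
 unfolding L2_on_def using rep_L2_add[of v w] by (auto elim: eventually_elim2)

lemma L2_on_scale: "v \<in> L2_on Omega ==> c *\<^sub>R v \<in> L2_on Omega"
 unfolding L2_on_def using rep_L2_scale[of c v] by (auto elim: eventually_elim2)

lemma L2_on_0: "0 \<in> L2_on Omega"
 unfolding L2_on_def using rep_L2_zero by (auto elim: eventually_mono)

lemma subspace_L2_on: "subspace (L2_on Omega)"
 by (intro subspaceI L2_on_0 L2_on_add L2_on_scale)

lemma L2_on_abs_test: "test_fun Omega psi ==> abs_L2 psi \<in> L2_on Omega"
 unfolding L2_on_def using rep_abs_L2[OF test_funD(8), of Omega psi] test_funD(4)[of Omega psi]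
 by (auto elim!: eventually_mono)

text \<open>Written with inner products, the defining identity is linear and continuous in v and g,
  so it passes to sums and limits.\<close>

lemma has_weak_partial_iff:
 assumes "b \<in> Basis"
 shows "has_weak_partial Omega b v g \<longleftrightarrow> g \<in> L2_on Omega \<and> (\<forall>psi. test_fun Omega psi --> v \<bullet> abs_L2 (partial b psi) = - (g \<bullet> abs_L2 psi))"
proof -
 have "(LINT x:Omega|lebesgue. rep_L2 w x * psi x) = w \<bullet> abs_L2 psi" if "test_fun Omega psi" for w psi
 unfolding inner_abs_L2_right[OF test_funD(8)[OF that]] set_lebesgue_integral_def
 using test_funD(4)[OF that] by (intro Bochner_Integration.integral_cong) (auto simp: indicator_def)
 then show ?thesis unfolding has_weak_partial_def using test_funD(3)[OF _ assms] by auto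
qed

lemma has_weak_partial_add:
 "b \<in> Basis ==> has_weak_partial Omega b v g ==> has_weak_partial Omega b w h ==> has_weak_partial Omega b (v + w) (g + h)"
 by (simp add: has_weak_partial_iff L2_on_add inner_add_left)

lemma has_weak_partial_scale:
 "b \<in> Basis ==> has_weak_partial Omega b v g ==> has_weak_partial Omega b (c *\<^sub>R v) (c *\<^sub>R g)"
 by (simp add: has_weak_partial_iff L2_on_scale)

lemma has_weak_partial_sum:
 assumes "b \<in> Basis" "finite I" "!!i. i \<in> I ==> has_weak_partial Omega b (v i) (g i)"
 shows "has_weak_partial Omega b (\<Sum>i\<in>I. c i *\<^sub>R v i) (\<Sum>i\<in>I. c i *\<^sub>R g i)"
 using assms(2,3)
proof (induction I rule: finite_induct)
 case empty
 show ?case using assms(1) by (simp add: has_weak_partial_iff L2_on_0)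
next
 case (insert i I)
 show ?case unfolding sum.insert[OF insert.hyps]
 by (intro has_weak_partial_add[OF assms(1)] has_weak_partial_scale[OF assms(1)] insert) auto
qed

lemma has_weak_partial_test:
 assumes "b \<in> Basis" "test_fun Omega psi"
 shows "has_weak_partial Omega b (abs_L2 psi) (abs_L2 (partial b psi))"
 unfolding has_weak_partial_iff[OF assms(1)]
proof (intro conjI allI impI L2_on_abs_test test_funD(3) assms)
 fix \<eta> assume \<eta>: "test_fun Omega \<eta>"
 note \<eta>' = test_funD(3)[OF \<eta> assms(1)] and psi' = test_funD(3)[OF assms(2,1)]
 have "(LINT x|lebesgue. partial b \<eta> x * psi x) = - (LINT x|lebesgue. \<eta> x * frechet_derivative psi (at x) b)"
 using test_funD(1)[OF psi'] by (intro test_fun_ibp_smooth(1)[OF \<eta> assms(1)] test_funD(2)[OF assms(2)]) (simp add: partial_def)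
 then show "abs_L2 psi \<bullet> abs_L2 (partial b \<eta>) = - (abs_L2 (partial b psi) \<bullet> abs_L2 \<eta>)"
 unfolding inner_abs_L2[OF test_funD(8)[OF assms(2)] test_funD(8)[OF \<eta>']] inner_abs_L2[OF test_funD(8)[OF psi'] test_funD(8)[OF \<eta>]]
 by (simp add: partial_def[symmetric] mult.commute)
qed

text \<open>\<open>weak_partial\<close> is a definite description, so uniqueness has to be shown.
  The difference of two candidates vanishes on \<open>Omega\<close> by the fundamental lemma and
  outside because both belong to \<open>L2_on\<close>.\<close>

lemma weak_partial_eqI:
 assumes "open Omega" "b \<in> Basis" "has_weak_partial Omega b v g"
 shows "weak_partial Omega b v = g"
 unfolding weak_partial_def
proof (rule the_equality, rule assms(3))
 fix h assume h: "has_weak_partial Omega b v h"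
 define d where "d = h - g"
 have hwp: "has_weak_partial Omega b 0 d"
 using has_weak_partial_add[OF assms(2) h has_weak_partial_scale[OF assms(2,3), of "-1"]] by (simp add: d_def)
 have "AE x in lebesgue. x \<in> Omega --> rep_L2 d x = 0"
 proof (rule fundamental_lemma[OF assms(1)])
 fix p q :: 'a
 have "sq_integrable (%x. indicator (cbox p q) x * rep_L2 d x)"
 unfolding sq_integrable_def
 proof (intro conjI)
 have "integrable lebesgue (%x. indicator (cbox p q) x *\<^sub>R (rep_L2 d x)\<^sup>2)"
 using sq_integrable_rep[of d] by (intro integrable_mult_indicator) (auto simp: sq_integrable_def)
 then show "integrable lebesgue (%x. (indicator (cbox p q) x * rep_L2 d x)\<^sup>2)"
 by (rule Bochner_Integration.integrable_cong[OF refl, THEN iffD1, rotated]) (auto simp: indicator_def)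
 qed (intro borel_measurable_times borel_measurable_indicator measurable_rep_L2, simp)
 then have "integrable lebesgue (%x. indicator (cbox p q) x * rep_L2 d x)"
 by (rule sq_integrable_imp_integrable[OF _ bounded_cbox[of p q]]) simp
 then show "set_integrable lebesgue (cbox p q) (rep_L2 d)" by (simp add: set_integrable_def)
 next
 fix psi assume psi: "test_fun Omega psi"
 have "d \<bullet> abs_L2 psi = 0" using hwp psi unfolding has_weak_partial_iff[OF assms(2)] by fastforce
 moreover have "(LINT x:Omega|lebesgue. rep_L2 d x * psi x) = d \<bullet> abs_L2 psi"
 unfolding inner_abs_L2_right[OF test_funD(8)[OF psi]] set_lebesgue_integral_def
 using test_funD(4)[OF psi] by (intro Bochner_Integration.integral_cong) (auto simp: indicator_def)
 ultimately show "(LINT x:Omega|lebesgue. rep_L2 d x * psi x) = 0" by simp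
 qed
 moreover have "AE x in lebesgue. x \<notin> Omega --> rep_L2 d x = 0" using hwp by (simp add: has_weak_partial_def L2_on_def)
 moreover note rep_L2_zero
 ultimately have "AE x in lebesgue. rep_L2 d x = rep_L2 0 x" by eventually_elim auto
 then have "d = 0" by (rule L2_eqI)
 then show "h = g" by (simp add: d_def)
qed

text \<open>\<open>v\<close> is the limit of test functions in \<open>H\<^sup>1\<close>, with limit gradient \<open>g\<close>.\<close>

definition H1_approx :: "'a::euclidean_space set => 'a L2 => ('a => 'a L2) => bool" where
 "H1_approx Omega v g \<longleftrightarrow> (\<exists>psi. (\<forall>n. test_fun Omega (psi n)) \<and> (%n. abs_L2 (psi n)) \<longlonglongrightarrow> v \<and>
 (\<forall>b\<in>Basis. (%n. abs_L2 (partial b (psi n))) \<longlonglongrightarrow> g b))"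

lemma H1_approxE:
 assumes "H1_approx Omega v g"
 obtains psi where "\<forall>n. test_fun Omega (psi n)" "(%n. abs_L2 (psi n)) \<longlonglongrightarrow> v"
 "\<forall>b\<in>Basis. (%n. abs_L2 (partial b (psi n))) \<longlonglongrightarrow> g b"
 using assms unfolding H1_approx_def by blast

lemma H1_approx_add:
 assumes "H1_approx Omega v g" "H1_approx Omega w h"
 shows "H1_approx Omega (v + w) (%b. g b + h b)"
proof -
 obtain psi where h1: "\<forall>n. test_fun Omega (psi n)" "(%n. abs_L2 (psi n)) \<longlonglongrightarrow> v"
 "\<forall>b\<in>Basis. (%n. abs_L2 (partial b (psi n))) \<longlonglongrightarrow> g b"
 by (rule H1_approxE[OF assms(1)])
 obtain \<eta> where h2: "\<forall>n. test_fun Omega (\<eta> n)" "(%n. abs_L2 (\<eta> n)) \<longlonglongrightarrow> w"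
 "\<forall>b\<in>Basis. (%n. abs_L2 (partial b (\<eta> n))) \<longlonglongrightarrow> h b"
 by (rule H1_approxE[OF assms(2)])
 note t1 = h1(1)[rule_format] and t2 = h2(1)[rule_format] and l = h1(2) h1(3)[rule_format] h2(2) h2(3)[rule_format]
 note t = t1 t2
 have p: "abs_L2 (partial b (%x. psi n x + \<eta> n x)) = abs_L2 (partial b (psi n)) + abs_L2 (partial b (\<eta> n))" if "b \<in> Basis" for b n
 unfolding test_fun_partial_linear(1)[OF t]
 by (rule abs_L2_add[OF test_funD(8)[OF test_funD(3)[OF t1 that]] test_funD(8)[OF test_funD(3)[OF t2 that]], symmetric])
 have q: "abs_L2 (%x. psi n x + \<eta> n x) = abs_L2 (psi n) + abs_L2 (\<eta> n)" for n
 by (rule abs_L2_add[OF test_funD(8)[OF t1] test_funD(8)[OF t2], symmetric])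
 show ?thesis unfolding H1_approx_def
 by (rule exI[of _ "%n x. psi n x + \<eta> n x"]) (simp add: p q test_fun_add t tendsto_add l)
qed

lemma H1_approx_scale:
 assumes "H1_approx Omega v g"
 shows "H1_approx Omega (c *\<^sub>R v) (%b. c *\<^sub>R g b)"
proof -
 obtain psi where h: "\<forall>n. test_fun Omega (psi n)" "(%n. abs_L2 (psi n)) \<longlonglongrightarrow> v" "\<forall>b\<in>Basis. (%n. abs_L2 (partial b (psi n))) \<longlonglongrightarrow> g b"
 by (rule H1_approxE[OF assms])
 note t = h(1)[rule_format] and l = h(2) h(3)[rule_format]
 have p: "abs_L2 (partial b (%x. c * psi n x)) = c *\<^sub>R abs_L2 (partial b (psi n))" if "b \<in> Basis" for b n
 unfolding test_fun_partial_linear(2)[OF t t] by (rule abs_L2_scale[OF test_funD(8)[OF test_funD(3)[OF t that]], symmetric])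
 have q: "abs_L2 (%x. c * psi n x) = c *\<^sub>R abs_L2 (psi n)" for n
 by (rule abs_L2_scale[OF test_funD(8)[OF t], symmetric])
 show ?thesis unfolding H1_approx_def
 by (rule exI[of _ "%n x. c * psi n x"]) (simp add: p q test_fun_scale t tendsto_scaleR l)
qed

lemma H1_approx_test: "test_fun Omega psi ==> H1_approx Omega (abs_L2 psi) (%b. abs_L2 (partial b psi))"
 unfolding H1_approx_def by (intro exI[of _ "%_. psi"]) simp

lemma H1_approx_sum:
 assumes "finite I" "!!i. i \<in> I ==> H1_approx Omega (v i) (g i)"
 shows "H1_approx Omega (\<Sum>i\<in>I. c i *\<^sub>R v i) (%b. \<Sum>i\<in>I. c i *\<^sub>R g i b)"
 using assms
proof (induction I rule: finite_induct)
 case empty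
 show ?case using H1_approx_test[OF test_fun_zero, of Omega] H1_approx_scale[OF H1_approx_test[OF test_fun_zero, of Omega], of 0] by simp
next
 case (insert i I)
 show ?case unfolding sum.insert[OF insert.hyps]
 by (intro H1_approx_add H1_approx_scale insert) auto
qed

text \<open>The definition of the weak derivative of w, tested with the approximating sequence of v.
  Compact supports leave no boundary term, and both sides pass to the limit.\<close>

lemma H1_approx_ibp:
 assumes "H1_approx Omega v g" "b \<in> Basis" "has_weak_partial Omega b w h"
 shows "w \<bullet> g b = - (h \<bullet> v)"
proof -
 obtain psi where h: "\<forall>n. test_fun Omega (psi n)" "(%n. abs_L2 (psi n)) \<longlonglongrightarrow> v" "\<forall>b\<in>Basis. (%n. abs_L2 (partial b (psi n))) \<longlonglongrightarrow> g b"
 by (rule H1_approxE[OF assms(1)])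
 note t = h(1)[rule_format] and l = h(2) h(3)[rule_format]
 have e: "w \<bullet> abs_L2 (partial b (psi n)) = - (h \<bullet> abs_L2 (psi n))" for n
 using assms(2,3) t[of n] by (simp add: has_weak_partial_iff)
 have "(%n. w \<bullet> abs_L2 (partial b (psi n))) \<longlonglongrightarrow> w \<bullet> g b" by (intro tendsto_intros l assms)
 moreover have "(%n. w \<bullet> abs_L2 (partial b (psi n))) \<longlonglongrightarrow> - (h \<bullet> v)" unfolding e by (intro tendsto_intros l)
 ultimately show ?thesis by (rule LIMSEQ_unique)
qed

lemma H1_0_approx:
 assumes "open Omega" "v \<in> H1_0 Omega"
 shows "H1_approx Omega v (%b. weak_partial Omega b v)"
proof -
 obtain psi where t: "!!n. test_fun Omega (psi n)" and l: "(%n. H1_norm Omega (v - abs_L2 (psi n))) \<longlonglongrightarrow> 0"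
 using assms(2) unfolding H1_0_def by blast
 have v: "has_weak_partial Omega b v (weak_partial Omega b v)" if "b \<in> Basis" for b
 proof -
 have "v \<in> H1 Omega" using assms(2) by (simp add: H1_0_def)
 then have "\<exists>g. has_weak_partial Omega b v g" using that by (simp add: H1_def)
 then obtain g where g: "has_weak_partial Omega b v g" ..
 show ?thesis unfolding weak_partial_eqI[OF assms(1) that g] by (rule g)
 qed
 have d: "weak_partial Omega b (v - abs_L2 (psi n)) = weak_partial Omega b v - abs_L2 (partial b (psi n))" if b: "b \<in> Basis" for b n
 using has_weak_partial_add[OF b v[OF b] has_weak_partial_scale[OF b has_weak_partial_test[OF b t], of "-1"]]
 by (intro weak_partial_eqI[OF assms(1) b]) simp
 have n1: "norm (v - abs_L2 (psi n)) <= H1_norm Omega (v - abs_L2 (psi n))" for n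
 unfolding H1_norm_def by (intro real_le_rsqrt) (simp add: sum_nonneg)
 have n2: "norm (weak_partial Omega b v - abs_L2 (partial b (psi n))) <= H1_norm Omega (v - abs_L2 (psi n))" if b: "b \<in> Basis" for b n
 unfolding H1_norm_def d[OF b, symmetric]
 using member_le_sum[OF b, of "%b. (norm (weak_partial Omega b (v - abs_L2 (psi n))))\<^sup>2"]
 by (intro real_le_rsqrt) (simp add: add_increasing)
 have L: "X \<longlonglongrightarrow> w" if "!!n. norm (w - X n) <= H1_norm Omega (v - abs_L2 (psi n))" for X :: "nat => 'a L2" and w
 proof -
 have "(%n. X n - w) \<longlonglongrightarrow> 0"
 by (rule Lim_null_comparison[OF _ l]) (use that in \<open>simp add: norm_minus_commute\<close>)
 then show ?thesis by (simp add: LIM_zero_iff)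
 qed
 show ?thesis unfolding H1_approx_def by (intro exI[of _ psi] conjI allI ballI t L[OF n1] L[OF n2])
qed

text \<open>The coordinate x . b has derivative 1 in direction b and is bounded by R on
  \<open>Omega\<close>. Integrating the square of psi by parts against it and applying
  Cauchy-Schwarz gives the factor 2 R; the inequality then passes to limits of test
  functions.\<close>

lemma H1_approx_poincare:
 fixes Omega :: "'a::euclidean_space set"
 assumes R: "0 < R" "!!x. x \<in> Omega ==> norm x <= R" and v: "H1_approx Omega v g" and b: "b \<in> Basis"
 shows "norm v <= 2 * R * norm (g b)"
proof -
 obtain psi where h: "\<forall>n. test_fun Omega (psi n)" "(%n. abs_L2 (psi n)) \<longlonglongrightarrow> v" "\<forall>b\<in>Basis. (%n. abs_L2 (partial b (psi n))) \<longlonglongrightarrow> g b"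
 by (rule H1_approxE[OF v])
 note t = h(1)[rule_format] and l = h(2) h(3)[rule_format]
 have P: "norm (abs_L2 psi) <= 2 * R * norm (abs_L2 (partial b psi))" if psi: "test_fun Omega psi" for psi
 proof -
 note sq = test_funD(8)[OF psi] and d = test_funD(3)[OF psi b]
 note sqd = test_funD(8)[OF d]
 have D: "((%x. psi x * (x \<bullet> b)) has_derivative (%h. psi x * (h \<bullet> b) + frechet_derivative psi (at x) h * (x \<bullet> b))) (at x)" for x
 by (rule derivative_eq_intros test_funD(2)[OF psi] refl)+
 have sqx: "sq_integrable (%x. psi x * (x \<bullet> b))" unfolding sq_integrable_def
 proof
 show m: "(%x. psi x * (x \<bullet> b)) \<in> blm"
 using test_funD(9)[OF psi] by (intro measurable_completion) simp
 show "integrable lebesgue (%x. (psi x * (x \<bullet> b))\<^sup>2)"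
 proof (rule Bochner_Integration.integrable_bound)
 show "integrable lebesgue (%x. R\<^sup>2 * (psi x)\<^sup>2)" using sq by (simp add: sq_integrable_def)
 show "AE x in lebesgue. norm ((psi x * (x \<bullet> b))\<^sup>2) <= norm (R\<^sup>2 * (psi x)\<^sup>2)"
 proof (rule AE_I2)
 fix x
 have "(psi x * (x \<bullet> b))\<^sup>2 <= R\<^sup>2 * (psi x)\<^sup>2"
 proof (cases "x \<in> Omega")
 case True
 have "\<bar>x \<bullet> b\<bar> <= R" using Basis_le_norm[OF b, of x] R(2)[OF True] by simp
 then have "(x \<bullet> b)\<^sup>2 <= R\<^sup>2" using R(1) by (simp add: abs_le_square_iff[symmetric])
 then show ?thesis by (simp add: power_mult_distrib mult.commute[of "(psi x)\<^sup>2"] mult_right_mono)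
 qed (simp add: test_funD(4)[OF psi])
 then show "norm ((psi x * (x \<bullet> b))\<^sup>2) <= norm (R\<^sup>2 * (psi x)\<^sup>2)" by simp
 qed
 qed (use m in measurable)
 qed
 have nx: "norm (abs_L2 (%x. psi x * (x \<bullet> b))) <= R * norm (abs_L2 psi)"
 proof (rule power2_le_imp_le)
 have "(LINT x|lebesgue. (psi x * (x \<bullet> b))\<^sup>2) <= (LINT x|lebesgue. R\<^sup>2 * (psi x)\<^sup>2)"
 proof (rule integral_mono)
 fix x
 show "(psi x * (x \<bullet> b))\<^sup>2 <= R\<^sup>2 * (psi x)\<^sup>2"
 proof (cases "x \<in> Omega")
 case True
 have "\<bar>x \<bullet> b\<bar> <= R" using Basis_le_norm[OF b, of x] R(2)[OF True] by simp
 then have "(x \<bullet> b)\<^sup>2 <= R\<^sup>2" using R(1) by (simp add: abs_le_square_iff[symmetric])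
 then show ?thesis by (simp add: power_mult_distrib mult.commute[of "(psi x)\<^sup>2"] mult_right_mono)
 qed (simp add: test_funD(4)[OF psi])
 qed (use sq sqx in \<open>auto simp: sq_integrable_def\<close>)
 then show "(norm (abs_L2 (%x. psi x * (x \<bullet> b))))\<^sup>2 <= (R * norm (abs_L2 psi))\<^sup>2"
 by (simp add: norm_abs_L2[OF sqx] norm_abs_L2[OF sq] power_mult_distrib)
 qed (use R(1) in simp)
 have c: "continuous_on UNIV (%x. psi x * (b \<bullet> b) + frechet_derivative psi (at x) b * (x \<bullet> b))"
 using test_funD(1)[OF psi] test_funD(1)[OF d] unfolding partial_def by (intro continuous_intros) auto
 have "(LINT x|lebesgue. partial b psi x * (psi x * (x \<bullet> b))) = - (LINT x|lebesgue. psi x * (psi x * (b \<bullet> b) + frechet_derivative psi (at x) b * (x \<bullet> b)))"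
 by (rule test_fun_ibp_smooth(1)[OF psi b D c])
 also have "... = - (LINT x|lebesgue. psi x * psi x + partial b psi x * (psi x * (x \<bullet> b)))"
 using b by (simp add: partial_def algebra_simps)
 also have "... = - (LINT x|lebesgue. psi x * psi x) - (LINT x|lebesgue. partial b psi x * (psi x * (x \<bullet> b)))"
 by (subst Bochner_Integration.integral_add) (auto intro: sq_integrable_mult sq sqx sqd)
 finally have "(norm (abs_L2 psi))\<^sup>2 = - 2 * (abs_L2 (partial b psi) \<bullet> abs_L2 (%x. psi x * (x \<bullet> b)))"
 unfolding norm_abs_L2[OF sq] inner_abs_L2[OF sqd sqx] by (simp add: power2_eq_square)
 also have "... <= 2 * (norm (abs_L2 (partial b psi)) * norm (abs_L2 (%x. psi x * (x \<bullet> b))))"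
 using Cauchy_Schwarz_ineq2[of "abs_L2 (partial b psi)" "abs_L2 (%x. psi x * (x \<bullet> b))"] by (simp add: abs_le_iff)
 also have "... <= 2 * (norm (abs_L2 (partial b psi)) * (R * norm (abs_L2 psi)))"
 by (intro mult_left_mono nx) auto
 finally have F: "norm (abs_L2 psi) * norm (abs_L2 psi) <= (2 * R * norm (abs_L2 (partial b psi))) * norm (abs_L2 psi)"
 by (simp add: power2_eq_square mult_ac)
 show ?thesis
 proof (cases "norm (abs_L2 psi) = 0")
 case False
 then have "0 < norm (abs_L2 psi)" by simp
 then show ?thesis by (rule mult_right_le_imp_le[OF F])
 qed (use R(1) in simp)
 qed
 have "(%n. norm (abs_L2 (psi n))) \<longlonglongrightarrow> norm v" by (intro tendsto_intros l)
 moreover have "(%n. 2 * R * norm (abs_L2 (partial b (psi n)))) \<longlonglongrightarrow> 2 * R * norm (g b)" by (intro tendsto_intros l b)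
 ultimately show ?thesis by (rule LIMSEQ_le) (intro exI[of _ 0] allI impI P t)
qed

lemma sq_integrable_imp_norm1_le:
 fixes v :: "'a::euclidean_space L2"
 assumes "AE x in lebesgue. x \<notin> cball 0 R --> rep_L2 v x = 0"
 shows "integrable lebesgue (rep_L2 v)" "(LINT x|lebesgue. \<bar>rep_L2 v x\<bar>) <= norm (abs_L2 (indicator (cball (0::'a) R))) * norm v"
proof -
 let ?w = "%x. indicator (cball 0 R) x * rep_L2 v x"
 have iS: "sq_integrable (indicator (cball (0::'a) R))" by (rule sq_integrable_indicator) simp
 have e: "AE x in lebesgue. rep_L2 v x = ?w x"
 using assms by eventually_elim (auto simp: indicator_def)
 have i: "integrable lebesgue ?w" by (rule sq_integrable_mult[OF iS sq_integrable_rep])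
 then show I: "integrable lebesgue (rep_L2 v)"
 using e by (subst integrable_cong_AE[where g = ?w]) auto
 have sa: "sq_integrable (%x. \<bar>rep_L2 v x\<bar>)" using sq_integrable_rep[of v] by (simp add: sq_integrable_def)
 have "(LINT x|lebesgue. \<bar>rep_L2 v x\<bar>) = (LINT x|lebesgue. indicator (cball 0 R) x * \<bar>rep_L2 v x\<bar>)"
 proof (rule integral_cong_AE)
 show "AE x in lebesgue. \<bar>rep_L2 v x\<bar> = indicator (cball 0 R) x * \<bar>rep_L2 v x\<bar>"
 using assms by eventually_elim (auto simp: indicator_def)
 show "(%x. indicator (cball 0 R) x * \<bar>rep_L2 v x\<bar>) \<in> blm"
 using sq_integrable_mult[OF iS sa] by auto
 qed measurable
 also have "... = abs_L2 (indicator (cball 0 R)) \<bullet> abs_L2 (%x. \<bar>rep_L2 v x\<bar>)"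
 by (rule inner_abs_L2[OF iS sa, symmetric])
 also have "... <= norm (abs_L2 (indicator (cball (0::'a) R))) * norm (abs_L2 (%x. \<bar>rep_L2 v x\<bar>))" by (rule norm_cauchy_schwarz)
 also have "norm (abs_L2 (%x. \<bar>rep_L2 v x\<bar>)) = norm v"
 proof (rule power2_eq_imp_eq)
 have "(norm v)\<^sup>2 = (LINT x|lebesgue. (rep_L2 v x)\<^sup>2)"
 unfolding power2_norm_eq_inner inner_L2_def by (simp add: power2_eq_square)
 then show "(norm (abs_L2 (%x. \<bar>rep_L2 v x\<bar>)))\<^sup>2 = (norm v)\<^sup>2"
 unfolding norm_abs_L2[OF sa] by simp
 qed auto
 finally show "(LINT x|lebesgue. \<bar>rep_L2 v x\<bar>) <= norm (abs_L2 (indicator (cball (0::'a) R))) * norm v" .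
qed

section \<open>The eigenbasis of the Dirichlet Laplacian\<close>

text \<open>The estimates obtained here depend on the set only through the radius R. This keeps
  their constants independent of the choice of the eigenbasis.\<close>

locale dirichlet_domain =
 fixes Omega :: "'a::euclidean_space set" and phi :: "nat => 'a L2" and lam :: "nat => real" and R :: real
 assumes open_domain: "open Omega" and R: "0 < R" "!!x. x \<in> Omega ==> norm x <= R"
 and eigenbasis: "dirichlet_eigenbasis Omega phi lam"
begin

lemma lam_pos: "0 < lam i"
 and orthonormal: "phi i \<bullet> phi j = (if i = j then 1 else 0)"
 and span_dense: "closure (span (range phi)) = L2_on Omega"
 and eigen_H1_0: "phi i \<in> H1_0 Omega"
 and eigen_H2: "phi i \<in> H2 Omega"
 and eigen_eq: "- laplacian Omega (phi i) = lam i *\<^sub>R phi i"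
 using eigenbasis by (auto simp: dirichlet_eigenbasis_def)

lemma closed_L2_on: "closed (L2_on Omega)"
 using closed_closure[of "span (range phi)"] by (simp add: span_dense)

lemma eigen_L2_on: "phi i \<in> L2_on Omega"
 using eigen_H1_0[of i] by (simp add: H1_0_def H1_def)

lemma H1_has_weak_partial:
 assumes "v \<in> H1 Omega" "b \<in> Basis"
 shows "has_weak_partial Omega b v (weak_partial Omega b v)"
proof -
 have "\<exists>g. has_weak_partial Omega b v g" using assms by (simp add: H1_def)
 then obtain g where g: "has_weak_partial Omega b v g" ..
 show ?thesis unfolding weak_partial_eqI[OF open_domain assms(2) g] by (rule g)
qed

lemma eigen_partial:
 assumes "b \<in> Basis"
 shows "has_weak_partial Omega b (phi i) (weak_partial Omega b (phi i))"
 "has_weak_partial Omega b (weak_partial Omega b (phi i)) (weak_partial Omega b (weak_partial Omega b (phi i)))"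
proof -
 have h: "phi i \<in> H1 Omega" "weak_partial Omega b (phi i) \<in> H1 Omega"
 using eigen_H2[of i] assms by (simp_all add: H2_def)
 show "has_weak_partial Omega b (phi i) (weak_partial Omega b (phi i))"
 "has_weak_partial Omega b (weak_partial Omega b (phi i)) (weak_partial Omega b (weak_partial Omega b (phi i)))"
 by (rule H1_has_weak_partial[OF h(1) assms], rule H1_has_weak_partial[OF h(2) assms])
qed

lemma H1_approx_eigen: "H1_approx Omega (phi i) (%b. weak_partial Omega b (phi i))"
 by (rule H1_0_approx[OF open_domain eigen_H1_0])

lemma H1_approx_comb:
 "finite I ==> H1_approx Omega (\<Sum>i\<in>I. c i *\<^sub>R phi i) (%b. \<Sum>i\<in>I. c i *\<^sub>R weak_partial Omega b (phi i))"
 by (rule H1_approx_sum[OF _ H1_approx_eigen])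

text \<open>Green's formula, with one derivative moved off the limit of test functions v onto the
  gradient of the eigenfunction.\<close>

lemma eigen_green:
 assumes "H1_approx Omega v g"
 shows "(\<Sum>b\<in>Basis. weak_partial Omega b (phi i) \<bullet> g b) = lam i * (phi i \<bullet> v)"
proof -
 have "(\<Sum>b\<in>Basis. weak_partial Omega b (phi i) \<bullet> g b) = (\<Sum>b\<in>Basis. - (weak_partial Omega b (weak_partial Omega b (phi i)) \<bullet> v))"
 by (intro sum.cong refl H1_approx_ibp[OF assms] eigen_partial)
 also have "... = (- laplacian Omega (phi i)) \<bullet> v" by (simp add: laplacian_def inner_sum_left sum_negf)
 also have "... = lam i * (phi i \<bullet> v)" unfolding eigen_eq by simp
 finally show ?thesis .
qed

text \<open>The eigenfunctions are orthogonal also for the Dirichlet form, with squared lengths lam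
  i, by Green's formula applied to the combination itself.\<close>

lemma comb_energy:
 assumes "finite I"
 shows "(\<Sum>b\<in>Basis. (norm (\<Sum>i\<in>I. c i *\<^sub>R weak_partial Omega b (phi i)))\<^sup>2) = (\<Sum>i\<in>I. lam i * (c i)\<^sup>2)"
proof -
 let ?g = "%b. \<Sum>i\<in>I. c i *\<^sub>R weak_partial Omega b (phi i)"
 have e: "(\<Sum>b\<in>Basis. weak_partial Omega b (phi i) \<bullet> ?g b) = lam i * c i" if "i \<in> I" for i
 using eigen_green[OF H1_approx_comb[OF assms, of c], of i] orthonormal_inner_sum(1)[OF orthonormal assms, of c i] that
 by (simp add: inner_commute)
 have "(\<Sum>b\<in>Basis. (norm (?g b))\<^sup>2) = (\<Sum>b\<in>Basis. \<Sum>i\<in>I. c i * (weak_partial Omega b (phi i) \<bullet> ?g b))"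
 unfolding power2_norm_eq_inner by (intro sum.cong refl) (subst inner_sum_left, simp)
 also have "... = (\<Sum>i\<in>I. c i * (\<Sum>b\<in>Basis. weak_partial Omega b (phi i) \<bullet> ?g b))"
 by (subst sum.swap) (simp add: sum_distrib_left)
 also have "... = (\<Sum>i\<in>I. lam i * (c i)\<^sup>2)"
 by (intro sum.cong refl) (simp add: e power2_eq_square)
 finally show ?thesis .
qed

text \<open>Poincare's inequality for a normalized eigenfunction. It allows the L^2 part of an H^1
  norm to be absorbed into the gradient part.\<close>

lemma lam_lower: "1 <= 4 * R\<^sup>2 * lam i"
proof -
 obtain b :: 'a where b: "b \<in> Basis" using nonempty_Basis by blast
 have "1 <= 2 * R * norm (weak_partial Omega b (phi i))"
 using H1_approx_poincare[OF R H1_approx_eigen b, of i] orthonormal[of i i] by (simp add: norm_eq_sqrt_inner)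
 then have "1\<^sup>2 <= (2 * R * norm (weak_partial Omega b (phi i)))\<^sup>2" by (intro power_mono) auto
 also have "... = 4 * R\<^sup>2 * (norm (weak_partial Omega b (phi i)))\<^sup>2" by (simp add: power_mult_distrib)
 also have "... <= 4 * R\<^sup>2 * (\<Sum>b\<in>Basis. (norm (weak_partial Omega b (phi i)))\<^sup>2)"
 by (intro mult_left_mono member_le_sum b) auto
 also have "... = 4 * R\<^sup>2 * lam i" using comb_energy[of "{i}" "%_. 1"] by simp
 finally show ?thesis by simp
qed

text \<open>By Green's formula the partial sums of the gradient of the eigenfunction expansion are Cauchy.\<close>

lemma dotH1_green:
 assumes v: "v \<in> L2_on Omega" and s: "summable (%i. lam i * (v \<bullet> phi i)\<^sup>2)"
 shows "(\<Sum>b\<in>Basis. weak_partial Omega b v \<bullet> weak_partial Omega b (phi i)) = lam i * (v \<bullet> phi i)"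
proof -
 define c where "c i = v \<bullet> phi i" for i
 let ?d = "%b i. c i *\<^sub>R weak_partial Omega b (phi i)"
 have v': "(%n. \<Sum>i<n. c i *\<^sub>R phi i) \<longlonglongrightarrow> v"
 using orthonormal_expansion[OF orthonormal, of v] v unfolding span_dense c_def sums_def .
 have sd: "summable (?d b)" if b: "b \<in> Basis" for b
 unfolding summable_Cauchy
 proof (intro allI impI)
 fix e :: real assume e: "0 < e"
 obtain N where N: "!!m n. N <= m ==> norm (\<Sum>i=m..<n. lam i * (c i)\<^sup>2) < e\<^sup>2"
 using s[unfolded summable_Cauchy, rule_format, of "e\<^sup>2"] e unfolding c_def by (meson zero_less_power)
 have "norm (\<Sum>i=m..<n. ?d b i) < e" if "N <= m" for m n
 proof -
 have "(norm (\<Sum>i=m..<n. ?d b i))\<^sup>2 <= (\<Sum>b\<in>Basis. (norm (\<Sum>i=m..<n. ?d b i))\<^sup>2)"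
 by (rule member_le_sum[OF b]) auto
 also have "... < e\<^sup>2" unfolding comb_energy[OF finite_atLeastLessThan] using N[OF that, of n] by simp
 finally show ?thesis using e by (simp add: power2_less_imp_less)
 qed
 then show "\<exists>N. \<forall>m\<ge>N. \<forall>n. norm (\<Sum>i=m..<n. ?d b i) < e" by blast
 qed
 let ?g = "%b. \<Sum>i. ?d b i"
 have g: "(%n. \<Sum>i<n. ?d b i) \<longlonglongrightarrow> ?g b" if "b \<in> Basis" for b
 using sd[OF that] by (rule summable_LIMSEQ)
 have hw: "weak_partial Omega b v = ?g b" if b: "b \<in> Basis" for b
 proof (rule weak_partial_eqI[OF open_domain b])
 have P: "has_weak_partial Omega b (\<Sum>i<n. c i *\<^sub>R phi i) (\<Sum>i<n. ?d b i)" for n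
 by (rule has_weak_partial_sum[OF b finite_lessThan eigen_partial(1)[OF b]])
 show "has_weak_partial Omega b v (?g b)"
 unfolding has_weak_partial_iff[OF b]
 proof (intro conjI allI impI)
 have "!!n. (\<Sum>i<n. ?d b i) \<in> L2_on Omega" using P by (simp add: has_weak_partial_iff[OF b])
 then show "?g b \<in> L2_on Omega" by (rule closed_sequentially[OF closed_L2_on _ g[OF b]])
 fix psi assume psi: "test_fun Omega psi"
 have e: "(\<Sum>i<n. c i *\<^sub>R phi i) \<bullet> abs_L2 (partial b psi) = - ((\<Sum>i<n. ?d b i) \<bullet> abs_L2 psi)" for n
 using P[of n] psi by (simp add: has_weak_partial_iff[OF b])
 have "(%n. (\<Sum>i<n. c i *\<^sub>R phi i) \<bullet> abs_L2 (partial b psi)) \<longlonglongrightarrow> v \<bullet> abs_L2 (partial b psi)" by (intro tendsto_intros v')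
 moreover have "(%n. (\<Sum>i<n. c i *\<^sub>R phi i) \<bullet> abs_L2 (partial b psi)) \<longlonglongrightarrow> - (?g b \<bullet> abs_L2 psi)"
 unfolding e by (intro tendsto_intros g b)
 ultimately show "v \<bullet> abs_L2 (partial b psi) = - (?g b \<bullet> abs_L2 psi)" by (rule LIMSEQ_unique)
 qed
 qed
 have e: "(\<Sum>b\<in>Basis. (\<Sum>i<n. ?d b i) \<bullet> weak_partial Omega b (phi i)) = lam i * ((\<Sum>i<n. c i *\<^sub>R phi i) \<bullet> phi i)" for n
 using eigen_green[OF H1_approx_comb[OF finite_lessThan], of i c n] by (simp only: inner_commute)
 have "(%n. \<Sum>b\<in>Basis. (\<Sum>i<n. ?d b i) \<bullet> weak_partial Omega b (phi i)) \<longlonglongrightarrow> (\<Sum>b\<in>Basis. weak_partial Omega b v \<bullet> weak_partial Omega b (phi i))"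
 by (intro tendsto_sum tendsto_inner tendsto_const) (simp add: hw g)
 moreover have "(%n. \<Sum>b\<in>Basis. (\<Sum>i<n. ?d b i) \<bullet> weak_partial Omega b (phi i)) \<longlonglongrightarrow> lam i * (v \<bullet> phi i)"
 unfolding e by (intro tendsto_intros v')
 ultimately show ?thesis by (rule LIMSEQ_unique)
qed

subsection \<open>The Fourier transform on \<open>L\<^sup>2(Omega)\<close>\<close>

lemma L2_on_cball: "v \<in> L2_on Omega ==> AE x in lebesgue. x \<notin> cball 0 R --> rep_L2 v x = 0"
 unfolding L2_on_def mem_Collect_eq by (erule eventually_mono) (use R(2) in auto)

lemma integrable_rep_L2: "v \<in> L2_on Omega ==> integrable lebesgue (rep_L2 v)"
 by (rule sq_integrable_imp_norm1_le(1)[OF L2_on_cball])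

lemma fourier_rep_add:
 assumes "v \<in> L2_on Omega" "w \<in> L2_on Omega"
 shows "fourier (rep_L2 (v + w)) xi = fourier (rep_L2 v) xi + fourier (rep_L2 w) xi"
proof -
 have "fourier (rep_L2 (v + w)) = fourier (%x. rep_L2 v x + rep_L2 w x)"
 by (rule fourier_cong_AE[OF _ _ rep_L2_add]) measurable
 then show ?thesis by (simp add: fourier_add integrable_rep_L2 assms)
qed

text \<open>On a bounded support L^2 convergence implies L^1 convergence, and therefore convergence
  of the transforms at each frequency.\<close>

lemma fourier_rep_tendsto:
 assumes "!!n. X n \<in> L2_on Omega" "X \<longlonglongrightarrow> v"
 shows "(%n. fourier (rep_L2 (X n)) xi) \<longlonglongrightarrow> fourier (rep_L2 v) xi"
proof -
 have v: "v \<in> L2_on Omega" by (rule closed_sequentially[OF closed_L2_on assms])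
 define K where "K = (2 * pi) powr (- real DIM('a) / 2) * norm (abs_L2 (indicator (cball (0::'a) R)))"
 have d: "X n - v \<in> L2_on Omega" for n using assms(1) v by (rule subspace_diff[OF subspace_L2_on])
 have B: "cmod (fourier (rep_L2 (X n)) xi - fourier (rep_L2 v) xi) <= K * norm (X n - v)" for n
 proof -
 have "fourier (rep_L2 (X n)) xi - fourier (rep_L2 v) xi = fourier (rep_L2 (X n - v)) xi"
 using fourier_rep_add[OF d v, of n xi] by simp
 then have "cmod (fourier (rep_L2 (X n)) xi - fourier (rep_L2 v) xi) <= (2 * pi) powr (- real DIM('a) / 2) * (LINT x|lebesgue. \<bar>rep_L2 (X n - v) x\<bar>)"
 by (simp only: cmod_fourier_le)
 also have "... <= K * norm (X n - v)"
 unfolding K_def mult.assoc by (intro mult_left_mono sq_integrable_imp_norm1_le(2) L2_on_cball d) simp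
 finally show ?thesis .
 qed
 have "(%n. norm (X n - v)) \<longlonglongrightarrow> 0"
 using assms(2) by (simp add: LIM_zero_iff tendsto_norm_zero)
 then have Z: "(%n. K * norm (X n - v)) \<longlonglongrightarrow> 0" by (rule tendsto_mult_right_zero)
 have "(%n. fourier (rep_L2 (X n)) xi - fourier (rep_L2 v) xi) \<longlonglongrightarrow> 0"
 by (rule Lim_null_comparison[OF always_eventually[OF allI[OF B]] Z])
 then show ?thesis by (simp add: LIM_zero_iff)
qed

lemma fourier_abs_test: "test_fun Omega psi ==> fourier (rep_L2 (abs_L2 psi)) = fourier psi"
 by (intro fourier_cong_AE measurable_rep_L2 rep_abs_L2 borel_measurable_integrable test_funD(8) test_funD(6))

lemma H1_approx_L2_on:
 assumes "H1_approx Omega v g"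
 shows "v \<in> L2_on Omega" "b \<in> Basis ==> g b \<in> L2_on Omega"
 "b \<in> Basis ==> fourier (rep_L2 (g b)) xi = (\<i> * (xi \<bullet> b)) * fourier (rep_L2 v) xi"
proof -
 obtain psi where h: "\<forall>n. test_fun Omega (psi n)" "(%n. abs_L2 (psi n)) \<longlonglongrightarrow> v" "\<forall>b\<in>Basis. (%n. abs_L2 (partial b (psi n))) \<longlonglongrightarrow> g b"
 by (rule H1_approxE[OF assms])
 note t = h(1)[rule_format] and l = h(2) h(3)[rule_format]
 have a: "abs_L2 (psi n) \<in> L2_on Omega" for n by (rule L2_on_abs_test[OF t])
 show "v \<in> L2_on Omega" by (rule closed_sequentially[OF closed_L2_on a l(1)])
 assume b: "b \<in> Basis"
 have a': "abs_L2 (partial b (psi n)) \<in> L2_on Omega" for n by (rule L2_on_abs_test[OF test_funD(3)[OF t b]])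
 show "g b \<in> L2_on Omega" by (rule closed_sequentially[OF closed_L2_on a' l(2)[OF b]])
 have e: "fourier (rep_L2 (abs_L2 (partial b (psi n)))) xi = (\<i> * (xi \<bullet> b)) * fourier (rep_L2 (abs_L2 (psi n))) xi" for n
 unfolding fourier_abs_test[OF t] fourier_abs_test[OF test_funD(3)[OF t b]] by (rule fourier_partial[OF t b])
 have "(%n. fourier (rep_L2 (abs_L2 (partial b (psi n)))) xi) \<longlonglongrightarrow> fourier (rep_L2 (g b)) xi"
 by (rule fourier_rep_tendsto[OF a' l(2)[OF b]])
 moreover have "(%n. fourier (rep_L2 (abs_L2 (partial b (psi n)))) xi) \<longlonglongrightarrow> (\<i> * (xi \<bullet> b)) * fourier (rep_L2 v) xi"
 unfolding e by (intro tendsto_mult tendsto_const fourier_rep_tendsto[OF a l(1)])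
 ultimately show "fourier (rep_L2 (g b)) xi = (\<i> * (xi \<bullet> b)) * fourier (rep_L2 v) xi" by (rule LIMSEQ_unique)
qed

lemma fourier_rep_bessel:
 "v \<in> L2_on Omega ==> (INTP xi. ennreal ((cmod (fourier (rep_L2 v) xi))\<^sup>2)) <= ennreal ((norm v)\<^sup>2)"
 unfolding nn_integral_rep_L2[symmetric] by (rule fourier_bessel[OF integrable_rep_L2 measurable_rep_L2])

lemma H1_approx_bessel:
 assumes "H1_approx Omega v g"
 shows "(INTP xi. ennreal ((1 + (norm xi)\<^sup>2) * (cmod (fourier (rep_L2 v) xi))\<^sup>2))
 <= ennreal ((norm v)\<^sup>2 + (\<Sum>b\<in>Basis. (norm (g b))\<^sup>2))"
proof -
 note L = H1_approx_L2_on[OF assms]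
 have e: "(1 + (norm xi)\<^sup>2) * (cmod (fourier (rep_L2 v) xi))\<^sup>2
 = (cmod (fourier (rep_L2 v) xi))\<^sup>2 + (\<Sum>b\<in>Basis. (cmod (fourier (rep_L2 (g b)) xi))\<^sup>2)" for xi
 by (simp add: L(3) norm_mult power_mult_distrib sum_distrib_right[symmetric] norm_power2_Basis[symmetric] algebra_simps)
 have "(INTP xi. ennreal ((1 + (norm xi)\<^sup>2) * (cmod (fourier (rep_L2 v) xi))\<^sup>2))
 = (INTP xi. ennreal ((cmod (fourier (rep_L2 v) xi))\<^sup>2) + (\<Sum>b\<in>Basis. ennreal ((cmod (fourier (rep_L2 (g b)) xi))\<^sup>2)))"
 unfolding e by (simp add: ennreal_plus sum_nonneg)
 also have "... = (INTP xi. ennreal ((cmod (fourier (rep_L2 v) xi))\<^sup>2)) + (\<Sum>b\<in>Basis. \<integral>\<^sup>+xi. ennreal ((cmod (fourier (rep_L2 (g b)) xi))\<^sup>2) \<partial>lebesgue)"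
 by (subst nn_integral_add) (simp_all add: nn_integral_sum del: sum_ennreal)
 also have "... <= ennreal ((norm v)\<^sup>2) + (\<Sum>b\<in>Basis. ennreal ((norm (g b))\<^sup>2))"
 by (intro add_mono sum_mono fourier_rep_bessel L)
 also have "... = ennreal ((norm v)\<^sup>2 + (\<Sum>b\<in>Basis. (norm (g b))\<^sup>2))" by (simp add: ennreal_plus sum_nonneg)
 finally show ?thesis .
qed

text \<open>The endpoint H^1 of the interpolation. The constant adds to the gradient energy the L^2
  norm, absorbed by \<open>lam_lower\<close>.\<close>

lemma comb_bessel:
 "(INTP xi. ennreal ((1 + (norm xi)\<^sup>2) * (cmod (fourier (rep_L2 (\<Sum>i<n. c i *\<^sub>R phi i)) xi))\<^sup>2))
 <= ennreal ((1 + 4 * R\<^sup>2) * (\<Sum>i<n. lam i * (c i)\<^sup>2))"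
proof -
 have "(norm (\<Sum>i<n. c i *\<^sub>R phi i))\<^sup>2 = (\<Sum>i<n. (c i)\<^sup>2)" by (rule orthonormal_inner_sum(2)[OF orthonormal finite_lessThan])
 also have "... <= (\<Sum>i<n. 4 * R\<^sup>2 * (lam i * (c i)\<^sup>2))"
 using mult_right_mono[OF lam_lower, of "(c _)\<^sup>2"] by (intro sum_mono) (simp add: mult.assoc)
 also have "... = 4 * R\<^sup>2 * (\<Sum>i<n. lam i * (c i)\<^sup>2)" by (rule sum_distrib_left[symmetric])
 finally have "(norm (\<Sum>i<n. c i *\<^sub>R phi i))\<^sup>2 + (\<Sum>b\<in>Basis. (norm (\<Sum>i<n. c i *\<^sub>R weak_partial Omega b (phi i)))\<^sup>2)
 <= (1 + 4 * R\<^sup>2) * (\<Sum>i<n. lam i * (c i)\<^sup>2)"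
 unfolding comb_energy[OF finite_lessThan] by (simp add: algebra_simps)
 then show ?thesis using H1_approx_bessel[OF H1_approx_comb[OF finite_lessThan, of c n]] by (meson ennreal_leI order_trans)
qed

end

section \<open>Square roots of extended reals and the interpolation weight\<close>

lemma esqrt_power2: "(esqrt x)\<^sup>2 = x"
 by (cases x) (auto simp: esqrt_def ennreal_power)

lemma esqrt_mono: "x <= y ==> esqrt x <= esqrt y"
 by (cases x; cases y) (auto simp: esqrt_def top_unique intro!: ennreal_leI)

lemma esqrt_ennreal: "0 <= r ==> esqrt (ennreal r) = ennreal (sqrt r)"
 by (simp add: esqrt_def)

lemma esqrt_of_power2: "esqrt (x\<^sup>2) = x"
 by (cases x) (auto simp: esqrt_def ennreal_power)

lemma esqrt_le: "x <= y\<^sup>2 ==> esqrt x <= y"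
 using esqrt_mono[of x "y\<^sup>2"] by (simp add: esqrt_of_power2)

context
 fixes beta :: real
 assumes beta: "0 < beta" "beta < 1"
begin

text \<open>Integrated over s this gives a constant multiple of x^beta. The power is thus a
  superposition of the functions s x / (1 + s x), which the K-functional handles one at a
  time.\<close>

definition interp_weight :: "real => real => real" where
 "interp_weight s x = (if 0 < s then s powr (- beta - 1) * (s * x / (1 + s * x)) else 0)"

lemma interp_weight_measurable [measurable]:
 assumes [measurable]: "f \<in> borel_measurable M" "g \<in> borel_measurable M"
 shows "(%x. interp_weight (f x) (g x)) \<in> borel_measurable M"
 unfolding interp_weight_def by measurable

lemma interp_weight_scale:
 assumes "0 < x"
 shows "(\<integral>\<^sup>+s. ennreal (interp_weight s x) \<partial>lborel) = ennreal (x powr beta) * (\<integral>\<^sup>+s. ennreal (interp_weight s 1) \<partial>lborel)"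
proof -
 have "(\<integral>\<^sup>+s. ennreal (interp_weight s x) \<partial>lborel) = ennreal \<bar>1 / x\<bar> * (\<integral>\<^sup>+s. ennreal (interp_weight (0 + (1 / x) * s) x) \<partial>lborel)"
 using assms by (intro nn_integral_real_affine) auto
 also have "(%s. ennreal (interp_weight (0 + (1 / x) * s) x)) = (%s. ennreal (x powr (beta + 1)) * ennreal (interp_weight s 1))"
 proof
 fix s
 have "interp_weight (s / x) x = x powr (beta + 1) * interp_weight s 1"
 proof (cases "0 < s")
 case True
 have "(s / x) powr (- beta - 1) = s powr (- beta - 1) * x powr (beta + 1)"
 using True assms by (simp add: powr_divide powr_minus_divide[of x "beta + 1", symmetric] powr_minus field_simps)
 (simp add: powr_add[symmetric])
 then show ?thesis using True assms by (simp add: interp_weight_def)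
 qed (use assms in \<open>simp add: interp_weight_def zero_less_divide_iff\<close>)
 then show "ennreal (interp_weight (0 + (1 / x) * s) x) = ennreal (x powr (beta + 1)) * ennreal (interp_weight s 1)"
 by (simp add: ennreal_mult')
 qed
 also have "(\<integral>\<^sup>+s. ennreal (x powr (beta + 1)) * ennreal (interp_weight s 1) \<partial>lborel) = ennreal (x powr (beta + 1)) * (\<integral>\<^sup>+s. ennreal (interp_weight s 1) \<partial>lborel)"
 by (rule nn_integral_cmult) measurable
 also have "ennreal \<bar>1 / x\<bar> * (ennreal (x powr (beta + 1)) * (\<integral>\<^sup>+s. ennreal (interp_weight s 1) \<partial>lborel)) = ennreal (x powr beta) * (\<integral>\<^sup>+s. ennreal (interp_weight s 1) \<partial>lborel)"
 using assms by (simp add: mult.assoc[symmetric] ennreal_mult[symmetric] powr_add)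
 finally show ?thesis .
qed

text \<open>The constant is cancelled at the end of the interpolation, so it must be neither 0 nor
  infinite. It is bounded below through the interval [1,2]; above, s^(-beta) is integrable at 0 and
  s^(-beta-1) at infinity because 0 < beta < 1.\<close>

lemma interp_weight_const:
 "(\<integral>\<^sup>+s. ennreal (interp_weight s 1) \<partial>lborel) ~= 0" "(\<integral>\<^sup>+s. ennreal (interp_weight s 1) \<partial>lborel) ~= \<infinity>"
proof -
 have "(\<integral>\<^sup>+s. ennreal (1/8) * indicator {1..2::real} s \<partial>lborel) <= (\<integral>\<^sup>+s. ennreal (interp_weight s 1) \<partial>lborel)"
 proof (rule nn_integral_mono)
 fix s :: real
 have "1 / 8 <= interp_weight s 1" if s: "1 <= s" "s <= 2"
 proof -
 have "(2::real) powr (-2) <= s powr (-2)" using s by (intro powr_mono2') auto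
 also have "... <= s powr (- beta - 1)" using s beta by (intro powr_mono) auto
 finally have "1 / 4 <= s powr (- beta - 1)" by (simp add: powr_minus powr_numeral)
 moreover have "1 / 2 <= s / (1 + s)" using s by (simp add: field_simps)
 ultimately have "(1 / 4) * (1 / 2) <= s powr (- beta - 1) * (s / (1 + s))" by (intro mult_mono) auto
 then show ?thesis using s by (simp add: interp_weight_def)
 qed
 then show "ennreal (1/8) * indicator {1..2} s <= ennreal (interp_weight s 1)"
 by (auto simp: indicator_def intro: ennreal_leI)
 qed
 moreover have "(\<integral>\<^sup>+s. ennreal (1/8) * indicator {1..2::real} s \<partial>lborel) = ennreal (1/8)"
 by (subst nn_integral_cmult_indicator) auto
 ultimately show "(\<integral>\<^sup>+s. ennreal (interp_weight s 1) \<partial>lborel) ~= 0" by auto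
 have F: "(\<integral>\<^sup>+s. ennreal (s powr (- beta - 1)) * indicator {1..} s \<partial>lborel) = ennreal (0 - (- (1 powr (- beta)) / beta))"
 proof (rule nn_integral_FTC_atLeast)
 show "((%s. - (s powr (- beta)) / beta) has_real_derivative s powr (- beta - 1)) (at s)" if "1 <= s" for s
 using that beta by (auto intro!: derivative_eq_intros)
 have "((%s. s powr (- beta)) \<longlongrightarrow> 0) at_top"
 using beta by (intro tendsto_neg_powr filterlim_ident) auto
 then have "((%s. - (s powr (- beta)) / beta) \<longlongrightarrow> - 0 / beta) at_top" using beta by (intro tendsto_intros) auto
 then show "((%s. - (s powr (- beta)) / beta) \<longlongrightarrow> 0) at_top" by simp
 qed auto
 have "(\<integral>\<^sup>+s. ennreal (interp_weight s 1) \<partial>lborel) <= (\<integral>\<^sup>+s. ennreal (indicator {..<1} s * rl_kernel (1 - beta) s) + ennreal (s powr (- beta - 1)) * indicator {1..} s \<partial>lborel)"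
 proof (rule nn_integral_mono)
 fix s :: real
 consider "s <= 0" | "0 < s" "s < 1" | "1 <= s" by linarith
 then show "ennreal (interp_weight s 1) <= ennreal (indicator {..<1} s * rl_kernel (1 - beta) s) + ennreal (s powr (- beta - 1)) * indicator {1..} s"
 proof cases
 case 2
 have "s powr (- beta - 1) * (s / (1 + s)) <= s powr (- beta - 1) * s"
 using 2 by (intro mult_left_mono) (auto simp: field_simps)
 also have "... = s powr (- beta)" using 2 by (simp add: powr_diff)
 finally show ?thesis using 2 by (simp add: interp_weight_def rl_kernel_def ennreal_leI)
 next
 case 3
 have "s powr (- beta - 1) * (s / (1 + s)) <= s powr (- beta - 1) * 1"
 using 3 by (intro mult_left_mono) (auto simp: field_simps)
 then show ?thesis using 3 by (simp add: interp_weight_def ennreal_leI add_increasing)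
 qed (simp add: interp_weight_def)
 qed
 also have "... = (\<integral>\<^sup>+s. ennreal (indicator {..<1} s * rl_kernel (1 - beta) s) \<partial>lborel) + ennreal (0 - (- (1 powr (- beta)) / beta))"
 unfolding F[symmetric] by (rule nn_integral_add) (simp_all add: rl_kernel_def)
 also have "(\<integral>\<^sup>+s. ennreal (indicator {..<1} s * rl_kernel (1 - beta) s) \<partial>lborel) = (INTP s. ennreal (indicator {..<1} s * rl_kernel (1 - beta) s))"
 by (rule nn_integral_completion[symmetric])
 also have "... = ennreal (1 powr (1 - beta) / (1 - beta))" using beta by (intro nn_integral_rl_kernel) auto
 finally show "(\<integral>\<^sup>+s. ennreal (interp_weight s 1) \<partial>lborel) ~= \<infinity>"
 using beta by (auto simp: top_unique simp flip: ennreal_plus)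
qed

end

section \<open>Sobolev norms of eigenfunction combinations and the coefficients of
  functionals\<close>

context dirichlet_domain
begin

text \<open>For a function supported in a bounded set the truncations in the definition are
  eventually the function itself almost everywhere. Its transform therefore is an admissible choice,
  and any two choices agree almost everywhere.\<close>

lemma plancherel_L2_on:
 assumes v: "v \<in> L2_on Omega"
 shows "AE xi in lebesgue. plancherel v xi = fourier (rep_L2 v) xi"
proof -
 let ?F = "fourier (rep_L2 v)"
 define N where "N = (%g n. \<integral>\<^sup>+xi. ennreal ((cmod (g xi - fourier (%x. indicator (ball 0 (real n)) x * rep_L2 v x) xi))\<^sup>2) \<partial>lebesgue)"
 have e: "\<forall>\<^sub>F n in sequentially. N g n = (INTP xi. ennreal ((cmod (g xi - ?F xi))\<^sup>2))" for g
 proof -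
 obtain n0 where n0: "R < real n0" using reals_Archimedean2 by blast
 have "N g n = (INTP xi. ennreal ((cmod (g xi - ?F xi))\<^sup>2))" if "n0 <= n" for n
 proof -
 have n: "R < real n" using n0 that by linarith
 have "fourier (%x. indicator (ball 0 (real n)) x * rep_L2 v x) = ?F"
 proof (rule fourier_cong_AE)
 show "AE x in lebesgue. indicator (ball 0 (real n)) x * rep_L2 v x = rep_L2 v x"
 using L2_on_cball[OF v] by eventually_elim (use n in \<open>auto simp: indicator_def\<close>)
 show "(%x. indicator (ball 0 (real n)) x * rep_L2 v x) \<in> blm"
 by (intro borel_measurable_times borel_measurable_indicator measurable_rep_L2) simp
 qed simp
 then show ?thesis by (simp only: N_def)
 qed
 then show ?thesis unfolding eventually_sequentially by blast
 qed
 have pl: "plancherel v = (SOME g. g \<in> blm \<and> N g \<longlonglongrightarrow> 0)"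
 unfolding plancherel_def N_def ..
 have "\<exists>g. g \<in> blm \<and> N g \<longlonglongrightarrow> 0"
 by (rule exI[of _ ?F]) (use e[of ?F] in \<open>auto intro: tendsto_eventually\<close>)
 then have P: "plancherel v \<in> blm \<and> N (plancherel v) \<longlonglongrightarrow> 0"
 unfolding pl by (rule someI_ex)
 note [measurable] = P[THEN conjunct1]
 have "N (plancherel v) \<longlonglongrightarrow> (INTP xi. ennreal ((cmod (plancherel v xi - ?F xi))\<^sup>2))"
 by (rule tendsto_eventually[OF e])
 then have "(INTP xi. ennreal ((cmod (plancherel v xi - ?F xi))\<^sup>2)) = 0"
 by (rule LIMSEQ_unique[OF _ P[THEN conjunct2]])
 then have "AE xi in lebesgue. ennreal ((cmod (plancherel v xi - ?F xi))\<^sup>2) = 0"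
 by (subst (asm) nn_integral_0_iff_AE) measurable
 then show ?thesis by eventually_elim (simp add: ennreal_eq_0_iff)
qed

text \<open>The extension by zero is one competitor in the quotient norm, so the infimum is at most
  its norm on the whole space.\<close>

lemma Hs_norm_le:
 assumes "v \<in> L2_on Omega"
 shows "Hs_norm Omega s v <= esqrt (INTP xi. ennreal ((1 + (norm xi)\<^sup>2) powr s * (cmod (fourier (rep_L2 v) xi))\<^sup>2))"
proof -
 have "Hs_norm Omega s v <= Hs_norm_space s v" unfolding Hs_norm_def by (rule INF_lower) simp
 also have "... = esqrt (INTP xi. ennreal ((1 + (norm xi)\<^sup>2) powr s * (cmod (fourier (rep_L2 v) xi))\<^sup>2))"
 unfolding Hs_norm_space_def using plancherel_L2_on[OF assms]
 by (intro arg_cong[where f = esqrt] nn_integral_cong_AE) (auto elim!: eventually_mono)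
 finally show ?thesis .
qed

lemma Hs_norm_H1:
 assumes "H1_approx Omega v g" "beta <= 1"
 shows "Hs_norm Omega beta v <= ennreal (sqrt ((norm v)\<^sup>2 + (\<Sum>b\<in>Basis. (norm (g b))\<^sup>2)))"
proof -
 have w: "(1 + (norm xi)\<^sup>2) powr beta <= 1 + (norm xi)\<^sup>2" for xi :: 'a
 using powr_mono[OF assms(2), of "1 + (norm xi)\<^sup>2"] by simp
 have "(INTP xi. ennreal ((1 + (norm xi)\<^sup>2) powr beta * (cmod (fourier (rep_L2 v) xi))\<^sup>2))
 <= (INTP xi. ennreal ((1 + (norm xi)\<^sup>2) * (cmod (fourier (rep_L2 v) xi))\<^sup>2))"
 by (intro nn_integral_mono ennreal_leI mult_right_mono w) simp
 also note H1_approx_bessel[OF assms(1)]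
 finally have "esqrt (INTP xi. ennreal ((1 + (norm xi)\<^sup>2) powr beta * (cmod (fourier (rep_L2 v) xi))\<^sup>2))
 <= esqrt (ennreal ((norm v)\<^sup>2 + (\<Sum>b\<in>Basis. (norm (g b))\<^sup>2)))" by (rule esqrt_mono)
 then show ?thesis using Hs_norm_le[OF H1_approx_L2_on(1)[OF assms(1)], of beta]
 by (simp add: esqrt_ennreal sum_nonneg del: ennreal_plus)
qed

text \<open>Places the eigenfunctions and their combinations in the space on which elements of
  \<open>Hneg\<close> are linear and bounded. Convergence in H^1 dominates convergence in
  H^beta.\<close>

lemma H1_approx_Hs_0:
 assumes "H1_approx Omega v g" "beta <= 1"
 shows "v \<in> Hs_0 Omega beta"
proof -
 obtain psi where h: "\<forall>n. test_fun Omega (psi n)" "(%n. abs_L2 (psi n)) \<longlonglongrightarrow> v" "\<forall>b\<in>Basis. (%n. abs_L2 (partial b (psi n))) \<longlonglongrightarrow> g b"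
 by (rule H1_approxE[OF assms(1)])
 note t = h(1)[rule_format] and l = h(2) h(3)[rule_format]
 let ?B = "%n. sqrt ((norm (v - abs_L2 (psi n)))\<^sup>2 + (\<Sum>b\<in>Basis. (norm (g b - abs_L2 (partial b (psi n))))\<^sup>2))"
 have B: "Hs_norm Omega beta (v - abs_L2 (psi n)) <= ennreal (?B n)" for n
 proof (rule Hs_norm_H1[OF _ assms(2)])
 show "H1_approx Omega (v - abs_L2 (psi n)) (%b. g b - abs_L2 (partial b (psi n)))"
 using H1_approx_add[OF assms(1) H1_approx_scale[OF H1_approx_test[OF t], of "-1"]] by simp
 qed
 have "?B \<longlonglongrightarrow> sqrt ((norm (v - v))\<^sup>2 + (\<Sum>b\<in>Basis. (norm (g b - g b))\<^sup>2))"
 by (intro tendsto_intros l)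
 then have "?B \<longlonglongrightarrow> 0" by simp
 then have "(%n. ennreal (?B n)) \<longlonglongrightarrow> ennreal 0" by (rule tendsto_ennrealI)
 then have "(%n. ennreal (?B n)) \<longlonglongrightarrow> 0" by simp
 then have "(%n. Hs_norm Omega beta (v - abs_L2 (psi n))) \<longlonglongrightarrow> 0"
 by (rule tendsto_sandwich[OF always_eventually[OF allI[OF zero_le]] always_eventually[OF allI[OF B]] tendsto_const])
 moreover have "Hs_norm Omega beta v < \<infinity>"
 using Hs_norm_H1[OF assms] by (rule le_less_trans) simp
 ultimately show ?thesis unfolding Hs_0_def using H1_approx_L2_on(1)[OF assms(1)] h(1) by blast
qed

lemma comb_L2_on: "(\<Sum>i<n. c i *\<^sub>R phi i) \<in> L2_on Omega"
 by (rule H1_approx_L2_on(1)[OF H1_approx_comb[OF finite_lessThan]])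

text \<open>The splitting \<open>v = (1 - (1 + sA)\<^sup>-\<^sup>1) v + (1 + sA)\<^sup>-\<^sup>1 v\<close> with \<open>A = -\<Delta>\<close> realizes the
 K-functional of \<open>(L\<^sup>2, H\<^sup>1)\<close>; integrating over \<open>s\<close> interpolates the two Bessel inequalities.\<close>

lemma comb_K_functional:
 assumes s: "0 < s"
 shows "(INTP xi. ennreal (s * (1 + (norm xi)\<^sup>2) / (1 + s * (1 + (norm xi)\<^sup>2)) * (cmod (fourier (rep_L2 (\<Sum>i<n. c i *\<^sub>R phi i)) xi))\<^sup>2))
 <= ennreal ((1 + 4 * R\<^sup>2) * (\<Sum>i<n. s * lam i / (1 + s * lam i) * (c i)\<^sup>2))"
proof -
 define c0 where "c0 i = s * lam i / (1 + s * lam i) * c i" for i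
 define c1 where "c1 i = 1 / (1 + s * lam i) * c i" for i
 have p: "0 < 1 + s * lam i" for i using s lam_pos[of i] by (simp add: add_pos_pos)
 have "c0 i + c1 i = c i" for i using p[of i] by (simp add: c0_def c1_def divide_simps) (simp add: algebra_simps)
 then have v: "(\<Sum>i<n. c i *\<^sub>R phi i) = (\<Sum>i<n. c0 i *\<^sub>R phi i) + (\<Sum>i<n. c1 i *\<^sub>R phi i)"
 by (simp add: sum.distrib[symmetric] scaleR_add_left[symmetric])
 let ?F0 = "fourier (rep_L2 (\<Sum>i<n. c0 i *\<^sub>R phi i))" and ?F1 = "fourier (rep_L2 (\<Sum>i<n. c1 i *\<^sub>R phi i))"
 \<comment> \<open>The best constant for splitting the square: the difference of the two sides,
   multiplied by 1 + t, is at least the square of |a| - t |b|. It is used with t = s (1 +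
   |xi|^2).\<close>
 have pw: "t / (1 + t) * (cmod (a + b))\<^sup>2 <= (cmod a)\<^sup>2 + t * (cmod b)\<^sup>2" if t: "0 < t" for t a b
 proof -
 have "t * (cmod (a + b))\<^sup>2 <= t * (cmod a + cmod b)\<^sup>2"
 using t by (intro mult_left_mono power_mono norm_triangle_ineq) auto
 also have "... <= (1 + t) * ((cmod a)\<^sup>2 + t * (cmod b)\<^sup>2)"
 proof -
 have "0 <= (cmod a - t * cmod b)\<^sup>2" by simp
 then show ?thesis by (simp add: power2_eq_square algebra_simps)
 qed
 finally show ?thesis using t by (simp add: pos_divide_le_eq mult.commute)
 qed
 have "(INTP xi. ennreal (s * (1 + (norm xi)\<^sup>2) / (1 + s * (1 + (norm xi)\<^sup>2)) * (cmod (fourier (rep_L2 (\<Sum>i<n. c i *\<^sub>R phi i)) xi))\<^sup>2))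
 <= (INTP xi. ennreal ((cmod (?F0 xi))\<^sup>2) + ennreal s * ennreal ((1 + (norm xi)\<^sup>2) * (cmod (?F1 xi))\<^sup>2))"
 proof (rule nn_integral_mono)
 fix xi :: 'a
 have "0 < s * (1 + (norm xi)\<^sup>2)" using s by (intro mult_pos_pos add_pos_nonneg) auto
 note pw[OF this, of "?F0 xi" "?F1 xi"]
 then have "ennreal (s * (1 + (norm xi)\<^sup>2) / (1 + s * (1 + (norm xi)\<^sup>2)) * (cmod (?F0 xi + ?F1 xi))\<^sup>2)
 <= ennreal ((cmod (?F0 xi))\<^sup>2 + s * ((1 + (norm xi)\<^sup>2) * (cmod (?F1 xi))\<^sup>2))" by (intro ennreal_leI) (simp add: mult.assoc)
 then show "ennreal (s * (1 + (norm xi)\<^sup>2) / (1 + s * (1 + (norm xi)\<^sup>2)) * (cmod (fourier (rep_L2 (\<Sum>i<n. c i *\<^sub>R phi i)) xi))\<^sup>2)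
 <= ennreal ((cmod (?F0 xi))\<^sup>2) + ennreal s * ennreal ((1 + (norm xi)\<^sup>2) * (cmod (?F1 xi))\<^sup>2)"
 unfolding v fourier_rep_add[OF comb_L2_on comb_L2_on] using s by (simp add: ennreal_plus ennreal_mult)
 qed
 also have "... = (INTP xi. ennreal ((cmod (?F0 xi))\<^sup>2)) + ennreal s * (INTP xi. ennreal ((1 + (norm xi)\<^sup>2) * (cmod (?F1 xi))\<^sup>2))"
 proof -
 have "(%xi::'a. 1 + (norm xi)\<^sup>2) \<in> blm" by (rule measurable_completion) measurable
 note [measurable] = this
 show ?thesis by (subst nn_integral_add, measurable) (subst nn_integral_cmult, measurable)
 qed
 also have "... <= ennreal (\<Sum>i<n. (c0 i)\<^sup>2) + ennreal s * ennreal ((1 + 4 * R\<^sup>2) * (\<Sum>i<n. lam i * (c1 i)\<^sup>2))"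
 using fourier_rep_bessel[OF comb_L2_on, of c0 n] orthonormal_inner_sum(2)[OF orthonormal finite_lessThan, of c0 n]
 by (intro add_mono mult_left_mono comb_bessel) simp_all
 also have "... = ennreal ((\<Sum>i<n. (c0 i)\<^sup>2) + s * ((1 + 4 * R\<^sup>2) * (\<Sum>i<n. lam i * (c1 i)\<^sup>2)))"
 proof -
 have 0: "0 <= (\<Sum>i<n. (c0 i)\<^sup>2)" by (intro sum_nonneg) simp
 have 1: "0 <= (1 + 4 * R\<^sup>2) * (\<Sum>i<n. lam i * (c1 i)\<^sup>2)"
 by (intro mult_nonneg_nonneg sum_nonneg add_nonneg_nonneg less_imp_le[OF lam_pos]) auto
 show ?thesis unfolding ennreal_plus[OF 0 mult_nonneg_nonneg[OF less_imp_le[OF s] 1]] ennreal_mult[OF less_imp_le[OF s] 1] ..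
 qed
 also have "... <= ennreal ((1 + 4 * R\<^sup>2) * (\<Sum>i<n. s * lam i / (1 + s * lam i) * (c i)\<^sup>2))"
 proof (rule ennreal_leI)
 have A: "(\<Sum>i<n. (c0 i)\<^sup>2) <= (1 + 4 * R\<^sup>2) * (\<Sum>i<n. (c0 i)\<^sup>2)"
 using sum_nonneg[of "{..<n}" "%i. (c0 i)\<^sup>2"] by (simp add: distrib_right)
 have B: "(\<Sum>i<n. (c0 i)\<^sup>2) + s * (\<Sum>i<n. lam i * (c1 i)\<^sup>2) = (\<Sum>i<n. s * lam i / (1 + s * lam i) * (c i)\<^sup>2)"
 unfolding sum_distrib_left sum.distrib[symmetric]
 proof (rule sum.cong[OF refl])
 fix i
 have "(t / (1 + t) * x)\<^sup>2 + t * (1 / (1 + t) * x)\<^sup>2 = t / (1 + t) * x\<^sup>2" if "0 < 1 + t" for t x :: real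
 proof -
 have "(t / (1 + t) * x)\<^sup>2 + t * (1 / (1 + t) * x)\<^sup>2 = (t\<^sup>2 * x\<^sup>2 + t * x\<^sup>2) / (1 + t)\<^sup>2"
 by (simp only: power_mult_distrib power_divide add_divide_distrib) simp
 also have "t\<^sup>2 * x\<^sup>2 + t * x\<^sup>2 = (1 + t) * (t * x\<^sup>2)" by (simp add: power2_eq_square algebra_simps)
 also have "(1 + t) * (t * x\<^sup>2) / (1 + t)\<^sup>2 = t / (1 + t) * x\<^sup>2" using that by (simp add: power2_eq_square)
 finally show ?thesis .
 qed
 from this[OF p[of i], of "c i"] show "(c0 i)\<^sup>2 + s * (lam i * (c1 i)\<^sup>2) = s * lam i / (1 + s * lam i) * (c i)\<^sup>2"
 by (simp add: c0_def c1_def mult.assoc)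
 qed
 show "(\<Sum>i<n. (c0 i)\<^sup>2) + s * ((1 + 4 * R\<^sup>2) * (\<Sum>i<n. lam i * (c1 i)\<^sup>2)) <= (1 + 4 * R\<^sup>2) * (\<Sum>i<n. s * lam i / (1 + s * lam i) * (c i)\<^sup>2)"
 unfolding B[symmetric] distrib_left using A by (simp only: mult.left_commute[of s] add_right_mono)
 qed
 finally show ?thesis .
qed

text \<open>Both powers are written as integrals of \<open>interp_weight\<close> over s, Tonelli
  exchanges the integrals, and the K-functional bound is applied for each s. The case beta = 0 is
  treated apart, because the constant \<open>kappa\<close> diverges there; it is Bessel's
  inequality.\<close>

lemma comb_interpolation:
 assumes beta: "0 <= beta" "beta < 1"
 shows "(INTP xi. ennreal ((1 + (norm xi)\<^sup>2) powr beta * (cmod (fourier (rep_L2 (\<Sum>i<n. c i *\<^sub>R phi i)) xi))\<^sup>2))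
 <= ennreal ((1 + 4 * R\<^sup>2) * (\<Sum>i<n. lam i powr beta * (c i)\<^sup>2))"
proof (cases "beta = 0")
 case True
 have pos: "0 < 1 + (norm xi)\<^sup>2" for xi :: 'a by (rule add_pos_nonneg) auto
 have "(\<Sum>i<n. (c i)\<^sup>2) <= (1 + 4 * R\<^sup>2) * (\<Sum>i<n. (c i)\<^sup>2)"
 using sum_nonneg[of "{..<n}" "%i. (c i)\<^sup>2"] by (simp add: distrib_right)
 then show ?thesis
 using order_trans[OF fourier_rep_bessel[OF comb_L2_on, of c n] ennreal_leI, of "(1 + 4 * R\<^sup>2) * (\<Sum>i<n. (c i)\<^sup>2)"]
 orthonormal_inner_sum(2)[OF orthonormal finite_lessThan, of c n] pos lam_pos
 by (simp add: True less_imp_neq[symmetric])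
next
 case False
 then have beta': "0 < beta" using beta by simp
 let ?F = "fourier (rep_L2 (\<Sum>i<n. c i *\<^sub>R phi i))"
 let ?W = "%s x. interp_weight beta s x"
 define kappa where "kappa = (\<integral>\<^sup>+s. ennreal (?W s 1) \<partial>lborel)"
 have kappa: "kappa ~= 0" "kappa ~= \<infinity>" unfolding kappa_def by (rule interp_weight_const[OF beta' beta(2)])+
 have nm: "(%xi::'a. 1 + (norm xi)\<^sup>2) \<in> blm" by (rule measurable_completion) measurable
 note [measurable] = nm
 have Fm: "(%xi. ennreal ((cmod (?F xi))\<^sup>2)) \<in> blm" by measurable
 have pos: "0 < 1 + (norm xi)\<^sup>2" for xi :: 'a by (rule add_pos_nonneg) auto
 have "kappa * (INTP xi. ennreal ((1 + (norm xi)\<^sup>2) powr beta * (cmod (?F xi))\<^sup>2))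
 = (INTP xi. kappa * ennreal ((1 + (norm xi)\<^sup>2) powr beta * (cmod (?F xi))\<^sup>2))"
 by (intro nn_integral_cmult[symmetric]) measurable
 also have "... = (\<integral>\<^sup>+xi. (\<integral>\<^sup>+s. ennreal (?W s (1 + (norm xi)\<^sup>2)) * ennreal ((cmod (?F xi))\<^sup>2) \<partial>lborel) \<partial>lebesgue)"
 proof (rule nn_integral_cong)
 fix xi :: 'a
 have "(\<integral>\<^sup>+s. ennreal (?W s (1 + (norm xi)\<^sup>2)) * ennreal ((cmod (?F xi))\<^sup>2) \<partial>lborel) = (\<integral>\<^sup>+s. ennreal (?W s (1 + (norm xi)\<^sup>2)) \<partial>lborel) * ennreal ((cmod (?F xi))\<^sup>2)"
 by (rule nn_integral_multc) (intro measurable_compose[OF interp_weight_measurable[OF beta' beta(2)] measurable_ennreal]; simp)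
 then show "kappa * ennreal ((1 + (norm xi)\<^sup>2) powr beta * (cmod (?F xi))\<^sup>2) = (\<integral>\<^sup>+s. ennreal (?W s (1 + (norm xi)\<^sup>2)) * ennreal ((cmod (?F xi))\<^sup>2) \<partial>lborel)"
 unfolding interp_weight_scale[OF beta' beta(2) pos] kappa_def[symmetric] by (simp add: ennreal_mult mult_ac)
 qed
 also have "... = (\<integral>\<^sup>+s. (INTP xi. ennreal (?W s (1 + (norm xi)\<^sup>2)) * ennreal ((cmod (?F xi))\<^sup>2)) \<partial>lborel)"
 proof -
 interpret pair_sigma_finite lborel "lebesgue :: 'a measure"
 by (intro pair_sigma_finite.intro sigma_finite_lborel sigma_finite_lebesgue)
 have m: "(%p. ennreal (?W (fst p) (1 + (norm (snd p))\<^sup>2)) * ennreal ((cmod (?F (snd p)))\<^sup>2)) \<in> borel_measurable (lborel \<Otimes>\<^sub>M lebesgue)"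
 proof (intro borel_measurable_times_ennreal measurable_compose[OF interp_weight_measurable[OF beta' beta(2)] measurable_ennreal])
 show "fst \<in> borel_measurable (lborel \<Otimes>\<^sub>M (lebesgue :: 'a measure))" using measurable_fst[of lborel lebesgue] by simp
 show "(%p. 1 + (norm (snd p :: 'a))\<^sup>2) \<in> borel_measurable ((lborel :: real measure) \<Otimes>\<^sub>M lebesgue)" by (rule measurable_compose[OF measurable_snd nm])
 show "(%p. ennreal ((cmod (?F (snd p)))\<^sup>2)) \<in> borel_measurable ((lborel :: real measure) \<Otimes>\<^sub>M lebesgue)" by (rule measurable_compose[OF measurable_snd Fm])
 qed
 show ?thesis using Fubini[OF m] by simp
 qed
 also have "... <= (\<integral>\<^sup>+s. (\<Sum>i<n. ennreal ((1 + 4 * R\<^sup>2) * (c i)\<^sup>2) * ennreal (?W s (lam i))) \<partial>lborel)"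
 proof (rule nn_integral_mono)
 fix s :: real
 show "(INTP xi. ennreal (?W s (1 + (norm xi)\<^sup>2)) * ennreal ((cmod (?F xi))\<^sup>2)) <= (\<Sum>i<n. ennreal ((1 + 4 * R\<^sup>2) * (c i)\<^sup>2) * ennreal (?W s (lam i)))"
 proof (cases "0 < s")
 case True
 have q: "0 <= s * lam i / (1 + s * lam i)" for i using True lam_pos[of i] by simp
 have W: "0 <= ?W s (lam i)" for i
 proof -
 have "?W s (lam i) = s powr (- beta - 1) * (s * lam i / (1 + s * lam i))" using True by (simp add: interp_weight_def[OF beta' beta(2)])
 then show ?thesis using mult_nonneg_nonneg[OF powr_ge_zero q] by simp
 qed
 have q': "0 <= s * (1 + (norm xi)\<^sup>2) / (1 + s * (1 + (norm xi)\<^sup>2))" for xi :: 'a using True by simp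
 have "(INTP xi. ennreal (?W s (1 + (norm xi)\<^sup>2)) * ennreal ((cmod (?F xi))\<^sup>2))
 = (INTP xi. ennreal (s powr (- beta - 1)) * ennreal (s * (1 + (norm xi)\<^sup>2) / (1 + s * (1 + (norm xi)\<^sup>2)) * (cmod (?F xi))\<^sup>2))"
 using q' True by (intro nn_integral_cong) (simp add: interp_weight_def[OF beta' beta(2)] ennreal_mult[symmetric] mult.assoc)
 also have "... = ennreal (s powr (- beta - 1)) * (INTP xi. ennreal (s * (1 + (norm xi)\<^sup>2) / (1 + s * (1 + (norm xi)\<^sup>2)) * (cmod (?F xi))\<^sup>2))"
 by (intro nn_integral_cmult) measurable
 also have "... <= ennreal (s powr (- beta - 1)) * ennreal ((1 + 4 * R\<^sup>2) * (\<Sum>i<n. s * lam i / (1 + s * lam i) * (c i)\<^sup>2))"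
 by (intro mult_left_mono comb_K_functional True) simp
 also have "... = ennreal (\<Sum>i<n. (1 + 4 * R\<^sup>2) * (c i)\<^sup>2 * ?W s (lam i))"
 using q True by (subst ennreal_mult[symmetric])
 (auto intro!: mult_nonneg_nonneg sum_nonneg arg_cong[where f = ennreal] sum.cong
 simp: sum_distrib_left interp_weight_def[OF beta' beta(2)] simp del: times_divide_eq_left times_divide_eq_right)
 also have "... = (\<Sum>i<n. ennreal ((1 + 4 * R\<^sup>2) * (c i)\<^sup>2 * ?W s (lam i)))"
 by (intro sum_ennreal[symmetric] mult_nonneg_nonneg W) auto
 also have "... = (\<Sum>i<n. ennreal ((1 + 4 * R\<^sup>2) * (c i)\<^sup>2) * ennreal (?W s (lam i)))"
 by (intro sum.cong refl ennreal_mult mult_nonneg_nonneg W) auto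
 finally show ?thesis .
 qed (simp add: interp_weight_def[OF beta' beta(2)])
 qed
 also have "... = (\<Sum>i<n. ennreal ((1 + 4 * R\<^sup>2) * (c i)\<^sup>2) * (ennreal (lam i powr beta) * kappa))"
 proof -
 have m: "(%s. ennreal (?W s (lam i))) \<in> borel_measurable lborel" for i
 by (rule measurable_compose[OF interp_weight_measurable[OF beta' beta(2)] measurable_ennreal]) simp_all
 have "(\<integral>\<^sup>+s. (\<Sum>i<n. ennreal ((1 + 4 * R\<^sup>2) * (c i)\<^sup>2) * ennreal (?W s (lam i))) \<partial>lborel) = (\<Sum>i<n. \<integral>\<^sup>+s. ennreal ((1 + 4 * R\<^sup>2) * (c i)\<^sup>2) * ennreal (?W s (lam i)) \<partial>lborel)"
 by (rule nn_integral_sum) (intro borel_measurable_times_ennreal borel_measurable_const m)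
 also have "... = (\<Sum>i<n. ennreal ((1 + 4 * R\<^sup>2) * (c i)\<^sup>2) * (ennreal (lam i powr beta) * kappa))"
 unfolding nn_integral_cmult[OF m] interp_weight_scale[OF beta' beta(2) lam_pos] kappa_def[symmetric] ..
 finally show ?thesis .
 qed
 also have "... = kappa * ennreal ((1 + 4 * R\<^sup>2) * (\<Sum>i<n. lam i powr beta * (c i)\<^sup>2))"
 proof -
 have "ennreal ((1 + 4 * R\<^sup>2) * (\<Sum>i<n. lam i powr beta * (c i)\<^sup>2)) = (\<Sum>i<n. ennreal ((1 + 4 * R\<^sup>2) * (c i)\<^sup>2) * ennreal (lam i powr beta))"
 unfolding sum_distrib_left by (subst sum_ennreal[symmetric]) (auto simp: ennreal_mult[symmetric] mult_ac intro!: sum.cong)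
 then show ?thesis by (simp only: sum_distrib_left mult_ac)
 qed
 finally show ?thesis using kappa by (simp add: ennreal_mult_le_mult_iff)
qed

text \<open>A functional is linear only on \<open>Hs_0\<close>, so membership of each partial sum
  has to accompany the induction.\<close>

lemma Hneg_comb:
 assumes F: "F \<in> Hneg Omega beta" and beta: "beta <= 1"
 shows "F (\<Sum>i<n. c i *\<^sub>R phi i) = (\<Sum>i<n. c i * F (phi i))"
proof -
 have add: "F (v + w) = F v + F w" if "v \<in> Hs_0 Omega beta" "w \<in> Hs_0 Omega beta" for v w using F that by (simp add: Hneg_def)
 have scale: "F (a *\<^sub>R v) = a * F v" if "v \<in> Hs_0 Omega beta" for a v using F that by (simp add: Hneg_def)
 show ?thesis
proof (induction n)
 case 0
 have "phi 0 \<in> Hs_0 Omega beta" by (rule H1_approx_Hs_0[OF H1_approx_eigen beta])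
 then have "F (0 *\<^sub>R phi 0) = 0 * F (phi 0)" by (rule scale)
 then show ?case by simp
next
 case (Suc n)
 have 1: "phi n \<in> Hs_0 Omega beta" by (rule H1_approx_Hs_0[OF H1_approx_eigen beta])
 have 2: "(\<Sum>i<n. c i *\<^sub>R phi i) \<in> Hs_0 Omega beta" by (rule H1_approx_Hs_0[OF H1_approx_comb[OF finite_lessThan] beta])
 have 3: "c n *\<^sub>R phi n \<in> Hs_0 Omega beta" by (rule H1_approx_Hs_0[OF H1_approx_scale[OF H1_approx_eigen] beta])
 have "F ((\<Sum>i<n. c i *\<^sub>R phi i) + c n *\<^sub>R phi n) = F (\<Sum>i<n. c i *\<^sub>R phi i) + F (c n *\<^sub>R phi n)"
 by (rule add[OF 2 3])
 moreover have "F (c n *\<^sub>R phi n) = c n * F (phi n)" by (rule scale[OF 1])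
 ultimately show ?case using Suc by simp
qed
qed

text \<open>The functional is tested with the combination whose coefficients are lam^(-beta) times
  its own values. \<open>comb_interpolation\<close> bounds the H^beta norm of this combination, and
  the value of the functional on it is the weighted sum of squares divided by the
  normalization.\<close>

lemma Hneg_coefficients:
 assumes F: "F \<in> Hneg Omega beta" and beta: "0 <= beta" "beta < 1"
 shows "(\<Sum>i. ennreal (lam i powr (- beta) * (F (phi i))\<^sup>2)) <= ennreal (1 + 4 * R\<^sup>2) * (Hneg_norm Omega beta F)\<^sup>2"
proof -
 let ?K = "1 + 4 * R\<^sup>2"
 have K: "0 < ?K" by (rule add_pos_nonneg) auto
 have fin: "Hneg_norm Omega beta F < \<infinity>" using F by (simp add: Hneg_def)
 define M where "M = enn2real (Hneg_norm Omega beta F)"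
 have M: "Hneg_norm Omega beta F = ennreal M" "0 <= M" using fin by (simp_all add: M_def)
 have S: "(\<Sum>i<n. lam i powr (- beta) * (F (phi i))\<^sup>2) <= ?K * M\<^sup>2" for n
 proof -
 define S where "S = (\<Sum>i<n. lam i powr (- beta) * (F (phi i))\<^sup>2)"
 have S0: "0 <= S" unfolding S_def by (intro sum_nonneg) auto
 show ?thesis
 proof (cases "S = 0")
 case False
 then have Sp: "0 < S" using S0 by simp
 \<comment> \<open>Chosen so that the combination below has H^beta norm at most 1:
   \<open>comb_interpolation\<close> bounds its square by K S / N^2 = 1.\<close>
 define N where "N = sqrt (?K * S)"
 have N: "0 < N" "N\<^sup>2 = ?K * S" using Sp K by (simp_all add: N_def)
 define c where "c i = lam i powr (- beta) * F (phi i) / N" for i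
 let ?v = "\<Sum>i<n. c i *\<^sub>R phi i"
 have "(\<Sum>i<n. lam i powr beta * (c i)\<^sup>2) = (\<Sum>i<n. (lam i powr (- beta) * (F (phi i))\<^sup>2) / N\<^sup>2)"
 proof (rule sum.cong[OF refl])
 fix i
 have "lam i powr beta * lam i powr (- beta) = 1" using lam_pos[of i] by (simp add: powr_minus field_simps)
 then have "lam i powr beta * (lam i powr (- beta))\<^sup>2 = lam i powr (- beta)" by (simp add: power2_eq_square mult.assoc[symmetric])
 then show "lam i powr beta * (c i)\<^sup>2 = (lam i powr (- beta) * (F (phi i))\<^sup>2) / N\<^sup>2"
 by (simp add: c_def power_divide power_mult_distrib mult.assoc[symmetric])
 qed
 also have "... = S / N\<^sup>2" by (simp add: S_def sum_divide_distrib)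
 finally have "?K * (\<Sum>i<n. lam i powr beta * (c i)\<^sup>2) = 1" using Sp K by (simp add: N(2))
 then have "Hs_norm Omega beta ?v <= esqrt (ennreal 1)"
 using order_trans[OF Hs_norm_le[OF comb_L2_on] esqrt_mono[OF comb_interpolation[OF beta, of c n]]] by simp
 then have "?v \<in> {v \<in> Hs_0 Omega beta. Hs_norm Omega beta v <= 1}"
 using H1_approx_Hs_0[OF H1_approx_comb[OF finite_lessThan, of c n], of beta] beta by (simp add: esqrt_ennreal del: ennreal_1) (simp add: esqrt_def)
 then have "ennreal \<bar>F ?v\<bar> <= ennreal M" unfolding M(1)[symmetric] Hneg_norm_def by (rule SUP_upper)
 then have "F ?v <= M" using M(2) by (simp add: ennreal_le_iff)
 moreover have "F ?v = S / N"
 unfolding Hneg_comb[OF F less_imp_le[OF beta(2)]] by (simp add: c_def S_def sum_divide_distrib power2_eq_square mult_ac)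
 ultimately have "S <= M * N" using N(1) by (simp add: pos_divide_le_eq)
 then have "S * S <= (M * N) * (M * N)" using S0 by (intro mult_mono) auto
 also have "... = (?K * M\<^sup>2) * S" using N(2) by (simp add: power2_eq_square mult_ac)
 finally have "S <= ?K * M\<^sup>2" using Sp by (rule mult_right_le_imp_le)
 then show ?thesis by (simp add: S_def)
 qed (use K M in \<open>simp add: S_def[symmetric]\<close>)
 qed
 have "(\<Sum>i. ennreal (lam i powr (- beta) * (F (phi i))\<^sup>2)) <= ennreal (?K * M\<^sup>2)"
 proof (rule suminf_le_const[OF summableI])
 fix n show "(\<Sum>i<n. ennreal (lam i powr (- beta) * (F (phi i))\<^sup>2)) <= ennreal (?K * M\<^sup>2)"
 using S[of n] by (subst sum_ennreal) (auto intro: ennreal_leI)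
 qed
 also have "... = ennreal ?K * (Hneg_norm Omega beta F)\<^sup>2"
 using K M by (simp only: M(1)) (simp add: ennreal_mult ennreal_power)
 finally show ?thesis .
qed

end

section \<open>Functions of time: measurability, test functions and distributional
  derivatives\<close>

text \<open>By completeness of \<open>lebesgue\<close>. Solution, data and chosen derivatives are
  identified only almost everywhere, and measurability has to survive such changes.\<close>

lemma lebesgue_measurable_AE:
 fixes f g :: "'a::euclidean_space => 'b::topological_space"
 assumes f: "f \<in> blm" and ae: "AE x in lebesgue. f x = g x"
 shows "g \<in> blm"
proof (rule borel_measurableI)
 fix S :: "'b set" assume S: "open S"
 from ae obtain N where N: "N \<in> null_sets lebesgue" "{x \<in> space lebesgue. \<not> f x = g x} \<subseteq> N"
 unfolding eventually_ae_filter by blast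
 have "f -` S \<inter> space lebesgue \<in> sets lebesgue" using f borel_open[OF S] by (rule measurable_sets)
 then have "f -` S \<inter> space lebesgue - N \<in> sets lebesgue" using N(1) by (intro sets.Diff) auto
 moreover have "g -` S \<inter> N \<in> null_sets lebesgue" by (rule null_sets_completion_subset[OF _ N(1)]) auto
 ultimately have "(f -` S \<inter> space lebesgue - N) \<union> (g -` S \<inter> N) \<in> sets lebesgue" by (intro sets.Un) auto
 also have "(f -` S \<inter> space lebesgue - N) \<union> (g -` S \<inter> N) = g -` S \<inter> space lebesgue"
 proof -
 have "f x = g x" if "x \<notin> N" for x using N(2) that by auto
 then show ?thesis by auto
 qed
 finally show "g -` S \<inter> space lebesgue \<in> sets lebesgue" .
qed

text \<open>The map \<open>p\<close> is arbitrary, so the lemma applies to the values themselves and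
  also to evaluation of functionals at an eigenfunction.\<close>

lemma simple_limit_measurable:
 fixes p :: "'x => 'b::{banach, second_countable_topology}"
 assumes s: "!!n. simple_function (lebesgue_on {0<..<T::real}) (s n)"
 and lim: "AE tau in lebesgue_on {0<..<T}. (%n. p (s n tau)) \<longlonglongrightarrow> p (v tau)"
 shows "(%tau. indicator {0<..<T} tau *\<^sub>R p (v tau)) \<in> blm"
proof -
 let ?S = "%n tau. indicator {0<..<T} tau *\<^sub>R p (s n tau)"
 have sf: "?S n \<in> blm" for n
 using borel_measurable_simple_function[OF simple_function_compose1[OF s, of p n]]
 by (subst (asm) borel_measurable_restrict_space_iff) auto
 have g: "(%tau. lim (%n. ?S n tau)) \<in> blm" by (rule borel_measurable_lim_metric) (rule sf)
 have "AE tau in lebesgue. tau \<in> {0<..<T} --> (%n. p (s n tau)) \<longlonglongrightarrow> p (v tau)"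
 using lim by (subst (asm) AE_restrict_space_iff) auto
 then have "AE tau in lebesgue. lim (%n. ?S n tau) = indicator {0<..<T} tau *\<^sub>R p (v tau)"
 proof (rule eventually_mono)
 fix tau assume tau: "tau \<in> {0<..<T} --> (%n. p (s n tau)) \<longlonglongrightarrow> p (v tau)"
 have "(%n. ?S n tau) \<longlonglongrightarrow> indicator {0<..<T} tau *\<^sub>R p (v tau)"
 using tau by (cases "tau \<in> {0<..<T}") auto
 then show "lim (%n. ?S n tau) = indicator {0<..<T} tau *\<^sub>R p (v tau)" by (rule limI)
 qed
 then show ?thesis by (rule lebesgue_measurable_AE[OF g])
qed

lemma scalar_L2_time:
 fixes e :: "'h::real_normed_vector"
 assumes w: "w \<in> blm" and M: "!!x. \<bar>w x\<bar> <= M" and X: "!!c. c *\<^sub>R e \<in> X"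
 and N: "!!c. N (c *\<^sub>R e) = ennreal (k * \<bar>c\<bar>)" and k: "0 <= k"
 shows "(%tau. w tau *\<^sub>R e) \<in> L2_time X N {0<..<T::real}"
proof -
 have M0: "0 <= M" using M[of 0] by linarith
 have w': "w \<in> borel_measurable (lebesgue_on {0<..<T})" using w by (rule measurable_restrict_space1)
 obtain s where "(\<forall>i. simple_function (lebesgue_on {0<..<T}) (s i)) \<and>
 (\<forall>x\<in>space (lebesgue_on {0<..<T}). (%i. s i x) \<longlonglongrightarrow> w x) \<and>
 (\<forall>i. \<forall>x\<in>space (lebesgue_on {0<..<T}). dist (s i x) 0 <= 2 * dist (w x) 0)"
 by (rule exE[OF borel_measurable_implies_sequence_metric[OF w', of 0]])
 then have s: "simple_function (lebesgue_on {0<..<T}) (s n)"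
 "x \<in> space (lebesgue_on {0<..<T}) ==> (%n. s n x) \<longlonglongrightarrow> w x" for n x by blast+
 have sm: "strongly_measurable X N {0<..<T} (%tau. w tau *\<^sub>R e)"
 unfolding strongly_measurable_def
 proof (intro exI[of _ "%n tau. s n tau *\<^sub>R e"] conjI allI AE_I2)
 show "simple_function (lebesgue_on {0<..<T}) (%tau. s n tau *\<^sub>R e)" for n
 by (rule simple_function_compose1[OF s(1)])
 show "(%tau. s n tau *\<^sub>R e) ` {0<..<T} \<subseteq> X" for n using X by auto
 show "w x *\<^sub>R e \<in> X" for x by (rule X)
 fix x assume x: "x \<in> space (lebesgue_on {0<..<T})"
 have "(%n. ennreal (k * \<bar>w x - s n x\<bar>)) \<longlonglongrightarrow> ennreal (k * \<bar>w x - w x\<bar>)" by (intro tendsto_intros s(2) x)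
 then show "(%n. N (w x *\<^sub>R e - s n x *\<^sub>R e)) \<longlonglongrightarrow> 0" by (simp add: scaleR_diff_left[symmetric] N)
 qed
 have "(\<integral>\<^sup>+tau. (N (w tau *\<^sub>R e))\<^sup>2 \<partial>lebesgue_on {0<..<T}) <= (\<integral>\<^sup>+tau. ennreal ((k * M)\<^sup>2) \<partial>lebesgue_on {0<..<T})"
 proof (rule nn_integral_mono)
 fix tau
 have "(k * \<bar>w tau\<bar>)\<^sup>2 <= (k * M)\<^sup>2" using M[of tau] k by (intro power_mono mult_left_mono) auto
 then show "(N (w tau *\<^sub>R e))\<^sup>2 <= ennreal ((k * M)\<^sup>2)" using k by (simp add: N ennreal_power ennreal_leI)
 qed
 also have "... < \<infinity>" by (cases "0 <= T") (simp_all add: emeasure_restrict_space ennreal_mult_less_top)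
 finally have "L2_time_norm N {0<..<T} (%tau. w tau *\<^sub>R e) < \<infinity>" by (auto simp: L2_time_norm_def esqrt_def)
 then show ?thesis using sm by (simp add: L2_time_def)
qed

text \<open>Reflection changes the transform of a real function into its conjugate times a
  phase.\<close>

lemma cmod_fourier_reflect:
 fixes w :: "real => real"
 shows "cmod (fourier (%x. w (T - x)) xi) = cmod (fourier w xi)"
proof -
 have "(LINT x|lebesgue. w x *\<^sub>R cis (- (x \<bullet> xi))) = (LINT x|lebesgue. w (T - x) *\<^sub>R cis (- ((T - x) \<bullet> xi)))"
 by (subst lebesgue_integral_real_affine[of "-1" _ T]) simp_all
 also have "... = (LINT x|lebesgue. cis (- (T * xi)) * cnj (w (T - x) *\<^sub>R cis (- (x \<bullet> xi))))"
 by (intro Bochner_Integration.integral_cong refl)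
 (simp add: cis_cnj scaleR_conv_of_real cis_mult mult.left_commute algebra_simps)
 also have "... = cis (- (T * xi)) * cnj (LINT x|lebesgue. w (T - x) *\<^sub>R cis (- (x \<bullet> xi)))"
 unfolding integral_mult_right_zero
 by (intro arg_cong[where f = "(*) _"] integral_bounded_linear'[OF bounded_linear_cnj bounded_linear_cnj]) simp
 finally show ?thesis by (simp add: fourier_def norm_mult)
qed

text \<open>The test functions in time: \<open>w = I\<^bsub>T-\<^esub>\<^sup>gamma h\<close>, whose right fractional derivative is \<open>h\<close>.\<close>

lemma test_fun_right:
 fixes h :: "real => real"
 assumes gamma: "0 < gamma" "gamma < 1 / 2" and T: "0 < T" and h: "test_fun {0<..<T} h"
 defines "w \<equiv> frac_int_right T gamma h"
 shows "(%tau. indicator {0<..<T} tau * w tau) \<in> blm" "\<exists>M. \<forall>x. \<bar>indicator {0<..<T} x * w x\<bar> <= M"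
 "(INTP xi. ennreal (\<bar>xi\<bar> powr (2 * gamma) * (cmod (fourier (%tau. indicator {0<..<T} tau * w tau) xi))\<^sup>2)) < \<infinity>"
 "has_distr_deriv 0 T (%x. frac_int_right T (1 - gamma) (%tau. indicator {0<..<T} tau * w tau) x) (%x. - h x)"
proof -
 define k where "k x = h (T - x)" for x
 have hm: "h \<in> borel_measurable borel" by (rule test_funD(9)[OF h])
 have kk: "k = (%x. h (T - x))" by (rule ext) (rule k_def)
 have km: "k \<in> blm" unfolding k_def
 by (rule measurable_completion) (intro measurable_compose[OF _ hm], measurable)
 obtain B where B: "\<forall>x. \<bar>h x\<bar> <= B" using test_funD(7)[OF h] by blast
 have k0: "k y = 0" if "y \<notin> {0<..<T}" for y
 proof -
 have "T - y \<notin> {0<..<T}" using that by auto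
 then show ?thesis unfolding k_def by (rule test_funD(4)[OF h])
 qed
 have ksq: "sq_integrable k" unfolding sq_integrable_def
 proof (intro conjI km)
 have "integrable lebesgue (%x. (h (T + (-1) * x))\<^sup>2)"
 using test_funD(8)[OF h] by (intro lebesgue_integrable_real_affine) (auto simp: sq_integrable_def)
 then show "integrable lebesgue (%x. (k x)\<^sup>2)" by (simp add: k_def)
 qed
 have kint: "integrable lebesgue k" by (rule sq_integrable_imp_integrable[where S = "{0..T}", OF ksq bounded_closed_interval]) (rule k0, auto)
 have wr: "w x = frac_int_left 0 gamma k (T - x)" for x
 using frac_int_right_reflect[of T gamma h "T - x"] by (simp add: w_def kk)
 have lm: "frac_int_left 0 gamma k \<in> blm" by (rule frac_int_left_measurable_real[OF km])
 obtain C where C: "0 < C" "!!t rho w. sq_integrable rho ==> (!!y. y \<notin> {0<..<t} ==> rho y = 0) ==>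
 w \<in> blm ==> (AE s in lebesgue. w s = indicator {0<..<t} s * frac_int_left 0 gamma rho s) ==>
 (INTP xi. ennreal (\<bar>xi\<bar> powr (2 * gamma) * (cmod (fourier w xi))\<^sup>2)) <= ennreal C * (INTP y. ennreal ((rho y)\<^sup>2))"
 by (rule frac_int_left_seminorm[OF gamma], rule that, assumption) blast
 let ?l = "%s. indicator {0<..<T} s * frac_int_left 0 gamma k s"
 have lm': "?l \<in> blm" by (intro borel_measurable_times borel_measurable_indicator lm) simp
 have e: "(%tau. indicator {0<..<T} tau * w tau) = (%tau. ?l (T - tau))" by (rule ext) (auto simp: indicator_def wr)
 have "(INTP xi. ennreal (\<bar>xi\<bar> powr (2 * gamma) * (cmod (fourier ?l xi))\<^sup>2)) <= ennreal C * (INTP y. ennreal ((k y)\<^sup>2))"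
 by (rule C(2)[OF ksq k0 lm']) auto
 also have "... < \<infinity>" unfolding nn_integral_sq[OF ksq] by (simp add: ennreal_mult_less_top)
 finally show "(INTP xi. ennreal (\<bar>xi\<bar> powr (2 * gamma) * (cmod (fourier (%tau. indicator {0<..<T} tau * w tau) xi))\<^sup>2)) < \<infinity>"
 unfolding e cmod_fourier_reflect[of ?l] .
 show bd: "\<exists>M. \<forall>x. \<bar>indicator {0<..<T} x * w x\<bar> <= M"
 proof (intro exI allI)
 fix x
 define M where "M = 1 / Gamma gamma * (B * (T powr gamma / gamma))"
 have G: "0 < Gamma gamma" by (rule Gamma_real_pos[OF gamma(1)])
 have B0: "0 <= B" using B[rule_format, of 0] by linarith
 show "\<bar>indicator {0<..<T} x * w x\<bar> <= M"
 proof (cases "x \<in> {0<..<T}")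
 case True
 let ?K = "%y. rl_kernel gamma (T - x - y) * k y"
 have "ennreal (norm (LINT y|lebesgue. ?K y)) <= (INTP y. ennreal (norm (?K y)))"
 by (rule norm_integral_le_nn_integral)
 also have "... <= (INTP y. ennreal B * ennreal (indicator {..<T} (T - x - y) * rl_kernel gamma (T - x - y)))"
 proof (rule nn_integral_mono)
 fix y
 have "\<bar>?K y\<bar> <= B * (indicator {..<T} (T - x - y) * rl_kernel gamma (T - x - y))"
 proof (cases "y \<in> {0<..<T}")
 case y: True
 have "\<bar>?K y\<bar> = rl_kernel gamma (T - x - y) * \<bar>k y\<bar>" by (simp add: abs_mult rl_kernel_def)
 also have "... <= rl_kernel gamma (T - x - y) * B" using B by (intro mult_left_mono) (auto simp: k_def rl_kernel_def)
 finally show ?thesis using y True by (simp add: mult.commute)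
 qed (use B0 k0 in \<open>simp add: rl_kernel_def\<close>)
 then show "ennreal (norm (?K y)) <= ennreal B * ennreal (indicator {..<T} (T - x - y) * rl_kernel gamma (T - x - y))"
 using B0 by (simp add: ennreal_mult[symmetric] rl_kernel_def ennreal_leI)
 qed
 also have "... = ennreal B * (INTP y. ennreal (indicator {..<T} (T - x - y) * rl_kernel gamma (T - x - y)))"
 by (rule nn_integral_cmult) (rule measurable_completion, measurable)
 also have "(INTP y. ennreal (indicator {..<T} (T - x - y) * rl_kernel gamma (T - x - y))) = (INTP y. ennreal (indicator {..<T} y * rl_kernel gamma y))"
 unfolding nn_integral_completion
 by (subst nn_integral_real_affine[of "%y. ennreal (indicator {..<T} y * rl_kernel gamma y)" "-1" "T - x"]) (simp_all add: rl_kernel_def)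
 also have "... = ennreal (T powr gamma / gamma)" using gamma T by (intro nn_integral_rl_kernel) auto
 finally have "norm (LINT y|lebesgue. ?K y) <= B * (T powr gamma / gamma)"
 using B0 gamma by (simp add: ennreal_mult[symmetric] ennreal_le_iff)
 then have "1 / Gamma gamma * \<bar>LINT y|lebesgue. ?K y\<bar> <= M" unfolding M_def using G by (intro mult_left_mono) auto
 moreover have "w x = 1 / Gamma gamma * (LINT y|lebesgue. ?K y)"
 unfolding wr by (rule frac_int_left_real) (simp add: k0)
 ultimately show ?thesis using True G by (simp add: abs_mult)
 qed (use B0 G gamma in \<open>simp add: M_def\<close>)
 qed
 show "(%tau. indicator {0<..<T} tau * w tau) \<in> blm"
 proof -
 obtain M where M: "\<forall>x. \<bar>indicator {0<..<T} x * w x\<bar> <= M" using bd ..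
 have lM: "\<bar>?l x\<bar> <= M" for x using M[rule_format, of "T - x"] fun_cong[OF e, of "T - x"] by simp
 have "set_integrable lebesgue {0..T} ?l" by (rule set_integrable_bounded[OF lm']) (use lM in simp)
 moreover have "(%x. indicator {0..T} x *\<^sub>R ?l x) = ?l" by (rule ext) (auto simp: indicator_def)
 ultimately have "integrable lebesgue ?l" by (simp only: set_integrable_def)
 then have "integrable lebesgue (%x. ?l (T + (-1) * x))" by (rule lebesgue_integrable_real_affine) simp
 then show ?thesis unfolding e by (intro borel_measurable_integrable) simp
 qed
 have R: "frac_int_right T (1 - gamma) (%tau. indicator {0<..<T} tau * w tau) x = frac_int_right T 1 h x" if x: "x \<in> {0<..<T}" for x
 proof -
 have "frac_int_right T (1 - gamma) (%tau. ?l (T - tau)) x = frac_int_left 0 (1 - gamma) ?l (T - x)"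
 using frac_int_right_reflect[of T "1 - gamma" "%tau. ?l (T - tau)" "T - x"] by simp
 also have "... = frac_int_left 0 (1 - gamma) (frac_int_left 0 gamma k) (T - x)"
 using frac_int_left_cutoff[of "T - x" T "1 - gamma" "frac_int_left 0 gamma k"] x by simp
 also have "... = frac_int_left 0 (1 - gamma + gamma) k (T - x)"
 using gamma by (intro frac_int_left_semigroup kint) (auto simp: k0)
 also have "... = frac_int_right T 1 h x"
 using frac_int_right_reflect[of T 1 h "T - x"] by (simp add: kk)
 finally show ?thesis unfolding e .
 qed
 have hint: "integrable lebesgue h" by (rule test_funD(6)[OF h])
 have h0: "h y = 0" if "y \<notin> {0<..<T}" for y by (rule test_funD(4)[OF h that])
 define J where "J = (LINT s|lebesgue. h s)"
 \<comment> \<open>On (0,T) the right integral of order 1 is the total integral minus the left one.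
   The constant pairs to zero with derivatives of test functions, so the distributional derivative
   is -h.\<close>
 have split: "frac_int_right T 1 h x = J - frac_int_left 0 1 h x" if x: "x \<in> {0<..<T}" for x
 proof -
 have i: "integrable lebesgue (%s. indicator {x<..<T} s *\<^sub>R h s)" "integrable lebesgue (%s. indicator {0<..<x} s *\<^sub>R h s)"
 by (rule integrable_mult_indicator[OF _ hint], simp)+
 have "J = (LINT s|lebesgue. indicator {x<..<T} s *\<^sub>R h s + indicator {0<..<x} s *\<^sub>R h s)"
 unfolding J_def
 proof (rule integral_cong_AE)
 show "AE s in lebesgue. h s = indicator {x<..<T} s *\<^sub>R h s + indicator {0<..<x} s *\<^sub>R h s"
 using lebesgue_singleton_AE[of x]
 proof eventually_elim
 case (elim s)
 then show ?case using x h0[of s] by (cases "s \<in> {0<..<T}") (auto simp: indicator_def)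
 qed
 qed (use hint i in auto)
 also have "... = (LINT s|lebesgue. indicator {x<..<T} s *\<^sub>R h s) + (LINT s|lebesgue. indicator {0<..<x} s *\<^sub>R h s)"
 by (rule Bochner_Integration.integral_add[OF i])
 also have "(LINT s|lebesgue. indicator {x<..<T} s *\<^sub>R h s) = frac_int_right T 1 h x"
 unfolding frac_int_right_def set_lebesgue_integral_def by (simp, intro Bochner_Integration.integral_cong) (auto simp: indicator_def)
 also have "(LINT s|lebesgue. indicator {0<..<x} s *\<^sub>R h s) = frac_int_left 0 1 h x"
 unfolding frac_int_left_def set_lebesgue_integral_def by (simp, intro Bochner_Integration.integral_cong) (auto simp: indicator_def)
 finally show ?thesis by simp
 qed
 let ?R = "frac_int_right T (1 - gamma) (%tau. indicator {0<..<T} tau * w tau)"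
 have f1m: "frac_int_left 0 1 h \<in> blm"
 using hint by (intro frac_int_left_measurable_real) auto
 have f1b: "\<bar>frac_int_left 0 1 h x\<bar> <= (LINT s|lebesgue. \<bar>h s\<bar>)" for x
 proof -
 have "\<bar>LINT s|lebesgue. rl_kernel 1 (x - s) * h s\<bar> <= (LINT s|lebesgue. \<bar>h s\<bar>)"
 using integral_abs_bound[of lebesgue "%s. rl_kernel 1 (x - s) * h s"]
 by (rule order_trans) (rule integral_mono', use hint in \<open>auto simp: rl_kernel_def abs_mult\<close>)
 then show ?thesis using frac_int_left_real[of h 1 x] h0 by simp
 qed
 have f1s: "set_integrable lebesgue {c..d} (frac_int_left 0 1 h)" for c d
 by (rule set_integrable_bounded[OF f1m]) (use f1b in simp)
 show "has_distr_deriv 0 T (%x. ?R x) (%x. - h x)"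
 unfolding has_distr_deriv_def
 proof (intro conjI allI impI)
 fix c d assume cd: "0 < c \<and> c < d \<and> d < T"
 have "set_integrable lebesgue {c..d} (%x. J - frac_int_left 0 1 h x)"
 by (intro set_integral_diff f1s set_integrable_bounded[where B = "\<bar>J\<bar>"]) auto
 moreover have "set_integrable lebesgue {c..d} (%x. J - frac_int_left 0 1 h x) = set_integrable lebesgue {c..d} ?R"
 by (rule set_integrable_cong) (use cd R split in auto)
 ultimately show "set_integrable lebesgue {c..d} ?R" by simp
 show "set_integrable lebesgue {c..d} (%x. - h x)"
 unfolding set_integrable_def using hint by (intro integrable_mult_indicator) auto
 next
 fix psi assume psi: "test_fun {0<..<T} psi"
 note dpsi = test_fun_deriv(3)[OF psi]
 have z: "indicator {0<..<T} x *\<^sub>R (deriv psi x *\<^sub>R ?R x) = deriv psi x * J - deriv psi x * frac_int_left 0 1 h x" for x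
 using R[of x] split[of x] test_funD(4)[OF dpsi, of x] by (cases "x \<in> {0<..<T}") (auto simp: algebra_simps)
 have "(LINT x|lebesgue. partial 1 psi x * 1) = - (LINT x|lebesgue. psi x * 0)"
 by (rule test_fun_ibp_smooth(1)[OF psi, of _ "%_. 1" "%_ _. 0"]) auto
 then have zero: "(LINT x|lebesgue. deriv psi x) = 0" by (simp add: test_fun_deriv(2)[OF psi])
 have i1: "integrable lebesgue (%x. deriv psi x * J)" using test_funD(6)[OF dpsi] by simp
 have i2: "integrable lebesgue (%x. deriv psi x * frac_int_left 0 1 h x)"
 proof -
 have "integrable lebesgue (%t. indicator {0<..<T} t *\<^sub>R (deriv psi t *\<^sub>R frac_int_left 0 1 h t))"
 by (rule test_fun_scaleR_integrable[OF dpsi T f1s])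
 moreover have "(%t. indicator {0<..<T} t *\<^sub>R (deriv psi t *\<^sub>R frac_int_left 0 1 h t)) = (%t. deriv psi t * frac_int_left 0 1 h t)"
 proof
 fix t
 show "indicator {0<..<T} t *\<^sub>R (deriv psi t *\<^sub>R frac_int_left 0 1 h t) = deriv psi t * frac_int_left 0 1 h t"
 using test_funD(4)[OF dpsi, of t] by (cases "t \<in> {0<..<T}") auto
 qed
 ultimately show ?thesis by simp
 qed
 have "(LINT t:{0<..<T}|lebesgue. deriv psi t *\<^sub>R ?R t) = (LINT x|lebesgue. deriv psi x * J) - (LINT x|lebesgue. deriv psi x * frac_int_left 0 1 h x)"
 unfolding set_lebesgue_integral_def z by (rule Bochner_Integration.integral_diff[OF i1 i2])
 also have "... = (LINT x|lebesgue. h x * psi x)"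
 using integral_deriv_frac_int_one[OF psi hint h0] zero by simp
 also have "... = - (LINT t:{0<..<T}|lebesgue. psi t *\<^sub>R - h t)"
 proof -
 have p: "indicator {0<..<T} t *\<^sub>R (psi t *\<^sub>R - h t) = - (h t * psi t)" for t
 using h0[of t] by (cases "t \<in> {0<..<T}") auto
 have "(LINT t:{0<..<T}|lebesgue. psi t *\<^sub>R - h t) = (LINT t|lebesgue. - (h t * psi t))"
 unfolding set_lebesgue_integral_def p ..
 then show ?thesis by simp
 qed
 finally show "(LINT t:{0<..<T}|lebesgue. deriv psi t *\<^sub>R ?R t) = - (LINT t:{0<..<T}|lebesgue. psi t *\<^sub>R - h t)" .
 qed
qed

text \<open>Measurability is asked of one side only. It is applied to integrands of the weak form
  whose measurability is not known beforehand.\<close>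

lemma lebesgue_integral_cong_AE:
 fixes f g :: "'a::euclidean_space => 'b::{banach, second_countable_topology}"
 assumes f: "f \<in> blm" and ae: "AE x in lebesgue. f x = g x"
 shows "(LINT x|lebesgue. g x) = (LINT x|lebesgue. f x)"
 by (rule integral_cong_AE[symmetric, OF f lebesgue_measurable_AE[OF f ae] ae])

text \<open>Valid without integrability: for a unit vector e both integrals exist or fail together,
  and in the latter case both sides are 0.\<close>

lemma integral_scaleR_unit:
 fixes e :: "'h::{real_inner, banach, second_countable_topology}"
 assumes e: "e \<bullet> e = 1"
 shows "(LINT x|M. f x *\<^sub>R e) = (LINT x|M. f x) *\<^sub>R e"
proof (cases "integrable M f")
 case False
 have "\<not> integrable M (%x. f x *\<^sub>R e)"
 proof
 assume "integrable M (%x. f x *\<^sub>R e)"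
 then have "integrable M (%x. (f x *\<^sub>R e) \<bullet> e)" by (rule integrable_inner_left)
 then show False using False e by simp
 qed
 then show ?thesis using False by (simp add: not_integrable_integral_eq)
qed simp

lemma has_distr_deriv_scaleR:
 fixes e :: "'h::{real_inner, banach, second_countable_topology}" and w g :: "real => real"
 assumes e: "e \<bullet> e = 1" and d: "has_distr_deriv a b w g"
 shows "has_distr_deriv a b (%x. w x *\<^sub>R e) (%x. g x *\<^sub>R e)"
proof -
 have s: "set_integrable lebesgue S (%x. k x *\<^sub>R e)" if "set_integrable lebesgue S k" for S k
 using that integrable_scaleR_left[of e lebesgue "%x. indicator S x *\<^sub>R k x"] by (simp add: set_integrable_def)
 have i: "(LINT t:S|lebesgue. p t *\<^sub>R (k t *\<^sub>R e)) = (LINT t:S|lebesgue. p t *\<^sub>R k t) *\<^sub>R e" for S p k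
 using integral_scaleR_unit[OF e, of lebesgue "%t. indicator S t *\<^sub>R (p t *\<^sub>R k t)"] by (simp add: set_lebesgue_integral_def)
 show ?thesis using d unfolding has_distr_deriv_def i by (auto intro: s)
qed

text \<open>Determines almost everywhere a derivative that was chosen by \<open>SOME\<close>, once
  one derivative is known explicitly.\<close>

lemma has_distr_deriv_unique:
 fixes w :: "real => 'h::{real_inner, banach, second_countable_topology}"
 assumes ab: "a < b" and g: "has_distr_deriv a b w g" and k: "has_distr_deriv a b w k"
 shows "AE x in lebesgue. x \<in> {a<..<b} --> g x = k x"
proof -
 have gi: "set_integrable lebesgue {c..d} g" and ki: "set_integrable lebesgue {c..d} k" if "a < c" "c < d" "d < b" for c d
 using g k that unfolding has_distr_deriv_def by simp_all
 have "AE x in lebesgue. x \<in> {a<..<b} --> g x - k x = 0"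
 proof (rule fundamental_lemma_vector[OF ab])
 show "set_integrable lebesgue {c..d} (%x. g x - k x)" if "a < c" "c < d" "d < b" for c d
 by (rule set_integral_diff(1)[OF gi[OF that] ki[OF that]])
 fix psi assume psi: "test_fun {a<..<b} psi"
 have "(LINT x:{a<..<b}|lebesgue. psi x *\<^sub>R (g x - k x)) = (LINT x:{a<..<b}|lebesgue. psi x *\<^sub>R g x) - (LINT x:{a<..<b}|lebesgue. psi x *\<^sub>R k x)"
 unfolding set_lebesgue_integral_def scaleR_diff_right
 by (rule Bochner_Integration.integral_diff[OF test_fun_scaleR_integrable[OF psi ab gi] test_fun_scaleR_integrable[OF psi ab ki]])
 moreover have "- (LINT x:{a<..<b}|lebesgue. psi x *\<^sub>R g x) = - (LINT x:{a<..<b}|lebesgue. psi x *\<^sub>R k x)"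
 using g k psi unfolding has_distr_deriv_def by simp
 ultimately show "(LINT x:{a<..<b}|lebesgue. psi x *\<^sub>R (g x - k x)) = 0" by simp
 qed
 then show ?thesis by simp
qed

lemma has_distr_deriv_cong:
 assumes "!!x. a < x ==> x < b ==> w x = v x"
 shows "has_distr_deriv a b w g \<longleftrightarrow> has_distr_deriv a b v g"
proof -
 have "set_integrable lebesgue {c..d} w = set_integrable lebesgue {c..d} v" if "a < c" "d < b" for c d
 by (rule set_integrable_cong) (use assms that in auto)
 moreover have "(LINT t:{a<..<b}|lebesgue. p t *\<^sub>R w t) = (LINT t:{a<..<b}|lebesgue. p t *\<^sub>R v t)" for p
 unfolding set_lebesgue_integral_def by (intro Bochner_Integration.integral_cong refl) (auto simp: indicator_def assms)
 ultimately show ?thesis unfolding has_distr_deriv_def by auto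
qed

lemma esqrt_less_top: "esqrt x < \<infinity> \<longleftrightarrow> x < \<infinity>"
 by (auto simp: esqrt_def less_top)

lemma L2_time_norm_power2: "(L2_time_norm N {0<..<T} v)\<^sup>2 = (INTP tau. (N (v tau))\<^sup>2 * indicator {0<..<T} tau)"
 unfolding L2_time_norm_def esqrt_power2 by (rule nn_integral_restrict_space) simp

lemma strongly_measurableD:
 assumes "strongly_measurable X N {0<..<T} v"
 obtains s where "\<forall>n. simple_function (lebesgue_on {0<..<T}) (s n)" "\<forall>n. s n ` {0<..<T} \<subseteq> X"
 "AE tau in lebesgue_on {0<..<T}. v tau \<in> X \<and> (%n. N (v tau - s n tau)) \<longlonglongrightarrow> 0"
proof -
 obtain s where S: "(\<forall>n. simple_function (lebesgue_on {0<..<T}) (s n) \<and> s n ` {0<..<T} \<subseteq> X) \<and>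
 (AE tau in lebesgue_on {0<..<T}. v tau \<in> X \<and> (%n. N (v tau - s n tau)) \<longlonglongrightarrow> 0)"
 by (rule exE[OF assms[unfolded strongly_measurable_def]])
 show ?thesis
 proof (rule that)
 show "\<forall>n. simple_function (lebesgue_on {0<..<T}) (s n)" "\<forall>n. s n ` {0<..<T} \<subseteq> X" using S by blast+
 show "AE tau in lebesgue_on {0<..<T}. v tau \<in> X \<and> (%n. N (v tau - s n tau)) \<longlonglongrightarrow> 0" by (rule conjunct2[OF S])
 qed
qed

lemma strongly_measurable_AE:
 assumes "strongly_measurable X N {0<..<T} v"
 shows "AE tau in lebesgue. tau \<in> {0<..<T} --> v tau \<in> X"
proof -
 have "AE tau in lebesgue_on {0<..<T}. v tau \<in> X"
 by (rule strongly_measurableD[OF assms]) (erule eventually_mono, simp)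
 then show ?thesis by (subst (asm) AE_restrict_space_iff) auto
qed

text \<open>The origin of the factor t^(1/2-alpha) in front of the norm of the initial
  datum.\<close>

lemma powr_sq_integrable:
 assumes "0 < alpha" "alpha < 1 / 2" "0 <= t"
 shows "(INTP s. ennreal ((indicator {0<..<t} s * s powr (- alpha))\<^sup>2)) = ennreal (t powr (1 - 2 * alpha) / (1 - 2 * alpha))"
proof -
 have "(INTP s. ennreal ((indicator {0<..<t} s * s powr (- alpha))\<^sup>2)) = (INTP s. ennreal (indicator {..<t} s * rl_kernel (1 - 2 * alpha) s))"
 by (intro nn_integral_cong arg_cong[where f = ennreal])
 (auto simp: indicator_def rl_kernel_def power2_eq_square powr_add[symmetric])
 also have "... = ennreal (t powr (1 - 2 * alpha) / (1 - 2 * alpha))" by (rule nn_integral_rl_kernel) (use assms in auto)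
 finally show ?thesis .
qed

section \<open>Coefficients of the data and of the weak solution\<close>

context dirichlet_domain
begin

lemma Hneg_coefficient:
 assumes "F \<in> Hneg Omega beta" "0 <= beta" "beta < 1"
 shows "ennreal (lam i powr (- beta) * (F (phi i))\<^sup>2) <= ennreal (1 + 4 * R\<^sup>2) * (Hneg_norm Omega beta F)\<^sup>2"
proof (rule order_trans[OF _ Hneg_coefficients[OF assms]])
 have "sum (%j. ennreal (lam j powr (- beta) * (F (phi j))\<^sup>2)) {i} <= (\<Sum>i. ennreal (lam i powr (- beta) * (F (phi i))\<^sup>2))"
 by (rule sum_le_suminf) auto
 then show "ennreal (lam i powr (- beta) * (F (phi i))\<^sup>2) <= (\<Sum>i. ennreal (lam i powr (- beta) * (F (phi i))\<^sup>2))"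
 by (simp only: sum.insert sum.empty finite.emptyI empty_iff not_False_eq_True add_0_right)
qed

text \<open>Strong measurability of the source is meant in the norm of H^(-beta). Evaluation at an
  eigenfunction is continuous for this norm, so the coefficients of the source are limits of simple
  functions.\<close>

lemma Hneg_coefficient_tendsto:
 assumes F: "F \<in> Hneg Omega beta" and s: "!!n. s n \<in> Hneg Omega beta" and beta: "0 <= beta" "beta < 1"
 and lim: "(%n. Hneg_norm Omega beta (F - s n)) \<longlonglongrightarrow> 0"
 shows "(%n. s n (phi i)) \<longlonglongrightarrow> F (phi i)"
proof -
 let ?N = "%n. Hneg_norm Omega beta (F - s n)"
 define L where "L = lam i powr (- beta)"
 have L: "0 < L" using lam_pos[of i] by (simp add: L_def)
 \<comment> \<open>The coefficient bound applies to the difference only where its norm is finite,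
   which convergence guarantees from some index on.\<close>
 have ev: "\<forall>\<^sub>F n in sequentially. ennreal (L * (F (phi i) - s n (phi i))\<^sup>2) <= ennreal (1 + 4 * R\<^sup>2) * (?N n)\<^sup>2"
 using order_tendstoD(2)[OF lim zero_less_one]
 proof eventually_elim
 case (elim n)
 have fin: "?N n < \<infinity>" by (rule less_trans[OF elim]) simp
 have "F - s n \<in> Hneg Omega beta" unfolding Hneg_def
 proof (intro CollectI conjI ballI allI fin)
 fix v w c assume v: "v \<in> Hs_0 Omega beta"
 have sc: "F (c *\<^sub>R v) = c * F v" "s n (c *\<^sub>R v) = c * s n v" using F s[of n] v by (simp_all add: Hneg_def)
 show "(F - s n) (c *\<^sub>R v) = c * (F - s n) v" unfolding fun_diff_def sc by (simp add: right_diff_distrib)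
 assume w: "w \<in> Hs_0 Omega beta"
 have ad: "F (v + w) = F v + F w" "s n (v + w) = s n v + s n w" using F s[of n] v w by (simp_all add: Hneg_def)
 show "(F - s n) (v + w) = (F - s n) v + (F - s n) w" unfolding fun_diff_def ad by simp
 qed
 from Hneg_coefficient[OF this beta, of i] show ?case by (simp add: L_def)
 qed
 have "(%n. ennreal (1 + 4 * R\<^sup>2) * (?N n)\<^sup>2) \<longlonglongrightarrow> ennreal (1 + 4 * R\<^sup>2) * (0 * 0)"
 unfolding power2_eq_square by (intro tendsto_mult_ennreal tendsto_const lim) auto
 then have "(%n. ennreal (1 + 4 * R\<^sup>2) * (?N n)\<^sup>2) \<longlonglongrightarrow> 0" by simp
 then have "(%n. ennreal (L * (F (phi i) - s n (phi i))\<^sup>2)) \<longlonglongrightarrow> 0"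
 by (rule tendsto_sandwich[OF always_eventually[OF allI[OF zero_le]] ev tendsto_const])
 then have "(%n. enn2real (ennreal (L * (F (phi i) - s n (phi i))\<^sup>2))) \<longlonglongrightarrow> 0"
 by (intro tendsto_enn2real) auto
 then have "(%n. L * (F (phi i) - s n (phi i))\<^sup>2) \<longlonglongrightarrow> 0" using L by simp
 then have "(%n. (1 / L) * (L * (F (phi i) - s n (phi i))\<^sup>2)) \<longlonglongrightarrow> 0" by (rule tendsto_mult_right_zero)
 then have "(%n. (F (phi i) - s n (phi i))\<^sup>2) \<longlonglongrightarrow> 0" using L by simp
 then have "(%n. sqrt ((F (phi i) - s n (phi i))\<^sup>2)) \<longlonglongrightarrow> sqrt 0" by (rule tendsto_real_sqrt)
 then have "(%n. F (phi i) - s n (phi i)) \<longlonglongrightarrow> 0" by (simp add: tendsto_rabs_zero_iff)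
 then have "(%n. F (phi i) - (F (phi i) - s n (phi i))) \<longlonglongrightarrow> F (phi i) - 0" by (intro tendsto_diff tendsto_const)
 then show ?thesis by simp
qed

lemma source_coefficient:
 assumes f: "f \<in> L2_time (Hneg Omega beta) (Hneg_norm Omega beta) {0<..<T}" and beta: "0 <= beta" "beta < 1"
 shows "sq_integrable (%tau. indicator {0<..<T} tau * f tau (phi i))" "AE tau in lebesgue. tau \<in> {0<..<T} --> f tau \<in> Hneg Omega beta"
proof -
 have sm: "strongly_measurable (Hneg Omega beta) (Hneg_norm Omega beta) {0<..<T} f" and fin: "L2_time_norm (Hneg_norm Omega beta) {0<..<T} f < \<infinity>"
 using f by (simp_all add: L2_time_def)
 show AH: "AE tau in lebesgue. tau \<in> {0<..<T} --> f tau \<in> Hneg Omega beta" by (rule strongly_measurable_AE[OF sm])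
 obtain s where s: "\<forall>n. simple_function (lebesgue_on {0<..<T}) (s n)" "\<forall>n. s n ` {0<..<T} \<subseteq> Hneg Omega beta"
 "AE tau in lebesgue_on {0<..<T}. f tau \<in> Hneg Omega beta \<and> (%n. Hneg_norm Omega beta (f tau - s n tau)) \<longlonglongrightarrow> 0"
 by (rule strongly_measurableD[OF sm])
 have "AE tau in lebesgue_on {0<..<T}. tau \<in> space (lebesgue_on {0<..<T})" by (rule AE_space)
 then have lim: "AE tau in lebesgue_on {0<..<T}. (%n. s n tau (phi i)) \<longlonglongrightarrow> f tau (phi i)"
 using s(3)
 proof eventually_elim
 case (elim tau)
 then have "tau \<in> {0<..<T}" by simp
 then have "s n tau \<in> Hneg Omega beta" for n using s(2) by blast
 from Hneg_coefficient_tendsto[OF conjunct1[OF elim(2)] this beta conjunct2[OF elim(2)]] show ?case .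
 qed
 have m: "(%tau. indicator {0<..<T} tau * f tau (phi i)) \<in> blm"
 using simple_limit_measurable[where p = "%F. F (phi i)" and v = f, OF s(1)[rule_format] lim] by simp
 show "sq_integrable (%tau. indicator {0<..<T} tau * f tau (phi i))" unfolding sq_integrable_def
 proof (intro conjI m integrableI_bounded borel_measurable_power)
 let ?K = "(1 + 4 * R\<^sup>2) * lam i powr beta"
 have K: "0 < ?K" using lam_pos[of i] by (intro mult_pos_pos add_pos_nonneg) auto
 have "ennreal (1 / ?K) * (INTP tau. ennreal (norm ((indicator {0<..<T} tau * f tau (phi i))\<^sup>2)))
 = (INTP tau. ennreal (1 / ?K) * ennreal (norm ((indicator {0<..<T} tau * f tau (phi i))\<^sup>2)))"
 by (rule nn_integral_cmult[symmetric]) (use m in measurable)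
 also have "... <= (INTP tau. (Hneg_norm Omega beta (f tau))\<^sup>2 * indicator {0<..<T} tau)"
 proof (rule nn_integral_mono_AE, use AH in eventually_elim)
 case (elim tau)
 show ?case
 proof (cases "tau \<in> {0<..<T}")
 case True
 have H: "f tau \<in> Hneg Omega beta" using elim True by simp
 define M where "M = enn2real (Hneg_norm Omega beta (f tau))"
 have M: "Hneg_norm Omega beta (f tau) = ennreal M" "0 <= M" using H by (simp_all add: M_def Hneg_def)
 have "lam i powr (- beta) * (f tau (phi i))\<^sup>2 <= (1 + 4 * R\<^sup>2) * M\<^sup>2"
 using Hneg_coefficient[OF H beta, of i] M(2) by (simp add: M(1) ennreal_power ennreal_mult[symmetric] ennreal_le_iff del: ennreal_plus)
 then have "lam i powr beta * (lam i powr (- beta) * (f tau (phi i))\<^sup>2) <= lam i powr beta * ((1 + 4 * R\<^sup>2) * M\<^sup>2)" by (rule mult_left_mono) simp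
 moreover have "lam i powr beta * lam i powr (- beta) = 1" using lam_pos[of i] by (simp add: powr_minus field_simps)
 ultimately have "(f tau (phi i))\<^sup>2 <= ?K * M\<^sup>2" by (simp add: mult.assoc[symmetric] mult.commute)
 then have "1 / ?K * (f tau (phi i))\<^sup>2 <= M\<^sup>2" using K by (simp add: pos_divide_le_eq mult.commute)
 then have "ennreal (1 / ?K * (f tau (phi i))\<^sup>2) <= ennreal (M\<^sup>2)" by (rule ennreal_leI)
 then show ?thesis using True M K by (simp add: ennreal_power ennreal_mult[symmetric])
 qed simp
 qed
 also have "... < \<infinity>" using fin unfolding L2_time_norm_power2[symmetric] by (simp add: power_less_top_ennreal)
 finally show "(INTP tau. ennreal (norm ((indicator {0<..<T} tau * f tau (phi i))\<^sup>2))) < \<infinity>"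
 using K by (auto simp: ennreal_mult_less_top ennreal_eq_0_iff)
 qed
qed

lemma test_in_W_space:
 assumes w: "w \<in> blm" "!!x. \<bar>w x\<bar> <= M" "!!x. x \<notin> {0<..<T} ==> w x = 0"
 and fin: "(INTP xi. ennreal (\<bar>xi\<bar> powr alpha * (cmod (fourier w xi))\<^sup>2)) < \<infinity>"
 shows "(%tau. w tau *\<^sub>R phi i) \<in> W_space alpha Omega phi lam T"
proof -
 have n: "norm (phi i) = 1" using orthonormal[of i i] by (simp add: norm_eq_sqrt_inner)
 have L: "c *\<^sub>R phi i \<in> L2_on Omega" for c by (rule L2_on_scale[OF eigen_L2_on])
 have D: "dotH_norm phi lam 1 (c *\<^sub>R phi i) = ennreal (sqrt (lam i) * \<bar>c\<bar>)" for c
 proof -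
 have "(\<Sum>j. ennreal (lam j powr 1 * ((c *\<^sub>R phi i) \<bullet> phi j)\<^sup>2)) = (\<Sum>j\<in>{i}. ennreal (lam j powr 1 * ((c *\<^sub>R phi i) \<bullet> phi j)\<^sup>2))"
 by (rule suminf_finite) (auto simp: orthonormal)
 then show ?thesis using lam_pos[of i] by (simp add: dotH_norm_def orthonormal esqrt_ennreal real_sqrt_mult)
 qed
 have "(\<Sum>j. (frac_seminorm (alpha / 2) T (%tau. (w tau *\<^sub>R phi i) \<bullet> phi j))\<^sup>2) = (\<Sum>j\<in>{i}. (frac_seminorm (alpha / 2) T (%tau. (w tau *\<^sub>R phi i) \<bullet> phi j))\<^sup>2)"
 proof (rule suminf_finite)
 fix j assume "j \<notin> {i}"
 then have "(%tau. indicator {0<..<T} tau * ((w tau *\<^sub>R phi i) \<bullet> phi j)) = (%tau. 0)" by (auto simp: orthonormal)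
 then show "(frac_seminorm (alpha / 2) T (%tau. (w tau *\<^sub>R phi i) \<bullet> phi j))\<^sup>2 = 0"
 unfolding frac_seminorm_def esqrt_power2 by (simp add: fourier_def)
 qed simp
 also have "... < \<infinity>"
 proof -
 have "(%tau. indicator {0<..<T} tau * ((w tau *\<^sub>R phi i) \<bullet> phi i)) = w"
 proof
 fix tau show "indicator {0<..<T} tau * ((w tau *\<^sub>R phi i) \<bullet> phi i) = w tau"
 using w(3)[of tau] by (cases "tau \<in> {0<..<T}") (simp_all add: orthonormal)
 qed
 then show ?thesis using fin unfolding frac_seminorm_def esqrt_power2 by simp
 qed
 finally have "frac_seminorm_vec (alpha / 2) T inner phi (%tau. w tau *\<^sub>R phi i) < \<infinity>"
 unfolding frac_seminorm_vec_def esqrt_less_top .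
 moreover have "(%tau. w tau *\<^sub>R phi i) \<in> L2_time (L2_on Omega) (%w. ennreal (norm w)) {0<..<T}"
 by (rule scalar_L2_time[OF w(1,2) L, where k = 1]) (simp_all add: n)
 moreover have "(%tau. w tau *\<^sub>R phi i) \<in> L2_time (dotH Omega phi lam 1) (dotH_norm phi lam 1) {0<..<T}"
 by (rule scalar_L2_time[OF w(1,2) _ D]) (simp_all add: dotH_def L D less_imp_le[OF lam_pos])
 ultimately show ?thesis unfolding W_space_def by simp
qed

end

context dirichlet_domain
begin

lemma weak_solution_coefficient:
 fixes i :: nat
 assumes alpha: "0 < alpha" "alpha < 1 / 2" and beta: "0 <= beta" "beta < 1" and T: "0 < T"
 and f: "f \<in> L2_time (Hneg Omega beta) (Hneg_norm Omega beta) {0<..<T}" and u0: "u0 \<in> Hneg Omega beta"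
 and ws: "weak_solution alpha Omega phi lam T u0 f u"
 defines "y \<equiv> %tau. indicator {0<..<T} tau * (u tau \<bullet> phi i)"
 and "g \<equiv> %tau. indicator {0<..<T} tau * (tau powr (- alpha) / Gamma (1 - alpha) * u0 (phi i) + f tau (phi i))"
 shows "sq_integrable y" "sq_integrable g"
 "AE x in lebesgue. x \<in> {0<..<T} --> y x = frac_int_left 0 alpha (%s. g s - lam i * y s) x"
proof -
 define gamma where "gamma = alpha / 2"
 have gamma: "0 < gamma" "gamma < 1 / 2" "2 * gamma = alpha" using alpha by (simp_all add: gamma_def)
 have gamma4: "1 / 2 < 1 - gamma" using gamma(2) by simp
 \<comment> \<open>Outside (0,T) the solution is unrestricted. Its extension by zero is globally
   measurable and square integrable, and it has the same left fractional integrals up to T.\<close>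
 define U where "U tau = indicator {0<..<T} tau *\<^sub>R u tau" for tau
 have U0: "U s = 0" if "s \<notin> {0<..<T}" for s using that by (simp add: U_def)
 have U0': "U s = 0" if "s <= 0" for s by (rule U0) (use that in auto)
 have W: "u \<in> W_space alpha Omega phi lam T" using ws by (simp add: weak_solution_def)
 have sm: "strongly_measurable (L2_on Omega) (%w. ennreal (norm w)) {0<..<T} u" and fin0: "L2_time_norm (%w. ennreal (norm w)) {0<..<T} u < \<infinity>"
 and finV: "frac_seminorm_vec (alpha / 2) T inner phi u < \<infinity>" and smD: "strongly_measurable (dotH Omega phi lam 1) (dotH_norm phi lam 1) {0<..<T} u"
 using W by (simp_all add: W_space_def L2_time_def)
 have AD: "AE tau in lebesgue. tau \<in> {0<..<T} --> u tau \<in> dotH Omega phi lam 1" by (rule strongly_measurable_AE[OF smD])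
 have Um: "U \<in> blm"
 proof -
 obtain s where s: "\<forall>n. simple_function (lebesgue_on {0<..<T}) (s n)" "\<forall>n. s n ` {0<..<T} \<subseteq> L2_on Omega"
 "AE tau in lebesgue_on {0<..<T}. u tau \<in> L2_on Omega \<and> (%n. ennreal (norm (u tau - s n tau))) \<longlonglongrightarrow> 0"
 by (rule strongly_measurableD[OF sm])
 have "AE tau in lebesgue_on {0<..<T}. (%n. s n tau) \<longlonglongrightarrow> u tau"
 using s(3)
 proof (rule eventually_mono)
 fix tau assume A: "u tau \<in> L2_on Omega \<and> (%n. ennreal (norm (u tau - s n tau))) \<longlonglongrightarrow> 0"
 have "(%n. ennreal (norm (u tau - s n tau))) \<longlonglongrightarrow> ennreal 0" using A by simp
 then have "(%n. enn2real (ennreal (norm (u tau - s n tau)))) \<longlonglongrightarrow> 0" by (rule tendsto_enn2real) simp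
 then have "(%n. norm (s n tau - u tau)) \<longlonglongrightarrow> 0" by (simp add: norm_minus_commute)
 then have "(%n. s n tau - u tau) \<longlonglongrightarrow> 0" by (rule tendsto_norm_zero_cancel)
 then show "(%n. s n tau) \<longlonglongrightarrow> u tau" by (simp add: LIM_zero_iff)
 qed
 from simple_limit_measurable[where p = "%x. x", OF s(1)[rule_format] this] show ?thesis by (simp add: U_def[abs_def])
 qed
 have Ufin: "(INTP s. ennreal ((norm (U s))\<^sup>2)) < \<infinity>"
 proof -
 have "(INTP s. ennreal ((norm (U s))\<^sup>2)) = (L2_time_norm (%w. ennreal (norm w)) {0<..<T} u)\<^sup>2"
 unfolding L2_time_norm_power2 by (rule nn_integral_cong) (simp add: U_def indicator_def ennreal_power)
 then show ?thesis using fin0 by (simp add: power_less_top_ennreal)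
 qed
 have Ucl: "AE s in lebesgue. U s \<in> closure (span (range phi))"
 using AD unfolding span_dense by (rule eventually_mono) (auto simp: U_def indicator_def dotH_def L2_on_0)
 have yU: "y = (%s. U s \<bullet> phi i)" by (simp add: y_def U_def)
 have fin: "(\<Sum>i. \<integral>\<^sup>+xi. ennreal (\<bar>xi\<bar> powr (2 * gamma) * (cmod (fourier (%s. U s \<bullet> phi i) xi))\<^sup>2) \<partial>lebesgue) < \<infinity>"
 using finV unfolding frac_seminorm_vec_def esqrt_less_top frac_seminorm_def esqrt_power2 gamma_def U_def by simp
 obtain G0 where G0: "has_distr_deriv 0 T (frac_int_left 0 (1 - gamma) U) G0"
 by (rule exE[OF frac_deriv_left_exists[OF gamma(1,2) T orthonormal Um U0 Ufin Ucl fin]])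
 have UI: "frac_int_left 0 (1 - gamma) U x = frac_int_left 0 (1 - gamma) u x" if "x <= T" for x
 using frac_int_left_cutoff[OF that, of "1 - gamma" u] by (simp add: U_def[abs_def])
 define G where "G = frac_deriv_left 0 T gamma u"
 have "has_distr_deriv 0 T (frac_int_left 0 (1 - gamma) u) G0"
 using G0 has_distr_deriv_cong[of 0 T "frac_int_left 0 (1 - gamma) U" "frac_int_left 0 (1 - gamma) u" G0] UI by simp
 \<comment> \<open>Existence passes the defining property on to the function chosen by
   \<open>SOME\<close>, which is the one in the weak form.\<close>
 then have "has_distr_deriv 0 T (frac_int_left 0 (1 - gamma) u) G"
 unfolding G_def frac_deriv_left_def distr_deriv_def by (rule someI[of "has_distr_deriv 0 T (frac_int_left 0 (1 - gamma) u)"])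
 then have G: "has_distr_deriv 0 T (frac_int_left 0 (1 - gamma) U) G"
 using has_distr_deriv_cong[of 0 T "frac_int_left 0 (1 - gamma) U" "frac_int_left 0 (1 - gamma) u" G] UI by simp
 have Gi: "set_integrable lebesgue {c..d} G" and Ii: "set_integrable lebesgue {c..d} (frac_int_left 0 (1 - gamma) U)" if "0 < c" "c < d" "d < T" for c d
 using G that unfolding has_distr_deriv_def by simp_all
 have unit: "phi i \<bullet> phi i = 1" by (simp add: orthonormal)
 show ysq: "sq_integrable y" unfolding sq_integrable_def
 proof (intro conjI integrableI_bounded)
 show ym: "y \<in> blm" unfolding yU by (intro borel_measurable_inner Um borel_measurable_const)
 show "(%x. (y x)\<^sup>2) \<in> blm" using ym by measurable
 have "(INTP x. ennreal (norm ((y x)\<^sup>2))) <= (INTP s. ennreal ((norm (U s))\<^sup>2))"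
 proof (rule nn_integral_mono)
 fix x
 have "norm (phi i) = 1" using unit by (simp add: norm_eq_sqrt_inner)
 then have "\<bar>y x\<bar>\<^sup>2 <= (norm (U x))\<^sup>2" using Cauchy_Schwarz_ineq2[of "U x" "phi i"] by (intro power_mono) (simp_all add: yU)
 then show "ennreal (norm ((y x)\<^sup>2)) <= ennreal ((norm (U x))\<^sup>2)" by (simp add: ennreal_leI)
 qed
 then show "(INTP x. ennreal (norm ((y x)\<^sup>2))) < \<infinity>" using Ufin by (rule le_less_trans)
 qed
 note fc = source_coefficient[OF f beta]
 have psq: "sq_integrable (%s. indicator {0<..<T} s * s powr (- alpha))" unfolding sq_integrable_def
 proof (intro conjI integrableI_bounded)
 show m: "(%s. indicator {0<..<T} s * s powr (- alpha)) \<in> blm" by (rule measurable_completion) measurable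
 show "(%s. (indicator {0<..<T} s * s powr (- alpha))\<^sup>2) \<in> blm" by (rule borel_measurable_power[OF m])
 show "(INTP s. ennreal (norm ((indicator {0<..<T} s * s powr (- alpha))\<^sup>2))) < \<infinity>"
 using powr_sq_integrable[OF alpha, of T] T by simp
 qed
 have geq: "g = (%tau. u0 (phi i) / Gamma (1 - alpha) * (indicator {0<..<T} tau * tau powr (- alpha)) + indicator {0<..<T} tau * f tau (phi i))"
 by (rule ext) (simp add: g_def algebra_simps)
 show gsq: "sq_integrable g" unfolding geq by (intro sq_integrable_add sq_integrable_scale psq fc(1))
 define r where "r s = g s - lam i * y s" for s
 have rsq: "sq_integrable r" unfolding r_def[abs_def] by (intro sq_integrable_diff sq_integrable_scale gsq ysq)
 have y0: "y s = 0" and g0: "g s = 0" if "s \<notin> {0<..<T}" for s using that by (simp_all add: y_def g_def)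
 have r0: "r s = 0" if "s \<notin> {0<..<T}" for s using y0[OF that] g0[OF that] by (simp add: r_def)
 have "AE x in lebesgue. x \<in> {0<..<T} --> y x = frac_int_left 0 (2 * gamma) r x"
 proof (rule volterra_from_weak[OF gamma(1,2) T ysq y0 rsq r0])
 fix h :: "real => real" assume h: "test_fun {0<..<T} h"
 define w where "w = (%tau. indicator {0<..<T} tau * frac_int_right T gamma h tau)"
 note tr = test_fun_right[OF gamma(1,2) T h, folded w_def]
 obtain M where M: "\<forall>x. \<bar>w x\<bar> <= M" using tr(2) unfolding w_def by blast
 have w0: "w x = 0" if "x \<notin> {0<..<T}" for x using that by (simp add: w_def)
 have wsq: "sq_integrable w" unfolding sq_integrable_def
 proof
 show "w \<in> blm" by (rule tr(1))
 have M2: "norm ((w x)\<^sup>2) <= M\<^sup>2" for x using power_mono[OF M[rule_format, of x] abs_ge_zero, of 2] by simp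
 have "set_integrable lebesgue {0..T} (%x. (w x)\<^sup>2)" by (rule set_integrable_bounded[OF borel_measurable_power[OF tr(1)] M2])
 moreover have "(%x. indicator {0..T} x *\<^sub>R (w x)\<^sup>2) = (%x. (w x)\<^sup>2)" by (rule ext) (auto simp: w_def indicator_def)
 ultimately show "integrable lebesgue (%x. (w x)\<^sup>2)" by (simp only: set_integrable_def)
 qed
 let ?v = "%tau. w tau *\<^sub>R phi i"
 have vW: "?v \<in> W_space alpha Omega phi lam T"
 by (rule test_in_W_space[OF tr(1) M[rule_format]]) (erule w0, use tr(3) in \<open>simp only: gamma(3)\<close>)
 define D where "D = frac_deriv_right 0 T gamma ?v"
 have IR: "frac_int_right T (1 - gamma) ?v x = frac_int_right T (1 - gamma) w x *\<^sub>R phi i" for x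
 using integral_scaleR_unit[OF unit, of lebesgue "%s. indicator {x<..<T} s *\<^sub>R ((s - x) powr (1 - gamma - 1) *\<^sub>R w s)"]
 by (simp add: frac_int_right_def set_lebesgue_integral_def)
 have hd: "has_distr_deriv 0 T (frac_int_right T (1 - gamma) ?v) (%x. (- h x) *\<^sub>R phi i)"
 using has_distr_deriv_scaleR[OF unit tr(4)] has_distr_deriv_cong[of 0 T "frac_int_right T (1 - gamma) ?v" "%x. frac_int_right T (1 - gamma) w x *\<^sub>R phi i"] IR by simp
 then have "has_distr_deriv 0 T (frac_int_right T (1 - gamma) ?v) (distr_deriv 0 T (frac_int_right T (1 - gamma) ?v))"
 unfolding distr_deriv_def by (rule someI[of "has_distr_deriv 0 T (frac_int_right T (1 - gamma) ?v)"])
 \<comment> \<open>Uniqueness identifies the chosen right derivative of the test function with h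
   times the eigenfunction. The minus sign of the right derivative cancels that of the
   distributional derivative.\<close>
 from has_distr_deriv_unique[OF T hd this]
 have AEd: "AE x in lebesgue. x \<in> {0<..<T} --> D x = h x *\<^sub>R phi i"
 proof (rule eventually_mono, intro impI)
 fix x assume A: "x \<in> {0<..<T} --> (- h x) *\<^sub>R phi i = distr_deriv 0 T (frac_int_right T (1 - gamma) ?v) x" and x: "x \<in> {0<..<T}"
 show "D x = h x *\<^sub>R phi i" unfolding D_def frac_deriv_right_def A[rule_format, OF x, symmetric] by simp
 qed
 define X where "X = (LINT x|lebesgue. deriv h x * frac_int_left 0 (1 - gamma) y x)"
 \<comment> \<open>The derivative G enters only as a locally integrable function, but h has compact
   support in (0,T). The distributional identity moves the derivative onto h, and the inner product
   with the eigenfunction then passes under the fractional integral.\<close>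
 have E1: "(LINT t:{0<..<T}|lebesgue. G t \<bullet> D t) = - X"
 proof -
 have hG: "integrable lebesgue (%t. indicator {0<..<T} t *\<^sub>R (h t *\<^sub>R G t))" by (rule test_fun_scaleR_integrable[OF h T Gi])
 note dh = test_fun_deriv(3)[OF h]
 have hI: "integrable lebesgue (%t. indicator {0<..<T} t *\<^sub>R (deriv h t *\<^sub>R frac_int_left 0 (1 - gamma) U t))" by (rule test_fun_scaleR_integrable[OF dh T Ii])
 have "(LINT t:{0<..<T}|lebesgue. G t \<bullet> D t) = (LINT t|lebesgue. (indicator {0<..<T} t *\<^sub>R (h t *\<^sub>R G t)) \<bullet> phi i)"
 unfolding set_lebesgue_integral_def
 proof (rule lebesgue_integral_cong_AE)
 show "(%t. (indicator {0<..<T} t *\<^sub>R (h t *\<^sub>R G t)) \<bullet> phi i) \<in> blm"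
 by (rule borel_measurable_integrable[OF integrable_inner_left[OF hG]])
 show "AE t in lebesgue. (indicator {0<..<T} t *\<^sub>R (h t *\<^sub>R G t)) \<bullet> phi i = indicator {0<..<T} t *\<^sub>R (G t \<bullet> D t)"
 using AEd by (rule eventually_mono) (simp add: indicator_def)
 qed
 also have "... = (LINT t:{0<..<T}|lebesgue. h t *\<^sub>R G t) \<bullet> phi i"
 unfolding set_lebesgue_integral_def by (rule integral_inner_left) (rule hG)
 also have "(LINT t:{0<..<T}|lebesgue. h t *\<^sub>R G t) = - (LINT t:{0<..<T}|lebesgue. deriv h t *\<^sub>R frac_int_left 0 (1 - gamma) U t)"
 using G h unfolding has_distr_deriv_def by simp
 also have "(- (LINT t:{0<..<T}|lebesgue. deriv h t *\<^sub>R frac_int_left 0 (1 - gamma) U t)) \<bullet> phi i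
 = - (LINT t|lebesgue. (indicator {0<..<T} t *\<^sub>R (deriv h t *\<^sub>R frac_int_left 0 (1 - gamma) U t)) \<bullet> phi i)"
 unfolding set_lebesgue_integral_def inner_minus_left by (subst integral_inner_left[OF hI]) simp
 also have "(%t. (indicator {0<..<T} t *\<^sub>R (deriv h t *\<^sub>R frac_int_left 0 (1 - gamma) U t)) \<bullet> phi i) = (%t. deriv h t * frac_int_left 0 (1 - gamma) y t)"
 proof
 fix t
 have "frac_int_left 0 (1 - gamma) U t \<bullet> phi i = frac_int_left 0 (1 - gamma) y t"
 unfolding yU by (rule frac_int_left_inner[OF set_integrable_frac_int_left(1)[OF gamma4 Um U0' Ufin] U0'])
 then show "(indicator {0<..<T} t *\<^sub>R (deriv h t *\<^sub>R frac_int_left 0 (1 - gamma) U t)) \<bullet> phi i = deriv h t * frac_int_left 0 (1 - gamma) y t"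
 using test_funD(4)[OF dh, of t] by (cases "t \<in> {0<..<T}") simp_all
 qed
 finally show ?thesis by (simp add: X_def)
 qed
 have iy: "integrable lebesgue (%t. lam i * (y t * w t))" and ig: "integrable lebesgue (%t. g t * w t)"
 using sq_integrable_mult[OF ysq wsq] sq_integrable_mult[OF gsq wsq] by simp_all
 \<comment> \<open>For almost every t the value of u lies in the spectral space of order 1, where
   Green's formula against an eigenfunction is available.\<close>
 have E2: "(LINT t:{0<..<T}|lebesgue. \<Sum>b\<in>Basis. weak_partial Omega b (u t) \<bullet> weak_partial Omega b (?v t)) = (LINT t|lebesgue. lam i * (y t * w t))"
 unfolding set_lebesgue_integral_def
 proof (rule lebesgue_integral_cong_AE[OF borel_measurable_integrable[OF iy]], rule eventually_mono[OF AD])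
 fix t assume t: "t \<in> {0<..<T} --> u t \<in> dotH Omega phi lam 1"
 show "lam i * (y t * w t) = indicator {0<..<T} t *\<^sub>R (\<Sum>b\<in>Basis. weak_partial Omega b (u t) \<bullet> weak_partial Omega b (?v t))"
 proof (cases "t \<in> {0<..<T}")
 case True
 have d: "u t \<in> L2_on Omega \<and> dotH_norm phi lam 1 (u t) < \<infinity>"
 using t[rule_format, OF True] by (simp only: dotH_def mem_Collect_eq)
 have "(\<Sum>j. ennreal (lam j powr 1 * (u t \<bullet> phi j)\<^sup>2)) < \<infinity>"
 using d[THEN conjunct2] unfolding dotH_norm_def esqrt_less_top .
 then have nt: "(\<Sum>j. ennreal (lam j powr 1 * (u t \<bullet> phi j)\<^sup>2)) ~= top"
 unfolding infinity_ennreal_def by (rule less_imp_neq)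
 have nn: "0 <= lam j powr 1 * (u t \<bullet> phi j)\<^sup>2" for j by (intro mult_nonneg_nonneg) simp_all
 have pe: "(%j. lam j powr 1 * (u t \<bullet> phi j)\<^sup>2) = (%j. lam j * (u t \<bullet> phi j)\<^sup>2)"
 by (rule ext) (simp only: powr_one[OF less_imp_le[OF lam_pos]])
 have sm: "summable (%j. lam j * (u t \<bullet> phi j)\<^sup>2)"
 using summable_suminf_not_top[OF nn nt] unfolding pe .
 have "(\<Sum>b\<in>Basis. weak_partial Omega b (u t) \<bullet> (w t *\<^sub>R weak_partial Omega b (phi i))) = w t * (\<Sum>b\<in>Basis. weak_partial Omega b (u t) \<bullet> weak_partial Omega b (phi i))"
 by (simp only: inner_scaleR_right sum_distrib_left)
 then have h1: "(\<Sum>b\<in>Basis. weak_partial Omega b (u t) \<bullet> (w t *\<^sub>R weak_partial Omega b (phi i))) = w t * (lam i * (u t \<bullet> phi i))"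
 unfolding dotH1_green[OF d[THEN conjunct1] sm] .
 have h2: "(\<Sum>b\<in>Basis. weak_partial Omega b (u t) \<bullet> (w t *\<^sub>R weak_partial Omega b (phi i))) = (\<Sum>b\<in>Basis. weak_partial Omega b (u t) \<bullet> weak_partial Omega b (?v t))"
 proof (rule sum.cong[OF refl])
 fix b :: 'a assume b: "b \<in> Basis"
 have "weak_partial Omega b (?v t) = w t *\<^sub>R weak_partial Omega b (phi i)"
 by (rule weak_partial_eqI[OF open_domain b has_weak_partial_scale[OF b eigen_partial(1)[OF b]]])
 then show "weak_partial Omega b (u t) \<bullet> (w t *\<^sub>R weak_partial Omega b (phi i)) = weak_partial Omega b (u t) \<bullet> weak_partial Omega b (?v t)" by (simp only:)
 qed
 have "(\<Sum>b\<in>Basis. weak_partial Omega b (u t) \<bullet> weak_partial Omega b (?v t)) = w t * (lam i * (u t \<bullet> phi i))"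
 by (rule trans[OF h2[symmetric] h1])
 moreover have "indicator {0<..<T} t = (1 :: real)" using True by simp
 ultimately show ?thesis unfolding y_def by (simp only: scaleR_one mult_1_left mult_ac)
 qed (simp add: w0)
 qed
 have lin: "F (c *\<^sub>R phi i) = c * F (phi i)" if "F \<in> Hneg Omega beta" for F c
 proof -
 have "phi i \<in> Hs_0 Omega beta" by (rule H1_approx_Hs_0[OF H1_approx_eigen]) (use beta in simp)
 then show ?thesis using that by (simp add: Hneg_def)
 qed
 have E3: "(LINT t:{0<..<T}|lebesgue. t powr (- alpha) / Gamma (1 - alpha) * u0 (?v t) + f t (?v t)) = (LINT t|lebesgue. g t * w t)"
 unfolding set_lebesgue_integral_def
 proof (rule lebesgue_integral_cong_AE[OF borel_measurable_integrable[OF ig]], rule eventually_mono[OF fc(2)])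
 fix t assume t: "t \<in> {0<..<T} --> f t \<in> Hneg Omega beta"
 show "g t * w t = indicator {0<..<T} t *\<^sub>R (t powr (- alpha) / Gamma (1 - alpha) * u0 (?v t) + f t (?v t))"
 using t by (cases "t \<in> {0<..<T}") (simp_all add: lin[OF u0] lin w0 g_def algebra_simps)
 qed
 have "(LINT t:{0<..<T}|lebesgue. G t \<bullet> D t) + (LINT t:{0<..<T}|lebesgue. \<Sum>b\<in>Basis. weak_partial Omega b (u t) \<bullet> weak_partial Omega b (?v t)) =
 (LINT t:{0<..<T}|lebesgue. t powr (- alpha) / Gamma (1 - alpha) * u0 (?v t) + f t (?v t))"
 using bspec[OF conjunct2[OF ws[unfolded weak_solution_def]] vW] unfolding G_def D_def gamma_def .
 then have "X = - ((LINT t|lebesgue. g t * w t) - (LINT t|lebesgue. lam i * (y t * w t)))" unfolding E1 E2 E3 by linarith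
 also have "(LINT t|lebesgue. g t * w t) - (LINT t|lebesgue. lam i * (y t * w t)) = (LINT t|lebesgue. g t * w t - lam i * (y t * w t))"
 by (rule Bochner_Integration.integral_diff[OF ig iy, symmetric])
 also have "(%t. g t * w t - lam i * (y t * w t)) = (%t. r t * frac_int_right T gamma h t)"
 proof
 fix t show "g t * w t - lam i * (y t * w t) = r t * frac_int_right T gamma h t"
 using y0[of t] g0[of t] by (cases "t \<in> {0<..<T}") (simp_all add: r_def w_def algebra_simps)
 qed
 finally show "(LINT x|lebesgue. deriv h x * frac_int_left 0 (1 - gamma) y x) = - (LINT x|lebesgue. r x * frac_int_right T gamma h x)"
 by (simp add: X_def)
 qed
 then show "AE x in lebesgue. x \<in> {0<..<T} --> y x = frac_int_left 0 alpha (%s. g s - lam i * y s) x"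
 unfolding gamma(3) r_def[abs_def] .
qed

end

section \<open>Summation over the spectrum and the regularity estimate\<close>

context dirichlet_domain
begin

text \<open>Through this formula the vector-valued seminorms become sums of scalar seminorms of the
  plain coefficients with weights lam^kappa.\<close>

lemma dotH_inner_basis: "dotH_inner phi lam kappa v (dotH_basis phi lam kappa i) = lam i powr (kappa / 2) * (v \<bullet> phi i)"
proof -
 have "(\<Sum>j. lam j powr kappa * (v \<bullet> phi j) * (dotH_basis phi lam kappa i \<bullet> phi j)) = (\<Sum>j\<in>{i}. lam j powr kappa * (v \<bullet> phi j) * (dotH_basis phi lam kappa i \<bullet> phi j))"
 by (rule suminf_finite) (auto simp: dotH_basis_def orthonormal)
 moreover have "lam i powr kappa * lam i powr (- kappa / 2) = lam i powr (kappa / 2)" by (simp add: powr_add[symmetric])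
 ultimately show ?thesis by (simp add: dotH_inner_def dotH_basis_def orthonormal mult_ac)
qed

lemma frac_seminorm_scale:
 "(frac_seminorm gamma t (%tau. c * w tau))\<^sup>2 = (INTP xi. ennreal (c\<^sup>2 * (\<bar>xi\<bar> powr (2 * gamma) * (cmod (fourier (%tau. indicator {0<..<t} tau * w tau) xi))\<^sup>2)))"
 unfolding frac_seminorm_def esqrt_power2 mult.left_commute[of _ c] fourier_scale
 by (simp add: power_mult_distrib mult_ac)

text \<open>The inequality (a + b)^2 <= 2 a^2 + 2 b^2 separates the initial datum from the source,
  and \<open>Hneg_coefficients\<close> is applied to each, pointwise in time for the source. The
  constant \<open>A\<close> is the squared L^2 norm over (0,1) of the time factor of the initial
  datum.\<close>

lemma coefficient_sum_bound:
 assumes alpha: "0 < alpha" "alpha < 1 / 2" and beta: "0 <= beta" "beta < 1" and t: "0 < t"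
 and fm: "!!i. (%tau. indicator {0<..<t} tau * f tau (phi i)) \<in> blm"
 and fH: "AE tau in lebesgue. tau \<in> {0<..<t} --> f tau \<in> Hneg Omega beta" and u0: "u0 \<in> Hneg Omega beta"
 defines "A \<equiv> 1 / ((1 - 2 * alpha) * (Gamma (1 - alpha))\<^sup>2)"
 shows "(\<Sum>i. ennreal (lam i powr (- beta)) * (INTP tau. ennreal ((indicator {0<..<t} tau * (tau powr (- alpha) / Gamma (1 - alpha) * u0 (phi i) + f tau (phi i)))\<^sup>2)))
 <= ennreal (2 * (1 + 4 * R\<^sup>2) * (1 + A)) * ((L2_time_norm (Hneg_norm Omega beta) {0<..<t} f)\<^sup>2 + (ennreal (t powr (1 / 2 - alpha)) * Hneg_norm Omega beta u0)\<^sup>2)"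
proof -
 let ?K = "1 + 4 * R\<^sup>2"
 have K: "0 < ?K" by (rule add_pos_nonneg) auto
 have k1: "0 <= 1 / ?K" and k2: "0 <= ?K" using K by simp_all
 have G: "0 < Gamma (1 - alpha)" using alpha by (intro Gamma_real_pos) simp
 have A: "0 <= A" using alpha by (simp add: A_def)
 define P where "P = L2_time_norm (Hneg_norm Omega beta) {0<..<t} f"
 define N where "N = Hneg_norm Omega beta u0"
 define F where "F i tau = indicator {0<..<t} tau * f tau (phi i)" for i tau
 define p where "p tau = indicator {0<..<t} tau * tau powr (- alpha)" for tau :: real
 have Fm [measurable]: "F i \<in> blm" for i using fm by (simp add: F_def[abs_def])
 have pm [measurable]: "p \<in> blm" unfolding p_def[abs_def] by (rule measurable_completion) measurable
 define cc where "cc i = u0 (phi i) / Gamma (1 - alpha)" for i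
 let ?g = "%i tau. indicator {0<..<t} tau * (tau powr (- alpha) / Gamma (1 - alpha) * u0 (phi i) + f tau (phi i))"
 let ?J = "t powr (1 - 2 * alpha) / (1 - 2 * alpha)"
 have J: "0 <= ?J" using alpha by simp
 have one: "(INTP tau. ennreal ((?g i tau)\<^sup>2)) <= ennreal (2 * (cc i)\<^sup>2) * ennreal ?J + 2 * (INTP tau. ennreal ((F i tau)\<^sup>2))" for i
 proof -
 have "(INTP tau. ennreal ((?g i tau)\<^sup>2)) <= (INTP tau. ennreal (2 * (cc i)\<^sup>2) * ennreal ((p tau)\<^sup>2) + 2 * ennreal ((F i tau)\<^sup>2))"
 proof (rule nn_integral_mono)
 fix tau
 have e: "?g i tau = cc i * p tau + F i tau" by (simp add: cc_def p_def F_def algebra_simps)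
 have "0 <= (cc i * p tau - F i tau)\<^sup>2" by simp
 then have "(?g i tau)\<^sup>2 <= 2 * (cc i)\<^sup>2 * (p tau)\<^sup>2 + 2 * (F i tau)\<^sup>2" unfolding e by (simp add: power2_eq_square algebra_simps)
 then have "ennreal ((?g i tau)\<^sup>2) <= ennreal (2 * (cc i)\<^sup>2 * (p tau)\<^sup>2 + 2 * (F i tau)\<^sup>2)" by (rule ennreal_leI)
 also have "... = ennreal (2 * (cc i)\<^sup>2) * ennreal ((p tau)\<^sup>2) + 2 * ennreal ((F i tau)\<^sup>2)" by (subst ennreal_plus) (simp_all add: ennreal_mult)
 finally show "ennreal ((?g i tau)\<^sup>2) <= ennreal (2 * (cc i)\<^sup>2) * ennreal ((p tau)\<^sup>2) + 2 * ennreal ((F i tau)\<^sup>2)" .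
 qed
 also have "... = ennreal (2 * (cc i)\<^sup>2) * (INTP tau. ennreal ((p tau)\<^sup>2)) + 2 * (INTP tau. ennreal ((F i tau)\<^sup>2))"
 by (subst nn_integral_add, measurable) (subst nn_integral_cmult, measurable, subst nn_integral_cmult, measurable)
 finally show ?thesis unfolding p_def using powr_sq_integrable[OF alpha, of t] t by simp
 qed
 have "(\<Sum>i. ennreal (lam i powr (- beta)) * (INTP tau. ennreal ((?g i tau)\<^sup>2)))
 <= (\<Sum>i. ennreal (2 * t powr (1 - 2 * alpha) * A) * ennreal (lam i powr (- beta) * (u0 (phi i))\<^sup>2) + 2 * (INTP tau. ennreal (lam i powr (- beta) * (F i tau)\<^sup>2)))"
 proof (rule suminf_le)
 fix i
 have a1: "ennreal (lam i powr (- beta)) * (ennreal (2 * (cc i)\<^sup>2) * ennreal ?J) = ennreal (2 * t powr (1 - 2 * alpha) * A) * ennreal (lam i powr (- beta) * (u0 (phi i))\<^sup>2)"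
 proof -
 have "ennreal (lam i powr (- beta)) * (ennreal (2 * (cc i)\<^sup>2) * ennreal ?J) = ennreal (lam i powr (- beta) * (2 * (cc i)\<^sup>2 * ?J))"
 proof -
 have n: "0 <= 2 * (cc i)\<^sup>2" by simp
 show ?thesis unfolding ennreal_mult[OF powr_ge_zero mult_nonneg_nonneg[OF n J]] ennreal_mult[OF n J] ..
 qed
 also have "lam i powr (- beta) * (2 * (cc i)\<^sup>2 * ?J) = (2 * t powr (1 - 2 * alpha) * A) * (lam i powr (- beta) * (u0 (phi i))\<^sup>2)"
 by (simp add: cc_def A_def power_divide mult_ac)
 also have "ennreal ... = ennreal (2 * t powr (1 - 2 * alpha) * A) * ennreal (lam i powr (- beta) * (u0 (phi i))\<^sup>2)"
 using A by (intro ennreal_mult) auto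
 finally show ?thesis .
 qed
 have a2: "ennreal (lam i powr (- beta)) * (2 * (INTP tau. ennreal ((F i tau)\<^sup>2))) = 2 * (INTP tau. ennreal (lam i powr (- beta) * (F i tau)\<^sup>2))"
 by (simp add: ennreal_mult nn_integral_cmult mult.left_commute)
 have "ennreal (lam i powr (- beta)) * (INTP tau. ennreal ((?g i tau)\<^sup>2))
 <= ennreal (lam i powr (- beta)) * (ennreal (2 * (cc i)\<^sup>2) * ennreal ?J + 2 * (INTP tau. ennreal ((F i tau)\<^sup>2)))"
 by (intro mult_left_mono one) simp
 then show "ennreal (lam i powr (- beta)) * (INTP tau. ennreal ((?g i tau)\<^sup>2))
 <= ennreal (2 * t powr (1 - 2 * alpha) * A) * ennreal (lam i powr (- beta) * (u0 (phi i))\<^sup>2) + 2 * (INTP tau. ennreal (lam i powr (- beta) * (F i tau)\<^sup>2))"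
 unfolding distrib_left a1 a2 .
 qed auto
 also have "... = ennreal (2 * t powr (1 - 2 * alpha) * A) * (\<Sum>i. ennreal (lam i powr (- beta) * (u0 (phi i))\<^sup>2)) + 2 * (\<Sum>i. \<integral>\<^sup>+tau. ennreal (lam i powr (- beta) * (F i tau)\<^sup>2) \<partial>lebesgue)"
 by (subst suminf_add[symmetric]) (auto intro: summableI simp: ennreal_suminf_cmult)
 also have "... <= ennreal (2 * t powr (1 - 2 * alpha) * A) * (ennreal ?K * N\<^sup>2) + 2 * (ennreal ?K * P\<^sup>2)"
 proof (intro add_mono mult_left_mono)
 show "(\<Sum>i. ennreal (lam i powr (- beta) * (u0 (phi i))\<^sup>2)) <= ennreal ?K * N\<^sup>2" unfolding N_def by (rule Hneg_coefficients[OF u0 beta])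
 let ?Z = "\<Sum>i. \<integral>\<^sup>+tau. ennreal (lam i powr (- beta) * (F i tau)\<^sup>2) \<partial>lebesgue"
 have Z: "?Z = (INTP tau. (\<Sum>i. ennreal (lam i powr (- beta) * (F i tau)\<^sup>2)))"
 by (rule nn_integral_suminf[symmetric]) measurable
 have Fm': "(%tau. ennreal (lam i powr (- beta) * (F i tau)\<^sup>2)) \<in> blm" for i by measurable
 have Sm: "(%tau. \<Sum>i. ennreal (lam i powr (- beta) * (F i tau)\<^sup>2)) \<in> blm"
 by (rule borel_measurable_suminf_order) (rule Fm')
 have "ennreal (1 / ?K) * ?Z = (INTP tau. ennreal (1 / ?K) * (\<Sum>i. ennreal (lam i powr (- beta) * (F i tau)\<^sup>2)))"
 unfolding Z by (rule nn_integral_cmult[OF Sm, symmetric])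
 also have "... <= (INTP tau. (Hneg_norm Omega beta (f tau))\<^sup>2 * indicator {0<..<t} tau)"
 proof (rule nn_integral_mono_AE, rule eventually_mono[OF fH])
 fix tau assume H: "tau \<in> {0<..<t} --> f tau \<in> Hneg Omega beta"
 show "ennreal (1 / ?K) * (\<Sum>i. ennreal (lam i powr (- beta) * (F i tau)\<^sup>2)) <= (Hneg_norm Omega beta (f tau))\<^sup>2 * indicator {0<..<t} tau"
 proof (cases "tau \<in> {0<..<t}")
 case True
 have Fe: "F i tau = f tau (phi i)" for i using True by (simp add: F_def)
 have "ennreal (1 / ?K) * (\<Sum>i. ennreal (lam i powr (- beta) * (F i tau)\<^sup>2)) <= ennreal (1 / ?K) * (ennreal ?K * (Hneg_norm Omega beta (f tau))\<^sup>2)"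
 unfolding Fe by (rule mult_left_mono[OF Hneg_coefficients[OF H[rule_format, OF True] beta]]) (rule zero_le)
 also have "... = ennreal (1 / ?K * ?K) * (Hneg_norm Omega beta (f tau))\<^sup>2"
 by (simp only: ennreal_mult[OF k1 k2] mult.assoc)
 also have "1 / ?K * ?K = 1" using K by simp
 finally show ?thesis using True by simp
 qed (simp add: F_def)
 qed
 also have "... = P\<^sup>2" unfolding P_def L2_time_norm_power2 ..
 finally have "ennreal ?K * (ennreal (1 / ?K) * ?Z) <= ennreal ?K * P\<^sup>2" by (rule mult_left_mono) simp
 also have "ennreal ?K * (ennreal (1 / ?K) * ?Z) = ennreal (?K * (1 / ?K)) * ?Z"
 by (simp only: ennreal_mult[OF k2 k1] mult.assoc)
 also have "?K * (1 / ?K) = 1" using K by simp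
 finally show "?Z <= ennreal ?K * P\<^sup>2" by simp
 qed auto
 also have "... = ennreal (2 * ?K * A) * (ennreal (t powr (1 - 2 * alpha)) * N\<^sup>2) + ennreal (2 * ?K) * P\<^sup>2"
 proof -
 have tA: "0 <= 2 * t powr (1 - 2 * alpha) * A" and KA: "0 <= 2 * ?K * A" using A k2 by (intro mult_nonneg_nonneg; simp)+
 have "ennreal (2 * t powr (1 - 2 * alpha) * A) * (ennreal ?K * N\<^sup>2) = ennreal (2 * t powr (1 - 2 * alpha) * A * ?K) * N\<^sup>2"
 unfolding ennreal_mult[OF tA k2] by (rule mult.assoc[symmetric])
 also have "2 * t powr (1 - 2 * alpha) * A * ?K = 2 * ?K * A * t powr (1 - 2 * alpha)" by simp
 also have "ennreal (2 * ?K * A * t powr (1 - 2 * alpha)) * N\<^sup>2 = ennreal (2 * ?K * A) * (ennreal (t powr (1 - 2 * alpha)) * N\<^sup>2)"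
 unfolding ennreal_mult[OF KA powr_ge_zero] by (rule mult.assoc)
 finally have e1: "ennreal (2 * t powr (1 - 2 * alpha) * A) * (ennreal ?K * N\<^sup>2) = ennreal (2 * ?K * A) * (ennreal (t powr (1 - 2 * alpha)) * N\<^sup>2)" .
 have e2: "2 * (ennreal ?K * P\<^sup>2) = ennreal (2 * ?K) * P\<^sup>2"
 unfolding ennreal_mult[OF zero_le_numeral k2] ennreal_numeral by (rule mult.assoc[symmetric])
 show ?thesis unfolding e1 e2 ..
 qed
 also have "ennreal (t powr (1 - 2 * alpha)) * N\<^sup>2 = (ennreal (t powr (1 / 2 - alpha)) * N)\<^sup>2"
 by (simp add: power_mult_distrib ennreal_power power2_eq_square[of "t powr _"] powr_add[symmetric])
 also have "ennreal (2 * ?K * A) * (ennreal (t powr (1 / 2 - alpha)) * N)\<^sup>2 + ennreal (2 * ?K) * P\<^sup>2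
 <= ennreal (2 * ?K * (1 + A)) * (ennreal (t powr (1 / 2 - alpha)) * N)\<^sup>2 + ennreal (2 * ?K * (1 + A)) * P\<^sup>2"
 using K A by (intro add_mono mult_right_mono ennreal_leI mult_left_mono) auto
 finally show ?thesis unfolding P_def N_def distrib_left by (simp only: add.commute)
qed

text \<open>Each term combines a time order theta alpha with a spectral order kappa subject to kappa
  + 2 theta - 2 = -beta, so all are controlled by one sum over the data. In order, (theta, kappa) is
  (1 - beta/2, 0), (1/2, 1 - beta), ((1 - beta)/2, 1) and (0, 2 - beta); the last one uses the
  energy estimate directly. The scalar estimate is a hypothesis, so that its constant can be fixed
  before the eigenbasis.\<close>

lemma regularity_terms:
 assumes alpha: "0 < alpha" "alpha < 1 / 2" and beta: "0 <= beta" "beta < 1" and T: "0 < T" and t: "0 < t" "t < T"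
 and f: "f \<in> L2_time (Hneg Omega beta) (Hneg_norm Omega beta) {0<..<T}" and u0: "u0 \<in> Hneg Omega beta"
 and ws: "weak_solution alpha Omega phi lam T u0 f u"
 and C: "0 < C" "!!lam t y r g theta. 0 < lam ==> sq_integrable r ==> (!!s. s \<notin> {0<..<t} ==> r s = 0) ==>
 sq_integrable y ==> (!!s. s \<notin> {0<..<t} ==> y s = 0) ==> (!!s. g s = r s + lam * y s) ==>
 (AE s in lebesgue. s \<in> {0<..<t} --> y s = frac_int_left 0 alpha r s) ==> 0 <= theta ==> theta <= 1 ==>
 (INTP xi. ennreal (\<bar>xi\<bar> powr (2 * (theta * alpha)) * (cmod (fourier y xi))\<^sup>2))
 <= ennreal (C * lam powr (2 * theta - 2)) * (INTP s. ennreal ((g s)\<^sup>2))"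
 defines "M \<equiv> (C + 1) * (2 * (1 + 4 * R\<^sup>2) * (1 + 1 / ((1 - 2 * alpha) * (Gamma (1 - alpha))\<^sup>2)))"
 shows "frac_seminorm_vec (alpha * (1 - beta / 2)) t inner phi u +
 frac_seminorm_vec (alpha / 2) t (dotH_inner phi lam (1 - beta)) (dotH_basis phi lam (1 - beta)) u +
 frac_seminorm_vec (alpha * (1 - beta) / 2) t (dotH_inner phi lam 1) (dotH_basis phi lam 1) u +
 L2_time_norm (dotH_norm phi lam (2 - beta)) {0<..<t} u
 <= ennreal (4 * sqrt M) * (L2_time_norm (Hneg_norm Omega beta) {0<..<t} f + ennreal (t powr (1 / 2 - alpha)) * Hneg_norm Omega beta u0)"
proof -
 define y where "y i tau = indicator {0<..<t} tau * (u tau \<bullet> phi i)" for i tau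
 define g where "g i tau = indicator {0<..<t} tau * (tau powr (- alpha) / Gamma (1 - alpha) * u0 (phi i) + f tau (phi i))" for i tau
 define r where "r i s = g i s - lam i * y i s" for i s
 note wc = weak_solution_coefficient[OF alpha beta T f u0 ws]
 have cut: "sq_integrable (%s. indicator {0<..<t} s * k s)" if k: "sq_integrable (%s. indicator {0<..<T} s * k s)" for k
 proof -
 have e: "(%s. indicator {0<..<t} s * k s) = (%s. indicator {0<..<t} s * (indicator {0<..<T} s * k s))"
 using t by (auto simp: indicator_def)
 have "integrable lebesgue (%s. indicator {0<..<t} s *\<^sub>R (indicator {0<..<T} s * k s)\<^sup>2)"
 using k by (intro integrable_mult_indicator) (auto simp: sq_integrable_def)
 moreover have "(%s. indicator {0<..<t} s *\<^sub>R (indicator {0<..<T} s * k s)\<^sup>2) = (%s. (indicator {0<..<t} s * (indicator {0<..<T} s * k s))\<^sup>2)"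
 by (auto simp: indicator_def)
 moreover have "(%s. indicator {0<..<t} s * (indicator {0<..<T} s * k s)) \<in> blm"
 by (intro borel_measurable_times borel_measurable_indicator sq_integrable_imp_measurable[OF k]) simp
 ultimately show ?thesis unfolding e sq_integrable_def by simp
 qed
 have ysq: "sq_integrable (y i)" for i unfolding y_def[abs_def] by (rule cut[OF wc(1)])
 have gsq: "sq_integrable (g i)" for i unfolding g_def[abs_def] by (rule cut[OF wc(2)])
 have rsq: "sq_integrable (r i)" for i unfolding r_def[abs_def] by (intro sq_integrable_diff sq_integrable_scale gsq ysq)
 have y0: "y i s = 0" and g0: "g i s = 0" and r0: "r i s = 0" if "s \<notin> {0<..<t}" for i s using that by (simp_all add: y_def g_def r_def)
 have gr: "g i s = r i s + lam i * y i s" for i s by (simp add: r_def)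
 \<comment> \<open>Causality: at s < t the fractional integral sees the right side only on (0,s), so
   the equation on (0,T) remains valid after both functions are cut at t.\<close>
 have eq: "AE s in lebesgue. s \<in> {0<..<t} --> y i s = frac_int_left 0 alpha (r i) s" for i
 using wc(3)[of i]
 proof (rule eventually_mono, intro impI)
 let ?R = "%s. indicator {0<..<T} s * (s powr (- alpha) / Gamma (1 - alpha) * u0 (phi i) + f s (phi i)) - lam i * (indicator {0<..<T} s * (u s \<bullet> phi i))"
 fix s assume A: "s \<in> {0<..<T} --> indicator {0<..<T} s * (u s \<bullet> phi i) = frac_int_left 0 alpha ?R s" and s: "s \<in> {0<..<t}"
 have "frac_int_left 0 alpha (%s. indicator {0<..<t} s *\<^sub>R ?R s) s = frac_int_left 0 alpha ?R s"
 by (rule frac_int_left_cutoff) (use s in simp)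
 moreover have "(%s. indicator {0<..<t} s *\<^sub>R ?R s) = r i"
 using t by (auto simp: r_def g_def y_def indicator_def)
 ultimately show "y i s = frac_int_left 0 alpha (r i) s" using A s t by (simp add: y_def)
 qed
 define S where "S = (\<Sum>i. ennreal (lam i powr (- beta)) * (INTP tau. ennreal ((g i tau)\<^sup>2)))"
 define P where "P = L2_time_norm (Hneg_norm Omega beta) {0<..<t} f"
 define Q where "Q = ennreal (t powr (1 / 2 - alpha)) * Hneg_norm Omega beta u0"
 have A0: "0 <= 2 * (1 + 4 * R\<^sup>2) * (1 + 1 / ((1 - 2 * alpha) * (Gamma (1 - alpha))\<^sup>2))"
 using alpha by (intro mult_nonneg_nonneg add_nonneg_nonneg) auto
 have M0: "0 <= M" unfolding M_def by (rule mult_nonneg_nonneg[OF _ A0]) (use C(1) in simp)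
 have Sb: "ennreal (C + 1) * S <= ennreal M * (P\<^sup>2 + Q\<^sup>2)"
 proof -
 have "S <= ennreal (2 * (1 + 4 * R\<^sup>2) * (1 + 1 / ((1 - 2 * alpha) * (Gamma (1 - alpha))\<^sup>2))) * (P\<^sup>2 + Q\<^sup>2)"
 unfolding S_def P_def Q_def g_def
 proof (rule coefficient_sum_bound[OF alpha beta t(1) _ _ u0])
 show "(%tau. indicator {0<..<t} tau * f tau (phi i)) \<in> blm" for i
 by (rule sq_integrable_imp_measurable[OF cut[OF source_coefficient(1)[OF f beta]]])
 show "AE tau in lebesgue. tau \<in> {0<..<t} --> f tau \<in> Hneg Omega beta"
 using source_coefficient(2)[OF f beta] by (rule eventually_mono) (use t in auto)
 qed
 then have "ennreal (C + 1) * S <= ennreal (C + 1) * (ennreal (2 * (1 + 4 * R\<^sup>2) * (1 + 1 / ((1 - 2 * alpha) * (Gamma (1 - alpha))\<^sup>2))) * (P\<^sup>2 + Q\<^sup>2))"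
 by (rule mult_left_mono) simp
 also have "... = ennreal M * (P\<^sup>2 + Q\<^sup>2)"
 proof -
 have c: "0 <= C + 1" using C(1) by simp
 show ?thesis unfolding M_def ennreal_mult[OF c A0] by (rule mult.assoc[symmetric])
 qed
 finally show ?thesis .
 qed
 have fin: "esqrt Z <= ennreal (sqrt M) * (P + Q)" if "Z <= ennreal (C + 1) * S" for Z
 proof (rule esqrt_le)
 have "Z <= ennreal M * (P\<^sup>2 + Q\<^sup>2)" using that Sb by (rule order_trans)
 also have "... <= ennreal M * (P + Q)\<^sup>2"
 proof (intro mult_left_mono)
 have "P\<^sup>2 + Q\<^sup>2 <= P\<^sup>2 + Q\<^sup>2 + (P * Q + P * Q)" by simp
 then show "P\<^sup>2 + Q\<^sup>2 <= (P + Q)\<^sup>2" by (simp add: power2_eq_square algebra_simps)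
 qed simp
 finally show "Z <= (ennreal (sqrt M) * (P + Q))\<^sup>2" using M0 by (simp add: power_mult_distrib ennreal_power)
 qed
 \<comment> \<open>The condition on kappa makes the spectral weight times the power of lam from
   \<open>volterra_estimate\<close> equal to lam^(-beta), whatever theta is.\<close>
 have weighted: "(\<Sum>i. (frac_seminorm (theta * alpha) t (%tau. lam i powr (kappa / 2) * (u tau \<bullet> phi i)))\<^sup>2) <= ennreal (C + 1) * S"
 if theta: "0 <= theta" "theta <= 1" and kappa: "kappa + (2 * theta - 2) = - beta" for theta kappa
 proof -
 have "(frac_seminorm (theta * alpha) t (%tau. lam i powr (kappa / 2) * (u tau \<bullet> phi i)))\<^sup>2 <= ennreal (C + 1) * (ennreal (lam i powr (- beta)) * (INTP tau. ennreal ((g i tau)\<^sup>2)))" for i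
 proof -
 have sq: "(lam i powr (kappa / 2))\<^sup>2 = lam i powr kappa" by (simp add: power2_eq_square powr_add[symmetric])
 have "(frac_seminorm (theta * alpha) t (%tau. lam i powr (kappa / 2) * (u tau \<bullet> phi i)))\<^sup>2 = (INTP xi. ennreal (lam i powr kappa) * ennreal (\<bar>xi\<bar> powr (2 * (theta * alpha)) * (cmod (fourier (y i) xi))\<^sup>2))"
 unfolding frac_seminorm_scale sq y_def[abs_def] by (simp add: ennreal_mult)
 also have "... = ennreal (lam i powr kappa) * (INTP xi. ennreal (\<bar>xi\<bar> powr (2 * (theta * alpha)) * (cmod (fourier (y i) xi))\<^sup>2))"
 proof (rule nn_integral_cmult)
 have [measurable]: "y i \<in> blm" by (rule sq_integrable_imp_measurable[OF ysq])
 have [measurable]: "(%xi::real. \<bar>xi\<bar> powr (2 * (theta * alpha))) \<in> blm" by (rule measurable_completion) measurable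
 show "(%xi. ennreal (\<bar>xi\<bar> powr (2 * (theta * alpha)) * (cmod (fourier (y i) xi))\<^sup>2)) \<in> blm" by measurable
 qed
 also have "... <= ennreal (lam i powr kappa) * (ennreal (C * lam i powr (2 * theta - 2)) * (INTP s. ennreal ((g i s)\<^sup>2)))"
 by (intro mult_left_mono C(2)[OF lam_pos rsq r0 ysq y0 gr eq theta]) simp_all
 also have "... = ennreal (lam i powr kappa * (C * lam i powr (2 * theta - 2))) * (INTP s. ennreal ((g i s)\<^sup>2))"
 unfolding ennreal_mult[OF powr_ge_zero mult_nonneg_nonneg[OF less_imp_le[OF C(1)] powr_ge_zero]] by (rule mult.assoc[symmetric])
 also have "lam i powr kappa * (C * lam i powr (2 * theta - 2)) = C * lam i powr (- beta)"
 by (simp add: powr_add[symmetric] kappa[symmetric])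
 also have "ennreal (C * lam i powr (- beta)) * (INTP s. ennreal ((g i s)\<^sup>2)) <= ennreal ((C + 1) * lam i powr (- beta)) * (INTP s. ennreal ((g i s)\<^sup>2))"
 by (intro mult_right_mono ennreal_leI) simp_all
 also have "... = ennreal (C + 1) * (ennreal (lam i powr (- beta)) * (INTP s. ennreal ((g i s)\<^sup>2)))"
 unfolding ennreal_mult[OF add_nonneg_nonneg[OF less_imp_le[OF C(1)] zero_le_one] powr_ge_zero] by (rule mult.assoc)
 finally show ?thesis .
 qed
 then have "(\<Sum>i. (frac_seminorm (theta * alpha) t (%tau. lam i powr (kappa / 2) * (u tau \<bullet> phi i)))\<^sup>2) <= (\<Sum>i. ennreal (C + 1) * (ennreal (lam i powr (- beta)) * (INTP tau. ennreal ((g i tau)\<^sup>2))))"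
 by (intro suminf_le) auto
 then show ?thesis unfolding S_def ennreal_suminf_cmult .
 qed
 have t1: "frac_seminorm_vec (alpha * (1 - beta / 2)) t inner phi u <= ennreal (sqrt M) * (P + Q)"
 unfolding frac_seminorm_vec_def using fin[OF weighted[of "1 - beta / 2" 0]] beta lam_pos by (simp add: mult.commute less_imp_neq[symmetric])
 have t2: "frac_seminorm_vec (alpha / 2) t (dotH_inner phi lam (1 - beta)) (dotH_basis phi lam (1 - beta)) u <= ennreal (sqrt M) * (P + Q)"
 unfolding frac_seminorm_vec_def dotH_inner_basis using fin[OF weighted[of "1 / 2" "1 - beta"]] by simp
 have t3: "frac_seminorm_vec (alpha * (1 - beta) / 2) t (dotH_inner phi lam 1) (dotH_basis phi lam 1) u <= ennreal (sqrt M) * (P + Q)"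
 unfolding frac_seminorm_vec_def dotH_inner_basis
 proof -
 have k3: "1 + (2 * ((1 - beta) / 2) - 2) = - beta" by (simp add: field_simps)
 have "(\<Sum>i. (frac_seminorm ((1 - beta) / 2 * alpha) t (%tau. lam i powr (1 / 2) * (u tau \<bullet> phi i)))\<^sup>2) <= ennreal (C + 1) * S"
 by (rule weighted[OF _ _ k3]) (use beta in auto)
 moreover have "(1 - beta) / 2 * alpha = alpha * (1 - beta) / 2" by simp
 ultimately show "esqrt (\<Sum>i. (frac_seminorm (alpha * (1 - beta) / 2) t (%tau. lam i powr (1 / 2) * (u tau \<bullet> phi i)))\<^sup>2) <= ennreal (sqrt M) * (P + Q)"
 by (intro fin) (simp only:)
 qed
 have t4: "L2_time_norm (dotH_norm phi lam (2 - beta)) {0<..<t} u <= ennreal (sqrt M) * (P + Q)"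
 proof -
 have ym [measurable]: "y i \<in> blm" for i by (rule sq_integrable_imp_measurable[OF ysq])
 have "(L2_time_norm (dotH_norm phi lam (2 - beta)) {0<..<t} u)\<^sup>2 = (INTP tau. (\<Sum>i. ennreal (lam i powr (2 - beta) * (y i tau)\<^sup>2)))"
 unfolding L2_time_norm_power2 dotH_norm_def esqrt_power2
 proof (rule nn_integral_cong)
 fix tau
 show "(\<Sum>i. ennreal (lam i powr (2 - beta) * (u tau \<bullet> phi i)\<^sup>2)) * indicator {0<..<t} tau = (\<Sum>i. ennreal (lam i powr (2 - beta) * (y i tau)\<^sup>2))"
 proof (cases "tau \<in> {0<..<t}")
 case True
 then have "y i tau = u tau \<bullet> phi i" and "indicator {0<..<t} tau = (1 :: ennreal)" for i by (simp_all add: y_def)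
 then show ?thesis by (simp only: mult_1_right)
 next
 case False
 then have "y i tau = 0" and "indicator {0<..<t} tau = (0 :: ennreal)" for i by (simp_all add: y_def)
 then show ?thesis by simp
 qed
 qed
 also have "... = (\<Sum>i. \<integral>\<^sup>+tau. ennreal (lam i powr (2 - beta) * (y i tau)\<^sup>2) \<partial>lebesgue)"
 by (rule nn_integral_suminf) measurable
 also have "... <= S" unfolding S_def
 proof (rule suminf_le)
 fix i
 have "alpha < 1" using alpha by simp
 from volterra_energy(2)[OF alpha(1) this less_imp_le[OF lam_pos] rsq r0 ysq y0 gr eq, of i]
 have v: "(lam i)\<^sup>2 * (LINT s|lebesgue. (y i s)\<^sup>2) <= (LINT s|lebesgue. (g i s)\<^sup>2)" .
 have p: "lam i powr (2 - beta) = lam i powr (- beta) * (lam i)\<^sup>2"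
 using powr_add[of "lam i" "- beta" 2] powr_numeral[OF less_imp_le[OF lam_pos[of i]], of "num.Bit0 num.One"] by simp
 have "(INTP tau. ennreal (lam i powr (2 - beta) * (y i tau)\<^sup>2)) = ennreal (lam i powr (2 - beta)) * (INTP tau. ennreal ((y i tau)\<^sup>2))"
 by (simp add: ennreal_mult nn_integral_cmult)
 also have "... = ennreal (lam i powr (- beta) * ((lam i)\<^sup>2 * (LINT s|lebesgue. (y i s)\<^sup>2)))"
 unfolding nn_integral_sq[OF ysq] p mult.assoc[symmetric] by (rule ennreal_mult'[symmetric]) simp
 also have "... <= ennreal (lam i powr (- beta) * (LINT s|lebesgue. (g i s)\<^sup>2))"
 by (intro ennreal_leI mult_left_mono v) simp
 also have "... = ennreal (lam i powr (- beta)) * (INTP tau. ennreal ((g i tau)\<^sup>2))"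
 unfolding nn_integral_sq[OF gsq] by (rule ennreal_mult') simp
 finally show "(INTP tau. ennreal (lam i powr (2 - beta) * (y i tau)\<^sup>2)) <= ennreal (lam i powr (- beta)) * (INTP tau. ennreal ((g i tau)\<^sup>2))" .
 qed auto
 \<comment> \<open>The energy estimate behind this term has constant 1; the summand 1 in
   \<open>C + 1\<close> lets the same factor cover it.\<close>
 also have "S <= ennreal (C + 1) * S"
 proof -
 have "ennreal 1 * S <= ennreal (C + 1) * S" using C(1) by (intro mult_right_mono ennreal_leI) auto
 then show ?thesis by simp
 qed
 finally show ?thesis using fin[of "(L2_time_norm (dotH_norm phi lam (2 - beta)) {0<..<t} u)\<^sup>2"] by (simp only: esqrt_of_power2)
 qed
 have "ennreal (4 * sqrt M) = ennreal (sqrt M) + ennreal (sqrt M) + ennreal (sqrt M) + ennreal (sqrt M)"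
 using M0 by (simp flip: ennreal_plus)
 then have four: "ennreal (4 * sqrt M) * (P + Q) = ennreal (sqrt M) * (P + Q) + ennreal (sqrt M) * (P + Q) + ennreal (sqrt M) * (P + Q) + ennreal (sqrt M) * (P + Q)"
 by (simp only: distrib_right)
 show ?thesis unfolding P_def[symmetric] Q_def[symmetric] four by (intro add_mono t1 t2 t3 t4)
qed

end

theorem theorem3p1:
  fixes \<alpha> :: real and \<Omega> :: "'a::euclidean_space set"
  assumes "DIM('a) \<in> {1, 2, 3}" and "convex_polygonal_domain \<Omega>" and "0 < \<alpha>" and "\<alpha> < 1 / 2"
  shows "\<exists>C>0. \<forall>\<phi> lam. dirichlet_eigenbasis \<Omega> \<phi> lam \<longrightarrow>
    (\<forall>\<beta> T f u0 u. 0 \<le> \<beta> \<and> \<beta> < 1 \<and> 0 < T \<and>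
      f \<in> L2_time (Hneg \<Omega> \<beta>) (Hneg_norm \<Omega> \<beta>) {0<..<T} \<and>
      u0 \<in> Hneg \<Omega> \<beta> \<and>
      weak_solution \<alpha> \<Omega> \<phi> lam T u0 f u \<longrightarrow>
      (\<forall>t. 0 < t \<and> t < T \<longrightarrow>
        frac_seminorm_vec (\<alpha> * (1 - \<beta> / 2)) t inner \<phi> u +
        frac_seminorm_vec (\<alpha> / 2) t (dotH_inner \<phi> lam (1 - \<beta>)) (dotH_basis \<phi> lam (1 - \<beta>)) u +
        frac_seminorm_vec (\<alpha> * (1 - \<beta>) / 2) t (dotH_inner \<phi> lam 1) (dotH_basis \<phi> lam 1) u +
        L2_time_norm (dotH_norm \<phi> lam (2 - \<beta>)) {0<..<t} u
        \<le> ennreal C * (L2_time_norm (Hneg_norm \<Omega> \<beta>) {0<..<t} f +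
            ennreal (t powr (1 / 2 - \<alpha>)) * Hneg_norm \<Omega> \<beta> u0)))"
proof -
  have op: "open \<Omega>" and pt: "polytope (closure \<Omega>)"
    using assms(2) by (simp_all add: convex_polygonal_domain_def)
  note cl = polytope_imp_compact[OF pt]
  have "bounded \<Omega>" by (rule bounded_subset[OF compact_imp_bounded[OF cl] closure_subset])
  then obtain R where R: "0 < R" "\<forall>x\<in>\<Omega>. norm x \<le> R" by (auto simp: bounded_pos)
  \<comment> \<open>This constant depends on \<alpha> alone and R on the domain alone. Both are
    fixed before the eigenbasis, \<beta>, T and the data are introduced.\<close>
  obtain C where C: "0 < C" "\<And>lam t y r g \<theta>. 0 < lam \<Longrightarrow> sq_integrable r \<Longrightarrow> (\<And>s. s \<notin> {0<..<t} \<Longrightarrow> r s = 0) \<Longrightarrow>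
    sq_integrable y \<Longrightarrow> (\<And>s. s \<notin> {0<..<t} \<Longrightarrow> y s = 0) \<Longrightarrow> (\<And>s. g s = r s + lam * y s) \<Longrightarrow>
    (AE s in lebesgue. s \<in> {0<..<t} \<longrightarrow> y s = frac_int_left 0 \<alpha> r s) \<Longrightarrow> 0 \<le> \<theta> \<Longrightarrow> \<theta> \<le> 1 \<Longrightarrow>
    (\<integral>\<^sup>+\<xi>. ennreal (\<bar>\<xi>\<bar> powr (2 * (\<theta> * \<alpha>)) * (cmod (fourier y \<xi>))\<^sup>2) \<partial>lebesgue)
      \<le> ennreal (C * lam powr (2 * \<theta> - 2)) * (\<integral>\<^sup>+s. ennreal ((g s)\<^sup>2) \<partial>lebesgue)"
    by (rule volterra_estimate[OF assms(3,4)], rule that, assumption) blast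
  define M where "M = (C + 1) * (2 * (1 + 4 * R\<^sup>2) * (1 + 1 / ((1 - 2 * \<alpha>) * (Gamma (1 - \<alpha>))\<^sup>2)))"
  have "0 < 1 / ((1 - 2 * \<alpha>) * (Gamma (1 - \<alpha>))\<^sup>2)"
    using assms(4) Gamma_real_pos[of "1 - \<alpha>"] by (intro divide_pos_pos mult_pos_pos zero_less_power) auto
  then have M: "0 < 4 * sqrt M" unfolding M_def using C(1)
    by (intro mult_pos_pos real_sqrt_gt_zero add_pos_pos add_pos_nonneg) auto
  show ?thesis
  proof (rule exI[of _ "4 * sqrt M"], intro conjI M allI impI, elim conjE)
    fix \<phi> :: "nat \<Rightarrow> 'a L2" and lam \<beta> T f u0 u t
    assume e: "dirichlet_eigenbasis \<Omega> \<phi> lam" and h: "0 \<le> \<beta>" "\<beta> < 1" "0 < T"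
      "f \<in> L2_time (Hneg \<Omega> \<beta>) (Hneg_norm \<Omega> \<beta>) {0<..<T}" "u0 \<in> Hneg \<Omega> \<beta>"
      "weak_solution \<alpha> \<Omega> \<phi> lam T u0 f u" and t: "0 < t" "t < T"
    interpret dirichlet_domain \<Omega> \<phi> lam R
      by (rule dirichlet_domain.intro[OF op R(1) R(2)[rule_format] e])
    show "frac_seminorm_vec (\<alpha> * (1 - \<beta> / 2)) t inner \<phi> u +
        frac_seminorm_vec (\<alpha> / 2) t (dotH_inner \<phi> lam (1 - \<beta>)) (dotH_basis \<phi> lam (1 - \<beta>)) u +
        frac_seminorm_vec (\<alpha> * (1 - \<beta>) / 2) t (dotH_inner \<phi> lam 1) (dotH_basis \<phi> lam 1) u +
        L2_time_norm (dotH_norm \<phi> lam (2 - \<beta>)) {0<..<t} u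
        \<le> ennreal (4 * sqrt M) * (L2_time_norm (Hneg_norm \<Omega> \<beta>) {0<..<t} f + ennreal (t powr (1 / 2 - \<alpha>)) * Hneg_norm \<Omega> \<beta> u0)"
      unfolding M_def by (rule regularity_terms[OF assms(3,4) h(1-3) t h(4-6) C])
  qed
qed

end
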